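(* Let $\Omega\subset\mathbb{R}^N$ be a smooth open bounded domain, let $a,b,c\in L^\infty(\Omega)$ with $\operatorname{ess\,inf}_\Omega a>0$, $\operatorname{ess\,inf}_\Omega b>0$, $\operatorname{ess\,inf}_\Omega c>0$, and let $F\in C^1(\mathbb{R}^2,\mathbb{R})$ satisfy: (F$_+$) $F(s,t)\ge 0$ for all $(s,t)\in\mathbb{R}^2$, $F(0,0)=0$, and $F\not\equiv 0$; (F$_0$) $\lim_{(s,t)\to(0,0)}\frac{F_s(s,t)}{|s|+|t|}=\lim_{(s,t)\to(0,0)}\frac{F_t(s,t)}{|s|+|t|}=0$; (F$_\infty$) $\lim_{|s|+|t|\to\infty}\frac{F_s(s,t)}{|s|+|t|}=\lim_{|s|+|t|\to\infty}\frac{F_t(s,t)}{|s|+|t|}=0$. Define $$s_F=2\|c\|_{L^1}\sup_{(s,t)\neq(0,0)}\frac{F(s,t)}{\|a\|_{L^1}s^2+\|b\|_{L^1}t^2},\qquad S_F=\sup_{(s,t)\neq(0,0)}\frac{|sF_s(s,t)+tF_t(s,t)|}{\|c/a\|_{L^\infty}^{-1}s^2+\|c/b\|_{L^\infty}^{-1}t^2}.$$ Consider, for a parameter $\lambda\ge 0$, the Neumann system $$-\Delta u+a(x)u=\lambda c(x)F_u(u,v)\ \text{in }\Omega,\quad -\Delta v+b(x)v=\lambda c(x)F_v(u,v)\ \text{in }\Omega,\quad \frac{\partial u}{\partial\nu}=\frac{\partial v}{\partial\nu}=0\ \text{on }\partial\Omega.$$ Then: (i) for every $0\le\lambda<S_F^{-1}$,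 the only solution of this system is the trivial pair $(u,v)=(0,0)$; (ii) for every $\lambda>s_F^{-1}$, the system has at least two distinct nontrivial pairs of solutions $(u_\lambda^i,v_\lambda^i)\in H^1(\Omega)^2$, $i\in\{1,2\}$.
   Context: $\nu$ denotes the outward unit normal to $\partial\Omega$; $F_s,F_t$ (also written $F_u,F_v$) denote the partial derivatives of $F$ with respect to its first and second variables; $\|\cdot\|_{L^p}$ is the norm of $L^p(\Omega)$. A solution of the system is a pair $(u,v)\in H^1(\Omega)^2$ such that $\int_\Omega(\nabla u\cdot\nabla\phi+a(x)u\phi)\,dx=\lambda\int_\Omega c(x)F_u(u,v)\phi\,dx$ and $\int_\Omega(\nabla v\cdot\nabla\psi+b(x)v\psi)\,dx=\lambda\int_\Omega c(x)F_v(u,v)\psi\,dx$ for all $\phi,\psi\in H^1(\Omega)$. (Under the hypotheses, $s_F$ and $S_F$ are finite and positive.) *)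

theory Defs
  imports "HOL-Analysis.Analysis"
begin

text \<open>C-infinity smoothness on an open set: a family of all iterated partial
derivatives D ds (ds = list of basis directions), each differentiable, with
D [] = f.\<close>
definition smooth_on_real :: "'a::euclidean_space set \<Rightarrow> ('a \<Rightarrow> real) \<Rightarrow> bool" where
  "smooth_on_real S f \<longleftrightarrow> (\<exists>D :: 'a list \<Rightarrow> 'a \<Rightarrow> real.
     (\<forall>x\<in>S. D [] x = f x) \<and>
     (\<forall>ds. \<forall>x\<in>S. (D ds has_derivative (\<lambda>h. \<Sum>i\<in>Basis. (h \<bullet> i) * D (i # ds) x)) (at x)))"

definition smooth_bounded_domain :: "'a::euclidean_space set \<Rightarrow> bool" where
  "smooth_bounded_domain \<Omega> \<longleftrightarrow> open \<Omega> \<and> bounded \<Omega> \<and> \<Omega> \<noteq> {} \<and>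
     (\<exists>\<rho>. smooth_on_real UNIV \<rho> \<and> \<Omega> = {x. \<rho> x < 0} \<and>
          (\<forall>x. \<rho> x = 0 \<longrightarrow> frechet_derivative \<rho> (at x) \<noteq> (\<lambda>h. 0)))"

definition test_fun :: "'a::euclidean_space set \<Rightarrow> ('a \<Rightarrow> real) \<Rightarrow> bool" where
  "test_fun \<Omega> \<phi> \<longleftrightarrow> smooth_on_real UNIV \<phi> \<and> compact (closure {x. \<phi> x \<noteq> 0})
      \<and> closure {x. \<phi> x \<noteq> 0} \<subseteq> \<Omega>"

definition L2_fun :: "'a::euclidean_space set \<Rightarrow> ('a \<Rightarrow> real) \<Rightarrow> bool" where
  "L2_fun \<Omega> u \<longleftrightarrow> u \<in> borel_measurable (lebesgue_on \<Omega>) \<and>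
      integrable (lebesgue_on \<Omega>) (\<lambda>x. (u x)^2)"

definition weak_grad :: "'a::euclidean_space set \<Rightarrow> ('a \<Rightarrow> real) \<Rightarrow> ('a \<Rightarrow> 'a) \<Rightarrow> bool" where
  "weak_grad \<Omega> u g \<longleftrightarrow> L2_fun \<Omega> u \<and> g \<in> borel_measurable (lebesgue_on \<Omega>) \<and>
      integrable (lebesgue_on \<Omega>) (\<lambda>x. (norm (g x))^2) \<and>
      (\<forall>\<phi>. test_fun \<Omega> \<phi> \<longrightarrow> (\<forall>i\<in>Basis.
         (\<integral>x. u x * frechet_derivative \<phi> (at x) i \<partial>lebesgue_on \<Omega>)
           = - (\<integral>x. (g x \<bullet> i) * \<phi> x \<partial>lebesgue_on \<Omega>)))"

definition H1 :: "'a::euclidean_space set \<Rightarrow> ('a \<Rightarrow> real) \<Rightarrow> bool" where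
  "H1 \<Omega> u \<longleftrightarrow> (\<exists>g. weak_grad \<Omega> u g)"

definition Linf_fun :: "'a::euclidean_space set \<Rightarrow> ('a \<Rightarrow> real) \<Rightarrow> bool" where
  "Linf_fun \<Omega> a \<longleftrightarrow> a \<in> borel_measurable (lebesgue_on \<Omega>) \<and>
      (\<exists>M. AE x in lebesgue_on \<Omega>. \<bar>a x\<bar> \<le> M)"

definition L1_norm :: "'a::euclidean_space set \<Rightarrow> ('a \<Rightarrow> real) \<Rightarrow> real" where
  "L1_norm \<Omega> a = (\<integral>x. \<bar>a x\<bar> \<partial>lebesgue_on \<Omega>)"

definition Linf_norm :: "'a::euclidean_space set \<Rightarrow> ('a \<Rightarrow> real) \<Rightarrow> real" where
  "Linf_norm \<Omega> a = Inf {C. 0 \<le> C \<and> (AE x in lebesgue_on \<Omega>. \<bar>a x\<bar> \<le> C)}"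

definition neumann_solution ::
  "'a::euclidean_space set \<Rightarrow> ('a \<Rightarrow> real) \<Rightarrow> ('a \<Rightarrow> real) \<Rightarrow> ('a \<Rightarrow> real)
   \<Rightarrow> (real \<Rightarrow> real \<Rightarrow> real) \<Rightarrow> (real \<Rightarrow> real \<Rightarrow> real) \<Rightarrow> real
   \<Rightarrow> ('a \<Rightarrow> real) \<Rightarrow> ('a \<Rightarrow> real) \<Rightarrow> bool" where
  "neumann_solution \<Omega> a b c Fs Ft lam u v \<longleftrightarrow>
     (\<exists>gu gv. weak_grad \<Omega> u gu \<and> weak_grad \<Omega> v gv \<and>
       (\<forall>\<phi> g\<phi>. weak_grad \<Omega> \<phi> g\<phi> \<longrightarrow>
          (\<integral>x. gu x \<bullet> g\<phi> x + a x * u x * \<phi> x \<partial>lebesgue_on \<Omega>)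
            = lam * (\<integral>x. c x * Fs (u x) (v x) * \<phi> x \<partial>lebesgue_on \<Omega>)) \<and>
       (\<forall>\<psi> g\<psi>. weak_grad \<Omega> \<psi> g\<psi> \<longrightarrow>
          (\<integral>x. gv x \<bullet> g\<psi> x + b x * v x * \<psi> x \<partial>lebesgue_on \<Omega>)
            = lam * (\<integral>x. c x * Ft (u x) (v x) * \<psi> x \<partial>lebesgue_on \<Omega>)))"

definition s_F :: "'a::euclidean_space set \<Rightarrow> ('a \<Rightarrow> real) \<Rightarrow> ('a \<Rightarrow> real) \<Rightarrow> ('a \<Rightarrow> real)
   \<Rightarrow> (real \<Rightarrow> real \<Rightarrow> real) \<Rightarrow> real" where
  "s_F \<Omega> a b c F = 2 * L1_norm \<Omega> c *
     Sup {F s t / (L1_norm \<Omega> a * s^2 + L1_norm \<Omega> b * t^2) | s t. (s, t) \<noteq> (0, 0)}"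

definition S_F :: "'a::euclidean_space set \<Rightarrow> ('a \<Rightarrow> real) \<Rightarrow> ('a \<Rightarrow> real) \<Rightarrow> ('a \<Rightarrow> real)
   \<Rightarrow> (real \<Rightarrow> real \<Rightarrow> real) \<Rightarrow> (real \<Rightarrow> real \<Rightarrow> real) \<Rightarrow> real" where
  "S_F \<Omega> a b c Fs Ft =
     Sup {\<bar>s * Fs s t + t * Ft s t\<bar> /
            (inverse (Linf_norm \<Omega> (\<lambda>x. c x / a x)) * s^2
             + inverse (Linf_norm \<Omega> (\<lambda>x. c x / b x)) * t^2) | s t. (s, t) \<noteq> (0, 0)}"

end

theory Submission
  imports Defs "HOL-Complex_Analysis.Great_Picard"
begin

text \<open>
  Writing \<open>w = (u, v)\<close> and using \<open>\<integral> \<bar>\<nabla>u\<bar>\<^sup>2 + a u\<^sup>2 + \<bar>\<nabla>v\<bar>\<^sup>2 + b v\<^sup>2\<close> as the square of the norm, solutions are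
  the critical points of \<open>E(w) = \<parallel>w\<parallel>\<^sup>2 / 2 - K(w)\<close> with \<open>K(w) = \<lambda> \<integral> c F(u, v)\<close>. Testing the
  equations with \<open>(u, v)\<close> gives \<open>\<parallel>w\<parallel>\<^sup>2 \<le> \<lambda> S_F \<parallel>w\<parallel>\<^sup>2\<close>, hence part (i). For part (ii), constant
  functions show \<open>inf E < 0\<close>, \<open>E\<close> is coercive because \<open>F\<close> is subquadratic at infinity, and \<open>0\<close> is a
  strict local minimum because \<open>F\<close> is \<open>o(\<bar>w\<bar>\<^sup>2)\<close> at the origin and bounded sets of \<open>H\<^sup>1\<close> are
  precompact in \<open>L\<^sup>2\<close>. So there is a global minimiser \<open>w\<^sub>1 \<noteq> 0\<close> and a mountain pass between \<open>0\<close> and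
  \<open>w\<^sub>1\<close>.

  Since \<open>\<nabla>F\<close> grows sublinearly, \<open>\<bar>\<nabla>F(p) - \<nabla>F(q)\<bar> \<le> \<epsilon> (1 + \<bar>q\<bar>) + C\<^sub>\<epsilon> \<bar>p - q\<bar>\<close>, and \<open>\<nabla>E\<close> is uniformly
  continuous on bounded sets. Explicit gradient steps \<open>\<Psi>(w) = w - h \<nabla>E(w)\<close> therefore decrease \<open>E\<close> by
  a fixed amount wherever \<open>\<parallel>\<nabla>E\<parallel>\<close> is bounded below. As \<open>\<Psi>\<close> fixes \<open>0\<close> and \<open>w\<^sub>1\<close>, the image of the
  segment from \<open>0\<close> to \<open>w\<^sub>1\<close> under every iterate of \<open>\<Psi>\<close> still meets a small sphere on which
  \<open>E \<ge> \<alpha> > 0\<close>, which is impossible without almost critical points at levels at least \<open>\<alpha> / 2\<close>; by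
  compactness these converge to a second solution.

  Compactness of \<open>H\<^sup>1 \<rightarrow> L\<^sup>2\<close> is obtained without an extension operator: near every point of the
  closure some cube \<open>C\<close> satisfies \<open>x + t C \<subseteq> \<Omega>\<close> for small \<open>t > 0\<close>, and averaging \<open>u\<close> over \<open>x + t C\<close> with
  a smooth weight is a compact operation that moves \<open>u\<close> by at most \<open>O(t) \<parallel>\<nabla>u\<parallel>\<close> in \<open>L\<^sup>2\<close>.
\<close>

section \<open>Two critical points of a compact perturbation of the norm\<close>

text \<open>Since \<open>F\<close> is only C^1, the gradient of the energy is continuous but need
  not be locally Lipschitz, so no descending flow is available directly from an ODE. The explicit
  steps ask for less: a first-order expansion of \<open>K\<close> with error
  \<open>e * |d| + C * |d|^2\<close> for a displacement \<open>d\<close>, for every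
  \<open>e > 0\<close> and uniformly over base points in a bounded set.

  The second choice is the unknown. A state is ((grad u, u / alpha), (grad v, v / beta)) with alpha
  = 1 / sqrt a and beta = 1 / sqrt b, all functions being extended by zero to the whole space. The
  quadratic form of the system is then the plain norm of a product of L^2 spaces, H^1 becomes a
  closed subspace \<open>W\<close>, and a critical point is a fixed point of the orthogonal
  projection onto \<open>W\<close> composed with the gradient of \<open>K\<close>. Smallness of
  \<open>K\<close> near 0 comes from uniform integrability of squares over L^2-compact sets.\<close>

lemma orthogonal_projection_exists:
  fixes W :: "'h::{real_inner, complete_space} set"
  assumes sub: "subspace W" and cl: "closed W"
  obtains y where "y \<in> W" "\<And>z. z \<in> W \<Longrightarrow> inner (x - y) z = 0"
proof -
  define d where "d = (INF y\<in>W. (norm (x - y))\<^sup>2)"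
  have bdd: "bdd_below ((\<lambda>y. (norm (x - y))\<^sup>2) ` W)" by (rule bdd_belowI2[of _ 0]) auto
  have W0: "0 \<in> W" using sub by (rule subspace_0)
  have d_le: "d \<le> (norm (x - y))\<^sup>2" if "y \<in> W" for y
    unfolding d_def using bdd that by (rule cINF_lower)
  have "\<exists>y\<in>W. (norm (x - y))\<^sup>2 < d + inverse (real (Suc n))" for n
    using cINF_less_iff[OF _ bdd, of "d + inverse (real (Suc n))"] W0
    unfolding d_def[symmetric] by auto
  then obtain Y where Y: "\<And>n. Y n \<in> W" "\<And>n. (norm (x - Y n))\<^sup>2 < d + inverse (real (Suc n))"
    by metis
  \<comment> \<open>The midpoint of \<open>Y m\<close> and \<open>Y n\<close> lies in
    \<open>W\<close>, so its squared distance to \<open>x\<close> is at least \<open>d\<close>. The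
    parallelogram identity then bounds |Y m - Y n|^2 by twice the sum of the two excesses over
    \<open>d\<close>.\<close>
  have par: "(norm (Y m - Y n))\<^sup>2 \<le> 2 * inverse (real (Suc m)) + 2 * inverse (real (Suc n))" for m n
  proof -
    have "(1/2) *\<^sub>R (Y m + Y n) \<in> W" using sub Y(1) by (simp add: subspace_add subspace_scale)
    then have "d \<le> (norm (x - (1/2) *\<^sub>R (Y m + Y n)))\<^sup>2" by (rule d_le)
    moreover have "4 * (norm (x - (1/2) *\<^sub>R (Y m + Y n)))\<^sup>2 + (norm (Y m - Y n))\<^sup>2
       = 2 * (norm (x - Y m))\<^sup>2 + 2 * (norm (x - Y n))\<^sup>2"
      unfolding power2_norm_eq_inner
      by (simp add: algebra_simps inner_commute)
    ultimately show ?thesis using Y(2)[of m] Y(2)[of n] by linarith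
  qed
  have "Cauchy Y"
  proof (rule metric_CauchyI)
    fix e :: real assume "e > 0"
    then have e2: "e\<^sup>2 / 4 > 0" by simp
    then obtain N where N: "inverse (real (Suc N)) < e\<^sup>2 / 4" using reals_Archimedean by blast
    show "\<exists>M. \<forall>m\<ge>M. \<forall>n\<ge>M. dist (Y m) (Y n) < e"
    proof (intro exI allI impI)
      fix m n assume mn: "m \<ge> N" "n \<ge> N"
      have "inverse (real (Suc k)) \<le> inverse (real (Suc N))" if "k \<ge> N" for k
        using that by (simp add: field_simps)
      from this[OF mn(1)] this[OF mn(2)] par[of m n] N have "(norm (Y m - Y n))\<^sup>2 < e\<^sup>2"
        by linarith
      then show "dist (Y m) (Y n) < e"
        using \<open>e > 0\<close> by (simp add: dist_norm power2_less_imp_less)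
    qed
  qed
  then obtain y where y: "Y \<longlonglongrightarrow> y" using Cauchy_convergent convergent_def by blast
  have yW: "y \<in> W" using cl y Y(1) closed_sequentially by blast
  have "(\<lambda>n. (norm (x - Y n))\<^sup>2) \<longlonglongrightarrow> (norm (x - y))\<^sup>2" by (intro tendsto_intros y)
  moreover have "(\<lambda>n. d + inverse (real (Suc n))) \<longlonglongrightarrow> d + 0"
    by (intro tendsto_intros LIMSEQ_inverse_real_of_nat)
  ultimately have le: "(norm (x - y))\<^sup>2 \<le> d"
    using LIMSEQ_le[of "\<lambda>n. (norm (x - Y n))\<^sup>2" _ "\<lambda>n. d + inverse (real (Suc n))" "d + 0"]
      Y(2)[THEN less_imp_le] by auto
  have "inner (x - y) z = 0" if z: "z \<in> W" for z
  proof (cases "z = 0")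
    case False
    \<comment> \<open>The value of \<open>t\<close> that minimises |x - (y + t z)|^2. A nonzero
      inner product would make this point strictly closer to \<open>x\<close> than
      \<open>y\<close>.\<close>
    define t where "t = inner (x - y) z / inner z z"
    have zz: "inner z z > 0" using False by simp
    have "y + t *\<^sub>R z \<in> W" using sub yW z by (simp add: subspace_add subspace_scale)
    then have "(norm (x - y))\<^sup>2 \<le> (norm (x - (y + t *\<^sub>R z)))\<^sup>2" using d_le order_trans[OF le] by blast
    also have "\<dots> = (norm (x - y))\<^sup>2 - 2 * t * inner (x - y) z + t\<^sup>2 * inner z z"
      unfolding power2_norm_eq_inner
      by (simp add: algebra_simps inner_commute power2_eq_square)
    also have "\<dots> = (norm (x - y))\<^sup>2 - (inner (x - y) z)\<^sup>2 / inner z z"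
      using zz unfolding t_def by (simp add: field_simps power2_eq_square)
    finally have "(inner (x - y) z)\<^sup>2 / inner z z \<le> 0" by linarith
    then show ?thesis using zz by (simp add: divide_le_0_iff)
  qed simp
  with yW show ?thesis using that by blast
qed

definition orth_proj :: "'h::{real_inner, complete_space} set \<Rightarrow> 'h \<Rightarrow> 'h" where
  "orth_proj W x = (SOME y. y \<in> W \<and> (\<forall>z\<in>W. inner (x - y) z = 0))"

lemma orth_proj:
  assumes "subspace W" "closed W"
  shows orth_proj_mem: "orth_proj W x \<in> W"
    and orth_proj_inner: "z \<in> W \<Longrightarrow> inner (orth_proj W x) z = inner x z"
proof -
  have *: "\<exists>y. y \<in> W \<and> (\<forall>z\<in>W. inner (x - y) z = 0)"
    by (rule orthogonal_projection_exists[OF assms, of x]) blast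
  note P = someI_ex[OF *, folded orth_proj_def]
  show "orth_proj W x \<in> W" using P by blast
  show "inner (orth_proj W x) z = inner x z" if "z \<in> W"
    using P that by (simp add: inner_diff_left)
qed

lemma orth_proj_lipschitz:
  assumes W: "subspace W" "closed W"
  shows "norm (orth_proj W x - orth_proj W y) \<le> norm (x - y)"
proof -
  let ?d = "orth_proj W x - orth_proj W y"
  have "?d \<in> W" using orth_proj_mem[OF W] W(1) subspace_diff by blast
  then have "inner ?d ?d = inner (x - y) ?d"
    using orth_proj_inner[OF W, of ?d x] orth_proj_inner[OF W, of ?d y]
    by (metis inner_diff_left)
  then have "norm ?d * norm ?d = inner (x - y) ?d"
    by (simp only: power2_norm_eq_inner[symmetric] power2_eq_square)
  also have "\<dots> \<le> norm (x - y) * norm ?d" by (rule norm_cauchy_schwarz)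
  finally show ?thesis by (cases "norm ?d = 0") auto
qed

lemma orth_proj_zero: "subspace W \<Longrightarrow> closed W \<Longrightarrow> orth_proj W 0 = 0"
  using orth_proj_mem[of W 0] orth_proj_inner[of W "orth_proj W 0" 0] by simp

lemma continuous_on_orth_proj: "subspace W \<Longrightarrow> closed W \<Longrightarrow> continuous_on S (orth_proj W)"
  by (rule lipschitz_on_continuous_on[of 1])
     (auto intro!: lipschitz_onI orth_proj_lipschitz simp: dist_norm)

section \<open>Descent steps, almost critical points and the mountain pass\<close>

text \<open>\<open>G u\<close> is the gradient of \<open>E\<close> along \<open>W\<close>: against
  vectors of \<open>W\<close> the projection of \<open>N u\<close> acts like \<open>N u\<close>. One
  step gains \<open>h * |G u|^2\<close> to first order, the quadratic terms cost at most half of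
  that, and the linear error of the expansion costs \<open>h * e * |G u|\<close>. The step is
  therefore useful as soon as \<open>norm (G u)\<close> exceeds \<open>2 * e\<close>.\<close>

lemma euler_step_decrease:
  fixes W :: "'h::{real_inner, complete_space} set" and N :: "'h \<Rightarrow> 'h" and K :: "'h \<Rightarrow> real"
  assumes W: "subspace W" "closed W"
    and S: "\<And>R e. e > 0 \<Longrightarrow> \<exists>C\<ge>0. \<forall>f f'. norm f \<le> R \<longrightarrow>
        \<bar>K f' - K f - inner (N f) (f' - f)\<bar> \<le> e * norm (f' - f) + C * (norm (f' - f))\<^sup>2"
    and e: "e > 0"
  defines "G \<equiv> \<lambda>u. u - orth_proj W (N u)" and "E \<equiv> \<lambda>u. (norm u)\<^sup>2 / 2 - K u"
  shows "\<exists>h>0. h \<le> 1 \<and> (\<forall>u\<in>W. norm u \<le> R \<longrightarrow>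
     E (u - h *\<^sub>R G u) \<le> E u - h * norm (G u) * (norm (G u) / 2 - e))"
proof -
  obtain C where C: "C \<ge> 0" "\<And>f f'. norm f \<le> R \<Longrightarrow>
        \<bar>K f' - K f - inner (N f) (f' - f)\<bar> \<le> e * norm (f' - f) + C * (norm (f' - f))\<^sup>2"
    using S[OF e, of R] by blast
  \<comment> \<open>The solution of \<open>h * (1/2 + C) = 1/2\<close>: the term 1/2 comes from the
    squared norm and \<open>C\<close> from the expansion of \<open>K\<close>.\<close>
  define h where "h = 1 / (1 + 2 * C)"
  have h: "h > 0" "h \<le> 1" "h * (1/2 + C) = 1/2"
    using C(1) by (auto simp: h_def field_simps)
  have "E (u - h *\<^sub>R G u) \<le> E u - h * norm (G u) * (norm (G u) / 2 - e)"
    if u: "u \<in> W" "norm u \<le> R" for u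
  proof -
    let ?g = "G u"
    have gW: "?g \<in> W" unfolding G_def using u W orth_proj_mem subspace_diff by blast
    have NG: "inner (N u) ?g = inner u ?g - (norm ?g)\<^sup>2"
      using orth_proj_inner[OF W gW, of "N u"] unfolding power2_norm_eq_inner
      by (simp add: G_def inner_diff_left)
    have "\<bar>K (u - h *\<^sub>R ?g) - K u - inner (N u) ((u - h *\<^sub>R ?g) - u)\<bar>
        \<le> e * norm ((u - h *\<^sub>R ?g) - u) + C * (norm ((u - h *\<^sub>R ?g) - u))\<^sup>2"
      by (rule C(2)[OF u(2)])
    then have A: "\<bar>K (u - h *\<^sub>R ?g) - K u + h * inner (N u) ?g\<bar> \<le> e * (h * norm ?g) + C * (h * norm ?g)\<^sup>2"
      using h by simp
    have B: "(norm (u - h *\<^sub>R ?g))\<^sup>2 = (norm u)\<^sup>2 - 2 * h * inner u ?g + h\<^sup>2 * (norm ?g)\<^sup>2"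
      unfolding power2_norm_eq_inner
      by (simp add: inner_diff_left inner_diff_right inner_commute power2_eq_square algebra_simps)
    have D: "(h * norm ?g)\<^sup>2 * (1/2 + C) = h * (norm ?g)\<^sup>2 / 2"
    proof -
      have "(h * norm ?g)\<^sup>2 * (1/2 + C) = h * (norm ?g)\<^sup>2 * (h * (1/2 + C))"
        by (simp only: power_mult_distrib power2_eq_square ac_simps)
      then show ?thesis unfolding h(3) by simp
    qed
    have "E (u - h *\<^sub>R ?g) = E u - h * inner u ?g + (h * norm ?g)\<^sup>2 / 2 - (K (u - h *\<^sub>R ?g) - K u)"
      unfolding E_def B by (simp add: field_simps power_mult_distrib)
    also have "\<dots> \<le> E u - h * inner u ?g + (h * norm ?g)\<^sup>2 / 2 + h * inner (N u) ?g
        + e * (h * norm ?g) + C * (h * norm ?g)\<^sup>2"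
      using A by linarith
    also have "\<dots> = E u - h * (norm ?g)\<^sup>2 + e * (h * norm ?g) + (h * norm ?g)\<^sup>2 * (1/2 + C)"
      unfolding NG by (simp add: algebra_simps)
    also have "\<dots> = E u - h * norm ?g * (norm ?g / 2 - e)"
      unfolding D by (simp add: algebra_simps power2_eq_square)
    finally show ?thesis .
  qed
  with h show ?thesis by blast
qed

text \<open>\<open>X n\<close> is the sum of a null sequence and of the projection of
  \<open>N (X n)\<close>, and the latter converges along a subsequence because \<open>N\<close> is
  compact on bounded subsets of \<open>W\<close>. Hence \<open>X\<close> itself converges along it,
  and continuity of \<open>N\<close> turns the limit into a fixed point.\<close>

lemma palais_smale_convergence:
  fixes W :: "'h::{real_inner, complete_space} set" and N :: "'h \<Rightarrow> 'h"
  assumes W: "subspace W" "closed W"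
    and Nc: "continuous_on UNIV N"
    and cpt: "\<And>R X. (\<forall>n. X n \<in> W \<and> norm (X n) \<le> R) \<Longrightarrow>
        \<exists>l r. strict_mono (r::nat \<Rightarrow> nat) \<and> (\<lambda>n. N (X (r n))) \<longlonglongrightarrow> l"
    and X: "\<And>n. X n \<in> W" "\<And>n. norm (X n) \<le> R"
      "(\<lambda>n. X n - orth_proj W (N (X n))) \<longlonglongrightarrow> 0"
  obtains u r where "strict_mono (r::nat \<Rightarrow> nat)" "(\<lambda>n. X (r n)) \<longlonglongrightarrow> u" "u \<in> W" "orth_proj W (N u) = u"
proof -
  obtain l r where r: "strict_mono r" "(\<lambda>n. N (X (r n))) \<longlonglongrightarrow> l" using cpt[of X R] X(1,2) by auto
  have "(\<lambda>n. X (r n) - orth_proj W (N (X (r n)))) \<longlonglongrightarrow> 0"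
    using LIMSEQ_subseq_LIMSEQ[OF X(3) r(1)] by (simp add: o_def)
  moreover have "(\<lambda>n. orth_proj W (N (X (r n)))) \<longlonglongrightarrow> orth_proj W l"
    by (rule continuous_on_tendsto_compose[OF continuous_on_orth_proj[OF W, of UNIV] r(2)]) auto
  ultimately have lim: "(\<lambda>n. X (r n)) \<longlonglongrightarrow> orth_proj W l"
    using tendsto_add[of "\<lambda>n. X (r n) - orth_proj W (N (X (r n)))" 0 sequentially "\<lambda>n. orth_proj W (N (X (r n)))"]
    by simp
  have "(\<lambda>n. N (X (r n))) \<longlonglongrightarrow> N (orth_proj W l)"
    by (rule continuous_on_tendsto_compose[OF Nc lim]) auto
  with r(2) have "N (orth_proj W l) = l" using LIMSEQ_unique by blast
  then show ?thesis using that[OF r(1) lim] orth_proj_mem[OF W] by simp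
qed

text \<open>On \<open>W\<close> the critical points of \<open>E\<close> are the fixed points of
  \<open>orth_proj W\<close> after \<open>N\<close>, because both say that \<open>u - N u\<close> is
  orthogonal to \<open>W\<close>. The two solutions are told apart by their energies, one negative
  and one at least \<open>\<alpha> / 2\<close>. The factor 1/4 in \<open>small\<close> and
  \<open>coercive\<close> leaves half of the quadratic term of \<open>E\<close>.\<close>

theorem two_nontrivial_critical_points:
  fixes W :: "'h::{real_inner, complete_space} set" and N :: "'h \<Rightarrow> 'h" and K :: "'h \<Rightarrow> real"
  assumes W: "subspace W" "closed W"
    and S: "\<And>R e. e > 0 \<Longrightarrow> \<exists>C\<ge>0. \<forall>f f'. norm f \<le> R \<longrightarrow>
        \<bar>K f' - K f - inner (N f) (f' - f)\<bar> \<le> e * norm (f' - f) + C * (norm (f' - f))\<^sup>2"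
    and Nc: "continuous_on UNIV N"
    and cpt: "\<And>R X. (\<forall>n. X n \<in> W \<and> norm (X n) \<le> R) \<Longrightarrow>
        \<exists>l r. strict_mono (r::nat \<Rightarrow> nat) \<and> (\<lambda>n. N (X (r n))) \<longlonglongrightarrow> l"
    and K0: "K 0 = 0" and N0: "N 0 = 0" and Kpos: "\<And>u. u \<in> W \<Longrightarrow> K u \<ge> 0"
    and small: "r0 > 0" "\<And>u. u \<in> W \<Longrightarrow> norm u \<le> r0 \<Longrightarrow> K u \<le> (norm u)\<^sup>2 / 4"
    and coercive: "\<And>u. u \<in> W \<Longrightarrow> K u \<le> (norm u)\<^sup>2 / 4 + C0"
    and e: "e \<in> W" "(norm e)\<^sup>2 / 2 < K e"
  shows "\<exists>u1\<in>W. \<exists>u2\<in>W. u1 \<noteq> 0 \<and> u2 \<noteq> 0 \<and> u1 \<noteq> u2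
    \<and> orth_proj W (N u1) = u1 \<and> orth_proj W (N u2) = u2"
proof -
  define G where "G = (\<lambda>u. u - orth_proj W (N u))"
  define E where "E = (\<lambda>u. (norm u)\<^sup>2 / 2 - K u)"
  have step: "\<exists>h>0. h \<le> 1 \<and> (\<forall>u\<in>W. norm u \<le> R \<longrightarrow>
     E (u - h *\<^sub>R G u) \<le> E u - h * norm (G u) * (norm (G u) / 2 - d))" if "d > 0" for d R
    unfolding E_def G_def by (rule euler_step_decrease[where K=K and N=N, OF W S that])
  note PS = palais_smale_convergence[OF W Nc cpt]
  have G0: "G 0 = 0" by (simp add: G_def N0 orth_proj_zero[OF W])
  have E0: "E 0 = 0" by (simp add: E_def K0)
  have GW: "G u \<in> W" if "u \<in> W" for u
    unfolding G_def using that W orth_proj_mem subspace_diff by blast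
  have Gc: "continuous_on UNIV G"
    unfolding G_def
    by (intro continuous_intros continuous_on_compose2[OF continuous_on_orth_proj[OF W, of UNIV] Nc]) auto
  \<comment> \<open>Continuity of \<open>K\<close> follows from its own expansion at
    \<open>u\<close> with \<open>e = 1\<close>: every term of the bound vanishes with the
    displacement.\<close>
  have Kc: "(\<lambda>n. K (X n)) \<longlonglongrightarrow> K u" if X: "X \<longlonglongrightarrow> u" for X :: "nat \<Rightarrow> 'h" and u
  proof -
    obtain C where C: "\<And>f'. \<bar>K f' - K u - inner (N u) (f' - u)\<bar> \<le> 1 * norm (f' - u) + C * (norm (f' - u))\<^sup>2"
      using S[of 1 "norm u"] by auto
    have d: "(\<lambda>n. X n - u) \<longlonglongrightarrow> 0" using X by (simp add: LIM_zero)
    have "(\<lambda>n. norm (X n - u) + C * (norm (X n - u))\<^sup>2) \<longlonglongrightarrow> norm (0::'h) + C * (norm (0::'h))\<^sup>2"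
      by (intro tendsto_intros d)
    then have "(\<lambda>n. norm (X n - u) + C * (norm (X n - u))\<^sup>2) \<longlonglongrightarrow> 0" by simp
    moreover have "\<forall>\<^sub>F n in sequentially. norm (K (X n) - K u - inner (N u) (X n - u)) \<le> norm (X n - u) + C * (norm (X n - u))\<^sup>2"
      using C by simp
    ultimately have 1: "(\<lambda>n. K (X n) - K u - inner (N u) (X n - u)) \<longlonglongrightarrow> 0"
      by (rule Lim_null_comparison[rotated])
    have 2: "(\<lambda>n. inner (N u) (X n - u)) \<longlonglongrightarrow> inner (N u) 0" by (intro tendsto_intros d)
    from tendsto_add[OF 1 2] have "(\<lambda>n. K (X n) - K u) \<longlonglongrightarrow> 0" by simp
    then show ?thesis by (rule LIM_zero_cancel)
  qed
  have Ec: "(\<lambda>n. E (X n)) \<longlonglongrightarrow> E u" if X: "X \<longlonglongrightarrow> u" for X :: "nat \<Rightarrow> 'h" and u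
    unfolding E_def by (intro tendsto_intros Kc X) simp
  have Elow: "E u \<ge> (norm u)\<^sup>2 / 4 - C0" if "u \<in> W" for u
    using coercive[OF that] by (simp add: E_def)
  \<comment> \<open>Almost critical points whose energies stay above \<open>A\<close> and tend to at
    most \<open>B\<close> produce a critical point with energy in [A, B]. Coercivity bounds them, so
    the compactness statement applies. It is used once with \<open>A = B = m\<close> and once for
    the mountain pass.\<close>
  have crit: "\<exists>u\<in>W. orth_proj W (N u) = u \<and> A \<le> E u \<and> E u \<le> B"
    if B: "\<And>n. \<exists>u\<in>W. A \<le> E u \<and> E u \<le> B + inverse (Suc n) \<and> norm (G u) \<le> inverse (Suc n)" for A B
  proof -
    obtain X where X: "\<And>n. X n \<in> W" "\<And>n. A \<le> E (X n)" "\<And>n. E (X n) \<le> B + inverse (Suc n)"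
      "\<And>n. norm (G (X n)) \<le> inverse (Suc n)"
      using B by metis
    have inv1: "inverse (real (Suc n)) \<le> 1" for n by (simp add: field_simps)
    have "norm (X n) \<le> sqrt (4 * (B + 1 + C0))" for n
    proof (rule real_le_rsqrt)
      show "(norm (X n))\<^sup>2 \<le> 4 * (B + 1 + C0)"
      proof -
        have "E (X n) \<le> B + 1" using order_trans[OF X(3)[of n] add_left_mono[OF inv1[of n]]] .
        with Elow[OF X(1)[of n]] show ?thesis by argo
      qed
    qed
    note bd = this
    have "(\<lambda>n. G (X n)) \<longlonglongrightarrow> 0"
      by (rule Lim_null_comparison[OF _ LIMSEQ_inverse_real_of_nat]) (intro always_eventually allI X(4))
    then have lim0: "(\<lambda>n. X n - orth_proj W (N (X n))) \<longlonglongrightarrow> 0" by (simp add: G_def)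
    obtain u r where r: "strict_mono (r::nat\<Rightarrow>nat)" and u: "(\<lambda>n. X (r n)) \<longlonglongrightarrow> u" "u \<in> W" "orth_proj W (N u) = u"
      by (rule PS[OF _ X(1) bd lim0]) auto
    have Eu: "(\<lambda>n. E (X (r n))) \<longlonglongrightarrow> E u" by (rule Ec[OF u(1)])
    have "A \<le> E u" using Eu X(2) by (intro LIMSEQ_le_const) auto
    moreover have "(\<lambda>n. B + inverse (real (Suc (r n)))) \<longlonglongrightarrow> B + 0"
      by (intro tendsto_intros LIMSEQ_subseq_LIMSEQ[OF LIMSEQ_inverse_real_of_nat r(1), unfolded o_def])
    then have "E u \<le> B + 0" by (rule LIMSEQ_le[OF Eu]) (use X(3) in auto)
    ultimately show ?thesis using u by auto
  qed
  define m where "m = (INF u\<in>W. E u)"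
  have bddE: "bdd_below (E ` W)"
    using Elow by (intro bdd_belowI2[of _ "- C0"]) (smt (verit) divide_nonneg_nonneg zero_le_power2)
  have m_le: "m \<le> E u" if "u \<in> W" for u
    unfolding m_def by (rule cINF_lower[OF bddE that])
  have m_less: "\<exists>u\<in>W. E u < m + d" if "d > 0" for d
    using cINF_less_iff[OF _ bddE, of "m + d"] e(1) that unfolding m_def[symmetric] by auto
  \<comment> \<open>A point whose energy exceeds the infimum by less than
    \<open>h * d * (d/4)\<close> must satisfy \<open>norm (G u) \<le> d\<close>: otherwise the step,
    taken with error \<open>d/4\<close>, would gain at least that amount and fall below the
    infimum.\<close>
  have "\<exists>u\<in>W. m \<le> E u \<and> E u \<le> m + inverse (Suc n) \<and> norm (G u) \<le> inverse (Suc n)" for n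
  proof -
    define d where "d = inverse (real (Suc n))"
    have d: "d > 0" "d \<le> 1" by (auto simp: d_def field_simps)
    define R where "R = sqrt (4 * (m + 1 + C0))"
    obtain h where h: "h > 0" "h \<le> 1" "\<And>u. u \<in> W \<Longrightarrow> norm u \<le> R \<Longrightarrow>
        E (u - h *\<^sub>R G u) \<le> E u - h * norm (G u) * (norm (G u) / 2 - d/4)"
      using step[of "d/4" R] d by auto
    have "min d (h * d * (d/4)) > 0" using d h by simp
    then obtain u where u: "u \<in> W" "E u < m + min d (h * d * (d/4))" using m_less by blast
    then have ud: "E u < m + d" "E u < m + h * d * (d/4)" by auto
    have "norm u \<le> R" unfolding R_def
    proof (rule real_le_rsqrt)
      show "(norm u)\<^sup>2 \<le> 4 * (m + 1 + C0)"
        using Elow[OF u(1)] ud(1) d(2) by argo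
    qed
    note h3 = h(3)[OF u(1) this]
    have "u - h *\<^sub>R G u \<in> W" using u(1) GW W(1) by (simp add: subspace_diff subspace_scale)
    then have le: "m \<le> E u - h * norm (G u) * (norm (G u) / 2 - d/4)" using h3 m_le by force
    have "norm (G u) \<le> d"
    proof (rule ccontr)
      assume "\<not> norm (G u) \<le> d"
      then have "h * d * (d/4) \<le> h * norm (G u) * (norm (G u) / 2 - d/4)"
        using d h by (intro mult_mono) auto
      with le ud(2) show False by linarith
    qed
    then show ?thesis using u(1) m_le[OF u(1)] ud(1) unfolding d_def by (intro bexI[of _ u]) auto
  qed
  from crit[OF this] obtain u1 where u1: "u1 \<in> W" "orth_proj W (N u1) = u1" "E u1 = m"
    by force
  have "m < 0" using m_le[OF e(1)] e(2) by (simp add: E_def)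
  have Esm: "E u \<ge> (norm u)\<^sup>2 / 4" if "u \<in> W" "norm u \<le> r0" for u
    using small(2)[OF that] by (simp add: E_def)
  have big: "norm u1 > r0"
  proof (rule ccontr)
    assume "\<not> norm u1 > r0"
    then have "0 \<le> E u1" using Esm[of u1] u1(1) by (smt (verit) divide_nonneg_nonneg zero_le_power2)
    then show False using u1(3) \<open>m < 0\<close> by simp
  qed
  \<comment> \<open>The height of the pass: on the sphere of radius \<open>r0\<close> in
    \<open>W\<close> the energy is at least \<open>r0^2 / 4\<close>.\<close>
  define \<alpha> where "\<alpha> = r0\<^sup>2 / 4"
  have \<alpha>: "\<alpha> > 0" using small(1) by (simp add: \<alpha>_def)
  \<comment> \<open>An upper bound for \<open>E\<close> on the segment from 0 to \<open>u1\<close>,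
    where \<open>K \<ge> 0\<close> leaves only the quadratic term. The summand
    \<open>\<alpha>\<close> puts \<open>M\<close> above the height of the pass.\<close>
  define M where "M = (norm u1)\<^sup>2 / 2 + \<alpha>"
  define R where "R = sqrt (4 * (M + C0))"
  have M\<alpha>: "M \<ge> \<alpha>" by (simp add: M_def)
  have inR: "norm u \<le> R" if "u \<in> W" "E u \<le> M" for u
    unfolding R_def using Elow[OF that(1)] that(2) by (intro real_le_rsqrt) argo
  have G1: "G u1 = 0" using u1 by (simp add: G_def)
  have "\<exists>u\<in>W. \<alpha>/2 \<le> E u \<and> E u \<le> M + inverse (Suc n) \<and> norm (G u) \<le> inverse (Suc n)" for n
  proof (rule ccontr)
    assume neg: "\<not> ?thesis"
    define d where "d = min (inverse (real (Suc n))) (min 1 \<alpha>)"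
    have d: "d > 0" "d \<le> 1" "d \<le> inverse (Suc n)" "d \<le> \<alpha>" using \<alpha> by (auto simp: d_def)
    have large: "norm (G u) > d" if "u \<in> W" "\<alpha>/2 \<le> E u" "E u \<le> M" for u
    proof -
      have "E u \<le> M + inverse (Suc n)" using that(3) by (simp add: add_increasing2)
      then have "norm (G u) > inverse (Suc n)" using neg that by force
      then show ?thesis using d by linarith
    qed
    obtain h where h: "h > 0" "h \<le> 1" "\<And>u. u \<in> W \<Longrightarrow> norm u \<le> R \<Longrightarrow>
        E (u - h *\<^sub>R G u) \<le> E u - h * norm (G u) * (norm (G u) / 2 - d/4)"
      using step[of "d/4" R] d by auto
    define \<Psi> where "\<Psi> = (\<lambda>u. u - h *\<^sub>R G u)"
    have \<Psi>W: "\<Psi> u \<in> W" if "u \<in> W" for u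
      unfolding \<Psi>_def using that GW W(1) by (simp add: subspace_diff subspace_scale)
    have \<Psi>nW: "(\<Psi> ^^ k) u \<in> W" if "u \<in> W" for u k
      using that by (induction k) (auto intro: \<Psi>W)
    have \<Psi>c: "continuous_on UNIV (\<Psi> ^^ k)" for k
    proof (induction k)
      case (Suc k)
      have c1: "continuous_on UNIV \<Psi>" unfolding \<Psi>_def by (intro continuous_intros Gc)
      show ?case using continuous_on_compose2[OF c1 Suc] by (simp add: o_def)
    qed (simp add: continuous_on_id')
    define D where "D = h * d * (d/4)"
    have D: "D > 0" using d h by (simp add: D_def)
    have dec1: "E (\<Psi> u) \<le> E u - D" if u: "u \<in> W" "\<alpha>/2 \<le> E u" "E u \<le> M" for u
    proof -
      have "h * d * (d/4) \<le> h * norm (G u) * (norm (G u) / 2 - d/4)"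
        using d h large[OF u] by (intro mult_mono) auto
      with h(3)[OF u(1) inR[OF u(1,3)]] show ?thesis by (simp add: \<Psi>_def D_def)
    qed
    \<comment> \<open>Below the level \<open>\<alpha> / 2\<close> nothing bounds \<open>G\<close>
      from below, so a step may raise the energy. Completing the square with
      \<open>x = norm (G u)\<close> shows that \<open>x * (x/2 - d/4)\<close> is at least
      \<open>- d^2 / 32\<close>. Since \<open>d\<close> was taken below both 1 and
      \<open>\<alpha>\<close>, the rise is at most \<open>\<alpha> / 32\<close>, and the level
      \<open>3 * \<alpha> / 4\<close> is not passed.\<close>
    have dec2: "E (\<Psi> u) \<le> 3 * \<alpha> / 4" if u: "u \<in> W" "E u \<le> \<alpha>/2" for u
    proof -
      have "E u \<le> M" using u(2) \<alpha> M\<alpha> by linarith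
      have "0 \<le> (norm (G u) - d/4)\<^sup>2" by simp
      then have "- (norm (G u) * (norm (G u) / 2 - d/4)) \<le> d\<^sup>2 / 32"
        by (simp add: power2_eq_square algebra_simps)
      also have "\<dots> \<le> d / 32" using d by (simp add: power2_eq_square mult_left_le)
      finally have "- (norm (G u) * (norm (G u) / 2 - d/4)) \<le> \<alpha> / 32" using d by linarith
      then have "h * (- (norm (G u) * (norm (G u) / 2 - d/4))) \<le> h * (\<alpha> / 32)"
        using h by (intro mult_left_mono) auto
      also have "\<dots> \<le> 1 * (\<alpha> / 32)" using h \<alpha> by (intro mult_right_mono) auto
      finally have "- (h * norm (G u) * (norm (G u) / 2 - d/4)) \<le> \<alpha> / 32" by (simp add: algebra_simps)
      with h(3)[OF u(1) inR[OF u(1) \<open>E u \<le> M\<close>]] u(2) \<alpha> show ?thesis unfolding \<Psi>_def by linarith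
    qed
    have iter: "E ((\<Psi> ^^ k) u) \<le> max (3 * \<alpha> / 4) (M - k * D)" if "u \<in> W" "E u \<le> M" for k u
    proof (induction k)
      case (Suc k)
      let ?w = "(\<Psi> ^^ k) u"
      have wW: "?w \<in> W" by (rule \<Psi>nW[OF that(1)])
      have "real k * D \<ge> 0" using D by simp
      then have wM: "E ?w \<le> M" using Suc M\<alpha> \<alpha> by linarith
      have kD: "real (Suc k) * D = real k * D + D" by (simp add: algebra_simps)
      show ?case
      proof (cases "\<alpha>/2 \<le> E ?w")
        case True
        show ?thesis unfolding kD funpow.simps o_apply using dec1[OF wW True wM] Suc D by linarith
      next
        case False
        show ?thesis using dec2[OF wW] False by auto
      qed
    qed (use that in auto)
    obtain k where k: "real k * D > M" using reals_Archimedean3[OF D] by blast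
    have fix0: "(\<Psi> ^^ k) 0 = 0" by (induction k) (auto simp: \<Psi>_def G0)
    have fix1: "(\<Psi> ^^ k) u1 = u1" by (induction k) (auto simp: \<Psi>_def G1)
    \<comment> \<open>After \<open>k\<close> steps the whole image of the segment lies below
      \<open>3 * \<alpha> / 4\<close>. Its ends never moved, because \<open>G\<close> vanishes at 0
      and at \<open>u1\<close>, and \<open>u1\<close> lies outside the ball of radius
      \<open>r0\<close>. So the image still meets the sphere, where the energy is at least
      \<open>\<alpha>\<close>.\<close>
    have "\<exists>t\<ge>0. t \<le> 1 \<and> norm ((\<Psi> ^^ k) (t *\<^sub>R u1)) = r0"
    proof (rule IVT')
      show "continuous_on {0..1} (\<lambda>t. norm ((\<Psi> ^^ k) (t *\<^sub>R u1)))"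
        by (intro continuous_intros continuous_on_compose2[OF \<Psi>c]) auto
    qed (use fix0 fix1 big small(1) in auto)
    then obtain t where t: "0 \<le> t" "t \<le> 1" "norm ((\<Psi> ^^ k) (t *\<^sub>R u1)) = r0" by blast
    have tW: "t *\<^sub>R u1 \<in> W" using W(1) u1(1) by (simp add: subspace_scale)
    have "(norm (t *\<^sub>R u1))\<^sup>2 \<le> (norm u1)\<^sup>2"
      using t by (intro power_mono) (auto simp: mult_left_le_one_le)
    then have "E (t *\<^sub>R u1) \<le> M" using Kpos[OF tW] \<alpha> unfolding E_def M_def by linarith
    from iter[OF tW this, of k] k \<alpha> have "E ((\<Psi> ^^ k) (t *\<^sub>R u1)) \<le> 3 * \<alpha> / 4" by auto
    moreover have "E ((\<Psi> ^^ k) (t *\<^sub>R u1)) \<ge> \<alpha>" using Esm[OF \<Psi>nW[OF tW, of k]] t(3) by (simp add: \<alpha>_def)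
    ultimately show False using \<alpha> by linarith
  qed
  from crit[OF this] obtain u2 where u2: "u2 \<in> W" "orth_proj W (N u2) = u2" "E u2 \<ge> \<alpha>/2" by blast
  have "u1 \<noteq> 0" "u2 \<noteq> 0" "u1 \<noteq> u2" using u1(3) u2(3) E0 \<open>m < 0\<close> \<alpha> by auto
  with u1 u2 show ?thesis by blast
qed

section \<open>The Hilbert space of square-integrable functions\<close>

text \<open>Borel functions on the whole space, measured by \<open>lborel\<close>: compositions,
  translations and Fubini then work for every representative, and a domain enters only through
  extension by zero.\<close>

definition sqint :: "('a::euclidean_space \<Rightarrow> 'b::euclidean_space) \<Rightarrow> bool" where
  "sqint f \<longleftrightarrow> f \<in> borel_measurable borel \<and> integrable lborel (\<lambda>x. (norm (f x))\<^sup>2)"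

lemma sqint_measurable [measurable_dest]: "sqint f \<Longrightarrow> f \<in> borel_measurable borel"
  by (simp add: sqint_def)

lemma sqint_integrable: "sqint f \<Longrightarrow> integrable lborel (\<lambda>x. (norm (f x))\<^sup>2)"
  by (simp add: sqint_def)

lemma sqintI_bound:
  assumes "f \<in> borel_measurable borel" "integrable lborel g" "\<And>x. (norm (f x))\<^sup>2 \<le> g x"
  shows "sqint f"
  unfolding sqint_def
proof (intro conjI assms(1) Bochner_Integration.integrable_bound[OF assms(2)] AE_I2)
  show "norm ((norm (f x))\<^sup>2) \<le> norm (g x)" for x
    using order_trans[OF assms(3)[of x] abs_ge_self] by simp
qed (use assms(1) in measurable)

lemma norm_sum_sq_le: "(norm (x + y :: 'b::real_normed_vector))\<^sup>2 \<le> 2 * (norm x)\<^sup>2 + 2 * (norm y)\<^sup>2"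
proof -
  have "(norm (x + y))\<^sup>2 \<le> (norm x + norm y)\<^sup>2" by (intro power_mono norm_triangle_ineq) auto
  also have "\<dots> \<le> 2 * (norm x)\<^sup>2 + 2 * (norm y)\<^sup>2"
    using sum_squares_bound[of "norm x" "norm y"] by (simp add: power2_sum)
  finally show ?thesis .
qed

lemma sqint_0 [simp]: "sqint (\<lambda>_. 0)" by (simp add: sqint_def)

lemma sqint_add: assumes "sqint f" "sqint g" shows "sqint (\<lambda>x. f x + g x)"
proof (rule sqintI_bound)
  show "integrable lborel (\<lambda>x. 2 * (norm (f x))\<^sup>2 + 2 * (norm (g x))\<^sup>2)"
    using assms by (intro Bochner_Integration.integrable_add integrable_mult_right sqint_integrable)
  show "(\<lambda>x. f x + g x) \<in> borel_measurable borel" using assms[THEN sqint_measurable] by measurable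
qed (rule norm_sum_sq_le)

lemma sqint_scaleR: assumes "sqint f" shows "sqint (\<lambda>x. r *\<^sub>R f x)"
  using assms by (auto simp: sqint_def power_mult_distrib)

lemma sqint_bounded_mult:
  assumes "sqint f" "h \<in> borel_measurable borel" "\<And>x. \<bar>h x\<bar> \<le> M"
  shows "sqint (\<lambda>x. h x *\<^sub>R f x)"
proof (rule sqintI_bound)
  show "integrable lborel (\<lambda>x. M\<^sup>2 * (norm (f x))\<^sup>2)"
    using assms by (intro integrable_mult_right sqint_integrable)
  show "(norm (h x *\<^sub>R f x))\<^sup>2 \<le> M\<^sup>2 * (norm (f x))\<^sup>2" for x
    unfolding norm_scaleR power_mult_distrib
    using assms(3)[of x] by (intro mult_right_mono power_mono) auto
  show "(\<lambda>x. h x *\<^sub>R f x) \<in> borel_measurable borel"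
    using assms(2) sqint_measurable[OF assms(1)] by measurable
qed

lemma sqint_norm_le:
  assumes "sqint f" "g \<in> borel_measurable borel" "\<And>x. norm (g x) \<le> norm (f x)"
  shows "sqint g"
  by (rule sqintI_bound[OF assms(2) sqint_integrable[OF assms(1)]]) (intro power_mono assms(3), simp)

lemma sqint_uminus: "sqint f \<Longrightarrow> sqint (\<lambda>x. - f x)"
  by (simp add: sqint_def)

lemma sqint_diff: "sqint f \<Longrightarrow> sqint g \<Longrightarrow> sqint (\<lambda>x. f x - g x)"
  using sqint_add[of f "\<lambda>x. - g x"] sqint_uminus by auto

lemma sqint_inner: assumes "sqint f" "sqint g" shows "integrable lborel (\<lambda>x. inner (f x) (g x))"
proof (rule Bochner_Integration.integrable_bound)
  show "integrable lborel (\<lambda>x. (norm (f x))\<^sup>2 + (norm (g x))\<^sup>2)"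
    using assms by (intro Bochner_Integration.integrable_add sqint_integrable)
  have "norm (inner (f x) (g x)) \<le> norm ((norm (f x))\<^sup>2 + (norm (g x))\<^sup>2)" for x
  proof -
    have "\<bar>inner (f x) (g x)\<bar> \<le> norm (f x) * norm (g x)" by (rule Cauchy_Schwarz_ineq2)
    moreover have "0 \<le> norm (f x) * norm (g x)" by simp
    ultimately show ?thesis using sum_squares_bound[of "norm (f x)" "norm (g x)"] by auto
  qed
  then show "AE x in lborel. norm (inner (f x) (g x)) \<le> norm ((norm (f x))\<^sup>2 + (norm (g x))\<^sup>2)" by simp
  show "(\<lambda>x. inner (f x) (g x)) \<in> borel_measurable lborel"
    using assms[THEN sqint_measurable] by measurable
qed

\<comment> \<open>L^2 as a complete inner product space\<close>
\<comment> \<open>As a type of its own, L^2 can be an instance of \<open>real_inner\<close> and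
  \<open>complete_space\<close>, so that the abstract critical point theorem and its products apply.
  The codomain is Euclidean since gradients and pairs of functions occur besides scalar
  ones.\<close>
quotient_type (overloaded) ('a, 'b) l2 = "'a::euclidean_space \<Rightarrow> 'b::euclidean_space" / partial:
  "\<lambda>f g. sqint f \<and> sqint g \<and> (AE x in lborel. f x = g x)"
  morphisms fn mk
proof (rule part_equivpI)
  show "\<exists>f::'a \<Rightarrow> 'b. sqint f \<and> sqint f \<and> (AE x in lborel. f x = f x)" by (auto intro: exI[of _ "\<lambda>_. 0"])
  show "symp (\<lambda>f g::'a \<Rightarrow> 'b. sqint f \<and> sqint g \<and> (AE x in lborel. f x = g x))"
    by (auto intro!: sympI)
  show "transp (\<lambda>f g::'a \<Rightarrow> 'b. sqint f \<and> sqint g \<and> (AE x in lborel. f x = g x))"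
    by (rule transpI) auto
qed

lemma sqint_fn [simp]: "sqint (fn f)"
  using Quotient_rep_reflp[OF Quotient_l2, of f] by simp

lemma fn_measurable [measurable]: "fn f \<in> borel_measurable borel"
  by (simp add: sqint_measurable)

lemma mk_fn [simp]: "mk (fn f) = f"
  by (rule Quotient_abs_rep[OF Quotient_l2])

lemma fn_mk: "sqint f \<Longrightarrow> AE x in lborel. fn (mk f) x = f x"
  using Quotient_rep_abs[OF Quotient_l2, of f] by simp

lemma mk_eq_iff: "sqint f \<Longrightarrow> sqint g \<Longrightarrow> mk f = mk g \<longleftrightarrow> (AE x in lborel. f x = g x)"
  using Quotient_rel[OF Quotient_l2, of f g] by simp

lemma l2_eq_iff: "f = g \<longleftrightarrow> (AE x in lborel. fn f x = fn g x)"
  using mk_eq_iff[of "fn f" "fn g"] by simp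

instantiation l2 :: (euclidean_space, euclidean_space) ab_group_add
begin
definition "0 = mk (\<lambda>_. 0)"
definition "f + g = mk (\<lambda>x. fn f x + fn g x)"
definition "f - g = mk (\<lambda>x. fn f x - fn g x)"
definition "- f = mk (\<lambda>x. - fn f x)"
lemma fn_0: "AE x in lborel. fn 0 x = 0"
  unfolding zero_l2_def by (rule fn_mk) simp
lemma fn_add: "AE x in lborel. fn (f + g) x = fn f x + fn g x"
  unfolding plus_l2_def by (rule fn_mk) (simp add: sqint_add)
lemma fn_diff: "AE x in lborel. fn (f - g) x = fn f x - fn g x"
  unfolding minus_l2_def by (rule fn_mk) (simp add: sqint_diff)
lemma fn_uminus: "AE x in lborel. fn (- f) x = - fn f x"
  unfolding uminus_l2_def by (rule fn_mk) (simp add: sqint_uminus)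
instance
proof
  fix f g h :: "('a, 'b) l2"
  show "f + g + h = f + (g + h)" unfolding l2_eq_iff
    using fn_add[of "f + g" h] fn_add[of f g] fn_add[of f "g + h"] fn_add[of g h]
    by eventually_elim (simp add: add.assoc)
  show "f + g = g + f" unfolding l2_eq_iff
    using fn_add[of f g] fn_add[of g f] by eventually_elim (simp add: add.commute)
  show "0 + f = f" unfolding l2_eq_iff
    using fn_add[of 0 f] fn_0 by eventually_elim simp
  show "- f + f = 0" unfolding l2_eq_iff
    using fn_add[of "- f" f] fn_uminus[of f] fn_0 by eventually_elim simp
  show "f - g = f + - g" unfolding l2_eq_iff
    using fn_add[of f "- g"] fn_uminus[of g] fn_diff[of f g] by eventually_elim simp
qed
end

instantiation l2 :: (euclidean_space, euclidean_space) real_inner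
begin
definition "r *\<^sub>R f = mk (\<lambda>x. r *\<^sub>R fn f x)"
definition "inner f g = (\<integral>x. inner (fn f x) (fn g x) \<partial>lborel)"
definition "norm (f::('a, 'b) l2) = sqrt (inner f f)"
definition "sgn (f::('a, 'b) l2) = inverse (norm f) *\<^sub>R f"
definition "dist (f::('a, 'b) l2) g = norm (f - g)"
definition "uniformity = (INF e\<in>{0 <..}. principal {((f::('a, 'b) l2), g). dist f g < e})"
definition "open (U :: ('a, 'b) l2 set) \<longleftrightarrow> (\<forall>x\<in>U. eventually (\<lambda>(x', y). x' = x \<longrightarrow> y \<in> U) uniformity)"
lemma fn_scaleR: "AE x in lborel. fn (r *\<^sub>R f) x = r *\<^sub>R fn f x"
  unfolding scaleR_l2_def by (rule fn_mk) (simp add: sqint_scaleR)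
lemma inner_fn_cong:
  assumes "AE x in lborel. fn f x = f' x" "AE x in lborel. fn g x = g' x"
    "f' \<in> borel_measurable borel" "g' \<in> borel_measurable borel"
  shows "inner f g = (\<integral>x. inner (f' x) (g' x) \<partial>lborel)"
  unfolding inner_l2_def
proof (rule integral_cong_AE)
  show "AE x in lborel. inner (fn f x) (fn g x) = inner (f' x) (g' x)" using assms(1,2) by eventually_elim simp
qed (use assms(3,4) in measurable)
instance
proof
  fix f g h :: "('a, 'b) l2" and r s :: real
  show "r *\<^sub>R (f + g) = r *\<^sub>R f + r *\<^sub>R g" unfolding l2_eq_iff
    using fn_scaleR[of r "f + g"] fn_add[of f g] fn_add[of "r *\<^sub>R f" "r *\<^sub>R g"] fn_scaleR[of r f] fn_scaleR[of r g]
    by eventually_elim (simp add: scaleR_right_distrib)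
  show "(r + s) *\<^sub>R f = r *\<^sub>R f + s *\<^sub>R f" unfolding l2_eq_iff
    using fn_scaleR[of "r + s" f] fn_add[of "r *\<^sub>R f" "s *\<^sub>R f"] fn_scaleR[of r f] fn_scaleR[of s f]
    by eventually_elim (simp add: scaleR_left_distrib)
  show "r *\<^sub>R s *\<^sub>R f = (r * s) *\<^sub>R f" unfolding l2_eq_iff
    using fn_scaleR[of r "s *\<^sub>R f"] fn_scaleR[of s f] fn_scaleR[of "r * s" f] by eventually_elim simp
  show "1 *\<^sub>R f = f" unfolding l2_eq_iff using fn_scaleR[of 1 f] by eventually_elim simp
  show "inner f g = inner g f" by (simp add: inner_l2_def inner_commute)
  show "inner (f + g) h = inner f h + inner g h"
    by (subst inner_fn_cong[OF fn_add AE_I2[OF refl]])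
       (simp_all add: inner_l2_def inner_add_left sqint_inner)
  show "inner (r *\<^sub>R f) g = r * inner f g"
    by (subst inner_fn_cong[OF fn_scaleR AE_I2[OF refl]])
       (simp_all add: inner_l2_def)
  show "0 \<le> inner f f" by (simp add: inner_l2_def)
  have "inner f f = 0 \<longleftrightarrow> (AE x in lborel. inner (fn f x) (fn f x) = 0)"
    unfolding inner_l2_def by (rule integral_nonneg_eq_0_iff_AE) (auto simp: sqint_inner)
  also have "\<dots> \<longleftrightarrow> (AE x in lborel. fn f x = fn 0 x)"
  proof (intro iffI)
    assume "AE x in lborel. inner (fn f x) (fn f x) = 0"
    then show "AE x in lborel. fn f x = fn 0 x" using fn_0 by eventually_elim simp
  next
    assume "AE x in lborel. fn f x = fn 0 x"
    then show "AE x in lborel. inner (fn f x) (fn f x) = 0" using fn_0[where 'a='a and 'b='b] by eventually_elim simp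
  qed
  finally show "inner f f = 0 \<longleftrightarrow> f = 0" by (simp add: l2_eq_iff)
qed (simp_all add: norm_l2_def sgn_l2_def dist_l2_def uniformity_l2_def open_l2_def)
end

lemma inner_mk:
  "sqint f \<Longrightarrow> sqint g \<Longrightarrow> inner (mk f) (mk g) = (\<integral>x. inner (f x) (g x) \<partial>lborel)"
  by (rule inner_fn_cong) (auto intro: fn_mk sqint_measurable)

lemma norm_mk: "sqint f \<Longrightarrow> (norm (mk f))\<^sup>2 = (\<integral>x. (norm (f x))\<^sup>2 \<partial>lborel)"
  unfolding power2_norm_eq_inner by (rule inner_mk)

lemma norm_fn: "(norm f)\<^sup>2 = (\<integral>x. (norm (fn f x))\<^sup>2 \<partial>lborel)"
  using norm_mk[of "fn f"] by simp

lemma mk_add: "sqint f \<Longrightarrow> sqint g \<Longrightarrow> mk f + mk g = mk (\<lambda>x. f x + g x)"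
  unfolding plus_l2_def using fn_mk[of f] fn_mk[of g]
  by (subst mk_eq_iff) (auto intro: sqint_add elim: eventually_elim2)

lemma mk_diff: "sqint f \<Longrightarrow> sqint g \<Longrightarrow> mk f - mk g = mk (\<lambda>x. f x - g x)"
  unfolding minus_l2_def using fn_mk[of f] fn_mk[of g]
  by (subst mk_eq_iff) (auto intro: sqint_diff elim: eventually_elim2)

lemma mk_scaleR: "sqint f \<Longrightarrow> r *\<^sub>R mk f = mk (\<lambda>x. r *\<^sub>R f x)"
  unfolding scaleR_l2_def using fn_mk[of f]
  by (subst mk_eq_iff) (auto intro: sqint_scaleR elim: eventually_mono)

lemma nn_integral_norm_fn: "(\<integral>\<^sup>+x. ennreal ((norm (fn f x))\<^sup>2) \<partial>lborel) = ennreal ((norm f)\<^sup>2)"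
  unfolding norm_fn by (rule nn_integral_eq_integral) (auto simp: sqint_integrable)

lemma sqint_iff_nn_integral:
  "sqint f \<longleftrightarrow> f \<in> borel_measurable borel \<and> (\<integral>\<^sup>+x. ennreal ((norm (f x))\<^sup>2) \<partial>lborel) < \<infinity>"
  unfolding sqint_def by (auto simp: integrable_iff_bounded)

text \<open>The Riesz-Fischer argument: a rapidly Cauchy subsequence converges almost everywhere,
  Fatou identifies the pointwise limit as the L^2 limit, and a Cauchy sequence follows its
  subsequence.\<close>

instance l2 :: (euclidean_space, euclidean_space) complete_space
proof
  fix X :: "nat \<Rightarrow> ('a, 'b) l2" assume X: "Cauchy X"
  have "\<exists>N. \<forall>m\<ge>N. \<forall>n\<ge>N. norm (X m - X n) < (1/2)^k" for k
    using CauchyD[OF X, of "(1/2)^k"] by simp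
  then obtain M where M: "\<And>k m n. m \<ge> M k \<Longrightarrow> n \<ge> M k \<Longrightarrow> norm (X m - X n) < (1/2)^k" by metis
  \<comment> \<open>The maximum puts \<open>r k\<close> beyond every \<open>M j\<close> with
    \<open>j \<le> k\<close>; the summand \<open>k\<close> makes \<open>r\<close> strictly
    increasing.\<close>
  define r where "r = (\<lambda>k. Max (M ` {..k}) + k)"
  have rM: "r k \<ge> M j" if "j \<le> k" for j k
    unfolding r_def using that by (intro trans_le_add1 Max_ge) auto
  have sm: "strict_mono r"
    unfolding strict_mono_Suc_iff
  proof
    fix k
    have "Max (M ` {..k}) \<le> Max (M ` {..Suc k})" by (intro Max_mono) auto
    then show "r k < r (Suc k)" unfolding r_def by linarith
  qed
  define f where "f = (\<lambda>k. fn (X (r k)))"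
  have [measurable]: "f k \<in> borel_measurable borel" for k by (simp add: f_def)
  have nnd: "(\<integral>\<^sup>+x. ennreal ((norm (f j x - f k x))\<^sup>2) \<partial>lborel) = ennreal ((norm (X (r j) - X (r k)))\<^sup>2)" for j k
    unfolding nn_integral_norm_fn[symmetric] f_def
    by (rule nn_integral_cong_AE) (use fn_diff[of "X (r j)" "X (r k)"] in eventually_elim, simp)
  \<comment> \<open>The squared increments are at most 4^-k in the mean, so the weight 2^k still
    leaves a summable series. Where the weighted sum is finite, the increments decay geometrically
    with ratio \<open>sqrt (1/2)\<close>, hence are summable themselves and not merely
    square-summable.\<close>
  have "(\<integral>\<^sup>+x. (\<Sum>k. ennreal (2^k * (norm (f (Suc k) x - f k x))\<^sup>2)) \<partial>lborel)
     = (\<Sum>k. \<integral>\<^sup>+x. ennreal (2^k * (norm (f (Suc k) x - f k x))\<^sup>2) \<partial>lborel)"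
    by (rule nn_integral_suminf) measurable
  also have "\<dots> \<le> (\<Sum>k. ennreal ((1/2)^k))"
  proof (rule suminf_le)
    fix k
    have "(\<integral>\<^sup>+x. ennreal (2^k * (norm (f (Suc k) x - f k x))\<^sup>2) \<partial>lborel)
        = ennreal (2^k) * ennreal ((norm (X (r (Suc k)) - X (r k)))\<^sup>2)"
      unfolding nnd[symmetric] by (subst ennreal_mult) (auto simp: nn_integral_cmult)
    also have "\<dots> \<le> ennreal (2^k) * ennreal (((1/2)^k)\<^sup>2)"
      using M[of k "r (Suc k)" "r k"] rM[of k "Suc k"] rM[of k k]
      by (intro mult_left_mono ennreal_leI power_mono) auto
    also have "\<dots> = ennreal ((1/2)^k)"
      by (subst ennreal_mult[symmetric]) (auto simp: power2_eq_square power_one_over)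
    finally show "(\<integral>\<^sup>+x. ennreal (2^k * (norm (f (Suc k) x - f k x))\<^sup>2) \<partial>lborel) \<le> ennreal ((1/2)^k)" .
  qed auto
  also have "\<dots> = ennreal (\<Sum>k. (1/2)^k)"
    by (rule suminf_ennreal2) (auto intro: summable_geometric)
  finally have "(\<integral>\<^sup>+x. (\<Sum>k. ennreal (2^k * (norm (f (Suc k) x - f k x))\<^sup>2)) \<partial>lborel) \<noteq> \<infinity>"
    by (auto simp: top_unique)
  then have "AE x in lborel. (\<Sum>k. ennreal (2^k * (norm (f (Suc k) x - f k x))\<^sup>2)) \<noteq> \<infinity>"
    by (rule nn_integral_PInf_AE[rotated]) measurable
  then have conv: "AE x in lborel. convergent (\<lambda>k. f k x)"
  proof eventually_elim
    fix x assume "(\<Sum>k. ennreal (2^k * (norm (f (Suc k) x - f k x))\<^sup>2)) \<noteq> \<infinity>"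
    moreover define a where "a = (\<lambda>k. ennreal (2^k * (norm (f (Suc k) x - f k x))\<^sup>2))"
    ultimately have fin: "suminf a \<noteq> \<infinity>" by simp
    obtain B where B: "B \<ge> 0" "suminf a = ennreal B"
      using fin by (cases "suminf a") simp_all
    have b: "norm (f (Suc k) x - f k x) \<le> sqrt B * (sqrt (1/2))^k" for k
    proof -
      have "ennreal (2^k * (norm (f (Suc k) x - f k x))\<^sup>2) \<le> ennreal B"
        using sum_le_suminf[where I="{k}" and f=a, OF summableI] unfolding B(2) by (simp add: a_def)
      then have "2^k * (norm (f (Suc k) x - f k x))\<^sup>2 \<le> B" using B(1) by simp
      then have "(norm (f (Suc k) x - f k x))\<^sup>2 \<le> B * (1/2)^k" by (simp add: field_simps power_one_over)
      then have "norm (f (Suc k) x - f k x) \<le> sqrt (B * (1/2)^k)" by (rule real_le_rsqrt)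
      then show ?thesis by (simp add: real_sqrt_mult real_sqrt_power)
    qed
    have sm: "summable (\<lambda>k. sqrt B * (sqrt (1/2))^k)"
      by (intro summable_mult summable_geometric) (simp add: real_sqrt_divide)
    have "summable (\<lambda>k. f (Suc k) x - f k x)"
      by (rule summable_comparison_test'[OF sm, of 0]) (rule b)
    then have "convergent (\<lambda>n. \<Sum>k<n. f (Suc k) x - f k x)" by (simp add: summable_iff_convergent)
    then have "convergent (\<lambda>n. f n x - f 0 x)" unfolding sum_lessThan_telescope[of "\<lambda>k. f k x"] .
    then show "convergent (\<lambda>k. f k x)" by (simp add: convergent_diff_const_right_iff)
  qed
  define g where "g = (\<lambda>x. lim (\<lambda>k. f k x))"
  have [measurable]: "g \<in> borel_measurable borel" unfolding g_def by measurable
  \<comment> \<open>Fatou in the index \<open>m\<close> for fixed \<open>k\<close>. It also yields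
    that \<open>g - f k\<close> is square-integrable, which is how membership of the limit in L^2 is
    obtained.\<close>
  have est: "(\<integral>\<^sup>+x. ennreal ((norm (g x - f k x))\<^sup>2) \<partial>lborel) \<le> ennreal (((1/2)^k)\<^sup>2)" for k
  proof -
    have "(\<integral>\<^sup>+x. ennreal ((norm (g x - f k x))\<^sup>2) \<partial>lborel)
        = (\<integral>\<^sup>+x. liminf (\<lambda>m. ennreal ((norm (f m x - f k x))\<^sup>2)) \<partial>lborel)"
    proof (rule nn_integral_cong_AE, use conv in eventually_elim)
      fix x assume "convergent (\<lambda>k. f k x)"
      then have "(\<lambda>m. f m x) \<longlonglongrightarrow> g x" by (simp add: g_def convergent_LIMSEQ_iff)
      then have "(\<lambda>m. ennreal ((norm (f m x - f k x))\<^sup>2)) \<longlonglongrightarrow> ennreal ((norm (g x - f k x))\<^sup>2)"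
        by (intro tendsto_intros)
      then show "ennreal ((norm (g x - f k x))\<^sup>2) = liminf (\<lambda>m. ennreal ((norm (f m x - f k x))\<^sup>2))"
        by (rule lim_imp_Liminf[OF trivial_limit_sequentially, symmetric])
    qed
    also have "\<dots> \<le> liminf (\<lambda>m. \<integral>\<^sup>+x. ennreal ((norm (f m x - f k x))\<^sup>2) \<partial>lborel)"
      by (rule nn_integral_liminf) measurable
    also have "\<dots> \<le> ennreal (((1/2)^k)\<^sup>2)"
    proof (rule Liminf_le)
      show "\<forall>\<^sub>F m in sequentially. (\<integral>\<^sup>+x. ennreal ((norm (f m x - f k x))\<^sup>2) \<partial>lborel) \<le> ennreal (((1/2)^k)\<^sup>2)"
        using eventually_ge_at_top[of k]
      proof eventually_elim
        case (elim m)
        show ?case unfolding nnd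
          using M[of k "r m" "r k"] rM[of k m] rM[of k k] elim by (intro ennreal_leI power_mono) auto
      qed
    qed simp
    finally show ?thesis .
  qed
  have gd: "sqint (\<lambda>x. g x - f k x)" for k
    unfolding sqint_iff_nn_integral using est[of k] by (auto simp: le_less_trans)
  have gs: "sqint g" using sqint_add[OF gd[of 0], of "f 0"] by (simp add: f_def)
  have lim: "norm (mk g - X (r k)) \<le> (1/2)^k" for k
  proof -
    have "mk g - X (r k) = mk (\<lambda>x. g x - f k x)"
      using mk_diff[OF gs, of "fn (X (r k))"] by (simp add: f_def)
    then have "ennreal ((norm (mk g - X (r k)))\<^sup>2) \<le> ennreal (((1/2)^k)\<^sup>2)"
      using est[of k] nn_integral_eq_integral[OF sqint_integrable[OF gd[of k]]] by (simp add: norm_mk gd)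
    then have "(norm (mk g - X (r k)))\<^sup>2 \<le> ((1/2)^k)\<^sup>2" by (subst (asm) ennreal_le_iff) auto
    then show ?thesis by (rule power2_le_imp_le) simp
  qed
  have "(\<lambda>k. X (r k) - mk g) \<longlonglongrightarrow> 0"
    by (rule Lim_null_comparison[OF always_eventually[OF allI[OF lim[unfolded norm_minus_commute[of "mk g"]]]]])
       (simp add: LIMSEQ_power_zero)
  then have "(\<lambda>k. X (r k)) \<longlonglongrightarrow> mk g" by (rule LIM_zero_cancel)
  then have "X \<longlonglongrightarrow> mk g"
    using X sm by (auto intro: Cauchy_converges_subseq simp: o_def)
  then show "convergent X" by (rule convergentI)
qed

section \<open>Smooth bump functions and the interior cone property\<close>

text \<open>Coinduction for smoothness: a class of functions whose partial derivatives stay in the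
  class consists of smooth functions. A choice of derivatives is iterated along the list of
  directions.\<close>

lemma smooth_on_real_coinduct:
  assumes fX: "f \<in> X"
    and step: "\<And>f. f \<in> X \<Longrightarrow> \<exists>f'. (\<forall>i\<in>Basis. f' i \<in> X) \<and>
      (\<forall>x. (f has_derivative (\<lambda>h. \<Sum>i\<in>Basis. (h \<bullet> i) * f' i x)) (at x))"
  shows "smooth_on_real UNIV f"
proof -
  obtain d where d: "\<And>f i. f \<in> X \<Longrightarrow> i \<in> Basis \<Longrightarrow> d f i \<in> X"
    "\<And>f x. f \<in> X \<Longrightarrow> (f has_derivative (\<lambda>h. \<Sum>i\<in>Basis. (h \<bullet> i) * d f i x)) (at x)"
  proof -
    have "\<forall>f. \<exists>f'. f \<in> X \<longrightarrow> (\<forall>i\<in>Basis. f' i \<in> X) \<and>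
      (\<forall>x. (f has_derivative (\<lambda>h. \<Sum>i\<in>Basis. (h \<bullet> i) * f' i x)) (at x))" using step by blast
    from choice[OF this] show ?thesis using that by blast
  qed
  \<comment> \<open>The definition of smoothness quantifies over all lists of vectors, while
    derivatives are controlled only along \<open>Basis\<close>; other entries are skipped so that
    \<open>D ds\<close> stays in \<open>X\<close>.\<close>
  define D where "D = (\<lambda>ds. foldr (\<lambda>i g. if i \<in> Basis then d g i else g) ds f)"
  have DX: "D ds \<in> X" for ds
    by (induction ds) (auto simp: D_def fX d(1))
  have "(D ds has_derivative (\<lambda>h. \<Sum>i\<in>Basis. (h \<bullet> i) * D (i # ds) x)) (at x)" for ds x
    using d(2)[OF DX[of ds], of x] by (simp add: D_def cong: sum.cong)
  then show ?thesis unfolding smooth_on_real_def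
    by (intro exI[of _ D]) (simp add: D_def)
qed

lemma smooth_on_real_derivative:
  assumes "smooth_on_real UNIV f"
  shows "\<exists>f'. (\<forall>i. smooth_on_real UNIV (f' i)) \<and>
    (\<forall>x. (f has_derivative (\<lambda>h. \<Sum>i\<in>Basis. (h \<bullet> i) * f' i x)) (at x))"
proof -
  obtain D where D: "\<And>x. D [] x = f x"
    "\<And>ds x. (D ds has_derivative (\<lambda>h. \<Sum>i\<in>Basis. (h \<bullet> i) * D (i # ds) x)) (at x)"
    using assms unfolding smooth_on_real_def by auto
  have "D [] = f" using D(1) by auto
  with D(2)[of "[]"] have 1: "(f has_derivative (\<lambda>h. \<Sum>i\<in>Basis. (h \<bullet> i) * D [i] x)) (at x)" for x by simp
  \<comment> \<open>The head of a list is the derivative taken last, so the first derivative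
    \<open>i\<close> goes to the end.\<close>
  have "smooth_on_real UNIV (D [i])" for i
    unfolding smooth_on_real_def by (rule exI[of _ "\<lambda>ds. D (ds @ [i])"]) (use D(2) in auto)
  with 1 show ?thesis by (intro exI[of _ "\<lambda>i. D [i]"]) simp
qed

lemma smooth_on_real_continuous:
  assumes "smooth_on_real UNIV f"
  shows "continuous_on UNIV f"
proof -
  obtain f' where "\<And>x. (f has_derivative (\<lambda>h. \<Sum>i\<in>Basis. (h \<bullet> i) * f' i x)) (at x)"
    using smooth_on_real_derivative[OF assms] by blast
  then show ?thesis by (intro continuous_at_imp_continuous_on ballI has_derivative_continuous)
qed

lemma sum_inner_Basis_unique:
  fixes g g' :: "'a::euclidean_space \<Rightarrow> real"
  assumes "(\<lambda>h::'a. \<Sum>i\<in>Basis. (h \<bullet> i) * g i) = (\<lambda>h. \<Sum>i\<in>Basis. (h \<bullet> i) * g' i)" "j \<in> Basis"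
  shows "g j = g' j"
  using fun_cong[OF assms(1), of j] assms(2) by (simp add: inner_Basis if_distrib if_distribR cong: if_cong)

lemma frechet_derivative_Basis:
  assumes "(f has_derivative (\<lambda>h::'a::euclidean_space. \<Sum>i\<in>Basis. (h \<bullet> i) * f' i)) (at x)" "j \<in> Basis"
  shows "frechet_derivative f (at x) j = f' j"
  unfolding frechet_derivative_at[OF assms(1), symmetric]
  using assms(2) by (simp add: inner_Basis if_distrib if_distribR cong: if_cong)

text \<open>The derivative of \<open>p(1/t) exp(-1/t)\<close> is of the same form, with
  \<open>p\<close> replaced by \<open>X\<^sup>2 (p - p')\<close>.\<close>
definition exp_flat :: "real poly \<Rightarrow> real \<Rightarrow> real" where
  "exp_flat p t = (if t > 0 then poly p (1 / t) * exp (- (1 / t)) else 0)"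

lemma poly_div_exp_tendsto_0: "((\<lambda>x::real. poly p x * exp (- x)) \<longlongrightarrow> 0) at_top"
proof -
  have "((\<lambda>x. \<Sum>i\<le>degree p. coeff p i * (x ^ i / exp x)) \<longlongrightarrow> (\<Sum>i\<le>degree p. coeff p i * 0)) at_top"
    by (intro tendsto_intros tendsto_power_div_exp_0)
  then show ?thesis
    by (simp add: poly_altdef exp_minus sum_distrib_right divide_inverse mult.assoc)
qed

text \<open>Only \<open>t = 0\<close> is delicate. There the right difference quotient is a
  polynomial in \<open>1/h\<close> times \<open>exp (- 1/h)\<close>, which tends to 0, and the left
  one is identically 0.\<close>

lemma has_real_derivative_exp_flat:
  "(exp_flat p has_real_derivative exp_flat ([:0, 0, 1:] * (p - pderiv p)) t) (at t)"
proof -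
  consider "t > 0" | "t < 0" | "t = 0" by linarith
  then show ?thesis
  proof cases
    case 1
    have "((\<lambda>t. poly p (1 / t) * exp (- (1 / t))) has_real_derivative
        exp_flat ([:0, 0, 1:] * (p - pderiv p)) t) (at t)"
      using 1 by (auto intro!: derivative_eq_intros simp: exp_flat_def field_simps power2_eq_square)
    moreover have "\<forall>\<^sub>F s in nhds t. exp_flat p s = poly p (1 / s) * exp (- (1 / s))"
      using eventually_nhds_in_open[of "{0<..}" t] 1 by (auto elim!: eventually_mono simp: exp_flat_def)
    ultimately show ?thesis by (subst DERIV_cong_ev[OF refl _ refl]) auto
  next
    case 2
    have "((\<lambda>t. 0) has_real_derivative exp_flat ([:0, 0, 1:] * (p - pderiv p)) t) (at t)"
      using 2 by (simp add: exp_flat_def)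
    moreover have "\<forall>\<^sub>F s in nhds t. exp_flat p s = 0"
      using eventually_nhds_in_open[of "{..<0}" t] 2 by (auto elim!: eventually_mono simp: exp_flat_def)
    ultimately show ?thesis by (subst DERIV_cong_ev[OF refl _ refl]) auto
  next
    case 3
    have "((\<lambda>h. exp_flat p h / h) \<longlongrightarrow> 0) (at_right 0)"
    proof (rule Lim_transform_eventually)
      have "((\<lambda>h. poly (pCons 0 p) (inverse h) * exp (- inverse h)) \<longlongrightarrow> 0) (at_right 0)"
        by (rule filterlim_compose[OF poly_div_exp_tendsto_0 filterlim_inverse_at_top_right])
      then show "((\<lambda>h. poly (pCons 0 p) (inverse h) * exp (- inverse h)) \<longlongrightarrow> 0) (at_right (0::real))" .
      show "\<forall>\<^sub>F h in at_right 0. poly (pCons 0 p) (inverse h) * exp (- inverse h) = exp_flat p h / h"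
        using eventually_at_right_less[of 0]
        by (auto elim!: eventually_mono simp: exp_flat_def divide_inverse)
    qed
    moreover have "((\<lambda>h. exp_flat p h / h) \<longlongrightarrow> 0) (at_left 0)"
    proof (rule Lim_transform_eventually)
      show "((\<lambda>h. 0) \<longlongrightarrow> 0) (at_left (0::real))" by simp
      show "\<forall>\<^sub>F h in at_left 0. 0 = exp_flat p h / h"
        by (simp add: eventually_at_filter exp_flat_def)
    qed
    ultimately have "((\<lambda>h. exp_flat p h / h) \<longlongrightarrow> 0) (at 0)"
      by (simp add: filterlim_at_split)
    then show ?thesis using 3 by (simp add: DERIV_def exp_flat_def)
  qed
qed

text \<open>A class closed under partial derivatives, to which the coinduction principle applies. It
  contains the bump functions and their products with coordinates, which serve as test functions
  later.\<close>

inductive flat_alg :: "('a::euclidean_space \<Rightarrow> real) \<Rightarrow> bool" where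
  flat_const: "flat_alg (\<lambda>_. c)"
| flat_affine: "flat_alg (\<lambda>x. x \<bullet> v + c)"
| flat_add: "flat_alg f \<Longrightarrow> flat_alg g \<Longrightarrow> flat_alg (\<lambda>x. f x + g x)"
| flat_mult: "flat_alg f \<Longrightarrow> flat_alg g \<Longrightarrow> flat_alg (\<lambda>x. f x * g x)"
| flat_exp: "flat_alg f \<Longrightarrow> flat_alg (\<lambda>x. exp_flat p (f x))"

lemma flat_alg_derivative:
  "flat_alg f \<Longrightarrow> \<exists>f'. (\<forall>i\<in>Basis. flat_alg (f' i)) \<and>
     (\<forall>x. (f has_derivative (\<lambda>h. \<Sum>i\<in>Basis. (h \<bullet> i) * f' i x)) (at x))"
proof (induction rule: flat_alg.induct)
  case (flat_const c)
  show ?case by (rule exI[of _ "\<lambda>_ _. 0"]) (simp add: flat_alg.flat_const)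
next
  case (flat_affine v c)
  have "((\<lambda>x. x \<bullet> v + c) has_derivative (\<lambda>h. \<Sum>i\<in>Basis. (h \<bullet> i) * (v \<bullet> i))) (at x)" for x
    unfolding euclidean_inner[symmetric] by (auto intro!: derivative_eq_intros)
  then show ?case by (intro exI[of _ "\<lambda>i _. v \<bullet> i"]) (simp add: flat_alg.flat_const)
next
  case (flat_add f g)
  then obtain f' g' where f: "\<forall>i\<in>Basis. flat_alg (f' i)" "\<And>x. (f has_derivative (\<lambda>h. \<Sum>i\<in>Basis. (h \<bullet> i) * f' i x)) (at x)"
    and g: "\<forall>i\<in>Basis. flat_alg (g' i)" "\<And>x. (g has_derivative (\<lambda>h. \<Sum>i\<in>Basis. (h \<bullet> i) * g' i x)) (at x)"
    by auto
  have "((\<lambda>x. f x + g x) has_derivative (\<lambda>h. \<Sum>i\<in>Basis. (h \<bullet> i) * (f' i x + g' i x))) (at x)" for x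
    using has_derivative_add[OF f(2) g(2), of x] by (simp add: sum.distrib distrib_left)
  then show ?case using f(1) g(1)
    by (intro exI[of _ "\<lambda>i x. f' i x + g' i x"]) (auto intro: flat_alg.flat_add)
next
  case (flat_mult f g)
  then obtain f' g' where f: "\<forall>i\<in>Basis. flat_alg (f' i)" "\<And>x. (f has_derivative (\<lambda>h. \<Sum>i\<in>Basis. (h \<bullet> i) * f' i x)) (at x)"
    and g: "\<forall>i\<in>Basis. flat_alg (g' i)" "\<And>x. (g has_derivative (\<lambda>h. \<Sum>i\<in>Basis. (h \<bullet> i) * g' i x)) (at x)"
    by auto
  have "((\<lambda>x. f x * g x) has_derivative (\<lambda>h. \<Sum>i\<in>Basis. (h \<bullet> i) * (f x * g' i x + f' i x * g x))) (at x)" for x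
    using has_derivative_mult[OF f(2) g(2), of x]
    by (simp add: sum.distrib distrib_left sum_distrib_left sum_distrib_right mult.left_commute mult.assoc)
  then show ?case using f(1) g(1) flat_mult.hyps
    by (intro exI[of _ "\<lambda>i x. f x * g' i x + f' i x * g x"] conjI ballI allI flat_alg.flat_add flat_alg.flat_mult) simp_all
next
  case (flat_exp f p)
  then obtain f' where f: "\<forall>i\<in>Basis. flat_alg (f' i)" "\<And>x. (f has_derivative (\<lambda>h. \<Sum>i\<in>Basis. (h \<bullet> i) * f' i x)) (at x)"
    by auto
  let ?q = "[:0, 0, 1:] * (p - pderiv p)"
  have "((\<lambda>x. exp_flat p (f x)) has_derivative (\<lambda>h. \<Sum>i\<in>Basis. (h \<bullet> i) * (exp_flat ?q (f x) * f' i x))) (at x)" for x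
  proof -
    have "(exp_flat p has_derivative (\<lambda>h. exp_flat ?q (f x) * h)) (at (f x))"
      using has_real_derivative_exp_flat by (rule has_field_derivative_imp_has_derivative)
    from has_derivative_compose[OF f(2) this] show ?thesis
      by (simp only: sum_distrib_left mult.left_commute)
  qed
  then show ?case using f(1) flat_exp.hyps
    by (intro exI[of _ "\<lambda>i x. exp_flat ?q (f x) * f' i x"] conjI ballI allI flat_alg.flat_mult flat_alg.flat_exp) simp_all
qed

lemma flat_alg_smooth: "flat_alg f \<Longrightarrow> smooth_on_real UNIV f"
  by (rule smooth_on_real_coinduct[of f "{f. flat_alg f}"]) (use flat_alg_derivative in auto)

text \<open>The variable occurs only in the affine generators, so only these change under the
  substitution.\<close>

lemma flat_alg_affine_comp: "flat_alg f \<Longrightarrow> flat_alg (\<lambda>y. f (r *\<^sub>R (y - x)))"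
proof (induction rule: flat_alg.induct)
  case (flat_affine v c)
  have "(\<lambda>y. (r *\<^sub>R (y - x)) \<bullet> v + c) = (\<lambda>y. y \<bullet> (r *\<^sub>R v) + (c - r * (x \<bullet> v)))"
    by (auto simp: inner_diff_left right_diff_distrib)
  then show ?case using flat_alg.flat_affine by metis
qed (auto intro: flat_alg.intros)

lemma flat_alg_prod: "finite A \<Longrightarrow> (\<And>i. i \<in> A \<Longrightarrow> flat_alg (f i)) \<Longrightarrow> flat_alg (\<lambda>x. \<Prod>i\<in>A. f i x)"
  by (induction rule: finite_induct) (auto intro: flat_alg.intros)

text \<open>For each coordinate the product of two flat functions of 1 - (z - v)_i / \<kappa> and 1
  + (z - v)_i / \<kappa> is positive exactly when (z - v)_i lies strictly between -\<kappa> and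
  \<kappa>. The product over the coordinates is thus positive exactly inside the cube, and dividing
  by its integral gives mass 1.\<close>

lemma bump_exists:
  fixes v :: "'a::euclidean_space"
  assumes \<kappa>: "\<kappa> > 0"
  defines "C \<equiv> cbox (v - \<kappa> *\<^sub>R One) (v + \<kappa> *\<^sub>R One)"
  obtains H :: "'a \<Rightarrow> real" and H' :: "'a \<Rightarrow> 'a \<Rightarrow> real" where
    "flat_alg H" "\<And>z. (H has_derivative (\<lambda>h. \<Sum>i\<in>Basis. (h \<bullet> i) * H' i z)) (at z)"
    "\<And>i. i \<in> Basis \<Longrightarrow> continuous_on UNIV (H' i)"
    "\<And>z. H z \<ge> 0" "\<And>z. z \<notin> C \<Longrightarrow> H z = 0" "\<And>z i. z \<notin> C \<Longrightarrow> i \<in> Basis \<Longrightarrow> H' i z = 0"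
    "integrable lborel H" "(\<integral>z. H z \<partial>lborel) = 1"
proof -
  define P where "P = (\<lambda>z::'a. \<Prod>i\<in>Basis. exp_flat 1 (z \<bullet> (i /\<^sub>R \<kappa>) + (1 - v \<bullet> i / \<kappa>)) * exp_flat 1 (z \<bullet> (- i /\<^sub>R \<kappa>) + (1 + v \<bullet> i / \<kappa>)))"
  have Pf: "flat_alg P" unfolding P_def
    by (intro flat_alg_prod finite_Basis flat_alg.flat_mult flat_alg.flat_exp flat_alg.flat_affine)
  have Pc: "continuous_on S P" for S
    using smooth_on_real_continuous[OF flat_alg_smooth[OF Pf]] continuous_on_subset by blast
  have e0: "exp_flat 1 t \<ge> 0" for t by (simp add: exp_flat_def)
  have P0: "P z \<ge> 0" for z unfolding P_def by (intro prod_nonneg mult_nonneg_nonneg e0) 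
  have Pz: "P z = 0" if "z \<notin> C" for z
  proof -
    from that obtain i where i: "i \<in> Basis" "z \<bullet> i < v \<bullet> i - \<kappa> \<or> z \<bullet> i > v \<bullet> i + \<kappa>"
      by (auto simp: C_def mem_box inner_diff_left inner_add_left not_le)
    then have "(z \<bullet> i - v \<bullet> i) / \<kappa> \<le> - 1 \<or> (z \<bullet> i - v \<bullet> i) / \<kappa> \<ge> 1"
      using \<kappa> by (auto simp: pos_divide_le_eq pos_le_divide_eq)
    then have "exp_flat 1 (z \<bullet> (i /\<^sub>R \<kappa>) + (1 - v \<bullet> i / \<kappa>)) * exp_flat 1 (z \<bullet> (- i /\<^sub>R \<kappa>) + (1 + v \<bullet> i / \<kappa>)) = 0"
      by (auto simp: exp_flat_def divide_inverse algebra_simps)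
    with i(1) show ?thesis unfolding P_def by (intro prod_zero) auto
  qed
  have Ppos: "P z > 0" if "z \<in> box (v - \<kappa> *\<^sub>R One) (v + \<kappa> *\<^sub>R One)" for z
    unfolding P_def
  proof (intro prod_pos)
    fix i :: 'a assume i: "i \<in> Basis"
    then have "v \<bullet> i - \<kappa> < z \<bullet> i" "z \<bullet> i < v \<bullet> i + \<kappa>"
      using that by (auto simp: mem_box inner_diff_left inner_add_left)
    then have "- 1 < (z \<bullet> i - v \<bullet> i) / \<kappa>" "(z \<bullet> i - v \<bullet> i) / \<kappa> < 1"
      using \<kappa> by (auto simp: pos_divide_less_eq pos_less_divide_eq)
    then have "z \<bullet> (i /\<^sub>R \<kappa>) + (1 - v \<bullet> i / \<kappa>) > 0" "z \<bullet> (- i /\<^sub>R \<kappa>) + (1 + v \<bullet> i / \<kappa>) > 0"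
      by (simp_all add: divide_inverse algebra_simps)
    then show "exp_flat 1 (z \<bullet> (i /\<^sub>R \<kappa>) + (1 - v \<bullet> i / \<kappa>)) * exp_flat 1 (z \<bullet> (- i /\<^sub>R \<kappa>) + (1 + v \<bullet> i / \<kappa>)) > 0"
      unfolding exp_flat_def by (simp only: if_True) simp
  qed
  have Pi: "integrable lborel P"
  proof -
    have "integrable lborel (\<lambda>x. indicator C x *\<^sub>R P x)"
      unfolding C_def by (intro borel_integrable_compact compact_cbox Pc)
    moreover have "(\<lambda>x. indicator C x *\<^sub>R P x) = P" using Pz by (auto simp: fun_eq_iff indicator_def)
    ultimately show ?thesis by simp
  qed
  define m where "m = (\<integral>z. P z \<partial>lborel)"
  have "m \<noteq> 0"
  proof
    assume "m = 0"
    then have "AE z in lborel. P z = 0"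
      using integral_nonneg_eq_0_iff_AE[OF Pi] P0 by (auto simp: m_def)
    then have "AE z in lborel. z \<notin> box (v - \<kappa> *\<^sub>R One) (v + \<kappa> *\<^sub>R One)"
      by eventually_elim (use Ppos in force)
    then have "emeasure lborel (box (v - \<kappa> *\<^sub>R One) (v + \<kappa> *\<^sub>R One)) = 0"
      by (subst (asm) AE_iff_measurable[OF _ refl]) auto
    then show False using \<kappa> by (simp add: emeasure_lborel_box_eq inner_diff_left inner_add_left prod_constant)
  qed
  moreover have "m \<ge> 0" unfolding m_def using P0 by simp
  ultimately have m: "m > 0" by simp
  define H where "H = (\<lambda>z. 1 / m * P z)"
  have Hf: "flat_alg H" unfolding H_def by (intro flat_alg.flat_mult flat_alg.flat_const Pf)
  obtain H' where H': "\<And>i. i \<in> Basis \<Longrightarrow> flat_alg (H' i)"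
    "\<And>z. (H has_derivative (\<lambda>h. \<Sum>i\<in>Basis. (h \<bullet> i) * H' i z)) (at z)"
    using flat_alg_derivative[OF Hf] by blast
  have Hz: "H z = 0" if "z \<notin> C" for z using Pz that by (simp add: H_def)
  have H'z: "H' i z = 0" if z: "z \<notin> C" and i: "i \<in> Basis" for z i
  proof -
    \<comment> \<open>The complement of the closed cube is open and \<open>H\<close> vanishes on
      it.\<close>
    have "(H has_derivative (\<lambda>h. 0)) (at z)"
    proof (rule has_derivative_transform_within_open[where f="\<lambda>_. 0" and s="- C", OF has_derivative_const])
      show "open (- C)" unfolding C_def by (intro open_Compl closed_cbox)
    qed (simp_all add: z Hz)
    from has_derivative_unique[OF H'(2) this] sum_inner_Basis_unique[of "\<lambda>i. H' i z" "\<lambda>_. 0" i] i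
    show ?thesis by auto
  qed
  show ?thesis
  proof (rule that[OF Hf H'(2) _ _ Hz H'z])
    show "continuous_on UNIV (H' i)" if "i \<in> Basis" for i
      using H'(1)[OF that] flat_alg_smooth smooth_on_real_continuous by blast
    show "integrable lborel H" "(\<integral>z. H z \<partial>lborel) = 1"
      using m Pi unfolding H_def by (auto simp flip: m_def)
    show "H z \<ge> 0" for z using P0 m by (simp add: H_def)
  qed
qed

lemma norm_diff_cbox_le:
  fixes v z :: "'a::euclidean_space" and \<kappa> :: real
  assumes "z \<in> cbox (v - \<kappa> *\<^sub>R One) (v + \<kappa> *\<^sub>R One)"
  shows "norm (z - v) \<le> DIM('a) * \<kappa>"
proof -
  have "norm (z - v) \<le> (\<Sum>i\<in>Basis. \<bar>(z - v) \<bullet> i\<bar>)" by (rule norm_le_l1)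
  also have "\<dots> \<le> (\<Sum>i\<in>(Basis::'a set). \<kappa>)"
    using assms by (intro sum_mono) (auto simp: mem_box inner_diff_left inner_add_left abs_le_iff algebra_simps)
  finally show ?thesis by simp
qed

section \<open>Interior cones of a smooth domain\<close>

text \<open>At a boundary point the defining function decreases strictly in the direction opposite
  to its gradient. This persists for nearby base points and nearby directions together, so a segment
  that starts in the domain near \<open>p\<close> and runs in such a direction keeps the defining
  function negative. No boundary chart is involved.\<close>

lemma smooth_domain_cone:
  fixes \<Omega> :: "'a::euclidean_space set"
  assumes dom: "smooth_bounded_domain \<Omega>" and p: "p \<in> closure \<Omega>"
  shows "\<exists>r>0. \<exists>t0>0. \<exists>v. \<exists>\<kappa>>0. \<forall>x\<in>ball p r \<inter> \<Omega>. \<forall>t. 0 < t \<and> t \<le> t0 \<longrightarrow>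
    (\<forall>z\<in>cbox (v - \<kappa> *\<^sub>R One) (v + \<kappa> *\<^sub>R One). x + t *\<^sub>R z \<in> \<Omega>)"
proof (cases "p \<in> \<Omega>")
  case True
  have "open \<Omega>" using dom by (simp add: smooth_bounded_domain_def)
  then obtain e where e: "e > 0" "ball p e \<subseteq> \<Omega>" using True open_contains_ball by blast
  let ?n = "real DIM('a)"
  have n: "?n \<ge> 1" using DIM_positive[where 'a='a] by linarith
  \<comment> \<open>Vectors of the unit cube have norm at most the dimension, so
    \<open>t *\<^sub>R z\<close> stays within \<open>e / 2\<close>.\<close>
  define t0 where "t0 = e / (2 * ?n)"
  have t0: "t0 > 0" using e n by (simp add: t0_def)
  have "x + t *\<^sub>R z \<in> \<Omega>" if x: "x \<in> ball p (e/2) \<inter> \<Omega>" and t: "0 < t" "t \<le> t0"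
    and z: "z \<in> cbox (0 - 1 *\<^sub>R One) (0 + 1 *\<^sub>R One)" for x t z
  proof -
    have "norm (t *\<^sub>R z) \<le> t0 * ?n"
      using norm_diff_cbox_le[OF z] t by (auto intro!: mult_mono)
    also have "\<dots> = e/2" using n by (simp add: t0_def)
    finally have "norm (t *\<^sub>R z) \<le> e/2" .
    moreover have "dist p (x + t *\<^sub>R z) \<le> dist p x + norm (t *\<^sub>R z)"
      using dist_triangle[of p "x + t *\<^sub>R z" x] by (simp add: dist_norm)
    ultimately have "x + t *\<^sub>R z \<in> ball p e" using x by auto
    then show ?thesis using e by blast
  qed
  then show ?thesis using e t0 by (intro exI[of _ "e/2"] conjI exI[of _ t0] exI[of _ 0] exI[of _ 1]) auto
next
  case False
  obtain \<rho> where \<rho>: "smooth_on_real UNIV \<rho>" "\<Omega> = {x. \<rho> x < 0}"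
    "\<And>x. \<rho> x = 0 \<Longrightarrow> frechet_derivative \<rho> (at x) \<noteq> (\<lambda>h. 0)"
    using dom unfolding smooth_bounded_domain_def by blast
  obtain \<rho>' where \<rho>': "\<And>i. smooth_on_real UNIV (\<rho>' i)"
    "\<And>x. (\<rho> has_derivative (\<lambda>h. \<Sum>i\<in>Basis. (h \<bullet> i) * \<rho>' i x)) (at x)"
    using smooth_on_real_derivative[OF \<rho>(1)] by blast
  have "p \<in> {x. \<rho> x \<le> 0}"
  proof (rule closure_minimal[THEN subsetD, OF _ _ p])
    show "closed {x. \<rho> x \<le> 0}"
      by (intro closed_Collect_le smooth_on_real_continuous[OF \<rho>(1)] continuous_on_const)
  qed (use \<rho>(2) in auto)
  then have p0: "\<rho> p = 0" using False \<rho>(2) by auto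
  define gr where "gr = (\<lambda>x. \<Sum>i\<in>Basis. \<rho>' i x *\<^sub>R i)"
  have gr: "(\<rho> has_derivative (\<lambda>h. h \<bullet> gr x)) (at x)" for x
    using \<rho>'(2)[of x] by (simp add: gr_def inner_sum_right mult.commute)
  have grc: "continuous_on UNIV gr"
    unfolding gr_def by (intro continuous_intros smooth_on_real_continuous \<rho>'(1))
  have gp: "gr p \<noteq> 0"
    using \<rho>(3)[OF p0] frechet_derivative_at[OF gr[of p]] by auto
  define v where "v = - gr p"
  have "v \<bullet> gr p < 0" using gp by (simp add: v_def)
  moreover have "continuous_on UNIV (\<lambda>y::'a \<times> 'a. snd y \<bullet> gr (fst y))"
    by (intro continuous_intros continuous_on_compose2[OF grc]) auto
  \<comment> \<open>Openness in the pair (base point, direction) provides one radius that serves for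
    both.\<close>
  then have "open {y::'a \<times> 'a. snd y \<bullet> gr (fst y) < 0}"
    by (intro open_Collect_less continuous_on_const)
  ultimately obtain d where d: "d > 0" "ball (p, v) d \<subseteq> {y. snd y \<bullet> gr (fst y) < 0}"
    using openE[of "{y::'a \<times> 'a. snd y \<bullet> gr (fst y) < 0}" "(p, v)"] by auto
  define e where "e = d / 2"
  have e: "e > 0" using d by (simp add: e_def)
  have neg: "z \<bullet> gr x < 0" if "norm (x - p) < e" "norm (z - v) < e" for x z
  proof -
    have "norm ((p, v) - (x, z)) \<le> norm (p - x) + norm (v - z)" 
      using norm_Pair_le[of "p - x" "v - z"] by simp
    then have "(x, z) \<in> ball (p, v) d" using that by (simp add: dist_norm norm_minus_commute e_def)
    then show ?thesis using d by auto
  qed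
  let ?n = "real DIM('a)"
  have n: "?n \<ge> 1" using DIM_positive[where 'a='a] by linarith
  define \<kappa> where "\<kappa> = e / (2 * ?n)"
  have \<kappa>: "\<kappa> > 0" "?n * \<kappa> < e" using e n by (auto simp: \<kappa>_def field_simps)
  \<comment> \<open>Directions in the cube have norm at most \<open>norm v + e\<close>, so the
    displacement stays within \<open>e / 2\<close> and the whole segment within \<open>e\<close> of
    \<open>p\<close>, where the sign of the directional derivative is known.\<close>
  define t0 where "t0 = e / (2 * (norm v + e))"
  have ve: "norm v + e > 0" using e by (simp add: add_nonneg_pos)
  have t0: "t0 > 0" using e ve by (simp add: t0_def)
  have "x + t *\<^sub>R z \<in> \<Omega>" if x: "x \<in> ball p (e/2) \<inter> \<Omega>" and t: "0 < t" "t \<le> t0"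
    and z: "z \<in> cbox (v - \<kappa> *\<^sub>R One) (v + \<kappa> *\<^sub>R One)" for x t z
  proof -
    have zv: "norm (z - v) < e" using norm_diff_cbox_le[OF z] \<kappa> by linarith
    have nz: "norm z \<le> norm v + e" using norm_triangle_ineq[of v "z - v"] zv by simp
    have "\<rho> (x + t *\<^sub>R z) < \<rho> (x + 0 *\<^sub>R z)"
    proof (rule DERIV_neg_imp_decreasing[OF t(1)])
      fix s assume s: "0 \<le> s" "s \<le> t"
      have "norm (s *\<^sub>R z) \<le> t0 * (norm v + e)"
        using s t nz by (auto intro!: mult_mono)
      also have "\<dots> = e / 2"
      proof -
        have "e / (2 * w) * w = e / 2" if "w > 0" for w :: real using that by simp
        from this[OF ve] show ?thesis by (simp only: t0_def)
      qed
      finally have "norm (s *\<^sub>R z) \<le> e/2" .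
      moreover have "norm (x + s *\<^sub>R z - p) \<le> norm (x - p) + norm (s *\<^sub>R z)"
        using norm_triangle_ineq[of "x - p" "s *\<^sub>R z"] by (simp add: algebra_simps)
      ultimately have "norm (x + s *\<^sub>R z - p) < e"
        using x by (simp add: dist_norm norm_minus_commute)
      then have lt: "z \<bullet> gr (x + s *\<^sub>R z) < 0" using neg zv by blast
      have "((\<lambda>s. x + s *\<^sub>R z) has_derivative (\<lambda>h. h *\<^sub>R z)) (at s)"
        by (auto intro!: derivative_eq_intros)
      from has_derivative_compose[OF this gr]
      have "((\<lambda>s. \<rho> (x + s *\<^sub>R z)) has_real_derivative z \<bullet> gr (x + s *\<^sub>R z)) (at s)"
        by (simp add: has_field_derivative_def mult_commute_abs)
      with lt show "\<exists>y. ((\<lambda>s. \<rho> (x + s *\<^sub>R z)) has_real_derivative y) (at s) \<and> y < 0" by blast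
    qed
    then show ?thesis using x \<rho>(2) by auto
  qed
  then show ?thesis using e t0 \<kappa> by (intro exI[of _ "e/2"] conjI exI[of _ t0] exI[of _ v] exI[of _ \<kappa>]) auto
qed

lemma compact_support_sqint:
  fixes f :: "'a::euclidean_space \<Rightarrow> real"
  assumes "continuous_on UNIV f" "compact C" "\<And>x. x \<notin> C \<Longrightarrow> f x = 0"
  shows "sqint f" "integrable lborel f" "\<exists>M. \<forall>x. \<bar>f x\<bar> \<le> M"
proof -
  have c: "continuous_on C f" using assms(1) continuous_on_subset by blast
  have "integrable lborel (\<lambda>x. indicator C x *\<^sub>R f x)" by (rule borel_integrable_compact[OF assms(2) c])
  moreover have "(\<lambda>x. indicator C x *\<^sub>R f x) = f" using assms(3) by (auto simp: fun_eq_iff indicator_def)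
  ultimately show "integrable lborel f" by simp
  have "integrable lborel (\<lambda>x. indicator C x *\<^sub>R (norm (f x))\<^sup>2)"
    by (intro borel_integrable_compact[OF assms(2)] continuous_intros c)
  moreover have "(\<lambda>x. indicator C x *\<^sub>R (norm (f x))\<^sup>2) = (\<lambda>x. (norm (f x))\<^sup>2)" using assms(3) by (auto simp: fun_eq_iff indicator_def)
  ultimately have "integrable lborel (\<lambda>x. (norm (f x))\<^sup>2)" by simp
  then show "sqint f" unfolding sqint_def using assms(1) borel_measurable_continuous_onI by blast
  have "bounded (f ` C)" using c assms(2) compact_continuous_image compact_imp_bounded by blast
  then obtain M where "\<And>x. x \<in> C \<Longrightarrow> \<bar>f x\<bar> \<le> M" by (auto simp: bounded_iff)
  then have "\<bar>f x\<bar> \<le> max M 0" for x using assms(3)[of x] by (cases "x \<in> C") (auto simp: max.coboundedI1)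
  then show "\<exists>M. \<forall>x. \<bar>f x\<bar> \<le> M" by blast
qed

lemma test_fun_sqint:
  assumes "test_fun \<Omega> \<phi>" and i: "i \<in> Basis"
  shows "sqint \<phi>" "sqint (\<lambda>x. frechet_derivative \<phi> (at x) i)"
    "x \<notin> \<Omega> \<Longrightarrow> \<phi> x = 0" "x \<notin> \<Omega> \<Longrightarrow> frechet_derivative \<phi> (at x) i = 0"
proof -
  let ?C = "closure {x. \<phi> x \<noteq> 0}"
  have sm: "smooth_on_real UNIV \<phi>" and C: "compact ?C" "?C \<subseteq> \<Omega>" using assms by (auto simp: test_fun_def)
  obtain \<phi>' where \<phi>': "\<And>i. smooth_on_real UNIV (\<phi>' i)"
    "\<And>x. (\<phi> has_derivative (\<lambda>h. \<Sum>i\<in>Basis. (h \<bullet> i) * \<phi>' i x)) (at x)"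
    using smooth_on_real_derivative[OF sm] by blast
  have fr: "frechet_derivative \<phi> (at x) i = \<phi>' i x" for x
    using frechet_derivative_Basis[OF \<phi>'(2) i] .
  have z: "\<phi> x = 0" if "x \<notin> ?C" for x using that closure_subset[of "{x. \<phi> x \<noteq> 0}"] by auto
  have z': "\<phi>' i x = 0" if "x \<notin> ?C" for x
  proof -
    have "(\<phi> has_derivative (\<lambda>h. 0)) (at x)"
    proof (rule has_derivative_transform_within_open[where f="\<lambda>_. 0" and s="- ?C", OF has_derivative_const])
      show "open (- ?C)" by (intro open_Compl closed_closure)
      show "x \<in> - ?C" using that by (simp only: Compl_iff not_False_eq_True)
      show "0 = \<phi> y" if "y \<in> - ?C" for y using z[OF ComplD[OF that]] by simp
    qed
    from has_derivative_unique[OF \<phi>'(2) this] sum_inner_Basis_unique[of "\<lambda>i. \<phi>' i x" "\<lambda>_. 0" i] i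
    show ?thesis by auto
  qed
  show "sqint \<phi>" by (rule compact_support_sqint[OF smooth_on_real_continuous[OF sm] C(1) z])
  show "sqint (\<lambda>x. frechet_derivative \<phi> (at x) i)" unfolding fr
    by (rule compact_support_sqint[OF smooth_on_real_continuous[OF \<phi>'(1)] C(1) z'])
  show "\<phi> x = 0" if "x \<notin> \<Omega>" using z[of x] subsetD[OF C(2), of x] that by fast
  show "frechet_derivative \<phi> (at x) i = 0" if "x \<notin> \<Omega>" unfolding fr using z'[of x] subsetD[OF C(2), of x] that by fast
qed

section \<open>Continuity of translations and relatively compact sets\<close>

lemma nn_integral_lborel_affine:
  fixes f :: "'a::euclidean_space \<Rightarrow> ennreal"
  assumes [measurable]: "f \<in> borel_measurable borel" and c: "c \<noteq> 0"
  shows "(\<integral>\<^sup>+x. f x \<partial>lborel) = ennreal (\<bar>c\<bar> ^ DIM('a)) * (\<integral>\<^sup>+x. f (t + c *\<^sub>R x) \<partial>lborel)"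
  by (subst lborel_affine[OF c, of t])
     (simp add: nn_integral_density nn_integral_distr nn_integral_cmult)

lemma integrable_lborel_translate:
  fixes f :: "'a::euclidean_space \<Rightarrow> real"
  assumes f: "integrable lborel f"
  shows "integrable lborel (\<lambda>x. f (x + h))" "(\<integral>x. f (x + h) \<partial>lborel) = (\<integral>x. f x \<partial>lborel)"
proof -
  have [measurable]: "f \<in> borel_measurable borel" using f by (simp add: borel_measurable_integrable[of lborel, simplified])
  have "integrable (distr lborel borel ((+) h)) f" using f by (simp add: lborel_distr_plus)
  then show "integrable lborel (\<lambda>x. f (x + h))" by (subst (asm) integrable_distr_eq) (auto simp: add.commute)
  have "(\<integral>x. f x \<partial>distr lborel borel ((+) h)) = (\<integral>x. f (h + x) \<partial>lborel)" by (rule integral_distr) auto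
  then show "(\<integral>x. f (x + h) \<partial>lborel) = (\<integral>x. f x \<partial>lborel)" by (simp add: lborel_distr_plus add.commute)
qed

text \<open>Translations are isometries of L^1, so continuity passes from \<open>g\<close> to any
  \<open>f\<close> close to it by three terms of size \<open>e / 3\<close>. It is used for sets
  approximated by open sets and for limits of functions.\<close>

lemma L1_translation_approx:
  fixes f :: "'a::euclidean_space \<Rightarrow> real"
  assumes f: "integrable lborel f"
    and approx: "\<And>e. e > 0 \<Longrightarrow> \<exists>g. integrable lborel g \<and> (\<integral>x. \<bar>f x - g x\<bar> \<partial>lborel) < e \<and>
       (\<lambda>n. \<integral>x. \<bar>g (x + h n) - g x\<bar> \<partial>lborel) \<longlonglongrightarrow> 0"
  shows "(\<lambda>n::nat. \<integral>x. \<bar>f (x + h n) - f x\<bar> \<partial>lborel) \<longlonglongrightarrow> 0"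
proof (rule LIMSEQ_I)
  fix e :: real assume "e > 0"
  then obtain g where g: "integrable lborel g" "(\<integral>x. \<bar>f x - g x\<bar> \<partial>lborel) < e/3"
    and lim: "(\<lambda>n. \<integral>x. \<bar>g (x + h n) - g x\<bar> \<partial>lborel) \<longlonglongrightarrow> 0"
    using approx[of "e/3"] by auto
  obtain N where N: "\<And>n. n \<ge> N \<Longrightarrow> norm ((\<integral>x. \<bar>g (x + h n) - g x\<bar> \<partial>lborel) - 0) < e/3"
    using LIMSEQ_D[OF lim, of "e/3"] \<open>e > 0\<close> by auto
  have fg: "integrable lborel (\<lambda>x. \<bar>f x - g x\<bar>)" using f g by simp
  have "norm ((\<integral>x. \<bar>f (x + h n) - f x\<bar> \<partial>lborel) - 0) < e" if "n \<ge> N" for n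
  proof -
    note T = integrable_lborel_translate[of _ "h n"]
    have "(\<integral>x. \<bar>f (x + h n) - f x\<bar> \<partial>lborel)
      \<le> (\<integral>x. \<bar>f (x + h n) - g (x + h n)\<bar> + \<bar>g (x + h n) - g x\<bar> + \<bar>f x - g x\<bar> \<partial>lborel)"
      using T(1)[OF f] T(1)[OF g(1)] f g(1) by (intro integral_mono) auto
    also have "\<dots> = (\<integral>x. \<bar>f (x + h n) - g (x + h n)\<bar> \<partial>lborel) + (\<integral>x. \<bar>g (x + h n) - g x\<bar> \<partial>lborel)
        + (\<integral>x. \<bar>f x - g x\<bar> \<partial>lborel)"
      using T(1)[OF f] T(1)[OF g(1)] f g(1) by simp
    also have "(\<integral>x. \<bar>f (x + h n) - g (x + h n)\<bar> \<partial>lborel) = (\<integral>x. \<bar>f x - g x\<bar> \<partial>lborel)"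
      by (rule T(2)[OF fg])
    finally have "(\<integral>x. \<bar>f (x + h n) - f x\<bar> \<partial>lborel) < e" using N[OF that] g(2) by auto
    then show ?thesis by simp
  qed
  then show "\<exists>no. \<forall>n\<ge>no. norm ((\<integral>x. \<bar>f (x + h n) - f x\<bar> \<partial>lborel) - 0) < e" by blast
qed

text \<open>A point of an open set stays in it under small shifts, so by dominated convergence the
  part of \<open>V\<close> that leaves \<open>V\<close> has vanishing measure. The part that enters
  has the same measure by translation invariance, hence the factor 2.\<close>

lemma L1_translation_open:
  fixes V :: "'a::euclidean_space set"
  assumes V: "open V" and fin: "emeasure lborel V < \<infinity>" and h: "h \<longlonglongrightarrow> 0"
  shows "(\<lambda>n. \<integral>x. \<bar>indicator V (x + h n) - indicator V x :: real\<bar> \<partial>lborel) \<longlonglongrightarrow> 0"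
proof -
  let ?f = "indicator V :: 'a \<Rightarrow> real"
  have [measurable]: "V \<in> sets borel" using V by simp
  have fi: "integrable lborel ?f" using fin by simp
  have eq: "(\<integral>x. \<bar>?f (x + h n) - ?f x\<bar> \<partial>lborel) = 2 * (\<integral>x. ?f x - ?f x * ?f (x + h n) \<partial>lborel)" for n
  proof -
    note T = integrable_lborel_translate[OF fi, of "h n"]
    have m: "integrable lborel (\<lambda>x. ?f x * ?f (x + h n))"
      by (rule Bochner_Integration.integrable_bound[OF fi]) (auto simp: indicator_def)
    have "(\<integral>x. \<bar>?f (x + h n) - ?f x\<bar> \<partial>lborel) = (\<integral>x. ?f (x + h n) + ?f x - 2 * (?f x * ?f (x + h n)) \<partial>lborel)"
      by (intro Bochner_Integration.integral_cong) (auto simp: indicator_def)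
    also have "\<dots> = (\<integral>x. ?f x \<partial>lborel) + (\<integral>x. ?f x \<partial>lborel) - 2 * (\<integral>x. ?f x * ?f (x + h n) \<partial>lborel)"
      using T fi m by (simp del: integral_indicator)
    also have "\<dots> = 2 * (\<integral>x. ?f x - ?f x * ?f (x + h n) \<partial>lborel)"
      using fi m by (simp del: integral_indicator)
    finally show ?thesis .
  qed
  have "(\<lambda>n. \<integral>x. ?f x - ?f x * ?f (x + h n) \<partial>lborel) \<longlonglongrightarrow> (\<integral>x. 0 \<partial>(lborel :: 'a measure))"
  proof (rule integral_dominated_convergence[where w = ?f])
    show "AE x in lborel. (\<lambda>n. ?f x - ?f x * ?f (x + h n)) \<longlonglongrightarrow> 0"
    proof (rule AE_I2)
      fix x :: 'a
      show "(\<lambda>n. ?f x - ?f x * ?f (x + h n)) \<longlonglongrightarrow> 0"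
      proof (cases "x \<in> V")
        case True
        have "(\<lambda>n. x + h n) \<longlonglongrightarrow> x + 0" by (intro tendsto_intros h)
        then have "\<forall>\<^sub>F n in sequentially. x + h n \<in> V" using V True by (auto dest: topological_tendstoD)
        then have "\<forall>\<^sub>F n in sequentially. ?f x - ?f x * ?f (x + h n) = 0"
          by eventually_elim (use True in auto)
        then show ?thesis by (rule tendsto_eventually)
      qed simp
    qed
    show "AE x in lborel. norm (?f x - ?f x * ?f (x + h n)) \<le> ?f x" for n
      by (auto simp: indicator_def)
  qed (use fi in auto)
  then have "(\<lambda>n. 2 * (\<integral>x. ?f x - ?f x * ?f (x + h n) \<partial>lborel)) \<longlonglongrightarrow> 2 * 0"
    by (intro tendsto_mult_left) simp
  then show ?thesis unfolding eq by simp
qed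

text \<open>Induction over integrable functions; indicators of Borel sets are reduced to open sets
  by outer regularity.\<close>

lemma L1_translation_continuous:
  fixes f :: "'a::euclidean_space \<Rightarrow> real"
  assumes f: "integrable lborel f" and h: "h \<longlonglongrightarrow> 0"
  shows "(\<lambda>n::nat. \<integral>x. \<bar>f (x + h n) - f x\<bar> \<partial>lborel) \<longlonglongrightarrow> 0"
  using f
proof (induction rule: integrable_induct)
  case (base A c)
  then have A[measurable]: "A \<in> sets borel" by simp
  have "(\<lambda>n. \<integral>x. \<bar>indicator A (x + h n) - indicator A x :: real\<bar> \<partial>lborel) \<longlonglongrightarrow> 0"
  proof (rule L1_translation_approx)
    show "integrable lborel (indicator A :: 'a \<Rightarrow> real)" using base by simp
    fix e :: real assume e: "e > 0"
    obtain U where U: "open U" "A \<subseteq> U" "emeasure lborel (U - A) < e"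
      by (rule outer_regular_lborel[OF A e])
    have [measurable]: "U \<in> sets borel" using U by simp
    have "emeasure lborel U = emeasure lborel A + emeasure lborel (U - A)"
      using U(2) by (subst plus_emeasure) (auto simp: Un_absorb1)
    then have Uf: "emeasure lborel U < \<infinity>" using base(2) U(3) by (auto simp: less_top ennreal_add_less_top intro: less_trans)
    have "(\<integral>x. \<bar>indicator A x - indicator U x :: real\<bar> \<partial>lborel) = (\<integral>x. indicator (U - A) x \<partial>lborel)"
      using U(2) by (intro Bochner_Integration.integral_cong) (auto simp: indicator_def)
    also have "\<dots> = measure lborel (U - A)" by simp
    also have "\<dots> < e"
    proof -
      have "emeasure lborel (U - A) \<noteq> top" using U(3) by auto
      with U(3) e show ?thesis by (simp add: emeasure_eq_ennreal_measure ennreal_less_iff)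
    qed
    finally show "\<exists>g. integrable lborel g \<and> (\<integral>x. \<bar>indicator A x - g x\<bar> \<partial>lborel) < e \<and>
        (\<lambda>n. \<integral>x. \<bar>g (x + h n) - g x\<bar> \<partial>lborel) \<longlonglongrightarrow> 0"
      using L1_translation_open[OF U(1) Uf h] Uf by (intro exI[of _ "indicator U"]) auto
  qed
  then have "(\<lambda>n. (\<integral>x. \<bar>indicator A (x + h n) - indicator A x :: real\<bar> \<partial>lborel) * \<bar>c\<bar>) \<longlonglongrightarrow> 0 * \<bar>c\<bar>"
    by (intro tendsto_mult_right)
  moreover have "\<bar>indicator A y * c - indicator A x * c\<bar> = \<bar>indicator A y - indicator A x\<bar> * \<bar>c\<bar>" for x y
    by (simp only: left_diff_distrib[symmetric] abs_mult)
  ultimately show ?case by simp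
next
  case (add f g)
  note T = integrable_lborel_translate(1)
  have "(\<lambda>n. (\<integral>x. \<bar>f (x + h n) - f x\<bar> \<partial>lborel) + (\<integral>x. \<bar>g (x + h n) - g x\<bar> \<partial>lborel)) \<longlonglongrightarrow> 0 + 0"
    by (intro tendsto_add add.IH)
  then have lim: "(\<lambda>n. (\<integral>x. \<bar>f (x + h n) - f x\<bar> \<partial>lborel) + (\<integral>x. \<bar>g (x + h n) - g x\<bar> \<partial>lborel)) \<longlonglongrightarrow> 0" by simp
  have le: "(\<integral>x. \<bar>f (x + h n) + g (x + h n) - (f x + g x)\<bar> \<partial>lborel)
      \<le> (\<integral>x. \<bar>f (x + h n) - f x\<bar> \<partial>lborel) + (\<integral>x. \<bar>g (x + h n) - g x\<bar> \<partial>lborel)" for n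
  proof -
    have "(\<integral>x. \<bar>f (x + h n) + g (x + h n) - (f x + g x)\<bar> \<partial>lborel)
      \<le> (\<integral>x. \<bar>f (x + h n) - f x\<bar> + \<bar>g (x + h n) - g x\<bar> \<partial>lborel)"
      using T[OF add.hyps(1)] T[OF add.hyps(2)] add.hyps by (intro integral_mono) auto
    also have "\<dots> = (\<integral>x. \<bar>f (x + h n) - f x\<bar> \<partial>lborel) + (\<integral>x. \<bar>g (x + h n) - g x\<bar> \<partial>lborel)"
      using T[OF add.hyps(1)] T[OF add.hyps(2)] add.hyps by simp
    finally show ?thesis .
  qed
  show ?case
    by (rule Lim_null_comparison[OF _ lim]) (auto intro!: always_eventually le)
next
  case (lim f s)
  show ?case
  proof (rule L1_translation_approx[OF lim.hyps(4)])
    fix e :: real assume e: "e > 0"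
    have "(\<lambda>i. \<integral>x. \<bar>f x - s i x\<bar> \<partial>lborel) \<longlonglongrightarrow> (\<integral>x. 0 \<partial>(lborel :: 'a measure))"
    proof (rule integral_dominated_convergence[where w = "\<lambda>x. 3 * \<bar>f x\<bar>"])
      show "AE x in lborel. (\<lambda>i. \<bar>f x - s i x\<bar>) \<longlonglongrightarrow> 0"
      proof (rule AE_I2)
        fix x :: 'a
        have "(\<lambda>i. \<bar>f x - s i x\<bar>) \<longlonglongrightarrow> \<bar>f x - f x\<bar>" using lim.hyps(2)[of x] by (intro tendsto_intros) auto
        then show "(\<lambda>i. \<bar>f x - s i x\<bar>) \<longlonglongrightarrow> 0" by simp
      qed
      show "AE x in lborel. norm \<bar>f x - s i x\<bar> \<le> 3 * \<bar>f x\<bar>" for i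
      proof (rule AE_I2)
        fix x :: 'a
        have "\<bar>s i x\<bar> \<le> 2 * \<bar>f x\<bar>" using lim.hyps(3)[of x i] by simp
        then show "norm \<bar>f x - s i x\<bar> \<le> 3 * \<bar>f x\<bar>" by simp
      qed
    qed (use lim.hyps(1,4) in \<open>auto intro: borel_measurable_integrable\<close>)
    then have "(\<lambda>i. \<integral>x. \<bar>f x - s i x\<bar> \<partial>lborel) \<longlonglongrightarrow> 0" by simp
    then obtain i where "norm ((\<integral>x. \<bar>f x - s i x\<bar> \<partial>lborel) - 0) < e" using LIMSEQ_D[OF _ e] by blast
    then show "\<exists>g. integrable lborel g \<and> (\<integral>x. \<bar>f x - g x\<bar> \<partial>lborel) < e \<and>
        (\<lambda>n. \<integral>x. \<bar>g (x + h n) - g x\<bar> \<partial>lborel) \<longlonglongrightarrow> 0"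
      using lim.hyps(1) lim.IH by (intro exI[of _ "s i"]) auto
  qed
qed

lemma L1_translation_small:
  fixes f :: "'a::euclidean_space \<Rightarrow> real"
  assumes f: "integrable lborel f" and e: "e > 0"
  shows "\<exists>d>0. \<forall>h. norm h < d \<longrightarrow> (\<integral>\<^sup>+x. ennreal \<bar>f (x + h) - f x\<bar> \<partial>lborel) \<le> ennreal e"
proof (rule ccontr)
  assume "\<not> ?thesis"
  then have "\<forall>n. \<exists>h. norm h < inverse (real (Suc n)) \<and> \<not> (\<integral>\<^sup>+x. ennreal \<bar>f (x + h) - f x\<bar> \<partial>lborel) \<le> ennreal e"
    by (meson inverse_positive_iff_positive of_nat_0_less_iff zero_less_Suc)
  then obtain h where h: "\<And>n. norm (h n) < inverse (real (Suc n))"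
    "\<And>n. \<not> (\<integral>\<^sup>+x. ennreal \<bar>f (x + h n) - f x\<bar> \<partial>lborel) \<le> ennreal e" by metis
  have "h \<longlonglongrightarrow> 0"
    by (rule Lim_null_comparison[OF _ LIMSEQ_inverse_real_of_nat]) (intro always_eventually allI less_imp_le h)
  from LIMSEQ_D[OF L1_translation_continuous[OF f this] e] obtain n
    where "norm ((\<integral>x. \<bar>f (x + h n) - f x\<bar> \<partial>lborel) - 0) < e" by blast
  then have "(\<integral>x. \<bar>f (x + h n) - f x\<bar> \<partial>lborel) \<le> e" by simp
  moreover have "(\<integral>\<^sup>+x. ennreal \<bar>f (x + h n) - f x\<bar> \<partial>lborel) = ennreal (\<integral>x. \<bar>f (x + h n) - f x\<bar> \<partial>lborel)"
    using integrable_lborel_translate(1)[OF f] f by (intro nn_integral_eq_integral) auto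
  ultimately show False using h(2)[of n] by (simp add: ennreal_leI)
qed

text \<open>Integrability is not assumed: the integral of a non-integrable function is 0 by
  convention. Inner integrals can thus be estimated for every parameter without a separate
  check.\<close>

lemma ennreal_norm_integral_le:
  fixes f :: "'a \<Rightarrow> 'b::{banach, second_countable_topology}"
  shows "ennreal (norm (\<integral>x. f x \<partial>M)) \<le> (\<integral>\<^sup>+x. ennreal (norm (f x)) \<partial>M)"
proof (cases "integrable M f")
  case True
  then show ?thesis by (rule integral_norm_bound_ennreal)
next
  case False
  then show ?thesis by (simp add: not_integrable_integral_eq)
qed

section \<open>Criteria for relative compactness\<close>

text \<open>A sequence in the closure is shadowed by one in \<open>S\<close> at distance below
  1/(n+1), which has the same limits along subsequences.\<close>

lemma compact_closure_sequentially:
  fixes S :: "'a::metric_space set"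
  assumes "\<And>X. (\<And>n::nat. X n \<in> S) \<Longrightarrow> \<exists>l r. strict_mono (r::nat\<Rightarrow>nat) \<and> (\<lambda>n. X (r n)) \<longlonglongrightarrow> l"
  shows "compact (closure S)"
  unfolding compact_eq_seq_compact_metric seq_compact_def
proof (intro allI impI)
  fix f :: "nat \<Rightarrow> 'a" assume f: "\<forall>n. f n \<in> closure S"
  have "\<exists>y\<in>S. dist y (f n) < inverse (real (Suc n))" for n
    using f closure_approachable by (metis inverse_positive_iff_positive of_nat_0_less_iff zero_less_Suc)
  then obtain g where g: "\<And>n. g n \<in> S" "\<And>n. dist (g n) (f n) < inverse (real (Suc n))" by metis
  obtain l r where r: "strict_mono (r::nat\<Rightarrow>nat)" "(\<lambda>n. g (r n)) \<longlonglongrightarrow> l" using assms[of g] g(1) by blast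
  have "(\<lambda>n. dist (g n) (f n)) \<longlonglongrightarrow> 0"
    by (rule Lim_null_comparison[OF _ LIMSEQ_inverse_real_of_nat]) (use g(2) in \<open>auto intro!: always_eventually less_imp_le\<close>)
  from LIMSEQ_subseq_LIMSEQ[OF this r(1)] have "(\<lambda>n. dist (g (r n)) (f (r n))) \<longlonglongrightarrow> 0" by (simp add: o_def)
  from tendsto_add[OF this r(2)[unfolded tendsto_dist_iff[of "\<lambda>n. g (r n)"]]]
  have lim: "(\<lambda>n. dist (g (r n)) (f (r n)) + dist (g (r n)) l) \<longlonglongrightarrow> 0" by simp
  have "(\<lambda>n. f (r n)) \<longlonglongrightarrow> l"
    unfolding tendsto_dist_iff[of "\<lambda>n. f (r n)"]
    by (rule Lim_null_comparison[OF _ lim]) (auto intro!: always_eventually dist_triangle3)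
  moreover have "l \<in> closure S" using r(2) g(1) unfolding closure_sequential by (intro exI[of _ "\<lambda>n. g (r n)"]) simp
  ultimately show "\<exists>l\<in>closure S. \<exists>r. strict_mono r \<and> (f \<circ> r) \<longlonglongrightarrow> l"
    using r(1) by (auto simp: o_def)
qed

text \<open>Being within \<open>e\<close> of some compact set for every \<open>e\<close> gives total
  boundedness. This is the form in which uniform limits of compact operators are compact;
  \<open>T\<close> may depend on \<open>e\<close>.\<close>

lemma compact_closure_approx:
  fixes S :: "'a::complete_space set"
  assumes "\<And>e. e > 0 \<Longrightarrow> \<exists>T. compact T \<and> (\<forall>x\<in>S. \<exists>y\<in>T. dist x y \<le> e)"
  shows "compact (closure S)"
  unfolding compact_eq_totally_bounded
proof (intro conjI allI impI)
  show "complete (closure S)" by (simp add: complete_eq_closed)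
  fix e :: real assume e: "e > 0"
  obtain T where T: "compact T" "\<And>x. x \<in> S \<Longrightarrow> \<exists>y\<in>T. dist x y \<le> e/4" using assms[of "e/4"] e by auto
  obtain k where k: "finite k" "T \<subseteq> (\<Union>x\<in>k. ball x (e/4))"
    using T(1) e unfolding compact_eq_totally_bounded by (metis divide_pos_pos zero_less_numeral)
  have "S \<subseteq> (\<Union>x\<in>k. cball x (e/2))"
  proof
    fix x assume "x \<in> S"
    then obtain y where y: "y \<in> T" "dist x y \<le> e/4" using T(2) by blast
    then obtain z where z: "z \<in> k" "dist z y < e/4" using k by auto
    have "dist z x \<le> e/2" using dist_triangle[of z x y] y z by (simp add: dist_commute)
    then show "x \<in> (\<Union>x\<in>k. cball x (e/2))" using z by auto
  qed
  then have "closure S \<subseteq> (\<Union>x\<in>k. cball x (e/2))"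
    by (rule closure_minimal) (intro closed_UN k(1) ballI closed_cball)
  also have "\<dots> \<subseteq> (\<Union>x\<in>k. ball x e)" using e by force
  finally show "\<exists>k. finite k \<and> closure S \<subseteq> (\<Union>x\<in>k. ball x e)" using k(1) by blast
qed

section \<open>Weak gradients and one-sided averages\<close>

definition weak_pair :: "'a::euclidean_space set \<Rightarrow> ('a \<Rightarrow> real) \<Rightarrow> ('a \<Rightarrow> 'a) \<Rightarrow> bool" where
  "weak_pair \<Omega> u g \<longleftrightarrow> sqint u \<and> sqint g \<and> (\<forall>x. x \<notin> \<Omega> \<longrightarrow> u x = 0 \<and> g x = 0) \<and>
     (\<forall>\<phi> i. test_fun \<Omega> \<phi> \<longrightarrow> i \<in> Basis \<longrightarrow>
        (\<integral>x. u x * frechet_derivative \<phi> (at x) i \<partial>lborel) = - (\<integral>x. (g x \<bullet> i) * \<phi> x \<partial>lborel))"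

lemma sqint_integrable_bounded_support:
  fixes f :: "'a::euclidean_space \<Rightarrow> real"
  assumes f: "sqint f" and bd: "bounded \<Omega>" and z: "\<And>x. x \<notin> \<Omega> \<Longrightarrow> f x = 0" and O[measurable]: "\<Omega> \<in> sets borel"
  shows "integrable lborel f" "(\<integral>x. \<bar>f x\<bar> \<partial>lborel) \<le> measure lborel \<Omega> + (\<integral>x. (norm (f x))\<^sup>2 \<partial>lborel)"
proof -
  have fin: "emeasure lborel \<Omega> < \<infinity>" by (rule emeasure_bounded_finite[OF bd])
  have i1: "integrable lborel (\<lambda>x. indicator \<Omega> x + (norm (f x))\<^sup>2)"
    using fin sqint_integrable[OF f] by (intro Bochner_Integration.integrable_add) auto
  have le: "\<bar>f x\<bar> \<le> indicator \<Omega> x + (norm (f x))\<^sup>2" for x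
  proof (cases "x \<in> \<Omega>")
    case True
    have "0 \<le> (\<bar>f x\<bar> - 1)\<^sup>2" by simp
    then have "2 * \<bar>f x\<bar> \<le> 1 + (f x)\<^sup>2" by (simp add: power2_diff)
    moreover have "\<bar>f x\<bar> \<ge> 0" by simp
    ultimately show ?thesis using True by simp
  qed (simp add: z)
  show i: "integrable lborel f"
    by (rule Bochner_Integration.integrable_bound[OF i1])
       (use le f in \<open>auto intro!: AE_I2 intro: order_trans[OF _ abs_ge_self] dest: sqint_measurable\<close>)
  have "(\<integral>x. \<bar>f x\<bar> \<partial>lborel) \<le> (\<integral>x. indicator \<Omega> x + (norm (f x))\<^sup>2 \<partial>lborel)"
    using i i1 le by (intro integral_mono) auto
  also have "\<dots> = measure lborel \<Omega> + (\<integral>x. (norm (f x))\<^sup>2 \<partial>lborel)"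
    using fin sqint_integrable[OF f] by (subst Bochner_Integration.integral_add) auto
  finally show "(\<integral>x. \<bar>f x\<bar> \<partial>lborel) \<le> measure lborel \<Omega> + (\<integral>x. (norm (f x))\<^sup>2 \<partial>lborel)" .
qed

section \<open>Averages over shrinking shifted cubes\<close>

text \<open>\<open>C\<close> need not contain the origin. With a cube given by the interior cone
  property, the average of \<open>u\<close> at \<open>x\<close> uses values on x + \<tau> C only,
  all taken inside the domain even when \<open>x\<close> is close to the boundary.\<close>

locale mollifier =
  fixes C :: "'a::euclidean_space set" and H :: "'a \<Rightarrow> real" and H' :: "'a \<Rightarrow> 'a \<Rightarrow> real" and R :: real
  assumes Ccpt: "compact C" and CR: "\<And>z. z \<in> C \<Longrightarrow> norm z \<le> R" and Rpos: "R > 0"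
    and Hflat: "flat_alg H"
    and Hderiv: "\<And>z. (H has_derivative (\<lambda>h. \<Sum>i\<in>Basis. (h \<bullet> i) * H' i z)) (at z)"
    and H'cont: "\<And>i. i \<in> Basis \<Longrightarrow> continuous_on UNIV (H' i)"
    and Hnn: "\<And>z. H z \<ge> 0" and Hz: "\<And>z. z \<notin> C \<Longrightarrow> H z = 0"
    and H'z: "\<And>z i. z \<notin> C \<Longrightarrow> i \<in> Basis \<Longrightarrow> H' i z = 0"
    and Hint: "integrable lborel H" and H1: "(\<integral>z. H z \<partial>lborel) = 1"
begin

lemma Hcont: "continuous_on UNIV H"
  by (rule smooth_on_real_continuous[OF flat_alg_smooth[OF Hflat]])

lemma Hmeas [measurable]: "H \<in> borel_measurable borel"
  using Hcont by (rule borel_measurable_continuous_onI)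

definition k :: "real \<Rightarrow> 'a \<Rightarrow> real" where
  "k \<tau> h = H (h /\<^sub>R \<tau>) / \<tau> ^ DIM('a)"

text \<open>The divergence of the field \<open>z \<mapsto> H z *\<^sub>R z\<close>. The derivative
  of \<open>k \<tau>\<close> in \<open>\<tau>\<close> is a rescaled \<open>L\<close>; being a
  divergence, it can be moved onto the weak gradient of \<open>u\<close>.\<close>

definition L :: "'a \<Rightarrow> real" where
  "L z = DIM('a) * H z + (\<Sum>i\<in>Basis. (z \<bullet> i) * H' i z)"

definition A :: "real \<Rightarrow> ('a \<Rightarrow> real) \<Rightarrow> 'a \<Rightarrow> real" where
  "A \<tau> u x = (\<integral>y. k \<tau> (y - x) * u y \<partial>lborel)"

lemma Lcont: "continuous_on UNIV L"
  unfolding L_def by (intro continuous_intros Hcont H'cont)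

lemma Lmeas [measurable]: "L \<in> borel_measurable borel"
  using Lcont by (rule borel_measurable_continuous_onI)

lemma Lz: "z \<notin> C \<Longrightarrow> L z = 0" by (simp add: L_def Hz H'z)

lemma Lbound: obtains M where "M \<ge> 0" "\<And>z. \<bar>L z\<bar> \<le> M"
  using compact_support_sqint(3)[OF Lcont Ccpt Lz] abs_ge_zero order_trans by blast

lemma kmeas [measurable (raw)]:
  assumes [measurable]: "f \<in> borel_measurable M" "g \<in> borel_measurable M"
  shows "(\<lambda>x. k (f x) (g x)) \<in> borel_measurable M"
  unfolding k_def by measurable

lemma kcont: "\<tau> > 0 \<Longrightarrow> continuous_on UNIV (k \<tau>)"
  unfolding k_def by (intro continuous_intros continuous_on_compose2[OF Hcont]) auto

lemma k_nonneg: "\<tau> > 0 \<Longrightarrow> k \<tau> h \<ge> 0" by (simp add: k_def Hnn)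

lemma k_zero: "h /\<^sub>R \<tau> \<notin> C \<Longrightarrow> k \<tau> h = 0" by (simp add: k_def Hz)

lemma k_supp: "\<tau> > 0 \<Longrightarrow> k \<tau> h \<noteq> 0 \<Longrightarrow> norm h \<le> \<tau> * R"
  using k_zero[where h=h and \<tau>=\<tau>] CR[of "h /\<^sub>R \<tau>"] by (auto simp: field_simps)

lemma nn_integral_k: assumes \<tau>: "\<tau> > 0" shows "(\<integral>\<^sup>+h. ennreal (k \<tau> h) \<partial>lborel) = 1"
proof -
  have "(\<integral>\<^sup>+h. ennreal (k \<tau> h) \<partial>lborel) = ennreal (\<bar>\<tau>\<bar> ^ DIM('a)) * (\<integral>\<^sup>+z. ennreal (k \<tau> (0 + \<tau> *\<^sub>R z)) \<partial>lborel)"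
    by (rule nn_integral_lborel_affine) (use \<tau> in auto)
  also have "(\<integral>\<^sup>+z. ennreal (k \<tau> (0 + \<tau> *\<^sub>R z)) \<partial>lborel) = (\<integral>\<^sup>+z. ennreal (1 / \<tau> ^ DIM('a)) * ennreal (H z) \<partial>lborel)"
    using \<tau> by (intro nn_integral_cong) (auto simp: k_def ennreal_mult[symmetric] Hnn)
  also have "\<dots> = ennreal (1 / \<tau> ^ DIM('a)) * ennreal 1"
    using nn_integral_eq_integral[OF Hint] Hnn H1 by (simp add: nn_integral_cmult)
  also have "ennreal (\<bar>\<tau>\<bar> ^ DIM('a)) * \<dots> = 1"
    using \<tau> by (simp add: ennreal_mult[symmetric])
  finally show ?thesis .
qed

lemma nn_integral_k_diff:
  assumes \<tau>: "\<tau> > 0"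
  shows "(\<integral>\<^sup>+y. ennreal (k \<tau> (y - x)) \<partial>lborel) = 1" "(\<integral>\<^sup>+x. ennreal (k \<tau> (y - x)) \<partial>lborel) = 1"
proof -
  show "(\<integral>\<^sup>+y. ennreal (k \<tau> (y - x)) \<partial>lborel) = 1"
    using nn_integral_lborel_affine[of "\<lambda>y. ennreal (k \<tau> (y - x))" 1 x] nn_integral_k[OF \<tau>] by simp
  show "(\<integral>\<^sup>+x. ennreal (k \<tau> (y - x)) \<partial>lborel) = 1"
    using nn_integral_lborel_affine[of "\<lambda>x. ennreal (k \<tau> (y - x))" "-1" y] nn_integral_k[OF \<tau>] by simp
qed

lemma k_bound: assumes "\<tau> > 0" obtains M where "M \<ge> 0" "\<And>h. k \<tau> h \<le> M"
proof -
  obtain B where B: "\<And>z. \<bar>H z\<bar> \<le> B" using compact_support_sqint(3)[OF Hcont Ccpt Hz] by blast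
  have "k \<tau> h \<le> B / \<tau> ^ DIM('a)" for h
    unfolding k_def using B[of "h /\<^sub>R \<tau>"] assms by (intro divide_right_mono) auto
  moreover have "B / \<tau> ^ DIM('a) \<ge> 0" using B[of 0] assms by simp
  ultimately show ?thesis using that by blast
qed

lemma k_mult_integrable:
  assumes u: "integrable lborel u" and \<tau>: "\<tau> > 0"
  shows "integrable lborel (\<lambda>y. k \<tau> (y - x) * u y)"
proof -
  obtain M where M: "M \<ge> 0" "\<And>h. k \<tau> h \<le> M" using k_bound[OF \<tau>] by blast
  have [measurable]: "u \<in> borel_measurable borel" using borel_measurable_integrable[OF u] by simp
  show ?thesis
  proof (rule Bochner_Integration.integrable_bound[of lborel "\<lambda>y. M * u y"])
    show "AE y in lborel. norm (k \<tau> (y - x) * u y) \<le> norm (M * u y)"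
      using M k_nonneg[OF \<tau>] by (auto intro!: AE_I2 mult_right_mono simp: abs_mult)
  qed (use u in auto)
qed

lemma A_meas [measurable]:
  assumes [measurable]: "u \<in> borel_measurable borel"
  shows "A \<tau> u \<in> borel_measurable borel"
  unfolding A_def by measurable

text \<open>Because the kernel has mass 1, A u - u at \<open>x\<close> is an average of u(x + h) -
  u(x) over |h| at most \<tau> R. After Tonelli only the L^1 modulus of continuity under
  translations remains. This identifies the limit of the averages in
  \<open>A_approx_L2\<close>.\<close>

lemma A_tendsto_L1:
  assumes u: "integrable lborel u" and s: "s \<longlonglongrightarrow> 0" "\<And>n. s n > 0"
  shows "\<And>n. integrable lborel (\<lambda>x. A (s n) u x - u x)"
    "(\<lambda>n. \<integral>x. norm (A (s n) u x - u x) \<partial>lborel) \<longlonglongrightarrow> 0"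
proof -
  have [measurable]: "u \<in> borel_measurable borel" using borel_measurable_integrable[OF u] by simp
  have le: "(\<integral>\<^sup>+x. ennreal (norm (A \<tau> u x - u x)) \<partial>lborel)
     \<le> (\<integral>\<^sup>+h. ennreal (k \<tau> h) * (\<integral>\<^sup>+x. ennreal \<bar>u (x + h) - u x\<bar> \<partial>lborel) \<partial>lborel)" if \<tau>: "\<tau> > 0" for \<tau>
  proof -
    have pt: "ennreal (norm (A \<tau> u x - u x)) \<le> (\<integral>\<^sup>+h. ennreal (k \<tau> h * \<bar>u (x + h) - u x\<bar>) \<partial>lborel)" for x
    proof -
      have ik: "integrable lborel (\<lambda>y. k \<tau> (y - x))"
        using nn_integral_k_diff(1)[OF \<tau>, of x] k_nonneg[OF \<tau>] by (intro integrableI_nonneg) auto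
      have k1: "(\<integral>y. k \<tau> (y - x) \<partial>lborel) = 1"
        using nn_integral_eq_integral[OF ik] nn_integral_k_diff(1)[OF \<tau>, of x] k_nonneg[OF \<tau>] by simp
      have "A \<tau> u x - u x = (\<integral>y. k \<tau> (y - x) * u y \<partial>lborel) - (\<integral>y. k \<tau> (y - x) * u x \<partial>lborel)"
        by (simp add: A_def k1)
      also have "\<dots> = (\<integral>y. k \<tau> (y - x) * (u y - u x) \<partial>lborel)"
        using k_mult_integrable[OF u \<tau>] ik
        by (subst Bochner_Integration.integral_diff[symmetric]) (auto simp: right_diff_distrib)
      finally have "ennreal (norm (A \<tau> u x - u x)) \<le> (\<integral>\<^sup>+y. ennreal (norm (k \<tau> (y - x) * (u y - u x))) \<partial>lborel)"
        using ennreal_norm_integral_le by metis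
      also have "\<dots> = (\<integral>\<^sup>+h. ennreal (norm (k \<tau> (h + x - x) * (u (x + h) - u x))) \<partial>lborel)"
        using nn_integral_lborel_affine[of "\<lambda>y. ennreal (norm (k \<tau> (y - x) * (u y - u x)))" 1 x] by (simp add: add.commute)
      also have "\<dots> = (\<integral>\<^sup>+h. ennreal (k \<tau> h * \<bar>u (x + h) - u x\<bar>) \<partial>lborel)"
        using k_nonneg[OF \<tau>] by (simp add: abs_mult)
      finally show ?thesis .
    qed
    have "(\<integral>\<^sup>+x. ennreal (norm (A \<tau> u x - u x)) \<partial>lborel)
      \<le> (\<integral>\<^sup>+x. (\<integral>\<^sup>+h. ennreal (k \<tau> h * \<bar>u (x + h) - u x\<bar>) \<partial>lborel) \<partial>lborel)"
      by (intro nn_integral_mono pt)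
    also have "\<dots> = (\<integral>\<^sup>+h. (\<integral>\<^sup>+x. ennreal (k \<tau> h * \<bar>u (x + h) - u x\<bar>) \<partial>lborel) \<partial>lborel)"
      by (rule lborel_pair.Fubini') measurable
    also have "\<dots> = (\<integral>\<^sup>+h. ennreal (k \<tau> h) * (\<integral>\<^sup>+x. ennreal \<bar>u (x + h) - u x\<bar> \<partial>lborel) \<partial>lborel)"
      using k_nonneg[OF \<tau>] by (intro nn_integral_cong) (simp add: ennreal_mult nn_integral_cmult)
    finally show ?thesis .
  qed
  have small: "\<exists>d>0. \<forall>\<tau>. 0 < \<tau> \<and> \<tau> < d \<longrightarrow> (\<integral>\<^sup>+x. ennreal (norm (A \<tau> u x - u x)) \<partial>lborel) \<le> ennreal e"
    if e: "e > 0" for e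
  proof -
    obtain d where d: "d > 0" "\<And>h. norm h < d \<Longrightarrow> (\<integral>\<^sup>+x. ennreal \<bar>u (x + h) - u x\<bar> \<partial>lborel) \<le> ennreal e"
      using L1_translation_small[OF u e] by blast
    have "(\<integral>\<^sup>+x. ennreal (norm (A \<tau> u x - u x)) \<partial>lborel) \<le> ennreal e" if \<tau>: "0 < \<tau>" "\<tau> < d / R" for \<tau>
    proof -
      have "(\<integral>\<^sup>+h. ennreal (k \<tau> h) * (\<integral>\<^sup>+x. ennreal \<bar>u (x + h) - u x\<bar> \<partial>lborel) \<partial>lborel)
        \<le> (\<integral>\<^sup>+h. ennreal (k \<tau> h) * ennreal e \<partial>lborel)"
      proof (intro nn_integral_mono)
        fix h
        show "ennreal (k \<tau> h) * (\<integral>\<^sup>+x. ennreal \<bar>u (x + h) - u x\<bar> \<partial>lborel) \<le> ennreal (k \<tau> h) * ennreal e"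
        proof (cases "k \<tau> h = 0")
          case False
          have "norm h \<le> \<tau> * R" by (rule k_supp[OF \<tau>(1) False])
          also have "\<dots> < d" using \<tau> Rpos by (simp add: field_simps)
          finally show ?thesis by (intro mult_left_mono d) auto
        qed simp
      qed
      also have "\<dots> = ennreal e" by (simp add: nn_integral_multc nn_integral_k[OF \<tau>(1)])
      finally show ?thesis using le[OF \<tau>(1)] by (rule order_trans[rotated])
    qed
    then show ?thesis using d(1) Rpos by (intro exI[of _ "d / R"]) auto
  qed
  have "(\<integral>\<^sup>+x. ennreal (norm (A \<tau> u x - u x)) \<partial>lborel) < \<infinity>" if \<tau>: "\<tau> > 0" for \<tau>
  proof -
    have iu: "integrable lborel (\<lambda>x. \<bar>u x\<bar>)" using u by simp
    have "(\<integral>\<^sup>+x. ennreal \<bar>u (x + h) - u x\<bar> \<partial>lborel) \<le> ennreal (2 * (\<integral>x. \<bar>u x\<bar> \<partial>lborel))" for h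
    proof -
      have "(\<integral>\<^sup>+x. ennreal \<bar>u (x + h) - u x\<bar> \<partial>lborel) = ennreal (\<integral>x. \<bar>u (x + h) - u x\<bar> \<partial>lborel)"
        using integrable_lborel_translate(1)[OF u] u by (intro nn_integral_eq_integral) auto
      also have "(\<integral>x. \<bar>u (x + h) - u x\<bar> \<partial>lborel) \<le> (\<integral>x. \<bar>u (x + h)\<bar> + \<bar>u x\<bar> \<partial>lborel)"
        using integrable_lborel_translate(1)[OF u] u by (intro integral_mono) auto
      also have "\<dots> = 2 * (\<integral>x. \<bar>u x\<bar> \<partial>lborel)"
        using integrable_lborel_translate[OF iu, of h] iu by simp
      finally show ?thesis by (simp add: ennreal_leI)
    qed
    then have "(\<integral>\<^sup>+h. ennreal (k \<tau> h) * (\<integral>\<^sup>+x. ennreal \<bar>u (x + h) - u x\<bar> \<partial>lborel) \<partial>lborel)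
      \<le> (\<integral>\<^sup>+h. ennreal (k \<tau> h) * ennreal (2 * (\<integral>x. \<bar>u x\<bar> \<partial>lborel)) \<partial>lborel)"
      by (intro nn_integral_mono mult_left_mono) auto
    also have "\<dots> = ennreal (2 * (\<integral>x. \<bar>u x\<bar> \<partial>lborel))" by (simp add: nn_integral_multc nn_integral_k[OF \<tau>])
    finally have "(\<integral>\<^sup>+x. ennreal (norm (A \<tau> u x - u x)) \<partial>lborel) \<le> ennreal (2 * (\<integral>x. \<bar>u x\<bar> \<partial>lborel))"
      using le[OF \<tau>] by (rule order_trans[rotated])
    then show ?thesis by (rule le_less_trans) simp
  qed
  then show int: "integrable lborel (\<lambda>x. A (s n) u x - u x)" for n
    using s(2)[of n] by (intro integrableI_bounded) auto
  show "(\<lambda>n. \<integral>x. norm (A (s n) u x - u x) \<partial>lborel) \<longlonglongrightarrow> 0"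
  proof (rule LIMSEQ_I)
    fix e :: real assume e: "e > 0"
    obtain d where d: "d > 0" "\<And>\<tau>. 0 < \<tau> \<Longrightarrow> \<tau> < d \<Longrightarrow> (\<integral>\<^sup>+x. ennreal (norm (A \<tau> u x - u x)) \<partial>lborel) \<le> ennreal (e/2)"
      using small[of "e/2"] e by auto
    obtain N where N: "\<And>n. n \<ge> N \<Longrightarrow> norm (s n - 0) < d" using LIMSEQ_D[OF s(1) d(1)] by blast
    have "norm ((\<integral>x. norm (A (s n) u x - u x) \<partial>lborel) - 0) < e" if "n \<ge> N" for n
    proof -
      have "ennreal (\<integral>x. norm (A (s n) u x - u x) \<partial>lborel) = (\<integral>\<^sup>+x. ennreal (norm (A (s n) u x - u x)) \<partial>lborel)"
        using int[of n] by (intro nn_integral_eq_integral[symmetric]) auto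
      also have "\<dots> \<le> ennreal (e/2)" using d(2)[OF s(2)] N[OF that] s(2)[of n] by auto
      finally have "(\<integral>x. norm (A (s n) u x - u x) \<partial>lborel) \<le> e/2" using e by (simp add: ennreal_le_iff)
      then show ?thesis using e by simp
    qed
    then show "\<exists>no. \<forall>n\<ge>no. norm ((\<integral>x. norm (A (s n) u x - u x) \<partial>lborel) - 0) < e" by blast
  qed
qed

end

lemma nn_integral_lborel_prod:
  fixes f :: "'a::euclidean_space \<times> 'b::euclidean_space \<Rightarrow> ennreal"
  assumes "f \<in> borel_measurable borel"
  shows "(\<integral>\<^sup>+p. f p \<partial>lborel) = (\<integral>\<^sup>+x. (\<integral>\<^sup>+y. f (x, y) \<partial>lborel) \<partial>lborel)"
  unfolding lborel_prod[symmetric]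
  by (rule lborel.nn_integral_fst[symmetric]) (use assms in \<open>simp add: borel_prod[symmetric] lborel_prod\<close>)

context mollifier
begin

text \<open>With q = 1/\<tau> the kernel is H(q h) q^n, and the product rule in \<open>q\<close>
  followed by the chain rule produces the two summands of \<open>L\<close>.\<close>

lemma k_has_derivative:
  assumes \<tau>: "\<tau> > 0"
  shows "((\<lambda>\<tau>. k \<tau> h) has_real_derivative - L (h /\<^sub>R \<tau>) / \<tau> ^ Suc (DIM('a))) (at \<tau>)"
proof -
  define q where "q = inverse \<tau>"
  define S where "S = (\<Sum>i\<in>Basis. (h \<bullet> i) * H' i (q *\<^sub>R h))"
  \<comment> \<open>The power rule lowers the exponent, so the dimension is written as a
    successor.\<close>
  obtain m where m: "DIM('a) = Suc m" using DIM_positive[where 'a='a] by (cases "DIM('a)") auto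
  have "((\<lambda>q. q *\<^sub>R h) has_derivative (\<lambda>d. d *\<^sub>R h)) (at q)"
    by (auto intro!: derivative_eq_intros)
  from has_derivative_compose[OF this Hderiv]
  have "((\<lambda>q. H (q *\<^sub>R h)) has_derivative (\<lambda>d. \<Sum>i\<in>Basis. ((d *\<^sub>R h) \<bullet> i) * H' i (q *\<^sub>R h))) (at q)" .
  moreover have "(\<lambda>d. \<Sum>i\<in>Basis. ((d *\<^sub>R h) \<bullet> i) * H' i (q *\<^sub>R h)) = (*) S"
    by (auto simp: fun_eq_iff S_def sum_distrib_left mult_ac)
  ultimately have "((\<lambda>q. H (q *\<^sub>R h)) has_real_derivative S) (at q)"
    by (simp only: has_field_derivative_def)
  then have "((\<lambda>q. H (q *\<^sub>R h) * q ^ DIM('a)) has_real_derivative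
      (S * q ^ DIM('a) + H (q *\<^sub>R h) * (real (DIM('a)) * q ^ m))) (at q)"
    using DERIV_mult[OF _ DERIV_pow[of "DIM('a)" q], of "\<lambda>q. H (q *\<^sub>R h)" S]
    by (simp add: m mult.commute del: power_Suc of_nat_Suc)
  moreover have "(inverse has_real_derivative - (q\<^sup>2)) (at \<tau>)"
    using \<tau> by (auto intro!: derivative_eq_intros simp: q_def power2_eq_square)
  ultimately have "((\<lambda>\<tau>. H (inverse \<tau> *\<^sub>R h) * inverse \<tau> ^ DIM('a)) has_real_derivative
      (S * q ^ DIM('a) + H (q *\<^sub>R h) * (real (DIM('a)) * q ^ m)) * - (q\<^sup>2)) (at \<tau>)"
    unfolding q_def by (rule DERIV_chain2)
  moreover have "(S * q ^ DIM('a) + H (q *\<^sub>R h) * (real (DIM('a)) * q ^ m)) * - (q\<^sup>2) = - L (h /\<^sub>R \<tau>) / \<tau> ^ Suc (DIM('a))"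
  proof -
    have "L (h /\<^sub>R \<tau>) = real (DIM('a)) * H (q *\<^sub>R h) + q * S"
      unfolding L_def S_def q_def[symmetric] sum_distrib_left by (simp add: mult.assoc)
    moreover have "x / \<tau> ^ Suc (DIM('a)) = x * q ^ Suc (DIM('a))" for x
      by (simp add: q_def divide_inverse power_inverse)
    ultimately show ?thesis by (simp only: m) (simp add: algebra_simps power2_eq_square)
  qed
  ultimately show ?thesis
    by (simp add: k_def divide_inverse power_inverse)
qed

text \<open>The functions (y - x)_i H((y - x)/\<tau>) are supported in x + \<tau> C, which lies in
  the domain, and are therefore test functions. Their i-th partial derivatives sum over
  \<open>i\<close> to L((y - x)/\<tau>), so the identity is the sum of the defining equations of the
  weak gradient.\<close>

lemma weak_identity_L:
  assumes wp: "weak_pair \<Omega> u g" and \<tau>: "\<tau> > 0" and sub: "\<And>z. z \<in> C \<Longrightarrow> x + \<tau> *\<^sub>R z \<in> \<Omega>"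
  shows "(\<integral>y. u y * L ((y - x) /\<^sub>R \<tau>) \<partial>lborel) = - (\<integral>y. (g y \<bullet> (y - x)) * H ((y - x) /\<^sub>R \<tau>) \<partial>lborel)"
proof -
  define \<phi> where "\<phi> = (\<lambda>i y. ((y - x) \<bullet> i) * H ((y - x) /\<^sub>R \<tau>))"
  let ?K = "(\<lambda>z. x + \<tau> *\<^sub>R z) ` C"
  have Kc: "compact ?K" by (intro compact_continuous_image Ccpt continuous_intros)
  have zK: "(y - x) /\<^sub>R \<tau> \<notin> C" if "y \<notin> ?K" for y
  proof
    assume "(y - x) /\<^sub>R \<tau> \<in> C"
    then have "x + \<tau> *\<^sub>R ((y - x) /\<^sub>R \<tau>) \<in> ?K" by blast
    with that \<tau> show False by simp
  qed
  have test: "test_fun \<Omega> (\<phi> i)" for i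
    unfolding test_fun_def
  proof (intro conjI)
    have "(\<lambda>y. (y - x) \<bullet> i) = (\<lambda>y. y \<bullet> i + (- (x \<bullet> i)))" by (auto simp: inner_diff_left)
    then have "flat_alg (\<lambda>y. (y - x) \<bullet> i)" using flat_alg.flat_affine by metis
    then have "flat_alg (\<phi> i)" unfolding \<phi>_def
      by (intro flat_alg.flat_mult flat_alg_affine_comp Hflat)
    then show "smooth_on_real UNIV (\<phi> i)" by (rule flat_alg_smooth)
    have "{y. \<phi> i y \<noteq> 0} \<subseteq> ?K" using zK Hz by (auto simp: \<phi>_def)
    then have sub': "closure {y. \<phi> i y \<noteq> 0} \<subseteq> ?K" by (rule closure_minimal[OF _ compact_imp_closed[OF Kc]])
    then show "compact (closure {y. \<phi> i y \<noteq> 0})"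
      using Kc by (metis closed_closure compact_Int_closed inf.absorb_iff2)
    show "closure {y. \<phi> i y \<noteq> 0} \<subseteq> \<Omega>" using sub' sub by auto
  qed
  have der: "frechet_derivative (\<phi> i) (at y) i = H ((y - x) /\<^sub>R \<tau>) + (((y - x) /\<^sub>R \<tau>) \<bullet> i) * H' i ((y - x) /\<^sub>R \<tau>)"
    if i: "i \<in> Basis" for i y
  proof -
    have "((\<lambda>y. (y - x) /\<^sub>R \<tau>) has_derivative (\<lambda>h. h /\<^sub>R \<tau>)) (at y)"
      by (auto intro!: derivative_eq_intros)
    from has_derivative_compose[OF this Hderiv]
    have 1: "((\<lambda>y. H ((y - x) /\<^sub>R \<tau>)) has_derivative (\<lambda>h. \<Sum>j\<in>Basis. ((h /\<^sub>R \<tau>) \<bullet> j) * H' j ((y - x) /\<^sub>R \<tau>))) (at y)" .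
    have 2: "((\<lambda>y. (y - x) \<bullet> i) has_derivative (\<lambda>h. h \<bullet> i)) (at y)"
      by (auto intro!: derivative_eq_intros)
    have "frechet_derivative (\<phi> i) (at y) = (\<lambda>h. ((y - x) \<bullet> i) * (\<Sum>j\<in>Basis. ((h /\<^sub>R \<tau>) \<bullet> j) * H' j ((y - x) /\<^sub>R \<tau>)) + (h \<bullet> i) * H ((y - x) /\<^sub>R \<tau>))"
      unfolding \<phi>_def by (rule frechet_derivative_at[OF has_derivative_mult[OF 2 1], symmetric])
    moreover have "(\<Sum>j\<in>Basis. ((i /\<^sub>R \<tau>) \<bullet> j) * H' j ((y - x) /\<^sub>R \<tau>)) = inverse \<tau> * H' i ((y - x) /\<^sub>R \<tau>)"
      using i by (simp add: inner_Basis if_distrib if_distribR cong: if_cong)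
    ultimately show ?thesis using i by (simp add: inner_Basis)
  qed
  have us: "sqint u" and gs: "sqint g" using wp by (auto simp: weak_pair_def)
  have id: "(\<integral>y. u y * frechet_derivative (\<phi> i) (at y) i \<partial>lborel) = - (\<integral>y. (g y \<bullet> i) * \<phi> i y \<partial>lborel)" if "i \<in> Basis" for i
    using wp test that by (simp add: weak_pair_def)
  have i1: "integrable lborel (\<lambda>y. u y * frechet_derivative (\<phi> i) (at y) i)" if "i \<in> Basis" for i
    using sqint_inner[OF us test_fun_sqint(2)[OF test that]] by simp
  have i2: "integrable lborel (\<lambda>y. (g y \<bullet> i) * \<phi> i y)" if "i \<in> Basis" for i
  proof -
    have \<phi>s: "sqint (\<phi> i)" by (rule test_fun_sqint(1)[OF test that])
    note [measurable] = sqint_measurable[OF \<phi>s]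
    have "sqint (\<lambda>y. \<phi> i y *\<^sub>R i)"
      by (rule sqint_norm_le[OF \<phi>s]) (use that in simp_all)
    from sqint_inner[OF gs this] show ?thesis by (simp add: mult.commute)
  qed
  have "(\<integral>y. u y * L ((y - x) /\<^sub>R \<tau>) \<partial>lborel) = (\<integral>y. (\<Sum>i\<in>Basis. u y * frechet_derivative (\<phi> i) (at y) i) \<partial>lborel)"
    by (intro Bochner_Integration.integral_cong refl)
       (simp add: der L_def sum.distrib sum_distrib_left distrib_left mult_ac)
  also have "\<dots> = (\<Sum>i\<in>Basis. (\<integral>y. u y * frechet_derivative (\<phi> i) (at y) i \<partial>lborel))"
    by (intro Bochner_Integration.integral_sum i1)
  also have "\<dots> = - (\<Sum>i\<in>Basis. (\<integral>y. (g y \<bullet> i) * \<phi> i y \<partial>lborel))"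
    by (simp add: id sum_negf)
  also have "(\<Sum>i\<in>Basis. (\<integral>y. (g y \<bullet> i) * \<phi> i y \<partial>lborel)) = (\<integral>y. (\<Sum>i\<in>Basis. (g y \<bullet> i) * \<phi> i y) \<partial>lborel)"
    by (intro Bochner_Integration.integral_sum[symmetric] i2)
  also have "\<dots> = (\<integral>y. (g y \<bullet> (y - x)) * H ((y - x) /\<^sub>R \<tau>) \<partial>lborel)"
  proof (intro Bochner_Integration.integral_cong refl)
    fix y
    show "(\<Sum>i\<in>Basis. (g y \<bullet> i) * \<phi> i y) = (g y \<bullet> (y - x)) * H ((y - x) /\<^sub>R \<tau>)"
      unfolding \<phi>_def euclidean_inner[of "g y" "y - x"] sum_distrib_right mult.assoc ..
  qed
  finally show ?thesis .
qed

text \<open>The fundamental theorem of calculus is applied to the kernel in the scale \<tau>, not to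
  \<open>u\<close> in space, so \<open>u\<close> needs only a weak gradient. Fubini exchanges the
  integrals and \<open>weak_identity_L\<close> replaces \<open>u\<close> by \<open>g\<close>.
  Positive \<open>s\<close> keeps the powers of 1/\<tau> bounded, which makes the double integral
  absolutely convergent.\<close>

lemma A_diff:
  assumes wp: "weak_pair \<Omega> u g" and u: "integrable lborel u" and st: "0 < s" "s \<le> t"
    and sub: "\<And>\<tau> z. s \<le> \<tau> \<Longrightarrow> \<tau> \<le> t \<Longrightarrow> z \<in> C \<Longrightarrow> x + \<tau> *\<^sub>R z \<in> \<Omega>"
  shows "A t u x - A s u x = (\<integral>\<tau>. indicator {s..t} \<tau> * (\<integral>y. (g y \<bullet> ((y - x) /\<^sub>R \<tau>)) * k \<tau> (y - x) \<partial>lborel) \<partial>lborel)"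
proof -
  have [measurable]: "u \<in> borel_measurable borel" using borel_measurable_integrable[OF u] by simp
  define f where "f = (\<lambda>\<tau> y. (- L ((y - x) /\<^sub>R \<tau>) / \<tau> ^ Suc (DIM('a))) * indicator {s..t} \<tau> * u y)"
  have ftc: "(\<integral>\<tau>. f \<tau> y \<partial>lborel) = (k t (y - x) - k s (y - x)) * u y" for y
  proof -
    have "(\<integral>\<tau>. (- L ((y - x) /\<^sub>R \<tau>) / \<tau> ^ Suc (DIM('a))) * indicator {s..t} \<tau> \<partial>lborel) = k t (y - x) - k s (y - x)"
    proof (rule integral_FTC_Icc_real[OF st(2)])
      fix \<tau> assume "s \<le> \<tau>" "\<tau> \<le> t"
      then have \<tau>: "\<tau> > 0" using st by simp
      show "((\<lambda>\<tau>. k \<tau> (y - x)) has_real_derivative - L ((y - x) /\<^sub>R \<tau>) / \<tau> ^ Suc (DIM('a))) (at \<tau>)"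
        by (rule k_has_derivative[OF \<tau>])
      have c0: "isCont L z" for z using Lcont continuous_on_eq_continuous_at[OF open_UNIV] by blast
      have c1: "isCont (\<lambda>\<tau>. (y - x) /\<^sub>R \<tau>) \<tau>" using \<tau> by (intro continuous_intros) auto
      have "isCont (\<lambda>\<tau>. L ((y - x) /\<^sub>R \<tau>)) \<tau>" by (rule isCont_o2[OF c1 c0])
      then show "isCont (\<lambda>\<tau>. - L ((y - x) /\<^sub>R \<tau>) / \<tau> ^ Suc (DIM('a))) \<tau>"
        using \<tau> by (intro isCont_divide isCont_minus isCont_power continuous_ident) auto
    qed
    then show ?thesis unfolding f_def by (simp only: integral_mult_left_zero)
  qed
  have "A t u x - A s u x = (\<integral>y. k t (y - x) * u y - k s (y - x) * u y \<partial>lborel)"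
    unfolding A_def using k_mult_integrable[OF u] st by (intro Bochner_Integration.integral_diff[symmetric]) auto
  also have "\<dots> = (\<integral>y. (\<integral>\<tau>. f \<tau> y \<partial>lborel) \<partial>lborel)"
    by (simp add: ftc left_diff_distrib)
  also have "\<dots> = (\<integral>\<tau>. (\<integral>y. f \<tau> y \<partial>lborel) \<partial>lborel)"
  proof (rule lborel_pair.Fubini_integral)
    obtain M where M: "M \<ge> 0" "\<And>z. \<bar>L z\<bar> \<le> M" by (rule Lbound) blast
    have m: "case_prod f \<in> borel_measurable (lborel \<Otimes>\<^sub>M lborel)"
      unfolding f_def by measurable
    define c where "c = M / s ^ Suc (DIM('a))"
    have c0: "c \<ge> 0" using M st by (simp add: c_def)
    have bd: "norm (f \<tau> y) \<le> c * indicator {s..t} \<tau> * \<bar>u y\<bar>" for \<tau> y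
    proof (cases "\<tau> \<in> {s..t}")
      case True
      have "\<bar>L ((y - x) /\<^sub>R \<tau>)\<bar> / \<tau> ^ Suc (DIM('a)) \<le> c"
        unfolding c_def using True st M by (intro frac_le power_mono zero_less_power) auto
      then have "\<bar>L ((y - x) /\<^sub>R \<tau>)\<bar> / \<tau> ^ Suc (DIM('a)) * \<bar>u y\<bar> \<le> c * \<bar>u y\<bar>"
        by (rule mult_right_mono) simp
      moreover have "norm (f \<tau> y) = \<bar>L ((y - x) /\<^sub>R \<tau>)\<bar> / \<tau> ^ Suc (DIM('a)) * \<bar>u y\<bar>"
        using True st unfolding f_def by (simp add: abs_mult abs_divide power_abs)
      moreover have "indicator {s..t} \<tau> = (1::real)" using True by simp
      ultimately show ?thesis by (simp only: mult_1_right)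
    qed (simp add: f_def)
    have iu: "integrable lborel (\<lambda>y. \<bar>u y\<bar>)" using u by simp
    have "(\<integral>\<^sup>+p. ennreal (norm (case_prod f p)) \<partial>(lborel \<Otimes>\<^sub>M lborel))
      = (\<integral>\<^sup>+\<tau>. (\<integral>\<^sup>+y. ennreal (norm (f \<tau> y)) \<partial>lborel) \<partial>lborel)"
      using m by (subst lborel.nn_integral_fst[symmetric]) auto
    also have "\<dots> \<le> (\<integral>\<^sup>+\<tau>. (\<integral>\<^sup>+y. ennreal (c * indicator {s..t} \<tau> * \<bar>u y\<bar>) \<partial>lborel) \<partial>lborel)"
      using bd by (intro nn_integral_mono ennreal_leI) auto
    also have "\<dots> = (\<integral>\<^sup>+\<tau>. ennreal (c * indicator {s..t} \<tau>) * ennreal (\<integral>y. \<bar>u y\<bar> \<partial>lborel) \<partial>lborel)"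
      using c0 nn_integral_eq_integral[OF iu]
      by (intro nn_integral_cong) (simp add: ennreal_mult nn_integral_cmult)
    also have "\<dots> = (\<integral>\<^sup>+\<tau>. ennreal (c) * indicator {s..t} \<tau> \<partial>lborel) * ennreal (\<integral>y. \<bar>u y\<bar> \<partial>lborel)"
      by (subst nn_integral_multc) (auto intro!: arg_cong2[where f="(*)"] nn_integral_cong simp: indicator_def)
    also have "\<dots> < \<infinity>" using st by (simp add: nn_integral_cmult_indicator ennreal_mult_less_top)
    finally show "integrable (lborel \<Otimes>\<^sub>M lborel) (case_prod f)"
      using m by (intro integrableI_bounded)
  qed
  also have "\<dots> = (\<integral>\<tau>. indicator {s..t} \<tau> * (\<integral>y. (g y \<bullet> ((y - x) /\<^sub>R \<tau>)) * k \<tau> (y - x) \<partial>lborel) \<partial>lborel)"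
  proof (intro Bochner_Integration.integral_cong refl)
    fix \<tau> :: real
    show "(\<integral>y. f \<tau> y \<partial>lborel) = indicator {s..t} \<tau> * (\<integral>y. (g y \<bullet> ((y - x) /\<^sub>R \<tau>)) * k \<tau> (y - x) \<partial>lborel)"
    proof (cases "\<tau> \<in> {s..t}")
      case True
      then have \<tau>: "\<tau> > 0" using st by auto
      have "(\<integral>y. f \<tau> y \<partial>lborel) = (\<integral>y. - (1 / \<tau> ^ Suc (DIM('a))) * (u y * L ((y - x) /\<^sub>R \<tau>)) \<partial>lborel)"
        unfolding f_def using True by (intro Bochner_Integration.integral_cong) auto
      also have "\<dots> = - (1 / \<tau> ^ Suc (DIM('a))) * (\<integral>y. u y * L ((y - x) /\<^sub>R \<tau>) \<partial>lborel)"
        by simp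
      also have "\<dots> = 1 / \<tau> ^ Suc (DIM('a)) * (\<integral>y. (g y \<bullet> (y - x)) * H ((y - x) /\<^sub>R \<tau>) \<partial>lborel)"
        using weak_identity_L[OF wp \<tau>, of x] sub True by simp
      also have "\<dots> = (\<integral>y. 1 / \<tau> ^ Suc (DIM('a)) * ((g y \<bullet> (y - x)) * H ((y - x) /\<^sub>R \<tau>)) \<partial>lborel)"
        by simp
      also have "\<dots> = (\<integral>y. (g y \<bullet> ((y - x) /\<^sub>R \<tau>)) * k \<tau> (y - x) \<partial>lborel)"
        by (intro Bochner_Integration.integral_cong refl)
           (simp only: k_def inner_scaleR_right power_Suc divide_inverse inverse_mult_distrib mult_1_left mult_ac)
      finally show ?thesis using True by simp
    qed (simp add: f_def)
  qed
  finally show ?thesis .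
qed

text \<open>On the support of the kernel (y - x)/\<tau> lies in \<open>C\<close> and has norm at
  most \<open>R\<close>. The remaining weight \<open>w\<close> on pairs (\<tau>, y) has total mass
  \<open>t - s\<close>, so Cauchy-Schwarz costs exactly that factor.\<close>

lemma A_diff_pointwise:
  assumes wp: "weak_pair \<Omega> u g" and u: "integrable lborel u" and st: "0 < s" "s \<le> t"
    and sub: "\<And>\<tau> z. s \<le> \<tau> \<Longrightarrow> \<tau> \<le> t \<Longrightarrow> z \<in> C \<Longrightarrow> x + \<tau> *\<^sub>R z \<in> \<Omega>"
  shows "ennreal ((A t u x - A s u x)\<^sup>2) \<le> ennreal (R\<^sup>2 * (t - s)) *
     (\<integral>\<^sup>+p. ennreal (indicator {s..t} (fst p) * k (fst p) (snd p - x) * (norm (g (snd p)))\<^sup>2) \<partial>lborel)"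
proof -
  have [measurable]: "g \<in> borel_measurable borel" using wp by (auto simp: weak_pair_def dest: sqint_measurable)
  define w where "w = (\<lambda>p. indicator {s..t} (fst p) * k (fst p) (snd p - x))"
  have fstm: "fst \<in> borel_measurable (borel :: (real \<times> 'a) measure)" and sndm: "snd \<in> borel_measurable (borel :: (real \<times> 'a) measure)"
    by (intro borel_measurable_continuous_onI continuous_intros)+
  note [measurable] = fstm sndm
  have w[measurable]: "w \<in> borel_measurable borel" unfolding w_def by measurable
  have w0: "w p \<ge> 0" for p unfolding w_def using k_nonneg[of "fst p"] st by (auto simp: indicator_def)
  have eq: "A t u x - A s u x = (\<integral>\<tau>. indicator {s..t} \<tau> * (\<integral>y. (g y \<bullet> ((y - x) /\<^sub>R \<tau>)) * k \<tau> (y - x) \<partial>lborel) \<partial>lborel)"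
    by (rule A_diff[OF wp u st sub])
  have "ennreal \<bar>A t u x - A s u x\<bar>
     \<le> (\<integral>\<^sup>+\<tau>. ennreal (norm (indicator {s..t} \<tau> * (\<integral>y. (g y \<bullet> ((y - x) /\<^sub>R \<tau>)) * k \<tau> (y - x) \<partial>lborel))) \<partial>lborel)"
    unfolding eq real_norm_def[symmetric] by (rule ennreal_norm_integral_le)
  also have "\<dots> \<le> (\<integral>\<^sup>+\<tau>. (\<integral>\<^sup>+y. ennreal (R * (norm (g y) * w (\<tau>, y))) \<partial>lborel) \<partial>lborel)"
  proof (intro nn_integral_mono)
    fix \<tau> :: real
    show "ennreal (norm (indicator {s..t} \<tau> * (\<integral>y. (g y \<bullet> ((y - x) /\<^sub>R \<tau>)) * k \<tau> (y - x) \<partial>lborel)))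
      \<le> (\<integral>\<^sup>+y. ennreal (R * (norm (g y) * w (\<tau>, y))) \<partial>lborel)"
    proof (cases "\<tau> \<in> {s..t}")
      case True
      then have \<tau>: "\<tau> > 0" using st by auto
      have "ennreal (norm (\<integral>y. (g y \<bullet> ((y - x) /\<^sub>R \<tau>)) * k \<tau> (y - x) \<partial>lborel))
        \<le> (\<integral>\<^sup>+y. ennreal (norm ((g y \<bullet> ((y - x) /\<^sub>R \<tau>)) * k \<tau> (y - x))) \<partial>lborel)"
        by (rule ennreal_norm_integral_le)
      also have "\<dots> \<le> (\<integral>\<^sup>+y. ennreal (R * (norm (g y) * w (\<tau>, y))) \<partial>lborel)"
      proof (intro nn_integral_mono ennreal_leI)
        fix y
        show "norm ((g y \<bullet> ((y - x) /\<^sub>R \<tau>)) * k \<tau> (y - x)) \<le> R * (norm (g y) * w (\<tau>, y))"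
        proof (cases "(y - x) /\<^sub>R \<tau> \<in> C")
          case inC: True
          have "\<bar>g y \<bullet> ((y - x) /\<^sub>R \<tau>)\<bar> \<le> norm (g y) * norm ((y - x) /\<^sub>R \<tau>)" by (rule Cauchy_Schwarz_ineq2)
          also have "\<dots> \<le> norm (g y) * R" by (intro mult_left_mono CR inC) simp
          finally have "\<bar>g y \<bullet> ((y - x) /\<^sub>R \<tau>)\<bar> * k \<tau> (y - x) \<le> norm (g y) * R * k \<tau> (y - x)"
            by (rule mult_right_mono) (rule k_nonneg[OF \<tau>])
          moreover have "norm ((g y \<bullet> ((y - x) /\<^sub>R \<tau>)) * k \<tau> (y - x)) = \<bar>g y \<bullet> ((y - x) /\<^sub>R \<tau>)\<bar> * k \<tau> (y - x)"
            by (simp only: real_norm_def abs_mult abs_of_nonneg[OF k_nonneg[OF \<tau>]])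
          moreover have "R * (norm (g y) * w (\<tau>, y)) = norm (g y) * R * k \<tau> (y - x)"
            using True by (simp add: w_def)
          ultimately show ?thesis by (simp only:)
        next
          case False
          then show ?thesis unfolding w_def by (simp add: k_zero)
        qed
      qed
      finally show ?thesis using True by simp
    qed simp
  qed
  also have "\<dots> = (\<integral>\<^sup>+p. ennreal (R * (norm (g (snd p)) * w p)) \<partial>lborel)"
    by (subst nn_integral_lborel_prod) auto
  \<comment> \<open>The weight is split as \<open>sqrt w * sqrt w\<close>, one root staying with |g|
    and the other giving the mass.\<close>
  also have "\<dots> = ennreal R * (\<integral>\<^sup>+p. ennreal (norm (g (snd p)) * sqrt (w p)) * ennreal (sqrt (w p)) \<partial>lborel)"
    using Rpos w0 by (subst nn_integral_cmult[symmetric]) (auto intro!: nn_integral_cong simp: ennreal_mult[symmetric] mult_ac)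
  finally have "(ennreal \<bar>A t u x - A s u x\<bar>)\<^sup>2
     \<le> (ennreal R * (\<integral>\<^sup>+p. ennreal (norm (g (snd p)) * sqrt (w p)) * ennreal (sqrt (w p)) \<partial>lborel))\<^sup>2"
    by (intro power_mono) auto
  also have "\<dots> = (ennreal R)\<^sup>2 * (\<integral>\<^sup>+p. ennreal (norm (g (snd p)) * sqrt (w p)) * ennreal (sqrt (w p)) \<partial>lborel)\<^sup>2"
    by (simp add: power_mult_distrib)
  also have "\<dots> \<le> (ennreal R)\<^sup>2 * ((\<integral>\<^sup>+p. (ennreal (norm (g (snd p)) * sqrt (w p)))\<^sup>2 \<partial>lborel) * (\<integral>\<^sup>+p. (ennreal (sqrt (w p)))\<^sup>2 \<partial>lborel))"
    by (intro mult_left_mono Cauchy_Schwarz_nn_integral) auto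
  also have "(\<integral>\<^sup>+p. (ennreal (sqrt (w p)))\<^sup>2 \<partial>lborel) = (\<integral>\<^sup>+p. ennreal (w p) \<partial>lborel)"
    using w0 by (intro nn_integral_cong) (simp add: ennreal_power)
  also have "\<dots> = (\<integral>\<^sup>+\<tau>. (\<integral>\<^sup>+y. ennreal (w (\<tau>, y)) \<partial>lborel) \<partial>lborel)"
    by (subst nn_integral_lborel_prod) auto
  also have "\<dots> = (\<integral>\<^sup>+\<tau>. indicator {s..t} \<tau> \<partial>lborel)"
  proof (intro nn_integral_cong)
    fix \<tau> :: real
    show "(\<integral>\<^sup>+y. ennreal (w (\<tau>, y)) \<partial>lborel) = indicator {s..t} \<tau>"
      using nn_integral_k_diff(1)[of \<tau> x] st by (cases "\<tau> \<in> {s..t}") (auto simp: w_def)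
  qed
  also have "\<dots> = ennreal (t - s)" using st by simp
  also have "(\<integral>\<^sup>+p. (ennreal (norm (g (snd p)) * sqrt (w p)))\<^sup>2 \<partial>lborel) = (\<integral>\<^sup>+p. ennreal (w p * (norm (g (snd p)))\<^sup>2) \<partial>lborel)"
    using w0 by (intro nn_integral_cong) (simp add: ennreal_power power_mult_distrib mult.commute)
  finally have "(ennreal \<bar>A t u x - A s u x\<bar>)\<^sup>2 \<le> (ennreal R)\<^sup>2 * ((\<integral>\<^sup>+p. ennreal (w p * (norm (g (snd p)))\<^sup>2) \<partial>lborel) * ennreal (t - s))" .
  also have "\<dots> = ennreal (R\<^sup>2 * (t - s)) * (\<integral>\<^sup>+p. ennreal (w p * (norm (g (snd p)))\<^sup>2) \<partial>lborel)"
    using Rpos st by (simp add: ennreal_mult ennreal_power mult_ac)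
  finally show ?thesis using Rpos by (simp add: w_def ennreal_power)
qed

text \<open>The kernel has mass 1 in \<open>x\<close> for fixed \<open>y\<close> as well.
  Integrating the pointwise bound over \<open>x\<close> first therefore removes it, and the interval
  of scales contributes a second factor \<open>t - s\<close>.\<close>

lemma A_diff_L2:
  assumes wp: "weak_pair \<Omega> u g" and u: "integrable lborel u" and st: "0 < s" "s \<le> t"
    and B[measurable]: "B \<in> sets borel"
    and sub: "\<And>x \<tau> z. x \<in> B \<Longrightarrow> s \<le> \<tau> \<Longrightarrow> \<tau> \<le> t \<Longrightarrow> z \<in> C \<Longrightarrow> x + \<tau> *\<^sub>R z \<in> \<Omega>"
  shows "(\<integral>\<^sup>+x. ennreal (indicator B x * (A t u x - A s u x)\<^sup>2) \<partial>lborel)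
     \<le> ennreal (R\<^sup>2 * (t - s)\<^sup>2 * (\<integral>y. (norm (g y))\<^sup>2 \<partial>lborel))"
proof -
  have gs: "sqint g" using wp by (auto simp: weak_pair_def)
  have [measurable]: "g \<in> borel_measurable borel" using gs by (rule sqint_measurable)
  have fstm: "fst \<in> borel_measurable (borel :: (real \<times> 'a) measure)" and sndm: "snd \<in> borel_measurable (borel :: (real \<times> 'a) measure)"
    by (intro borel_measurable_continuous_onI continuous_intros)+
  note [measurable] = fstm sndm
  define I where "I = (\<integral>y. (norm (g y))\<^sup>2 \<partial>lborel)"
  have I0: "I \<ge> 0" unfolding I_def by simp
  have "(\<integral>\<^sup>+x. ennreal (indicator B x * (A t u x - A s u x)\<^sup>2) \<partial>lborel)
     \<le> (\<integral>\<^sup>+x. ennreal (R\<^sup>2 * (t - s)) * (\<integral>\<^sup>+p. ennreal (indicator {s..t} (fst p) * k (fst p) (snd p - x) * (norm (g (snd p)))\<^sup>2) \<partial>lborel) \<partial>lborel)"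
  proof (intro nn_integral_mono)
    fix x
    show "ennreal (indicator B x * (A t u x - A s u x)\<^sup>2) \<le> ennreal (R\<^sup>2 * (t - s)) *
     (\<integral>\<^sup>+p. ennreal (indicator {s..t} (fst p) * k (fst p) (snd p - x) * (norm (g (snd p)))\<^sup>2) \<partial>lborel)"
      using A_diff_pointwise[OF wp u st sub, of x] by (cases "x \<in> B") auto
  qed
  also have "\<dots> = ennreal (R\<^sup>2 * (t - s)) * (\<integral>\<^sup>+x. (\<integral>\<^sup>+p. ennreal (indicator {s..t} (fst p) * k (fst p) (snd p - x) * (norm (g (snd p)))\<^sup>2) \<partial>lborel) \<partial>lborel)"
    by (rule nn_integral_cmult) measurable
  also have "(\<integral>\<^sup>+x. (\<integral>\<^sup>+p. ennreal (indicator {s..t} (fst p) * k (fst p) (snd p - x) * (norm (g (snd p)))\<^sup>2) \<partial>lborel) \<partial>lborel)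
     = (\<integral>\<^sup>+p. (\<integral>\<^sup>+x. ennreal (indicator {s..t} (fst p) * k (fst p) (snd p - x) * (norm (g (snd p)))\<^sup>2) \<partial>lborel) \<partial>lborel)"
    by (rule lborel_pair.Fubini') measurable
  also have "\<dots> = (\<integral>\<^sup>+p. ennreal (indicator {s..t} (fst p) * (norm (g (snd p)))\<^sup>2) \<partial>lborel)"
  proof (intro nn_integral_cong)
    fix p :: "real \<times> 'a"
    show "(\<integral>\<^sup>+x. ennreal (indicator {s..t} (fst p) * k (fst p) (snd p - x) * (norm (g (snd p)))\<^sup>2) \<partial>lborel)
        = ennreal (indicator {s..t} (fst p) * (norm (g (snd p)))\<^sup>2)"
    proof (cases "fst p \<in> {s..t}")
      case True
      then have \<tau>: "fst p > 0" using st by auto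
      have "(\<integral>\<^sup>+x. ennreal (k (fst p) (snd p - x) * (norm (g (snd p)))\<^sup>2) \<partial>lborel)
        = (\<integral>\<^sup>+x. ennreal (k (fst p) (snd p - x)) * ennreal ((norm (g (snd p)))\<^sup>2) \<partial>lborel)"
        using k_nonneg[OF \<tau>] by (intro nn_integral_cong) (simp add: ennreal_mult)
      also have "\<dots> = ennreal ((norm (g (snd p)))\<^sup>2)"
        by (subst nn_integral_multc) (auto simp: nn_integral_k_diff(2)[OF \<tau>])
      finally show ?thesis using True by simp
    qed simp
  qed
  also have "\<dots> = (\<integral>\<^sup>+\<tau>. (\<integral>\<^sup>+y. indicator {s..t} \<tau> * ennreal ((norm (g y))\<^sup>2) \<partial>lborel) \<partial>lborel)"
    by (subst nn_integral_lborel_prod) (auto intro!: nn_integral_cong simp: indicator_def)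
  also have "\<dots> = (\<integral>\<^sup>+\<tau>. indicator {s..t} \<tau> * ennreal I \<partial>lborel)"
    using nn_integral_eq_integral[OF sqint_integrable[OF gs]] by (simp add: nn_integral_cmult I_def)
  also have "\<dots> = ennreal (t - s) * ennreal I"
    using st by (subst nn_integral_multc) auto
  also have "ennreal (R\<^sup>2 * (t - s)) * \<dots> = ennreal (R\<^sup>2 * (t - s)\<^sup>2 * I)"
    using st I0 Rpos by (simp add: ennreal_mult[symmetric] power2_eq_square mult_ac)
  finally show ?thesis unfolding I_def .
qed

text \<open>The bound for two scales is uniform in the smaller one. Along a sequence of scales
  tending to 0 the averages converge to \<open>u\<close> almost everywhere, and Fatou carries the
  bound to the limit.\<close>

lemma A_approx_L2:
  assumes wp: "weak_pair \<Omega> u g" and u: "integrable lborel u" and t: "0 < t"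
    and B[measurable]: "B \<in> sets borel"
    and sub: "\<And>x \<tau> z. x \<in> B \<Longrightarrow> 0 < \<tau> \<Longrightarrow> \<tau> \<le> t \<Longrightarrow> z \<in> C \<Longrightarrow> x + \<tau> *\<^sub>R z \<in> \<Omega>"
  shows "(\<integral>\<^sup>+x. ennreal (indicator B x * (A t u x - u x)\<^sup>2) \<partial>lborel)
     \<le> ennreal (R\<^sup>2 * t\<^sup>2 * (\<integral>y. (norm (g y))\<^sup>2 \<partial>lborel))"
proof -
  have [measurable]: "u \<in> borel_measurable borel" using borel_measurable_integrable[OF u] by simp
  define s where "s = (\<lambda>n. t * inverse (real (Suc n)))"
  have s0: "s n > 0" "s n \<le> t" for n using t by (auto simp: s_def field_simps)
  have "s \<longlonglongrightarrow> t * 0" unfolding s_def by (intro tendsto_intros LIMSEQ_inverse_real_of_nat)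
  then have s: "s \<longlonglongrightarrow> 0" by simp
  obtain r where r: "strict_mono (r::nat\<Rightarrow>nat)" and ae: "AE x in lborel. (\<lambda>n. A (s (r n)) u x - u x) \<longlonglongrightarrow> 0"
    using tendsto_L1_AE_subseq[OF A_tendsto_L1[OF u s s0(1)]] by blast
  have "(\<integral>\<^sup>+x. ennreal (indicator B x * (A t u x - u x)\<^sup>2) \<partial>lborel)
     = (\<integral>\<^sup>+x. liminf (\<lambda>n. ennreal (indicator B x * (A t u x - A (s (r n)) u x)\<^sup>2)) \<partial>lborel)"
  proof (rule nn_integral_cong_AE, use ae in eventually_elim)
    fix x assume "(\<lambda>n. A (s (r n)) u x - u x) \<longlonglongrightarrow> 0"
    then have "(\<lambda>n. A (s (r n)) u x) \<longlonglongrightarrow> u x" by (rule LIM_zero_cancel)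
    then have "(\<lambda>n. ennreal (indicator B x * (A t u x - A (s (r n)) u x)\<^sup>2)) \<longlonglongrightarrow> ennreal (indicator B x * (A t u x - u x)\<^sup>2)"
      by (intro tendsto_intros)
    then show "ennreal (indicator B x * (A t u x - u x)\<^sup>2) = liminf (\<lambda>n. ennreal (indicator B x * (A t u x - A (s (r n)) u x)\<^sup>2))"
      by (rule lim_imp_Liminf[OF trivial_limit_sequentially, symmetric])
  qed
  also have "\<dots> \<le> liminf (\<lambda>n. \<integral>\<^sup>+x. ennreal (indicator B x * (A t u x - A (s (r n)) u x)\<^sup>2) \<partial>lborel)"
    by (rule nn_integral_liminf) measurable
  also have "\<dots> \<le> ennreal (R\<^sup>2 * t\<^sup>2 * (\<integral>y. (norm (g y))\<^sup>2 \<partial>lborel))"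
  proof (rule Liminf_le)
    show "\<forall>\<^sub>F n in sequentially. (\<integral>\<^sup>+x. ennreal (indicator B x * (A t u x - A (s (r n)) u x)\<^sup>2) \<partial>lborel)
        \<le> ennreal (R\<^sup>2 * t\<^sup>2 * (\<integral>y. (norm (g y))\<^sup>2 \<partial>lborel))"
    proof (intro always_eventually allI)
      fix n
      let ?s = "s (r n)"
      have "(\<integral>\<^sup>+x. ennreal (indicator B x * (A t u x - A ?s u x)\<^sup>2) \<partial>lborel) \<le> ennreal (R\<^sup>2 * (t - ?s)\<^sup>2 * (\<integral>y. (norm (g y))\<^sup>2 \<partial>lborel))"
        using s0[of "r n"] sub by (intro A_diff_L2[OF wp u _ _ B]) auto
      also have "\<dots> \<le> ennreal (R\<^sup>2 * t\<^sup>2 * (\<integral>y. (norm (g y))\<^sup>2 \<partial>lborel))"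
        using s0[of "r n"] by (intro ennreal_leI mult_right_mono mult_left_mono power_mono) auto
      finally show "(\<integral>\<^sup>+x. ennreal (indicator B x * (A t u x - A ?s u x)\<^sup>2) \<partial>lborel)
        \<le> ennreal (R\<^sup>2 * t\<^sup>2 * (\<integral>y. (norm (g y))\<^sup>2 \<partial>lborel))" .
    qed
  qed simp
  finally show ?thesis .
qed

end

section \<open>Compactness of the embedding of the first Sobolev space\<close>

lemma compact_closure_subset:
  fixes K :: "'a::t2_space set"
  assumes "compact K" "S \<subseteq> K"
  shows "compact (closure S)"
proof -
  have "closure S \<subseteq> K" using assms by (intro closure_minimal compact_imp_closed)
  then have "K \<inter> closure S = closure S" by blast
  then show ?thesis using compact_Int_closed[OF assms(1) closed_closure[of S]] by simp
qed

lemma sqint_indicator_bounded: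
  fixes f :: "'a::euclidean_space \<Rightarrow> real"
  assumes [measurable]: "f \<in> borel_measurable borel" "B \<in> sets borel" and fin: "emeasure lborel B < \<infinity>"
    and bd: "\<And>x. x \<in> B \<Longrightarrow> \<bar>f x\<bar> \<le> c"
  shows "sqint (\<lambda>x. indicator B x * f x)"
    "(\<integral>x. (norm (indicator B x * f x))\<^sup>2 \<partial>lborel) \<le> c\<^sup>2 * measure lborel B"
proof -
  have i: "integrable lborel (\<lambda>x. c\<^sup>2 * indicator B x)" using fin by (intro integrable_mult_right) simp
  have le: "(norm (indicator B x * f x))\<^sup>2 \<le> c\<^sup>2 * indicator B x" for x
    using bd[of x] power_mono[of "\<bar>f x\<bar>" c 2] by (auto simp: indicator_def)
  show s: "sqint (\<lambda>x. indicator B x * f x)" by (rule sqintI_bound[OF _ i le]) measurable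
  have "(\<integral>x. (norm (indicator B x * f x))\<^sup>2 \<partial>lborel) \<le> (\<integral>x. c\<^sup>2 * indicator B x \<partial>lborel)"
    by (rule integral_mono[OF sqint_integrable[OF s] i le])
  also have "\<dots> = c\<^sup>2 * measure lborel B" by simp
  finally show "(\<integral>x. (norm (indicator B x * f x))\<^sup>2 \<partial>lborel) \<le> c\<^sup>2 * measure lborel B" .
qed

context mollifier
begin

text \<open>At a fixed scale the kernel is bounded and uniformly continuous on bounded sets. An L^1
  bound on \<open>u\<close> thus makes the averages uniformly bounded and equicontinuous on a ball
  \<open>S\<close> containing the domain. Arzela-Ascoli gives uniform convergence, which is L^2
  convergence on the finite measure set \<open>B\<close>.\<close>

lemma A_precompact:
  assumes bd: "bounded \<Omega>" and B[measurable]: "B \<in> sets borel" and BO: "B \<subseteq> \<Omega>" and t: "t > 0"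
  shows "compact (closure {mk (\<lambda>x. indicator B x * A t u x) | u. integrable lborel u \<and>
      (\<integral>x. \<bar>u x\<bar> \<partial>lborel) \<le> M \<and> (\<forall>x. x \<notin> \<Omega> \<longrightarrow> u x = 0)})"
proof (rule compact_closure_sequentially)
  fix X :: "nat \<Rightarrow> ('a, real) l2"
  assume X: "X n \<in> {mk (\<lambda>x. indicator B x * A t u x) | u. integrable lborel u \<and>
      (\<integral>x. \<bar>u x\<bar> \<partial>lborel) \<le> M \<and> (\<forall>x. x \<notin> \<Omega> \<longrightarrow> u x = 0)}" for n
  then have "\<forall>n. \<exists>u. X n = mk (\<lambda>x. indicator B x * A t u x) \<and> integrable lborel u \<and>
      (\<integral>x. \<bar>u x\<bar> \<partial>lborel) \<le> M \<and> (\<forall>x. x \<notin> \<Omega> \<longrightarrow> u x = 0)" by blast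
  then obtain u where u: "\<And>n. X n = mk (\<lambda>x. indicator B x * A t (u n) x)" "\<And>n. integrable lborel (u n)"
    "\<And>n. (\<integral>x. \<bar>u n x\<bar> \<partial>lborel) \<le> M" "\<And>n x. x \<notin> \<Omega> \<Longrightarrow> u n x = 0" by metis
  have [measurable]: "u n \<in> borel_measurable borel" for n using borel_measurable_integrable[OF u(2)] by simp
  have M0: "M \<ge> 0" using u(3)[of 0] order_trans[of 0 "\<integral>x. \<bar>u 0 x\<bar> \<partial>lborel" M] by simp
  obtain \<rho> where \<rho>: "\<rho> > 0" "\<Omega> \<subseteq> cball 0 \<rho>"
    using bd unfolding bounded_pos by (auto simp: subset_iff)
  define S where "S = cball (0::'a) \<rho>"
  have S: "compact S" "\<Omega> \<subseteq> S" using \<rho> by (auto simp: S_def)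
  have Bf: "emeasure lborel B < \<infinity>" using bounded_subset[OF bd BO] by (rule emeasure_bounded_finite)
  obtain Mk where Mk: "Mk \<ge> 0" "\<And>h. k t h \<le> Mk" using k_bound[OF t] by blast
  have bdA: "\<bar>A t (u n) x\<bar> \<le> Mk * M" for n x
  proof -
    have "\<bar>A t (u n) x\<bar> \<le> (\<integral>y. \<bar>k t (y - x) * u n y\<bar> \<partial>lborel)"
      unfolding A_def using integral_norm_bound[of lborel "\<lambda>y. k t (y - x) * u n y"] by simp
    also have "\<dots> \<le> (\<integral>y. Mk * \<bar>u n y\<bar> \<partial>lborel)"
    proof (rule integral_mono)
      show "integrable lborel (\<lambda>y. \<bar>k t (y - x) * u n y\<bar>)"
        by (rule integrable_abs[OF k_mult_integrable[OF u(2) t]])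
      show "integrable lborel (\<lambda>y. Mk * \<bar>u n y\<bar>)" using u(2)[of n] by simp
      show "\<bar>k t (y - x) * u n y\<bar> \<le> Mk * \<bar>u n y\<bar>" for y
        using Mk(2)[of "y - x"] k_nonneg[OF t, of "y - x"] by (simp add: abs_mult mult_right_mono)
    qed
    also have "\<dots> \<le> Mk * M" using u(3)[of n] Mk(1) by (simp add: mult_left_mono)
    finally show ?thesis .
  qed
  have equi: "\<exists>d. 0 < d \<and> (\<forall>n y. y \<in> S \<and> norm (x - y) < d \<longrightarrow> norm (A t (u n) x - A t (u n) y) < e)"
    if x: "x \<in> S" and e: "e > 0" for x e
  proof -
    \<comment> \<open>Both \<open>w\<close> and \<open>x\<close> lie in the ball of radius
      \<open>\<rho>\<close>, so the arguments \<open>w - x\<close> lie in the one of radius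
      \<open>2 * \<rho>\<close>.\<close>
    have "uniformly_continuous_on (cball 0 (2 * \<rho>)) (k t)"
      by (intro compact_uniformly_continuous compact_cball continuous_on_subset[OF kcont[OF t]]) auto
    then obtain d where d: "d > 0" "\<And>a b. a \<in> cball 0 (2 * \<rho>) \<Longrightarrow> b \<in> cball 0 (2 * \<rho>) \<Longrightarrow> dist a b < d \<Longrightarrow> dist (k t a) (k t b) < e / (M + 1)"
      unfolding uniformly_continuous_on_def using e M0 by (metis add_nonneg_pos divide_pos_pos zero_less_one)
    have "norm (A t (u n) x - A t (u n) y) < e" if y: "y \<in> S" "norm (x - y) < d" for n y
    proof -
      note ki = k_mult_integrable[OF u(2) t]
      have le: "\<bar>k t (w - x) * u n w - k t (w - y) * u n w\<bar> \<le> e / (M + 1) * \<bar>u n w\<bar>" for w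
      proof (cases "w \<in> \<Omega>")
        case True
        have "norm (w - x) \<le> 2 * \<rho>" "norm (w - y) \<le> 2 * \<rho>"
          using True \<rho>(2) x y(1) norm_triangle_ineq4[of w x] norm_triangle_ineq4[of w y]
          by (auto simp: S_def subset_iff)
        moreover have "dist (w - x) (w - y) < d" using y(2) by (simp add: dist_norm norm_minus_commute)
        ultimately have "dist (k t (w - x)) (k t (w - y)) < e / (M + 1)" by (intro d(2)) auto
        then have "\<bar>k t (w - x) - k t (w - y)\<bar> * \<bar>u n w\<bar> \<le> e / (M + 1) * \<bar>u n w\<bar>"
          by (intro mult_right_mono) (auto simp: dist_real_def)
        then show ?thesis by (simp only: left_diff_distrib[symmetric] abs_mult)
      qed (simp add: u(4))
      have "A t (u n) x - A t (u n) y = (\<integral>w. k t (w - x) * u n w - k t (w - y) * u n w \<partial>lborel)"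
        unfolding A_def by (rule Bochner_Integration.integral_diff[symmetric]) (rule ki)+
      then have "norm (A t (u n) x - A t (u n) y) \<le> (\<integral>w. \<bar>k t (w - x) * u n w - k t (w - y) * u n w\<bar> \<partial>lborel)"
        using integral_norm_bound[of lborel "\<lambda>w. k t (w - x) * u n w - k t (w - y) * u n w"] by simp
      also have "\<dots> \<le> (\<integral>w. e / (M + 1) * \<bar>u n w\<bar> \<partial>lborel)"
        using ki u(2)[of n] le by (intro integral_mono) auto
      also have "\<dots> \<le> e / (M + 1) * M" using u(3)[of n] e M0 by (simp only: integral_mult_right_zero) (intro mult_left_mono, auto)
      also have "\<dots> < e" using e M0 by (simp add: field_simps)
      finally show ?thesis .
    qed
    with d(1) show ?thesis by blast
  qed
  obtain G r where G: "continuous_on S G" and r: "strict_mono (r :: nat \<Rightarrow> nat)"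
    and lim: "\<And>e. 0 < e \<Longrightarrow> \<exists>N. \<forall>n x. n \<ge> N \<and> x \<in> S \<longrightarrow> norm (A t (u (r n)) x - G x) < e"
    by (rule Arzela_Ascoli[OF S(1), of "\<lambda>n. A t (u n)" "Mk * M"]) (use bdA equi in auto)
  \<comment> \<open>The limit is continuous on \<open>S\<close> only; cutting it off makes it Borel
    on the whole space.\<close>
  define G' where "G' = (\<lambda>x. indicator S x *\<^sub>R G x)"
  have [measurable]: "G' \<in> borel_measurable borel" unfolding G'_def
    using compact_imp_closed[OF S(1)] by (intro borel_measurable_continuous_on_indicator G) auto
  have BS: "B \<subseteq> S" using BO S by blast
  have GG: "G' x = G x" if "x \<in> B" for x using that BS by (auto simp: G'_def)
  have bG: "bounded (G ` S)" using G S(1) compact_continuous_image compact_imp_bounded by blast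
  then obtain cG where cG: "\<And>x. x \<in> S \<Longrightarrow> \<bar>G x\<bar> \<le> cG" by (auto simp: bounded_iff)
  have sG: "sqint (\<lambda>x. indicator B x * G' x)"
    by (rule sqint_indicator_bounded[OF _ _ Bf, where c=cG]) (use GG BS cG in auto)
  have sA: "sqint (\<lambda>x. indicator B x * A t (u n) x)" for n
    by (rule sqint_indicator_bounded[OF _ _ Bf, where c="Mk * M"]) (use bdA in auto)
  have "(\<lambda>n. X (r n)) \<longlonglongrightarrow> mk (\<lambda>x. indicator B x * G' x)"
  proof (rule LIMSEQ_I)
    fix e :: real assume e: "e > 0"
    define q where "q = sqrt (measure lborel B)"
    define e' where "e' = e / (q + 1)"
    have sq: "q \<ge> 0" by (simp add: q_def)
    have e': "e' > 0" using e sq by (simp add: e'_def)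
    obtain N where N: "\<And>n x. n \<ge> N \<Longrightarrow> x \<in> S \<Longrightarrow> norm (A t (u (r n)) x - G x) < e'" using lim[OF e'] by blast
    have "norm (X (r n) - mk (\<lambda>x. indicator B x * G' x)) < e" if n: "n \<ge> N" for n
    proof -
      let ?D = "\<lambda>x. A t (u (r n)) x - G' x"
      have D: "\<bar>?D x\<bar> \<le> e'" if "x \<in> B" for x using N[OF n, of x] that BS GG[OF that] by auto
      have "X (r n) - mk (\<lambda>x. indicator B x * G' x) = mk (\<lambda>x. indicator B x * ?D x)"
        unfolding u(1) by (simp add: mk_diff[OF sA sG] right_diff_distrib)
      then have "(norm (X (r n) - mk (\<lambda>x. indicator B x * G' x)))\<^sup>2 \<le> e'\<^sup>2 * measure lborel B"
        using sqint_indicator_bounded[OF _ B Bf D] by (simp add: norm_mk)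
      also have "\<dots> = (e' * sqrt (measure lborel B))\<^sup>2" by (simp add: power_mult_distrib)
      finally have "norm (X (r n) - mk (\<lambda>x. indicator B x * G' x)) \<le> e' * sqrt (measure lborel B)"
        by (rule power2_le_imp_le) (use e' in simp)
      also have "\<dots> < e" using e sq unfolding q_def[symmetric] e'_def by (simp add: field_simps)
      finally show ?thesis .
    qed
    then show "\<exists>no. \<forall>n\<ge>no. norm (X (r n) - mk (\<lambda>x. indicator B x * G' x)) < e" by blast
  qed
  with r show "\<exists>l r. strict_mono (r::nat\<Rightarrow>nat) \<and> (\<lambda>n. X (r n)) \<longlonglongrightarrow> l" by blast
qed

end

definition h1_ball :: "'a::euclidean_space set \<Rightarrow> real \<Rightarrow> ('a \<Rightarrow> real) set" where
  "h1_ball \<Omega> K = {u. \<exists>g. weak_pair \<Omega> u g \<and> (\<integral>x. (norm (u x))\<^sup>2 \<partial>lborel) \<le> K \<and> (\<integral>x. (norm (g x))\<^sup>2 \<partial>lborel) \<le> K}"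

lemma h1_ball_sqint: "u \<in> h1_ball \<Omega> K \<Longrightarrow> sqint u"
  by (auto simp: h1_ball_def weak_pair_def)

lemma sqint_indicator_mult: "sqint (u::'a::euclidean_space \<Rightarrow> real) \<Longrightarrow> B \<in> sets borel \<Longrightarrow> sqint (\<lambda>x. indicator B x * u x)"
  using sqint_bounded_mult[of u "indicator B" 1] by (simp add: indicator_def)

text \<open>On \<open>B\<close> every \<open>u\<close> of the ball is within
  \<open>t * R * sqrt K'\<close> of its average at scale \<open>t\<close>, and for fixed
  \<open>t\<close> these averages form a relatively compact set.\<close>

lemma (in mollifier) rellich_local:
  assumes bd: "bounded \<Omega>" and O[measurable]: "\<Omega> \<in> sets borel"
    and B[measurable]: "B \<in> sets borel" and BO: "B \<subseteq> \<Omega>" and t0: "t0 > 0"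
    and sub: "\<And>x \<tau> z. x \<in> B \<Longrightarrow> 0 < \<tau> \<Longrightarrow> \<tau> \<le> t0 \<Longrightarrow> z \<in> C \<Longrightarrow> x + \<tau> *\<^sub>R z \<in> \<Omega>"
  shows "compact (closure ((\<lambda>u. mk (\<lambda>x. indicator B x * u x)) ` h1_ball \<Omega> K))"
proof (rule compact_closure_approx)
  fix e :: real assume e: "e > 0"
  define K' where "K' = max K 0"
  have K': "K' \<ge> 0" "K \<le> K'" by (auto simp: K'_def)
  \<comment> \<open>Chosen so that \<open>R * t * sqrt K'\<close> is at most \<open>t * q\<close>;
    the added 1 keeps \<open>q\<close> positive when \<open>K'\<close> is 0.\<close>
  define q where "q = R * (sqrt K' + 1)"
  have q: "q > 0" using Rpos K'(1) by (simp add: q_def add_nonneg_pos)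
  define t where "t = min t0 (e / q)"
  have t: "t > 0" "t \<le> t0" "t * q \<le> e" using t0 e q by (auto simp: t_def min_def field_simps)
  define T where "T = closure {mk (\<lambda>x. indicator B x * A t u x) | u. integrable lborel u \<and>
      (\<integral>x. \<bar>u x\<bar> \<partial>lborel) \<le> measure lborel \<Omega> + K' \<and> (\<forall>x. x \<notin> \<Omega> \<longrightarrow> u x = 0)}"
  have "compact T" unfolding T_def by (rule A_precompact[OF bd B BO t(1)])
  moreover have "\<exists>y\<in>T. dist (mk (\<lambda>x. indicator B x * u x)) y \<le> e" if uh: "u \<in> h1_ball \<Omega> K" for u
  proof -
    obtain g where g: "weak_pair \<Omega> u g" "(\<integral>x. (norm (u x))\<^sup>2 \<partial>lborel) \<le> K" "(\<integral>x. (norm (g x))\<^sup>2 \<partial>lborel) \<le> K"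
      using uh unfolding h1_ball_def by blast
    have us: "sqint u" and uz: "\<And>x. x \<notin> \<Omega> \<Longrightarrow> u x = 0" using g(1) by (auto simp: weak_pair_def)
    note [measurable] = sqint_measurable[OF us]
    note iu = sqint_integrable_bounded_support[OF us bd uz O]
    have sB: "sqint (\<lambda>x. indicator B x * u x)" by (rule sqint_indicator_mult[OF us B])
    have "(\<integral>\<^sup>+x. ennreal (indicator B x * (A t u x - u x)\<^sup>2) \<partial>lborel) \<le> ennreal (R\<^sup>2 * t\<^sup>2 * (\<integral>y. (norm (g y))\<^sup>2 \<partial>lborel))"
      using t(2) sub by (intro A_approx_L2[OF g(1) iu(1) t(1) B]) auto
    also have "\<dots> \<le> ennreal (R\<^sup>2 * t\<^sup>2 * K')" using g(3) K' by (intro ennreal_leI mult_left_mono) auto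
    finally have le: "(\<integral>\<^sup>+x. ennreal (indicator B x * (A t u x - u x)\<^sup>2) \<partial>lborel) \<le> ennreal (R\<^sup>2 * t\<^sup>2 * K')" .
    have nn: "(\<integral>\<^sup>+x. ennreal ((norm (indicator B x * (A t u x - u x)))\<^sup>2) \<partial>lborel) \<le> ennreal (R\<^sup>2 * t\<^sup>2 * K')"
    proof -
      have "(norm (indicator B x * d))\<^sup>2 = indicator B x * d\<^sup>2" for x and d :: real by (auto simp: indicator_def)
      then show ?thesis using le by simp
    qed
    have sD: "sqint (\<lambda>x. indicator B x * (A t u x - u x))"
      unfolding sqint_iff_nn_integral using nn by (auto simp: le_less_trans)
    have sA: "sqint (\<lambda>x. indicator B x * A t u x)"
      using sqint_add[OF sD sB] by (simp add: algebra_simps)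
    have "ennreal ((norm (mk (\<lambda>x. indicator B x * (A t u x - u x))))\<^sup>2) \<le> ennreal (R\<^sup>2 * t\<^sup>2 * K')"
      unfolding norm_mk[OF sD] using nn nn_integral_eq_integral[OF sqint_integrable[OF sD]] by simp
    then have "(norm (mk (\<lambda>x. indicator B x * (A t u x - u x))))\<^sup>2 \<le> R\<^sup>2 * t\<^sup>2 * K'"
      by (subst (asm) ennreal_le_iff) (use K' in auto)
    also have "\<dots> = (R * t * sqrt K')\<^sup>2" using K' by (simp add: power_mult_distrib)
    finally have "norm (mk (\<lambda>x. indicator B x * (A t u x - u x))) \<le> R * t * sqrt K'"
      by (rule power2_le_imp_le) (use Rpos t K' in auto)
    also have "\<dots> \<le> t * q" using Rpos t unfolding q_def by (simp add: algebra_simps)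
    also have "\<dots> \<le> e" by (rule t(3))
    finally have "dist (mk (\<lambda>x. indicator B x * A t u x)) (mk (\<lambda>x. indicator B x * u x)) \<le> e"
      unfolding dist_norm mk_diff[OF sA sB] by (simp add: right_diff_distrib)
    then have "dist (mk (\<lambda>x. indicator B x * u x)) (mk (\<lambda>x. indicator B x * A t u x)) \<le> e"
      by (simp add: dist_commute)
    moreover have "mk (\<lambda>x. indicator B x * A t u x) \<in> T"
      unfolding T_def
    proof (rule subsetD[OF closure_subset])
      have "(\<integral>x. \<bar>u x\<bar> \<partial>lborel) \<le> measure lborel \<Omega> + K'" using iu(2) g(2) K' by linarith
      then show "mk (\<lambda>x. indicator B x * A t u x) \<in> {mk (\<lambda>x. indicator B x * A t u x) | u. integrable lborel u \<and>
          (\<integral>x. \<bar>u x\<bar> \<partial>lborel) \<le> measure lborel \<Omega> + K' \<and> (\<forall>x. x \<notin> \<Omega> \<longrightarrow> u x = 0)}"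
        using iu(1) uz by blast
    qed
    ultimately show ?thesis by blast
  qed
  ultimately show "\<exists>T. compact T \<and> (\<forall>x\<in>(\<lambda>u. mk (\<lambda>x. indicator B x * u x)) ` h1_ball \<Omega> K. \<exists>y\<in>T. dist x y \<le> e)" by blast
qed

section \<open>Patching the local compactness statements\<close>

definition l2_mult :: "('a::euclidean_space \<Rightarrow> real) \<Rightarrow> ('a, 'b::euclidean_space) l2 \<Rightarrow> ('a, 'b) l2" where
  "l2_mult h f = mk (\<lambda>x. h x *\<^sub>R fn f x)"

lemma l2_mult_lipschitz:
  assumes h[measurable]: "h \<in> borel_measurable borel" and bd: "\<And>x. \<bar>h x\<bar> \<le> M"
  shows "norm (l2_mult h f - l2_mult h g) \<le> M * norm (f - g)"
proof -
  have s: "sqint (\<lambda>x. h x *\<^sub>R fn f x)" for f using sqint_bounded_mult[OF sqint_fn h bd] .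
  have M0: "M \<ge> 0" using bd[of undefined] by linarith
  have "(norm (l2_mult h f - l2_mult h g))\<^sup>2 = (\<integral>x. (norm (h x *\<^sub>R fn f x - h x *\<^sub>R fn g x))\<^sup>2 \<partial>lborel)"
    unfolding l2_mult_def mk_diff[OF s s] by (rule norm_mk[OF sqint_diff[OF s s]])
  also have "\<dots> \<le> (\<integral>x. M\<^sup>2 * (norm (fn (f - g) x))\<^sup>2 \<partial>lborel)"
  proof (rule integral_mono_AE)
    show "integrable lborel (\<lambda>x. (norm (h x *\<^sub>R fn f x - h x *\<^sub>R fn g x))\<^sup>2)" by (rule sqint_integrable[OF sqint_diff[OF s s]])
    show "integrable lborel (\<lambda>x. M\<^sup>2 * (norm (fn (f - g) x))\<^sup>2)" by (intro integrable_mult_right sqint_integrable sqint_fn)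
    show "AE x in lborel. (norm (h x *\<^sub>R fn f x - h x *\<^sub>R fn g x))\<^sup>2 \<le> M\<^sup>2 * (norm (fn (f - g) x))\<^sup>2"
      using fn_diff[of f g]
    proof eventually_elim
      case (elim x)
      have "norm (h x *\<^sub>R fn f x - h x *\<^sub>R fn g x) = \<bar>h x\<bar> * norm (fn (f - g) x)"
        unfolding elim by (simp flip: scaleR_diff_right)
      also have "\<dots> \<le> M * norm (fn (f - g) x)" by (intro mult_right_mono bd) simp
      finally have "(norm (h x *\<^sub>R fn f x - h x *\<^sub>R fn g x))\<^sup>2 \<le> (M * norm (fn (f - g) x))\<^sup>2" by (intro power_mono) auto
      then show ?case by (simp only: power_mult_distrib)
    qed
  qed
  also have "\<dots> = (M * norm (f - g))\<^sup>2" by (simp add: norm_fn power_mult_distrib)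
  finally show ?thesis by (rule power2_le_imp_le) (simp add: M0)
qed

lemma l2_mult_continuous:
  assumes "h \<in> borel_measurable borel" "\<And>x. \<bar>h x\<bar> \<le> M"
  shows "continuous_on S (l2_mult h)"
proof (rule lipschitz_on_continuous_on[of "\<bar>M\<bar>"], rule lipschitz_onI)
  fix f g :: "('a, 'b) l2"
  show "dist (l2_mult h f) (l2_mult h g) \<le> \<bar>M\<bar> * dist f g"
    unfolding dist_norm using l2_mult_lipschitz[OF assms, of f g]
    by (rule order_trans) (intro mult_right_mono, auto)
qed simp

text \<open>The indicator of the union is that of \<open>B1\<close> plus that of \<open>B2\<close>
  cut off outside \<open>B1\<close>. Cutting off is continuous on L^2, and sums of elements of two
  compact sets form a compact set.\<close>

lemma rellich_union:
  assumes B[measurable]: "B1 \<in> sets borel" "B2 \<in> sets borel"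
    and c: "compact (closure ((\<lambda>u. mk (\<lambda>x. indicator B1 x * u x)) ` h1_ball \<Omega> K))"
      "compact (closure ((\<lambda>u. mk (\<lambda>x. indicator B2 x * u x)) ` h1_ball \<Omega> K))"
  shows "compact (closure ((\<lambda>u. mk (\<lambda>x. indicator (B1 \<union> B2) x * u x)) ` h1_ball \<Omega> K))"
proof -
  let ?h = "indicator (- B1) :: 'a \<Rightarrow> real"
  let ?K1 = "closure ((\<lambda>u. mk (\<lambda>x. indicator B1 x * u x)) ` h1_ball \<Omega> K)"
  let ?K2 = "l2_mult ?h ` closure ((\<lambda>u. mk (\<lambda>x. indicator B2 x * u x)) ` h1_ball \<Omega> K)"
  have hm: "?h \<in> borel_measurable borel" using B by measurable
  have "compact ?K2" by (intro compact_continuous_image c l2_mult_continuous[OF hm, of 1]) (simp add: indicator_def)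
  then have "compact {x + y |x y. x \<in> ?K1 \<and> y \<in> ?K2}" by (intro compact_sums c)
  moreover have "(\<lambda>u. mk (\<lambda>x. indicator (B1 \<union> B2) x * u x)) ` h1_ball \<Omega> K \<subseteq> {x + y |x y. x \<in> ?K1 \<and> y \<in> ?K2}"
  proof (rule image_subsetI)
    fix u assume u: "u \<in> h1_ball \<Omega> K"
    note us = h1_ball_sqint[OF u]
    have s: "sqint (\<lambda>x. indicator B x * u x)" if "B \<in> sets borel" for B by (rule sqint_indicator_mult[OF us that])
    have s2: "sqint (\<lambda>x. ?h x *\<^sub>R fn (mk (\<lambda>x. indicator B2 x * u x)) x)"
      by (rule sqint_bounded_mult[OF sqint_fn hm, of 1]) (simp add: indicator_def)
    have "mk (\<lambda>x. indicator (B1 \<union> B2) x * u x) = mk (\<lambda>x. indicator B1 x * u x) + l2_mult ?h (mk (\<lambda>x. indicator B2 x * u x))"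
      unfolding l2_mult_def mk_add[OF s[OF B(1)] s2]
    proof (subst mk_eq_iff)
      show "sqint (\<lambda>x. indicator (B1 \<union> B2) x * u x)" using B by (intro s) auto
      show "sqint (\<lambda>x. indicator B1 x * u x + ?h x *\<^sub>R fn (mk (\<lambda>x. indicator B2 x * u x)) x)"
        by (rule sqint_add[OF s[OF B(1)] s2])
      show "AE x in lborel. indicator (B1 \<union> B2) x * u x = indicator B1 x * u x + ?h x *\<^sub>R fn (mk (\<lambda>x. indicator B2 x * u x)) x"
        using fn_mk[OF s[OF B(2)]] by eventually_elim (auto simp: indicator_def)
    qed
    moreover have "mk (\<lambda>x. indicator B1 x * u x) \<in> ?K1" by (intro subsetD[OF closure_subset] imageI u)
    moreover have "l2_mult ?h (mk (\<lambda>x. indicator B2 x * u x)) \<in> ?K2" by (intro subsetD[OF closure_subset] imageI u)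
    ultimately show "mk (\<lambda>x. indicator (B1 \<union> B2) x * u x) \<in> {x + y |x y. x \<in> ?K1 \<and> y \<in> ?K2}" by blast
  qed
  ultimately show ?thesis by (rule compact_closure_subset)
qed

text \<open>Each point of the compact closure has a ball on which a single cone works; finitely many
  of them are glued by \<open>rellich_union\<close>.\<close>

theorem rellich:
  fixes \<Omega> :: "'a::euclidean_space set"
  assumes dom: "smooth_bounded_domain \<Omega>"
  shows "compact (closure (mk ` h1_ball \<Omega> K))"
proof -
  have op: "open \<Omega>" and bd: "bounded \<Omega>" using dom by (auto simp: smooth_bounded_domain_def)
  have O[measurable]: "\<Omega> \<in> sets borel" using op by simp
  let ?Q = "\<lambda>B. compact (closure ((\<lambda>u. mk (\<lambda>x. indicator B x * u x)) ` h1_ball \<Omega> K))"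
  have loc: "\<exists>r>0. ?Q (ball p r \<inter> \<Omega>)" if p: "p \<in> closure \<Omega>" for p
  proof -
    obtain r t0 v \<kappa> where r: "r > 0" and t0: "t0 > 0" and \<kappa>: "\<kappa> > 0"
      and sub: "\<forall>x\<in>ball p r \<inter> \<Omega>. \<forall>t. 0 < t \<and> t \<le> t0 \<longrightarrow>
        (\<forall>z\<in>cbox (v - \<kappa> *\<^sub>R One) (v + \<kappa> *\<^sub>R One). x + t *\<^sub>R z \<in> \<Omega>)"
      using smooth_domain_cone[OF dom p] by (elim exE conjE) (rule that; assumption)
    define C where "C = cbox (v - \<kappa> *\<^sub>R One) (v + \<kappa> *\<^sub>R One)"
    obtain H H' where H: "flat_alg H" "\<And>z. (H has_derivative (\<lambda>h. \<Sum>i\<in>Basis. (h \<bullet> i) * H' i z)) (at z)"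
      "\<And>i. i \<in> Basis \<Longrightarrow> continuous_on UNIV (H' i)"
      "\<And>z. H z \<ge> 0" "\<And>z. z \<notin> C \<Longrightarrow> H z = 0" "\<And>z i. z \<notin> C \<Longrightarrow> i \<in> Basis \<Longrightarrow> H' i z = 0"
      "integrable lborel H" "(\<integral>z. H z \<partial>lborel) = 1"
      unfolding C_def by (rule bump_exists[OF \<kappa>, of v]) blast
    obtain R where R: "R > 0" "\<And>z. z \<in> C \<Longrightarrow> norm z \<le> R"
      using compact_imp_bounded[OF compact_cbox, of "v - \<kappa> *\<^sub>R One" "v + \<kappa> *\<^sub>R One"] unfolding bounded_pos C_def by blast
    interpret mollifier C H H' R
    proof
      show "compact C" unfolding C_def by (rule compact_cbox)
    qed (fact R H)+
    have "?Q (ball p r \<inter> \<Omega>)"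
    proof (rule rellich_local[OF bd O _ _ t0])
      show "x + \<tau> *\<^sub>R z \<in> \<Omega>" if "x \<in> ball p r \<inter> \<Omega>" "0 < \<tau>" "\<tau> \<le> t0" "z \<in> C" for x \<tau> z
        using sub that unfolding C_def by blast
    qed auto
    with r show ?thesis by blast
  qed
  then obtain r where r: "\<And>p. p \<in> closure \<Omega> \<Longrightarrow> r p > 0" "\<And>p. p \<in> closure \<Omega> \<Longrightarrow> ?Q (ball p (r p) \<inter> \<Omega>)" by metis
  have "compact (closure \<Omega>)" using bd by (simp add: compact_closure)
  then obtain P where P: "P \<subseteq> closure \<Omega>" "finite P" "closure \<Omega> \<subseteq> (\<Union>p\<in>P. ball p (r p))"
    by (rule compactE_image[of _ "closure \<Omega>" "\<lambda>p. ball p (r p)"]) (use r(1) in auto)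
  have "?Q (\<Union>p\<in>P'. ball p (r p) \<inter> \<Omega>)" if "finite P'" "P' \<subseteq> closure \<Omega>" for P'
    using that
  proof (induction rule: finite_induct)
    case empty
    have "finite ((\<lambda>u. mk (\<lambda>x. indicator {} x * u x)) ` h1_ball \<Omega> K)"
      by (rule finite_subset[of _ "{mk (\<lambda>_. 0)}"]) auto
    then show ?case by (simp add: finite_imp_compact closure_closed finite_imp_closed)
  next
    case (insert p P')
    have "?Q ((ball p (r p) \<inter> \<Omega>) \<union> (\<Union>p\<in>P'. ball p (r p) \<inter> \<Omega>))"
    proof (rule rellich_union)
      show "ball p (r p) \<inter> \<Omega> \<in> sets borel" by simp
      show "(\<Union>p\<in>P'. ball p (r p) \<inter> \<Omega>) \<in> sets borel"
        by (intro borel_open open_UN ballI open_Int op open_ball)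
      show "?Q (ball p (r p) \<inter> \<Omega>)" using insert.prems by (intro r(2)) auto
      show "?Q (\<Union>p\<in>P'. ball p (r p) \<inter> \<Omega>)" using insert.prems by (intro insert.IH) auto
    qed
    then show ?case by simp
  qed
  from this[OF P(2,1)] have "?Q (\<Union>p\<in>P. ball p (r p) \<inter> \<Omega>)" .
  moreover have "(\<Union>p\<in>P. ball p (r p) \<inter> \<Omega>) = \<Omega>" using P(3) closure_subset[of \<Omega>] by blast
  moreover have "(\<lambda>u. mk (\<lambda>x. indicator \<Omega> x * u x)) ` h1_ball \<Omega> K = mk ` h1_ball \<Omega> K"
  proof (rule image_cong[OF refl])
    fix u assume "u \<in> h1_ball \<Omega> K"
    then have "x \<notin> \<Omega> \<Longrightarrow> u x = 0" for x by (auto simp: h1_ball_def weak_pair_def)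
    then have "(\<lambda>x. indicator \<Omega> x * u x) = u" by (auto simp: fun_eq_iff indicator_def)
    then show "mk (\<lambda>x. indicator \<Omega> x * u x) = mk u" by simp
  qed
  ultimately show ?thesis by simp
qed

section \<open>Superposition operators\<close>

lemma l2_tail_single:
  fixes f :: "('a::euclidean_space, 'b::euclidean_space) l2"
  assumes e: "e > 0"
  shows "\<exists>n::nat. (\<integral>x. indicator {x. real n \<le> norm (fn f x)} x * (norm (fn f x))\<^sup>2 \<partial>lborel) \<le> e"
proof -
  have "(\<lambda>n. \<integral>x. indicator {x. real n \<le> norm (fn f x)} x * (norm (fn f x))\<^sup>2 \<partial>lborel) \<longlonglongrightarrow> (\<integral>x. 0 \<partial>(lborel :: 'a measure))"
  proof (rule integral_dominated_convergence[where w="\<lambda>x. (norm (fn f x))\<^sup>2"])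
    show "AE x in lborel. (\<lambda>n. indicator {x. real n \<le> norm (fn f x)} x * (norm (fn f x))\<^sup>2) \<longlonglongrightarrow> 0"
    proof (rule AE_I2)
      fix x
      obtain N :: nat where N: "norm (fn f x) < real N" using reals_Archimedean2 by blast
      have "\<forall>\<^sub>F n in sequentially. indicator {x. real n \<le> norm (fn f x)} x * (norm (fn f x))\<^sup>2 = 0"
        using eventually_ge_at_top[of N]
      proof eventually_elim
        case (elim n)
        then have "\<not> real n \<le> norm (fn f x)" using N by linarith
        then show ?case by simp
      qed
      then show "(\<lambda>n. indicator {x. real n \<le> norm (fn f x)} x * (norm (fn f x))\<^sup>2) \<longlonglongrightarrow> 0"
        by (rule tendsto_eventually)
    qed
    show "AE x in lborel. norm (indicator {x. real n \<le> norm (fn f x)} x * (norm (fn f x))\<^sup>2) \<le> (norm (fn f x))\<^sup>2" for n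
      by (intro AE_I2) (auto simp: indicator_def)
  qed (auto simp: sqint_integrable)
  then obtain n where "norm ((\<integral>x. indicator {x. real n \<le> norm (fn f x)} x * (norm (fn f x))\<^sup>2 \<partial>lborel) - 0) < e"
    using LIMSEQ_D[OF _ e] by force
  then show ?thesis by (intro exI[of _ n]) auto
qed

text \<open>Uniform integrability of the squares over a compact set. With \<open>g\<close> from a
  finite net close to \<open>f\<close>, at a point where |f| is at least \<open>A\<close> either |g|
  is at most half of |f|, and then |f| is at most 2 |f - g|, or |g| exceeds the threshold of
  \<open>g\<close> and |f| is below 2 |g|.\<close>

lemma l2_tail_compact:
  fixes Q :: "('a::euclidean_space, 'b::euclidean_space) l2 set"
  assumes Q: "compact Q" and e: "e > 0"
  shows "\<exists>A>0. \<forall>f\<in>Q. (\<integral>x. indicator {x. A \<le> norm (fn f x)} x * (norm (fn f x))\<^sup>2 \<partial>lborel) \<le> e"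
proof -
  \<comment> \<open>With \<open>d^2 = e / 8\<close> both \<open>4 * d^2\<close> and the four tails
    of size \<open>e / 8\<close> contribute \<open>e / 2\<close>.\<close>
  define d where "d = sqrt (e / 8)"
  have d: "d > 0" "d\<^sup>2 = e / 8" using e by (auto simp: d_def)
  obtain k where k: "finite k" "Q \<subseteq> (\<Union>g\<in>k. ball g d)"
    using Q d(1) unfolding compact_eq_totally_bounded by blast
  have "\<exists>n::nat. (\<integral>x. indicator {x. real n \<le> norm (fn g x)} x * (norm (fn g x))\<^sup>2 \<partial>lborel) \<le> e / 8" for g :: "('a, 'b) l2"
    using l2_tail_single[of "e/8" g] e by simp
  then obtain n :: "('a, 'b) l2 \<Rightarrow> nat" where n: "\<And>g. (\<integral>x. indicator {x. real (n g) \<le> norm (fn g x)} x * (norm (fn g x))\<^sup>2 \<partial>lborel) \<le> e / 8"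
    by metis
  \<comment> \<open>The sum dominates each \<open>n g\<close>; doubling it matches the case |g| >
    |f| / 2.\<close>
  define A where "A = 2 * real (\<Sum>g\<in>k. n g) + 1"
  have A: "A > 0" by (simp add: A_def add_nonneg_pos sum_nonneg)
  have "(\<integral>x. indicator {x. A \<le> norm (fn f x)} x * (norm (fn f x))\<^sup>2 \<partial>lborel) \<le> e" if fQ: "f \<in> Q" for f
  proof -
    obtain g where g: "g \<in> k" "dist g f < d" using k(2) fQ by auto
    have nA: "2 * real (n g) \<le> A"
    proof -
      have "n g \<le> sum n k" using member_le_sum[of g k n] g(1) k(1) by simp
      then have "real (n g) \<le> real (sum n k)" by (simp only: of_nat_le_iff)
      then show ?thesis unfolding A_def by linarith
    qed
    have i1: "integrable lborel (\<lambda>x. (norm (fn (f - g) x))\<^sup>2)" by (simp add: sqint_integrable)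
    have i2: "integrable lborel (\<lambda>x. indicator {x. real (n g) \<le> norm (fn g x)} x * (norm (fn g x))\<^sup>2)"
      by (rule Bochner_Integration.integrable_bound[OF sqint_integrable[OF sqint_fn[of g]]]) (auto simp: indicator_def)
    have i3: "integrable lborel (\<lambda>x. indicator {x. A \<le> norm (fn f x)} x * (norm (fn f x))\<^sup>2)"
      by (rule Bochner_Integration.integrable_bound[OF sqint_integrable[OF sqint_fn[of f]]]) (auto simp: indicator_def)
    have "(\<integral>x. indicator {x. A \<le> norm (fn f x)} x * (norm (fn f x))\<^sup>2 \<partial>lborel)
      \<le> (\<integral>x. 4 * (norm (fn (f - g) x))\<^sup>2 + 4 * (indicator {x. real (n g) \<le> norm (fn g x)} x * (norm (fn g x))\<^sup>2) \<partial>lborel)"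
    proof (rule integral_mono_AE[OF i3])
      show "integrable lborel (\<lambda>x. 4 * (norm (fn (f - g) x))\<^sup>2 + 4 * (indicator {x. real (n g) \<le> norm (fn g x)} x * (norm (fn g x))\<^sup>2))"
        using i1 i2 by simp
      show "AE x in lborel. indicator {x. A \<le> norm (fn f x)} x * (norm (fn f x))\<^sup>2
         \<le> 4 * (norm (fn (f - g) x))\<^sup>2 + 4 * (indicator {x. real (n g) \<le> norm (fn g x)} x * (norm (fn g x))\<^sup>2)"
        using fn_diff[of f g]
      proof eventually_elim
        case (elim x)
        show ?case
        proof (cases "A \<le> norm (fn f x)")
          case True
          show ?thesis
          proof (cases "2 * norm (fn g x) \<le> norm (fn f x)")
            case small: True
            have "norm (fn f x) \<le> norm (fn (f - g) x) + norm (fn g x)"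
              unfolding elim using norm_triangle_ineq[of "fn f x - fn g x" "fn g x"] by simp
            then have "norm (fn f x) \<le> 2 * norm (fn (f - g) x)" using small by linarith
            then have "(norm (fn f x))\<^sup>2 \<le> (2 * norm (fn (f - g) x))\<^sup>2" by (intro power_mono) auto
            then have "(norm (fn f x))\<^sup>2 \<le> 4 * (norm (fn (f - g) x))\<^sup>2" by (simp add: power_mult_distrib)
            then show ?thesis using True by (simp add: add_increasing2)
          next
            case False
            then have "real (n g) \<le> norm (fn g x)" using nA True by linarith
            moreover have "(norm (fn f x))\<^sup>2 \<le> (2 * norm (fn g x))\<^sup>2" using False by (intro power_mono) auto
            ultimately show ?thesis using True by (simp add: power_mult_distrib add_increasing)
          qed
        qed simp
      qed
    qed
    also have "\<dots> = 4 * (norm (f - g))\<^sup>2 + 4 * (\<integral>x. indicator {x. real (n g) \<le> norm (fn g x)} x * (norm (fn g x))\<^sup>2 \<partial>lborel)"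
      using i1 i2 by (simp add: norm_fn)
    also have "\<dots> \<le> 4 * d\<^sup>2 + 4 * (e / 8)"
    proof -
      have "(norm (f - g))\<^sup>2 \<le> d\<^sup>2" using g(2) by (intro power_mono) (auto simp: dist_norm norm_minus_commute)
      then show ?thesis using n[of g] by linarith
    qed
    also have "\<dots> = e" using d(2) by simp
    finally show ?thesis .
  qed
  with A show ?thesis by blast
qed

text \<open>\<open>N\<close> is the gradient of \<open>K\<close> on L^2. The assumption
  \<open>modulus\<close> stands in for a Lipschitz bound: the non-Lipschitz part of \<open>G\<close>
  is arbitrarily small relative to \<open>1 + norm q\<close>, which is what sublinear growth and
  continuity provide.\<close>

locale nemytskii =
  fixes Om :: "'a::euclidean_space set" and Phi :: "'a \<Rightarrow> 'b::euclidean_space \<Rightarrow> real" and G :: "'a \<Rightarrow> 'b \<Rightarrow> 'b"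
  assumes Om_meas [measurable]: "Om \<in> sets borel" and Om_fin: "emeasure lborel Om < \<infinity>"
    and G_meas: "\<And>f. f \<in> borel_measurable borel \<Longrightarrow> (\<lambda>x. G x (f x)) \<in> borel_measurable borel"
    and Phi_meas: "\<And>f. f \<in> borel_measurable borel \<Longrightarrow> (\<lambda>x. Phi x (f x)) \<in> borel_measurable borel"
    and G_out: "\<And>x p. x \<notin> Om \<Longrightarrow> G x p = 0" and Phi_out: "\<And>x p. x \<notin> Om \<Longrightarrow> Phi x p = 0"
    and G_zero: "\<And>x. G x 0 = 0"
    and Phi_deriv: "\<And>x p. (Phi x has_derivative (\<lambda>h. G x p \<bullet> h)) (at p)"
    and modulus: "\<And>e. e > 0 \<Longrightarrow> \<exists>C\<ge>0. \<forall>x p q. norm (G x p - G x q) \<le> e * (1 + norm q) + C * norm (p - q)"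
    and Phi_nonneg: "\<And>x p. Phi x p \<ge> 0"
    and Phi_small: "\<And>e. e > 0 \<Longrightarrow> \<exists>d>0. \<forall>x p. norm p \<le> d \<longrightarrow> Phi x p \<le> e * (norm p)\<^sup>2"
    and Phi_quad: "\<exists>C\<ge>0. \<forall>x p. Phi x p \<le> C * (norm p)\<^sup>2"
    and Phi_large: "\<And>e. e > 0 \<Longrightarrow> \<exists>C\<ge>0. \<forall>x p. Phi x p \<le> e * (norm p)\<^sup>2 + C"
begin

definition N :: "('a, 'b) l2 \<Rightarrow> ('a, 'b) l2" where "N f = mk (\<lambda>x. G x (fn f x))"
definition K :: "('a, 'b) l2 \<Rightarrow> real" where "K f = (\<integral>x. Phi x (fn f x) \<partial>lborel)"

text \<open>Outside \<open>Om\<close> the left side vanishes, so the first summand may be cut off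
  there. The constant in it would otherwise not be square-integrable over the whole space.\<close>

lemma modulus': "e > 0 \<Longrightarrow> \<exists>C\<ge>0. \<forall>x p q. norm (G x p - G x q) \<le> indicator Om x * (e * (1 + norm q)) + C * norm (p - q)"
proof -
  assume "e > 0"
  from modulus[OF this] obtain C where C: "C \<ge> 0" "\<And>x p q. norm (G x p - G x q) \<le> e * (1 + norm q) + C * norm (p - q)" by blast
  have "norm (G x p - G x q) \<le> indicator Om x * (e * (1 + norm q)) + C * norm (p - q)" for x p q
    using C(2)[of x p q] C(1) G_out[of x] by (cases "x \<in> Om") auto
  with C(1) show ?thesis by blast
qed

lemma sqint_weight:
  assumes f: "sqint (f :: 'a \<Rightarrow> 'b)"
  shows "sqint (\<lambda>x. indicator Om x * (1 + norm (f x)))"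
    "(\<integral>x. (norm (indicator Om x * (1 + norm (f x))))\<^sup>2 \<partial>lborel) \<le> 2 * measure lborel Om + 2 * (\<integral>x. (norm (f x))\<^sup>2 \<partial>lborel)"
proof -
  note [measurable] = sqint_measurable[OF f]
  have i: "integrable lborel (\<lambda>x. 2 * indicator Om x + 2 * (norm (f x))\<^sup>2)"
    using Om_fin sqint_integrable[OF f] by (intro Bochner_Integration.integrable_add integrable_mult_right) auto
  have le: "(norm (indicator Om x * (1 + norm (f x))))\<^sup>2 \<le> 2 * indicator Om x + 2 * (norm (f x))\<^sup>2" for x
    using norm_sum_sq_le[of 1 "norm (f x)"] by (auto simp: indicator_def)
  show s: "sqint (\<lambda>x. indicator Om x * (1 + norm (f x)))" by (rule sqintI_bound[OF _ i le]) measurable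
  have "(\<integral>x. (norm (indicator Om x * (1 + norm (f x))))\<^sup>2 \<partial>lborel) \<le> (\<integral>x. 2 * indicator Om x + 2 * (norm (f x))\<^sup>2 \<partial>lborel)"
    by (rule integral_mono[OF sqint_integrable[OF s] i le])
  also have "\<dots> = 2 * measure lborel Om + 2 * (\<integral>x. (norm (f x))\<^sup>2 \<partial>lborel)"
    using Om_fin sqint_integrable[OF f] by (subst Bochner_Integration.integral_add) auto
  finally show "(\<integral>x. (norm (indicator Om x * (1 + norm (f x))))\<^sup>2 \<partial>lborel) \<le> 2 * measure lborel Om + 2 * (\<integral>x. (norm (f x))\<^sup>2 \<partial>lborel)" .
qed

lemma sqint_G: assumes f: "sqint f" shows "sqint (\<lambda>x. G x (f x))"
proof -
  obtain C where C: "C \<ge> 0" "\<And>x p q. norm (G x p - G x q) \<le> indicator Om x * (1 * (1 + norm q)) + C * norm (p - q)"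
    using modulus'[of 1] by auto
  have le: "norm (G x (f x)) \<le> indicator Om x * (1 + norm (f x)) + C * norm (f x)" for x
  proof -
    have "norm (G x (f x)) \<le> indicator Om x + C * norm (f x)" using C(2)[of x "f x" 0] by (simp add: G_zero)
    moreover have "indicator Om x \<le> indicator Om x * (1 + norm (f x))" by (simp add: indicator_def)
    ultimately show ?thesis by linarith
  qed
  have s: "sqint (\<lambda>x. indicator Om x * (1 + norm (f x)) + C * norm (f x))"
  proof (rule sqint_add[OF sqint_weight(1)[OF f]])
    have "sqint (\<lambda>x. norm (f x))" using f by (intro sqint_norm_le[OF f]) (auto dest: sqint_measurable)
    from sqint_scaleR[OF this, of C] show "sqint (\<lambda>x. C * norm (f x))" by simp
  qed
  show ?thesis
    by (rule sqint_norm_le[OF s G_meas[OF sqint_measurable[OF f]]]) (rule order_trans[OF le], simp)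
qed

lemma Phi_integrable: assumes f: "sqint f" shows "integrable lborel (\<lambda>x. Phi x (f x))"
proof -
  obtain C where C: "C \<ge> 0" "\<And>x p. Phi x p \<le> C * (norm p)\<^sup>2" using Phi_quad by blast
  show ?thesis
  proof (rule Bochner_Integration.integrable_bound)
    show "integrable lborel (\<lambda>x. C * (norm (f x))\<^sup>2)" using sqint_integrable[OF f] by simp
    show "AE x in lborel. norm (Phi x (f x)) \<le> norm (C * (norm (f x))\<^sup>2)"
      using C Phi_nonneg by (intro AE_I2) simp
    show "(\<lambda>x. Phi x (f x)) \<in> borel_measurable lborel" using Phi_meas[OF sqint_measurable[OF f]] by simp
  qed
qed

lemma K_mk: assumes f: "sqint f" shows "K (mk f) = (\<integral>x. Phi x (f x) \<partial>lborel)"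
  unfolding K_def
proof (rule integral_cong_AE)
  show "AE x in lborel. Phi x (fn (mk f) x) = Phi x (f x)" using fn_mk[OF f] by eventually_elim simp
qed (use Phi_meas[OF sqint_measurable[OF f]] Phi_meas[OF fn_measurable] in auto)

lemma N_mk: assumes f: "sqint f" shows "N (mk f) = mk (\<lambda>x. G x (f x))"
  unfolding N_def
proof (subst mk_eq_iff[OF sqint_G[OF sqint_fn] sqint_G[OF f]])
  show "AE x in lborel. G x (fn (mk f) x) = G x (f x)" using fn_mk[OF f] by eventually_elim simp
qed

text \<open>The mean value inequality for \<open>Phi x y - G x q \<bullet> y\<close> on the segment
  from \<open>q\<close> to \<open>p\<close>: its gradient at \<open>y\<close> is
  \<open>G x y - G x q\<close>, and |y - q| is at most |p - q|.\<close>

lemma taylor: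
  assumes e: "e \<ge> 0" and C: "C \<ge> 0" "\<And>p q. norm (G x p - G x q) \<le> e * (1 + norm q) + C * norm (p - q)"
  shows "\<bar>Phi x p - Phi x q - G x q \<bullet> (p - q)\<bar> \<le> (e * (1 + norm q) + C * norm (p - q)) * norm (p - q)"
proof -
  define B where "B = e * (1 + norm q) + C * norm (p - q)"
  have "norm ((Phi x p - G x q \<bullet> p) - (Phi x q - G x q \<bullet> q)) \<le> B * norm (p - q)"
  proof (rule differentiable_bound[where S="closed_segment q p" and f'="\<lambda>y h. G x y \<bullet> h - G x q \<bullet> h"])
    fix y assume y: "y \<in> closed_segment q p"
    show "((\<lambda>y. Phi x y - G x q \<bullet> y) has_derivative (\<lambda>h. G x y \<bullet> h - G x q \<bullet> h)) (at y within closed_segment q p)"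
      by (intro has_derivative_diff has_derivative_at_withinI[OF Phi_deriv] has_derivative_inner_right has_derivative_ident)
    show "onorm (\<lambda>h. G x y \<bullet> h - G x q \<bullet> h) \<le> B"
    proof (rule onorm_bound)
      show "0 \<le> B" using e C by (simp add: B_def)
      fix h :: 'b
      have "norm (y - q) \<le> norm (p - q)" using y by (metis dist_commute dist_norm segment_bound1 norm_minus_commute)
      then have "norm (G x y - G x q) \<le> B"
        unfolding B_def using C(2)[of y q] mult_left_mono[OF _ C(1)] by fastforce
      then have "norm (G x y - G x q) * norm h \<le> B * norm h" by (rule mult_right_mono) simp
      then show "norm (G x y \<bullet> h - G x q \<bullet> h) \<le> B * norm h"
        using Cauchy_Schwarz_ineq2[of "G x y - G x q" h] by (simp add: inner_diff_left)
    qed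
  qed auto
  moreover have "(Phi x p - G x q \<bullet> p) - (Phi x q - G x q \<bullet> q) = Phi x p - Phi x q - G x q \<bullet> (p - q)"
    by (simp add: inner_diff_right)
  ultimately show ?thesis by (simp add: B_def)
qed

lemma K_expansion:
  assumes e: "e > 0"
  shows "\<exists>C\<ge>0. \<forall>f f'. norm f \<le> R \<longrightarrow>
    \<bar>K f' - K f - inner (N f) (f' - f)\<bar> \<le> e * norm (f' - f) + C * (norm (f' - f))\<^sup>2"
proof -
  \<comment> \<open>Bounds the L^2 norm of the weight \<open>w\<close> for all \<open>f\<close> of
    norm at most \<open>R\<close>. After Cauchy-Schwarz the linear error is
    \<open>e0 * q = e\<close>; the added 1 makes the division safe.\<close>
  define q where "q = sqrt (2 * measure lborel Om + 2 * R\<^sup>2) + 1"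
  have q: "q > 0" "q \<ge> sqrt (2 * measure lborel Om + 2 * R\<^sup>2)" by (auto simp: q_def add_nonneg_pos)
  define e0 where "e0 = e / q"
  have e0: "e0 > 0" using e q by (simp add: e0_def)
  obtain C where C: "C \<ge> 0" "\<And>x p p'. norm (G x p - G x p') \<le> indicator Om x * (e0 * (1 + norm p')) + C * norm (p - p')"
    using modulus'[OF e0] by blast
  have "\<bar>K f' - K f - inner (N f) (f' - f)\<bar> \<le> e * norm (f' - f) + C * (norm (f' - f))\<^sup>2" if f: "norm f \<le> R" for f f'
  proof -
    define D where "D = (\<lambda>x. fn f' x - fn f x)"
    have sD: "sqint D" unfolding D_def by (intro sqint_diff sqint_fn)
    note [measurable] = sqint_measurable[OF sD]
    have nD: "(\<integral>x. (norm (D x))\<^sup>2 \<partial>lborel) = (norm (f' - f))\<^sup>2"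
      using norm_mk[OF sD] mk_diff[OF sqint_fn[of f'] sqint_fn[of f]] by (simp add: D_def)
    have snD: "sqint (\<lambda>x. norm (D x))" by (rule sqint_norm_le[OF sD]) auto
    have nnD: "norm (mk (\<lambda>x. norm (D x))) = norm (f' - f)"
      using norm_mk[OF snD] nD by (simp add: power2_eq_iff_nonneg)
    define w where "w = (\<lambda>x. indicator Om x * (1 + norm (fn f x)))"
    have sw: "sqint w" unfolding w_def by (rule sqint_weight[OF sqint_fn])
    have nw: "(norm (mk w))\<^sup>2 \<le> 2 * measure lborel Om + 2 * (norm f)\<^sup>2"
      unfolding norm_mk[OF sw] norm_fn[of f] unfolding w_def by (rule sqint_weight[OF sqint_fn])
    have "(norm f)\<^sup>2 \<le> R\<^sup>2" using f by (intro power_mono) auto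
    then have "norm (mk w) \<le> sqrt (2 * measure lborel Om + 2 * R\<^sup>2)" using nw by (intro real_le_rsqrt) linarith
    then have nwq: "norm (mk w) \<le> q" using q by linarith
    have iw: "integrable lborel (\<lambda>x. w x * norm (D x))" using sqint_inner[OF sw snD] by simp
    have iD: "integrable lborel (\<lambda>x. (norm (D x))\<^sup>2)" by (rule sqint_integrable[OF sD])
    have i1: "integrable lborel (\<lambda>x. Phi x (fn f' x))" "integrable lborel (\<lambda>x. Phi x (fn f x))"
      by (auto intro: Phi_integrable)
    have i2: "integrable lborel (\<lambda>x. G x (fn f x) \<bullet> D x)" by (rule sqint_inner[OF sqint_G[OF sqint_fn] sD])
    have "inner (N f) (f' - f) = (\<integral>x. G x (fn f x) \<bullet> D x \<partial>lborel)"
      using inner_mk[OF sqint_G[OF sqint_fn[of f]] sD] mk_diff[OF sqint_fn[of f'] sqint_fn[of f]]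
      by (simp add: N_def D_def)
    then have "K f' - K f - inner (N f) (f' - f) = (\<integral>x. Phi x (fn f' x) - Phi x (fn f x) - G x (fn f x) \<bullet> D x \<partial>lborel)"
      using i1 i2 by (simp add: K_def)
    then have "\<bar>K f' - K f - inner (N f) (f' - f)\<bar> \<le> (\<integral>x. \<bar>Phi x (fn f' x) - Phi x (fn f x) - G x (fn f x) \<bullet> D x\<bar> \<partial>lborel)"
      using integral_norm_bound[of lborel "\<lambda>x. Phi x (fn f' x) - Phi x (fn f x) - G x (fn f x) \<bullet> D x"] by simp
    also have "\<dots> \<le> (\<integral>x. e0 * (w x * norm (D x)) + C * (norm (D x))\<^sup>2 \<partial>lborel)"
    proof (rule integral_mono)
      show "integrable lborel (\<lambda>x. \<bar>Phi x (fn f' x) - Phi x (fn f x) - G x (fn f x) \<bullet> D x\<bar>)" using i1 i2 by simp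
      show "integrable lborel (\<lambda>x. e0 * (w x * norm (D x)) + C * (norm (D x))\<^sup>2)" using iw iD by simp
      fix x
      have "\<bar>Phi x (fn f' x) - Phi x (fn f x) - G x (fn f x) \<bullet> (fn f' x - fn f x)\<bar>
        \<le> (indicator Om x * e0 * (1 + norm (fn f x)) + C * norm (fn f' x - fn f x)) * norm (fn f' x - fn f x)"
        using C e0 by (intro taylor) (auto simp: mult.assoc)
      then show "\<bar>Phi x (fn f' x) - Phi x (fn f x) - G x (fn f x) \<bullet> D x\<bar> \<le> e0 * (w x * norm (D x)) + C * (norm (D x))\<^sup>2"
        unfolding D_def w_def by (simp add: algebra_simps power2_eq_square)
    qed
    also have "\<dots> = e0 * inner (mk w) (mk (\<lambda>x. norm (D x))) + C * (norm (f' - f))\<^sup>2"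
      using iw iD nD by (simp add: inner_mk[OF sw snD])
    also have "\<dots> \<le> e0 * (norm (mk w) * norm (f' - f)) + C * (norm (f' - f))\<^sup>2"
      using norm_cauchy_schwarz[of "mk w" "mk (\<lambda>x. norm (D x))"] e0 nnD by simp
    also have "e0 * (norm (mk w) * norm (f' - f)) \<le> e0 * (q * norm (f' - f))"
      using e0 nwq by (intro mult_left_mono mult_right_mono) auto
    also have "e0 * (q * norm (f' - f)) = e * norm (f' - f)" using q by (simp add: e0_def)
    finally show ?thesis by simp
  qed
  with C(1) show ?thesis by blast
qed

lemma N_diff_bound:
  assumes e0: "e0 > 0"
  shows "\<exists>C\<ge>0. \<forall>f f'. (norm (N f' - N f))\<^sup>2 \<le> 4 * e0\<^sup>2 * (measure lborel Om + (norm f)\<^sup>2) + 2 * C\<^sup>2 * (norm (f' - f))\<^sup>2"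
proof -
  obtain C where C: "C \<ge> 0" "\<And>x p p'. norm (G x p - G x p') \<le> indicator Om x * (e0 * (1 + norm p')) + C * norm (p - p')"
    using modulus'[OF e0] by blast
  have "(norm (N f' - N f))\<^sup>2 \<le> 4 * e0\<^sup>2 * (measure lborel Om + (norm f)\<^sup>2) + 2 * C\<^sup>2 * (norm (f' - f))\<^sup>2" for f f'
  proof -
    have sD: "sqint (\<lambda>x. fn f' x - fn f x)" by (intro sqint_diff sqint_fn)
    have nD: "(\<integral>x. (norm (fn f' x - fn f x))\<^sup>2 \<partial>lborel) = (norm (f' - f))\<^sup>2"
      using norm_mk[OF sD] mk_diff[OF sqint_fn[of f'] sqint_fn[of f]] by simp
    define w where "w = (\<lambda>x. indicator Om x * (1 + norm (fn f x)))"
    have sw: "sqint w" and nw: "(\<integral>x. (norm (w x))\<^sup>2 \<partial>lborel) \<le> 2 * measure lborel Om + 2 * (norm f)\<^sup>2"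
      unfolding w_def using sqint_weight[OF sqint_fn[of f]] by (auto simp: norm_fn)
    have sG: "sqint (\<lambda>x. G x (fn f' x) - G x (fn f x))" by (intro sqint_diff sqint_G sqint_fn)
    have iw: "integrable lborel (\<lambda>x. (norm (w x))\<^sup>2)" and iD: "integrable lborel (\<lambda>x. (norm (fn f' x - fn f x))\<^sup>2)"
      by (auto intro: sqint_integrable sw sD simp del: real_norm_def)
    have "(norm (N f' - N f))\<^sup>2 = (\<integral>x. (norm (G x (fn f' x) - G x (fn f x)))\<^sup>2 \<partial>lborel)"
      unfolding N_def mk_diff[OF sqint_G[OF sqint_fn] sqint_G[OF sqint_fn]] by (rule norm_mk[OF sG])
    also have "\<dots> \<le> (\<integral>x. 2 * e0\<^sup>2 * (norm (w x))\<^sup>2 + 2 * C\<^sup>2 * (norm (fn f' x - fn f x))\<^sup>2 \<partial>lborel)"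
    proof (rule integral_mono[OF sqint_integrable[OF sG]])
      show "integrable lborel (\<lambda>x. 2 * e0\<^sup>2 * (norm (w x))\<^sup>2 + 2 * C\<^sup>2 * (norm (fn f' x - fn f x))\<^sup>2)"
        by (intro Bochner_Integration.integrable_add integrable_mult_right iw iD)
      fix x
      have "norm (G x (fn f' x) - G x (fn f x)) \<le> e0 * w x + C * norm (fn f' x - fn f x)"
        using C(2)[of x "fn f' x" "fn f x"] by (simp add: w_def mult_ac)
      then have "(norm (G x (fn f' x) - G x (fn f x)))\<^sup>2 \<le> (e0 * w x + C * norm (fn f' x - fn f x))\<^sup>2"
        by (intro power_mono) auto
      also have "\<dots> \<le> 2 * (e0 * w x)\<^sup>2 + 2 * (C * norm (fn f' x - fn f x))\<^sup>2"
        using norm_sum_sq_le[of "e0 * w x" "C * norm (fn f' x - fn f x)"] by simp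
      finally show "(norm (G x (fn f' x) - G x (fn f x)))\<^sup>2 \<le> 2 * e0\<^sup>2 * (norm (w x))\<^sup>2 + 2 * C\<^sup>2 * (norm (fn f' x - fn f x))\<^sup>2"
        by (simp add: power_mult_distrib)
    qed
    also have "\<dots> = 2 * e0\<^sup>2 * (\<integral>x. (norm (w x))\<^sup>2 \<partial>lborel) + 2 * C\<^sup>2 * (norm (f' - f))\<^sup>2"
      using iw iD nD by (subst Bochner_Integration.integral_add) (auto simp del: real_norm_def)
    also have "2 * e0\<^sup>2 * (\<integral>x. (norm (w x))\<^sup>2 \<partial>lborel) \<le> 2 * e0\<^sup>2 * (2 * measure lborel Om + 2 * (norm f)\<^sup>2)"
      by (intro mult_left_mono nw) simp
    finally show ?thesis by (simp add: algebra_simps)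
  qed
  with C(1) show ?thesis by blast
qed

lemma N_continuous: "continuous_on UNIV N"
  unfolding continuous_on_iff
proof (intro ballI allI impI)
  fix f :: "('a, 'b) l2" and e :: real assume e: "e > 0"
  define q where "q = measure lborel Om + (norm f)\<^sup>2 + 1"
  have q: "q > 0" by (simp add: q_def add_nonneg_pos)
  \<comment> \<open>With this \<open>e0\<close> the first summand of \<open>N_diff_bound\<close>
    stays strictly below \<open>e^2 / 2\<close>; the radius \<open>d\<close> below limits the second
    one to \<open>e^2 / 2\<close>.\<close>
  define e0 where "e0 = e / sqrt (8 * q)"
  have e0: "e0 > 0" "e0\<^sup>2 = e\<^sup>2 / (8 * q)" using e q by (auto simp: e0_def power_divide)
  obtain C where C: "C \<ge> 0" "\<And>f f'. (norm (N f' - N f))\<^sup>2 \<le> 4 * e0\<^sup>2 * (measure lborel Om + (norm f)\<^sup>2) + 2 * C\<^sup>2 * (norm (f' - f))\<^sup>2"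
    using N_diff_bound[OF e0(1)] by blast
  define d where "d = e / (2 * C + 1)"
  have d: "d > 0" using e C by (simp add: d_def)
  have "dist (N f') (N f) < e" if "dist f' f < d" for f'
  proof -
    have "(norm (f' - f))\<^sup>2 \<le> d\<^sup>2" using that by (intro power_mono) (auto simp: dist_norm)
    then have 1: "2 * C\<^sup>2 * (norm (f' - f))\<^sup>2 \<le> 2 * C\<^sup>2 * d\<^sup>2" by (intro mult_left_mono) auto
    have "C * d \<le> e / 2" using e C by (simp add: d_def field_simps)
    then have "(C * d)\<^sup>2 \<le> (e/2)\<^sup>2" using C d by (intro power_mono) auto
    then have 2: "2 * C\<^sup>2 * d\<^sup>2 \<le> e\<^sup>2 / 2" by (simp add: power_mult_distrib power_divide)
    have "4 * e0\<^sup>2 * (measure lborel Om + (norm f)\<^sup>2) < 4 * e0\<^sup>2 * q"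
      using e0(1) by (intro mult_strict_left_mono) (auto simp: q_def)
    also have "\<dots> = e\<^sup>2 / 2" using q by (simp add: e0(2))
    finally have "(norm (N f' - N f))\<^sup>2 < e\<^sup>2" using C(2)[of f' f] 1 2 by linarith
    then show ?thesis using e by (simp add: dist_norm power2_less_imp_less)
  qed
  with d show "\<exists>d>0. \<forall>f'\<in>UNIV. dist f' f < d \<longrightarrow> dist (N f') (N f) < e" by blast
qed

lemma K_nonneg: "K f \<ge> 0" unfolding K_def using Phi_nonneg by simp

lemma Phi_zero: "Phi x 0 = 0"
  using Phi_quad Phi_nonneg[of x 0] by (metis antisym mult_zero_right norm_zero power_zero_numeral)

lemma K_zero: "K 0 = 0"
  unfolding zero_l2_def K_mk[OF sqint_0] by (simp add: Phi_zero)

lemma N_zero: "N 0 = 0"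
  unfolding zero_l2_def N_mk[OF sqint_0] by (simp add: G_zero)

lemma K_coercive:
  assumes e: "e > 0"
  shows "\<exists>C. \<forall>f. K f \<le> e * (norm f)\<^sup>2 + C"
proof -
  obtain C where C: "C \<ge> 0" "\<And>x p. Phi x p \<le> e * (norm p)\<^sup>2 + C" using Phi_large[OF e] by blast
  have "K f \<le> e * (norm f)\<^sup>2 + C * measure lborel Om" for f
  proof -
    have i: "integrable lborel (\<lambda>x. C * indicator Om x)" using Om_fin by (intro integrable_mult_right) auto
    have "K f \<le> (\<integral>x. e * (norm (fn f x))\<^sup>2 + C * indicator Om x \<partial>lborel)"
      unfolding K_def
    proof (rule integral_mono[OF Phi_integrable[OF sqint_fn]])
      show "integrable lborel (\<lambda>x. e * (norm (fn f x))\<^sup>2 + C * indicator Om x)"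
        by (intro Bochner_Integration.integrable_add[OF _ i] integrable_mult_right sqint_integrable sqint_fn)
      show "Phi x (fn f x) \<le> e * (norm (fn f x))\<^sup>2 + C * indicator Om x" for x
        using C(2)[of x "fn f x"] Phi_out[of x] e by (cases "x \<in> Om") auto
    qed
    also have "\<dots> = e * (norm f)\<^sup>2 + C * measure lborel Om"
      using Om_fin by (subst Bochner_Integration.integral_add[OF _ i]) (auto simp: norm_fn sqint_integrable)
    finally show ?thesis .
  qed
  then show ?thesis by blast
qed

text \<open>\<open>K\<close> is o(r^2) along rays, uniformly over a compact set of directions. Where
  |r f| is at most \<open>d\<close> the density is small relative to its square. Elsewhere |f| is at
  least \<open>A\<close>, and only the quadratic bound is used, but the squares carry little mass
  there by uniform integrability.\<close>

lemma K_small: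
  assumes Q: "compact Q" and e: "e > 0"
  shows "\<exists>r0>0. \<forall>f\<in>Q. \<forall>r. 0 \<le> r \<and> r \<le> r0 \<longrightarrow> K (r *\<^sub>R f) \<le> e * r\<^sup>2"
proof -
  obtain C where C: "C \<ge> 0" "\<And>x p. Phi x p \<le> C * (norm p)\<^sup>2" using Phi_quad by blast
  obtain b where b: "\<And>f. f \<in> Q \<Longrightarrow> norm f \<le> b" using compact_imp_bounded[OF Q] by (auto simp: bounded_iff)
  define e1 where "e1 = e / (2 * (b\<^sup>2 + 1))"
  have b1: "b\<^sup>2 + 1 > 0" by (simp add: add_nonneg_pos)
  have e1: "e1 > 0" "e1 * b\<^sup>2 \<le> e / 2" using e b1 by (auto simp: e1_def field_simps)
  define e2 where "e2 = e / (2 * (C + 1))"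
  have e2: "e2 > 0" "C * e2 \<le> e / 2" using e C(1) by (auto simp: e2_def field_simps)
  obtain d where d: "d > 0" "\<And>x p. norm p \<le> d \<Longrightarrow> Phi x p \<le> e1 * (norm p)\<^sup>2" using Phi_small[OF e1(1)] by blast
  obtain A where A: "A > 0" "\<And>f. f \<in> Q \<Longrightarrow> (\<integral>x. indicator {x. A \<le> norm (fn f x)} x * (norm (fn f x))\<^sup>2 \<partial>lborel) \<le> e2"
    using l2_tail_compact[OF Q e2(1)] by blast
  \<comment> \<open>For \<open>r \<le> r0\<close> a value of \<open>r * f\<close> beyond
    \<open>d\<close> forces the value of \<open>f\<close> to be at least \<open>A\<close>.\<close>
  define r0 where "r0 = d / A"
  have r0: "r0 > 0" using d A by (simp add: r0_def)
  have "K (r *\<^sub>R f) \<le> e * r\<^sup>2" if f: "f \<in> Q" and r: "0 \<le> r" "r \<le> r0" for f r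
  proof -
    let ?t = "\<lambda>x. indicator {x. A \<le> norm (fn f x)} x * (norm (fn f x))\<^sup>2"
    have it: "integrable lborel ?t"
      by (rule Bochner_Integration.integrable_bound[OF sqint_integrable[OF sqint_fn[of f]]]) (auto simp: indicator_def)
    have "K (r *\<^sub>R f) = (\<integral>x. Phi x (r *\<^sub>R fn f x) \<partial>lborel)"
      unfolding scaleR_l2_def by (rule K_mk[OF sqint_scaleR[OF sqint_fn]])
    also have "\<dots> \<le> (\<integral>x. r\<^sup>2 * e1 * (norm (fn f x))\<^sup>2 + r\<^sup>2 * C * ?t x \<partial>lborel)"
    proof (rule integral_mono[OF Phi_integrable[OF sqint_scaleR[OF sqint_fn]]])
      show "integrable lborel (\<lambda>x. r\<^sup>2 * e1 * (norm (fn f x))\<^sup>2 + r\<^sup>2 * C * ?t x)"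
        by (intro Bochner_Integration.integrable_add integrable_mult_right it sqint_integrable sqint_fn)
      fix x
      have n: "(norm (r *\<^sub>R fn f x))\<^sup>2 = r\<^sup>2 * (norm (fn f x))\<^sup>2" by (simp add: power_mult_distrib)
      show "Phi x (r *\<^sub>R fn f x) \<le> r\<^sup>2 * e1 * (norm (fn f x))\<^sup>2 + r\<^sup>2 * C * ?t x"
      proof (cases "norm (r *\<^sub>R fn f x) \<le> d")
        case True
        have "0 \<le> r\<^sup>2 * C * ?t x" using C(1) by (simp add: indicator_def)
        then show ?thesis using d(2)[OF True, of x] n by (simp add: mult_ac)
      next
        case False
        have "A \<le> norm (fn f x)"
        proof (rule ccontr)
          assume "\<not> A \<le> norm (fn f x)"
          then have "r * norm (fn f x) \<le> r0 * A" using r r0 by (intro mult_mono) auto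
          then show False using False r A by (simp add: r0_def)
        qed
        moreover have "0 \<le> r\<^sup>2 * e1 * (norm (fn f x))\<^sup>2" using e1(1) by simp
        ultimately show ?thesis using C(2)[of x "r *\<^sub>R fn f x"] n by (simp add: mult_ac)
      qed
    qed
    also have "\<dots> = r\<^sup>2 * e1 * (norm f)\<^sup>2 + r\<^sup>2 * C * (\<integral>x. ?t x \<partial>lborel)"
      using it by (subst Bochner_Integration.integral_add) (auto simp: norm_fn sqint_integrable)
    also have "\<dots> \<le> r\<^sup>2 * (e1 * b\<^sup>2) + r\<^sup>2 * (C * e2)"
    proof (intro add_mono)
      have "(norm f)\<^sup>2 \<le> b\<^sup>2" using b[OF f] by (intro power_mono) auto
      then show "r\<^sup>2 * e1 * (norm f)\<^sup>2 \<le> r\<^sup>2 * (e1 * b\<^sup>2)" using e1(1) unfolding mult.assoc by (intro mult_left_mono) auto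
      show "r\<^sup>2 * C * (\<integral>x. ?t x \<partial>lborel) \<le> r\<^sup>2 * (C * e2)" using A(2)[OF f] C(1) unfolding mult.assoc by (intro mult_left_mono) auto
    qed
    also have "\<dots> \<le> r\<^sup>2 * (e / 2) + r\<^sup>2 * (e / 2)" using e1 e2 by (intro add_mono mult_left_mono) auto
    finally show ?thesis by (simp add: mult.commute)
  qed
  with r0 show ?thesis by blast
qed

end

section \<open>Growth of the potential\<close>

locale potential =
  fixes F Fs Ft :: "real \<Rightarrow> real \<Rightarrow> real"
  assumes F_deriv: "\<And>s t. ((\<lambda>(p, q). F p q) has_derivative (\<lambda>(h, k). Fs s t * h + Ft s t * k)) (at (s, t))"
    and Fs_cont: "continuous_on UNIV (\<lambda>(s, t). Fs s t)"
    and Ft_cont: "continuous_on UNIV (\<lambda>(s, t). Ft s t)"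
    and F_nonneg: "\<And>s t. F s t \<ge> 0"
    and F_00: "F 0 0 = 0"
    and F0_s: "((\<lambda>(s, t). Fs s t / (\<bar>s\<bar> + \<bar>t\<bar>)) \<longlongrightarrow> 0) (at (0, 0))"
    and F0_t: "((\<lambda>(s, t). Ft s t / (\<bar>s\<bar> + \<bar>t\<bar>)) \<longlongrightarrow> 0) (at (0, 0))"
    and Finf_s: "((\<lambda>(s, t). Fs s t / (\<bar>s\<bar> + \<bar>t\<bar>)) \<longlongrightarrow> 0) (filtercomap (\<lambda>(s, t). \<bar>s\<bar> + \<bar>t\<bar>) at_top)"
    and Finf_t: "((\<lambda>(s, t). Ft s t / (\<bar>s\<bar> + \<bar>t\<bar>)) \<longlongrightarrow> 0) (filtercomap (\<lambda>(s, t). \<bar>s\<bar> + \<bar>t\<bar>) at_top)"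
begin

definition V :: "real \<times> real \<Rightarrow> real" where "V p = F (fst p) (snd p)"
definition DV :: "real \<times> real \<Rightarrow> real \<times> real" where "DV p = (Fs (fst p) (snd p), Ft (fst p) (snd p))"

lemma DV_cont: "continuous_on UNIV DV"
  using continuous_on_Pair[OF Fs_cont Ft_cont] by (simp add: DV_def[abs_def] case_prod_beta')

lemma V_deriv: "(V has_derivative (\<lambda>h. DV p \<bullet> h)) (at p)"
proof -
  have "(V has_derivative (\<lambda>(h, k). Fs (fst p) (snd p) * h + Ft (fst p) (snd p) * k)) (at p)"
    using F_deriv[of "fst p" "snd p"] by (simp add: V_def[abs_def] case_prod_beta')
  moreover have "(\<lambda>(h, k). Fs (fst p) (snd p) * h + Ft (fst p) (snd p) * k) = (\<lambda>h. DV p \<bullet> h)"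
    by (auto simp: DV_def inner_prod_def)
  ultimately show ?thesis by simp
qed

lemma norm_DV_le:
  assumes "\<bar>Fs (fst p) (snd p) / (\<bar>fst p\<bar> + \<bar>snd p\<bar>)\<bar> < e" "\<bar>Ft (fst p) (snd p) / (\<bar>fst p\<bar> + \<bar>snd p\<bar>)\<bar> < e" "p \<noteq> 0"
  shows "norm (DV p) \<le> 4 * e * norm p"
proof -
  define m where "m = \<bar>fst p\<bar> + \<bar>snd p\<bar>"
  have m: "m > 0" using assms(3) by (cases p) (auto simp: m_def zero_prod_def)
  have e: "e > 0" using assms(1) by (meson abs_ge_zero le_less_trans)
  have "\<bar>fst p\<bar> \<le> norm p" "\<bar>snd p\<bar> \<le> norm p"
    using norm_fst_le[of "fst p" "snd p"] norm_snd_le[of "snd p" "fst p"] by auto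
  then have m2: "m \<le> 2 * norm p" by (simp add: m_def)
  have "\<bar>Fs (fst p) (snd p)\<bar> \<le> e * m" "\<bar>Ft (fst p) (snd p)\<bar> \<le> e * m"
    using assms(1,2) m unfolding m_def[symmetric] by (auto simp: abs_divide pos_divide_less_eq)
  moreover have "norm (DV p) \<le> \<bar>Fs (fst p) (snd p)\<bar> + \<bar>Ft (fst p) (snd p)\<bar>"
    unfolding DV_def using norm_Pair_le[of "Fs (fst p) (snd p)" "Ft (fst p) (snd p)"] by simp
  ultimately have "norm (DV p) \<le> e * (2 * m)" by simp
  also have "\<dots> \<le> e * (2 * (2 * norm p))" using m2 e by (intro mult_left_mono) auto
  finally show ?thesis by simp
qed

lemma DV_small:
  assumes e: "e > 0"
  shows "\<exists>d>0. \<forall>p. p \<noteq> 0 \<and> norm p < d \<longrightarrow> norm (DV p) \<le> e * norm p"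
proof -
  have e4: "e / 4 > 0" using e by simp
  have "\<forall>\<^sub>F p in at (0, 0). dist (case p of (s, t) \<Rightarrow> Fs s t / (\<bar>s\<bar> + \<bar>t\<bar>)) 0 < e / 4"
    "\<forall>\<^sub>F p in at (0, 0). dist (case p of (s, t) \<Rightarrow> Ft s t / (\<bar>s\<bar> + \<bar>t\<bar>)) 0 < e / 4"
    using tendstoD[OF F0_s e4] tendstoD[OF F0_t e4] by auto
  then have "\<forall>\<^sub>F p in at (0::real \<times> real). \<bar>Fs (fst p) (snd p) / (\<bar>fst p\<bar> + \<bar>snd p\<bar>)\<bar> < e / 4 \<and> \<bar>Ft (fst p) (snd p) / (\<bar>fst p\<bar> + \<bar>snd p\<bar>)\<bar> < e / 4"
    unfolding zero_prod_def by eventually_elim (auto simp: case_prod_beta' dist_real_def)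
  then obtain d where d: "d > 0" "\<And>p. p \<noteq> 0 \<Longrightarrow> dist p 0 < d \<Longrightarrow> \<bar>Fs (fst p) (snd p) / (\<bar>fst p\<bar> + \<bar>snd p\<bar>)\<bar> < e / 4 \<and> \<bar>Ft (fst p) (snd p) / (\<bar>fst p\<bar> + \<bar>snd p\<bar>)\<bar> < e / 4"
    unfolding eventually_at by auto
  have "norm (DV p) \<le> e * norm p" if "p \<noteq> 0" "norm p < d" for p
    using norm_DV_le[of p "e/4"] d(2)[of p] that by simp
  with d(1) show ?thesis by blast
qed

lemma DV_large:
  assumes e: "e > 0"
  shows "\<exists>R>0. \<forall>p. norm p \<ge> R \<longrightarrow> norm (DV p) \<le> e * norm p"
proof -
  let ?FF = "filtercomap (\<lambda>(s, t). \<bar>s\<bar> + \<bar>t\<bar>) (at_top :: real filter)"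
  have e4: "e / 4 > 0" using e by simp
  have "\<forall>\<^sub>F p in ?FF. dist (case p of (s, t) \<Rightarrow> Fs s t / (\<bar>s\<bar> + \<bar>t\<bar>)) 0 < e / 4"
    "\<forall>\<^sub>F p in ?FF. dist (case p of (s, t) \<Rightarrow> Ft s t / (\<bar>s\<bar> + \<bar>t\<bar>)) 0 < e / 4"
    using tendstoD[OF Finf_s e4] tendstoD[OF Finf_t e4] by auto
  then have "\<forall>\<^sub>F p in ?FF. \<bar>Fs (fst p) (snd p) / (\<bar>fst p\<bar> + \<bar>snd p\<bar>)\<bar> < e / 4 \<and> \<bar>Ft (fst p) (snd p) / (\<bar>fst p\<bar> + \<bar>snd p\<bar>)\<bar> < e / 4"
    by eventually_elim (auto simp: case_prod_beta' dist_real_def)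
  then obtain Q where Q: "eventually Q at_top" "\<And>p. Q (case p of (s, t) \<Rightarrow> \<bar>s\<bar> + \<bar>t\<bar>) \<Longrightarrow>
      \<bar>Fs (fst p) (snd p) / (\<bar>fst p\<bar> + \<bar>snd p\<bar>)\<bar> < e / 4 \<and> \<bar>Ft (fst p) (snd p) / (\<bar>fst p\<bar> + \<bar>snd p\<bar>)\<bar> < e / 4"
    unfolding eventually_filtercomap by blast
  obtain R0 where R0: "\<And>r. r \<ge> R0 \<Longrightarrow> Q r" using Q(1) unfolding eventually_at_top_linorder by blast
  define R where "R = max R0 1"
  have "norm (DV p) \<le> e * norm p" if "norm p \<ge> R" for p
  proof -
    have "norm p \<le> \<bar>fst p\<bar> + \<bar>snd p\<bar>" using norm_Pair_le[of "fst p" "snd p"] by simp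
    then have "Q (case p of (s, t) \<Rightarrow> \<bar>s\<bar> + \<bar>t\<bar>)" using that by (intro R0) (auto simp: R_def case_prod_beta')
    moreover have "p \<noteq> 0" using that by (auto simp: R_def)
    ultimately show ?thesis using norm_DV_le[of p "e/4"] Q(2)[of p] by simp
  qed
  then show ?thesis by (intro exI[of _ R]) (auto simp: R_def)
qed

text \<open>The hypothesis at the origin speaks of punctured neighbourhoods; the value at 0 itself
  comes from continuity. This makes the zero pair a critical point.\<close>

lemma DV_zero: "DV 0 = 0"
proof -
  obtain d where d: "d > 0" "\<And>p. p \<noteq> 0 \<Longrightarrow> norm p < d \<Longrightarrow> norm (DV p) \<le> 1 * norm p" using DV_small[of 1] by auto
  have t1: "(DV \<longlongrightarrow> 0) (at 0)"
  proof (rule Lim_null_comparison)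
    show "\<forall>\<^sub>F p in at 0. norm (DV p) \<le> norm p"
      unfolding eventually_at using d by (intro exI[of _ d]) auto
    show "(norm \<longlongrightarrow> 0) (at (0 :: real \<times> real))" using tendsto_norm_zero[OF tendsto_ident_at] .
  qed
  have t2: "(DV \<longlongrightarrow> DV 0) (at 0)"
    using DV_cont[unfolded continuous_on_def, rule_format, OF UNIV_I, of 0] .
  show ?thesis by (rule tendsto_unique[OF at_neq_bot t2 t1])
qed

lemma DV_affine:
  assumes e: "e > 0"
  shows "\<exists>C\<ge>0. \<forall>p. norm (DV p) \<le> e * norm p + C"
proof -
  obtain R where R: "R > 0" "\<And>p. norm p \<ge> R \<Longrightarrow> norm (DV p) \<le> e * norm p" using DV_large[OF e] by blast
  have "bounded (DV ` cball 0 R)"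
    by (intro compact_imp_bounded compact_continuous_image continuous_on_subset[OF DV_cont] compact_cball) auto
  then obtain C where C: "C > 0" "\<And>p. norm p \<le> R \<Longrightarrow> norm (DV p) \<le> C" unfolding bounded_pos by auto
  have "norm (DV p) \<le> e * norm p + C" for p
    using R(2)[of p] C(1) C(2)[of p] e by (cases "norm p \<ge> R") (auto simp: add_increasing add_increasing2)
  with C(1) show ?thesis by (intro exI[of _ C]) auto
qed

lemma DV_linear: "\<exists>C\<ge>0. \<forall>p. norm (DV p) \<le> C * norm p"
proof -
  obtain d where d: "d > 0" "\<And>p. p \<noteq> 0 \<Longrightarrow> norm p < d \<Longrightarrow> norm (DV p) \<le> 1 * norm p" using DV_small[of 1] by auto
  obtain C where C: "C \<ge> 0" "\<And>p. norm (DV p) \<le> 1 * norm p + C" using DV_affine[of 1] by auto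
  have "norm (DV p) \<le> (1 + C / d) * norm p" for p
  proof (cases "norm p < d")
    case True
    have "0 \<le> C / d * norm p" using C d by simp
    then show ?thesis using d(2)[OF _ True] DV_zero by (cases "p = 0") (auto simp: distrib_right)
  next
    case False
    have "C = C / d * d" using d by simp
    also have "\<dots> \<le> C / d * norm p" using False C d by (intro mult_left_mono) auto
    finally show ?thesis using C(2)[of p] by (simp add: distrib_right)
  qed
  moreover have "1 + C / d \<ge> 0" using C d by simp
  ultimately show ?thesis by blast
qed

text \<open>On a large ball uniform continuity handles close points and boundedness, divided by
  \<open>d\<close>, handles the others. Outside, sublinear growth makes both values small relative
  to the norms, and |p| is at most |q| + |p - q|.\<close>

lemma DV_modulus:
  assumes e: "e > 0"
  shows "\<exists>C\<ge>0. \<forall>p q. norm (DV p - DV q) \<le> e * (1 + norm q) + C * norm (p - q)"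
proof -
  have e2: "e / 2 > 0" using e by simp
  obtain R where R: "R > 0" "\<And>p. norm p \<ge> R \<Longrightarrow> norm (DV p) \<le> e / 2 * norm p" using DV_large[OF e2] by blast
  have "bounded (DV ` cball 0 (R + 1))"
    by (intro compact_imp_bounded compact_continuous_image continuous_on_subset[OF DV_cont] compact_cball) auto
  then obtain M where M: "M > 0" "\<And>p. norm p \<le> R + 1 \<Longrightarrow> norm (DV p) \<le> M" unfolding bounded_pos by auto
  have "uniformly_continuous_on (cball 0 (R + 1)) DV"
    by (intro compact_uniformly_continuous compact_cball continuous_on_subset[OF DV_cont]) auto
  then obtain d where d: "d > 0" "\<And>p q. norm p \<le> R + 1 \<Longrightarrow> norm q \<le> R + 1 \<Longrightarrow> dist p q < d \<Longrightarrow> dist (DV p) (DV q) < e"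
    unfolding uniformly_continuous_on_def using e by (metis mem_cball_0)
  define C where "C = e + 2 * M / d + M"
  have C0: "C \<ge> 0" using e M d by (simp add: C_def)
  have parts: "e * x \<le> C * x" "2 * M / d * x \<le> C * x" "M * x \<le> C * x" if "x \<ge> 0" for x
  proof -
    have "C * x = e * x + 2 * M / d * x + M * x" by (simp add: C_def distrib_right)
    moreover have "0 \<le> e * x" "0 \<le> 2 * M / d * x" "0 \<le> M * x" using that e M(1) d(1) by auto
    ultimately show "e * x \<le> C * x" "2 * M / d * x \<le> C * x" "M * x \<le> C * x" by linarith+
  qed
  have "norm (DV p - DV q) \<le> e * (1 + norm q) + C * norm (p - q)" for p q
  proof -
    define D where "D = norm (p - q)"
    have D0: "D \<ge> 0" by (simp add: D_def)
    have tri: "norm (DV p - DV q) \<le> norm (DV p) + norm (DV q)" by (rule norm_triangle_ineq4)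
    have pq: "norm p \<le> norm q + D" "norm q \<le> norm p + D"
      using norm_triangle_ineq2[of p q] norm_triangle_ineq2[of q p] by (auto simp: D_def norm_minus_commute)
    have eq0: "0 \<le> e * (1 + norm q)" using e by simp
    \<comment> \<open>The radii \<open>R\<close> and \<open>R + 1\<close> overlap: in the mixed
      cases the points are at distance at least 1, so the bound \<open>M\<close> for the inner point
      is absorbed into \<open>M * norm (p - q)\<close>.\<close>
    consider (a) "norm p \<le> R + 1" "norm q \<le> R + 1" | (b) "norm p \<ge> R" "norm q \<ge> R"
      | (c) "norm p > R + 1" "norm q < R" | (d) "norm p < R" "norm q > R + 1" by linarith
    then have "norm (DV p - DV q) \<le> e * (1 + norm q) + C * D"
    proof cases
      case a
      show ?thesis
      proof (cases "D < d")
        case True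
        then have "norm (DV p - DV q) < e" using d(2)[OF a] by (simp add: dist_norm D_def)
        also have "e \<le> e * (1 + norm q)" using e by simp
        finally show ?thesis using C0 D0 by (simp add: add_increasing2)
      next
        case False
        have "norm (DV p - DV q) \<le> 2 * M" using tri M(2)[OF a(1)] M(2)[OF a(2)] by linarith
        also have "2 * M = 2 * M / d * d" using d by simp
        also have "\<dots> \<le> 2 * M / d * D" using False M d by (intro mult_left_mono) auto
        also have "\<dots> \<le> C * D" by (rule parts(2)[OF D0])
        finally show ?thesis using eq0 by linarith
      qed
    next
      case b
      have "norm (DV p - DV q) \<le> e / 2 * norm p + e / 2 * norm q" using tri R(2)[OF b(1)] R(2)[OF b(2)] by linarith
      also have "\<dots> \<le> e / 2 * (norm q + D) + e / 2 * norm q" using pq e by (intro add_mono mult_left_mono) auto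
      also have "\<dots> = e * norm q + e / 2 * D" by (simp add: field_simps)
      also have "\<dots> \<le> e * (1 + norm q) + e * D" using e D0 by (intro add_mono mult_left_mono mult_right_mono) auto
      also have "\<dots> \<le> e * (1 + norm q) + C * D" using parts(1)[OF D0] by simp
      finally show ?thesis .
    next
      case c
      have "D \<ge> 1" using pq c by linarith
      have "norm (DV p) \<le> e / 2 * norm p" using c by (intro R(2)) auto
      also have "\<dots> \<le> e / 2 * (norm q + D)" using pq e by (intro mult_left_mono) auto
      finally have 1: "norm (DV p) \<le> e * (1 + norm q) + e * D"
      proof -
        assume "norm (DV p) \<le> e / 2 * (norm q + D)"
        also have "\<dots> \<le> e * (1 + norm q + D)" using e D0 by (intro mult_mono) auto
        finally show ?thesis by (simp add: algebra_simps)
      qed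
      have "norm (DV q) \<le> M * 1" using M(2)[of q] c by simp
      also have "\<dots> \<le> M * D" using \<open>D \<ge> 1\<close> M by (intro mult_left_mono) auto
      finally have "norm (DV p - DV q) \<le> e * (1 + norm q) + (e * D + M * D)" using tri 1 by linarith
      also have "e * D + M * D \<le> C * D" using D0 M d by (simp add: C_def distrib_right)
      finally show ?thesis by simp
    next
      case d
      have "D \<ge> 1" using pq d by linarith
      have "norm (DV p) \<le> M * 1" using M(2)[of p] d by simp
      also have "\<dots> \<le> M * D" using \<open>D \<ge> 1\<close> M by (intro mult_left_mono) auto
      also have "\<dots> \<le> C * D" by (rule parts(3)[OF D0])
      finally have 1: "norm (DV p) \<le> C * D" .
      have "norm (DV q) \<le> e / 2 * norm q" using d R by (intro R(2)) auto
      also have "\<dots> \<le> e * (1 + norm q)" using e by (intro mult_mono) auto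
      finally show ?thesis using tri 1 by linarith
    qed
    then show ?thesis by (simp add: D_def)
  qed
  with C0 show ?thesis by blast
qed

lemma V_zero: "V 0 = 0" by (simp add: V_def F_00)

lemma V_nonneg: "V p \<ge> 0" by (simp add: V_def F_nonneg)

lemma V_le:
  assumes "\<And>y. norm y \<le> norm p \<Longrightarrow> norm (DV y) \<le> B" 
  shows "V p \<le> B * norm p"
proof -
  have B0: "B \<ge> 0" using assms[of 0] norm_ge_zero order_trans by (metis norm_ge_zero norm_zero)
  have "norm (V p - V 0) \<le> B * norm (p - 0)"
  proof (rule differentiable_bound[where S="cball 0 (norm p)" and f'="\<lambda>y h. DV y \<bullet> h"])
    fix y :: "real \<times> real" assume y: "y \<in> cball 0 (norm p)"
    show "(V has_derivative (\<lambda>h. DV y \<bullet> h)) (at y within cball 0 (norm p))" by (rule has_derivative_at_withinI[OF V_deriv])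
    show "onorm (\<lambda>h. DV y \<bullet> h) \<le> B"
    proof (rule onorm_bound[OF B0])
      fix h
      have "norm (DV y \<bullet> h) \<le> norm (DV y) * norm h" using Cauchy_Schwarz_ineq2[of "DV y" h] by simp
      also have "\<dots> \<le> B * norm h" using assms[of y] y by (intro mult_right_mono) auto
      finally show "norm (DV y \<bullet> h) \<le> B * norm h" .
    qed
  qed auto
  then show ?thesis by (simp add: V_zero)
qed

lemma V_small:
  assumes e: "e > 0"
  shows "\<exists>d>0. \<forall>p. norm p \<le> d \<longrightarrow> V p \<le> e * (norm p)\<^sup>2"
proof -
  obtain d where d: "d > 0" "\<And>p. p \<noteq> 0 \<Longrightarrow> norm p < d \<Longrightarrow> norm (DV p) \<le> e * norm p" using DV_small[OF e] by blast
  have "V p \<le> e * (norm p)\<^sup>2" if p: "norm p \<le> d / 2" for p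
  proof -
    have "V p \<le> (e * norm p) * norm p"
    proof (rule V_le)
      fix y :: "real \<times> real" assume y: "norm y \<le> norm p"
      have "norm (DV y) \<le> e * norm y" using d(2)[of y] p y d(1) DV_zero by (cases "y = 0") auto
      also have "\<dots> \<le> e * norm p" using y e by (intro mult_left_mono) auto
      finally show "norm (DV y) \<le> e * norm p" .
    qed
    then show ?thesis by (simp add: power2_eq_square mult.assoc)
  qed
  with d(1) show ?thesis by (intro exI[of _ "d/2"]) auto
qed

lemma V_quad: "\<exists>C\<ge>0. \<forall>p. V p \<le> C * (norm p)\<^sup>2"
proof -
  obtain C where C: "C \<ge> 0" "\<And>p. norm (DV p) \<le> C * norm p" using DV_linear by blast
  have "V p \<le> C * (norm p)\<^sup>2" for p
  proof -
    have "V p \<le> (C * norm p) * norm p"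
    proof (rule V_le)
      fix y :: "real \<times> real" assume y: "norm y \<le> norm p"
      show "norm (DV y) \<le> C * norm p" using C(2)[of y] mult_left_mono[OF y C(1)] by linarith
    qed
    then show ?thesis by (simp add: power2_eq_square mult.assoc)
  qed
  with C(1) show ?thesis by blast
qed

lemma V_large:
  assumes e: "e > 0"
  shows "\<exists>C\<ge>0. \<forall>p. V p \<le> e * (norm p)\<^sup>2 + C"
proof -
  have e2: "e / 2 > 0" using e by simp
  obtain C where C: "C \<ge> 0" "\<And>p. norm (DV p) \<le> e / 2 * norm p + C" using DV_affine[OF e2] by blast
  have "V p \<le> e * (norm p)\<^sup>2 + C\<^sup>2 / (2 * e)" for p
  proof -
    define n where "n = norm p"
    have "V p \<le> (e / 2 * norm p + C) * norm p"
    proof (rule V_le)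
      fix y :: "real \<times> real" assume y: "norm y \<le> norm p"
      show "norm (DV y) \<le> e / 2 * norm p + C" using C(2)[of y] mult_left_mono[OF y, of "e/2"] e by linarith
    qed
    also have "\<dots> = e / 2 * n\<^sup>2 + C * n" by (simp add: n_def power2_eq_square algebra_simps)
    \<comment> \<open>Young's inequality trades the linear term for half of the allowed quadratic
      one.\<close>
    also have "C * n \<le> e / 2 * n\<^sup>2 + C\<^sup>2 / (2 * e)"
    proof -
      have "0 \<le> (e * n - C)\<^sup>2 / (2 * e)" using e by simp
      also have "\<dots> = e / 2 * n\<^sup>2 - C * n + C\<^sup>2 / (2 * e)" using e by (simp add: power2_eq_square field_simps)
      finally show ?thesis by linarith
    qed
    finally show ?thesis by (simp add: n_def)
  qed
  moreover have "C\<^sup>2 / (2 * e) \<ge> 0" using e by simp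
  ultimately show ?thesis by blast
qed

end

text \<open>In the unknowns \<open>p = (u / \<alpha>, v / \<beta>)\<close> the linear part of the
  energy becomes the norm of a space of square-integrable functions.\<close>

locale weighted_potential = potential F Fs Ft for F Fs Ft +
  fixes Om :: "'a::euclidean_space set" and \<kappa> \<alpha> \<beta> :: "'a \<Rightarrow> real" and \<Lambda> L :: real
  assumes Om_meas [measurable]: "Om \<in> sets borel" and Om_fin: "emeasure lborel Om < \<infinity>"
    and \<kappa>_meas [measurable]: "\<kappa> \<in> borel_measurable borel" and \<alpha>_meas [measurable]: "\<alpha> \<in> borel_measurable borel"
    and \<beta>_meas [measurable]: "\<beta> \<in> borel_measurable borel"
    and \<kappa>_bound: "\<And>x. 0 \<le> \<kappa> x" "\<And>x. \<kappa> x \<le> \<Lambda>" and \<alpha>_bound: "\<And>x. \<bar>\<alpha> x\<bar> \<le> L" and \<beta>_bound: "\<And>x. \<bar>\<beta> x\<bar> \<le> L"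
    and \<kappa>_out: "\<And>x. x \<notin> Om \<Longrightarrow> \<kappa> x = 0"
begin

text \<open>\<open>S x\<close> recovers (u, v) from the rescaled unknowns. It is diagonal and hence
  symmetric, which is why the gradient \<open>G\<close> of \<open>Phi\<close> applies it once inside
  and once outside \<open>DV\<close>.\<close>

definition S :: "'a \<Rightarrow> real \<times> real \<Rightarrow> real \<times> real" where "S x p = (\<alpha> x * fst p, \<beta> x * snd p)"
definition Phi :: "'a \<Rightarrow> real \<times> real \<Rightarrow> real" where "Phi x p = \<kappa> x * V (S x p)"
definition G :: "'a \<Rightarrow> real \<times> real \<Rightarrow> real \<times> real" where "G x p = \<kappa> x *\<^sub>R S x (DV (S x p))"

lemma \<Lambda>0: "\<Lambda> \<ge> 0" using \<kappa>_bound[of undefined] by linarith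
lemma L0: "L \<ge> 0" using \<alpha>_bound[of undefined] by linarith

lemma norm_S: "norm (S x p) \<le> L * norm p"
proof -
  have "(norm (S x p))\<^sup>2 = (\<alpha> x * fst p)\<^sup>2 + (\<beta> x * snd p)\<^sup>2"
    by (simp add: S_def norm_Pair)
  also have "\<dots> \<le> L\<^sup>2 * (fst p)\<^sup>2 + L\<^sup>2 * (snd p)\<^sup>2"
    unfolding power_mult_distrib using \<alpha>_bound[of x] \<beta>_bound[of x] L0
    by (intro add_mono mult_right_mono) (auto simp: abs_le_square_iff[symmetric])
  also have "\<dots> = (L * norm p)\<^sup>2"
    by (cases p) (simp add: norm_Pair power_mult_distrib distrib_left)
  finally show ?thesis by (rule power2_le_imp_le) (simp add: L0)
qed

lemma S_diff: "S x p - S x q = S x (p - q)" by (simp add: S_def right_diff_distrib)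

lemma S_linear: "bounded_linear (S x)"
  unfolding S_def[abs_def]
  by (intro bounded_linear_Pair bounded_linear_const_mult bounded_linear_fst bounded_linear_snd)

lemma S_meas [measurable (raw)]: "f \<in> borel_measurable borel \<Longrightarrow> (\<lambda>x. S x (f x)) \<in> borel_measurable borel"
  unfolding S_def by (intro borel_measurable_Pair borel_measurable_times)
     (auto intro: measurable_compose[OF _ borel_measurable_continuous_onI[OF continuous_on_fst[OF continuous_on_id]]]
       measurable_compose[OF _ borel_measurable_continuous_onI[OF continuous_on_snd[OF continuous_on_id]]])

lemma V_cont: "continuous_on UNIV V"
  using V_deriv has_derivative_continuous by (intro continuous_at_imp_continuous_on) blast

sublocale nemytskii Om Phi G
proof
  show "Om \<in> sets borel" "emeasure lborel Om < \<infinity>" by (fact Om_meas Om_fin)+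
  fix f :: "'a \<Rightarrow> real \<times> real" assume f: "f \<in> borel_measurable borel"
  have "(\<lambda>x. DV (S x (f x))) \<in> borel_measurable borel"
    by (rule measurable_compose[OF S_meas[OF f] borel_measurable_continuous_onI[OF DV_cont]])
  then show "(\<lambda>x. G x (f x)) \<in> borel_measurable borel"
    unfolding G_def by (intro borel_measurable_scaleR \<kappa>_meas S_meas)
  have "(\<lambda>x. V (S x (f x))) \<in> borel_measurable borel"
    by (rule measurable_compose[OF S_meas[OF f] borel_measurable_continuous_onI[OF V_cont]])
  then show "(\<lambda>x. Phi x (f x)) \<in> borel_measurable borel"
    unfolding Phi_def by (intro borel_measurable_times \<kappa>_meas)
next
  fix x and p :: "real \<times> real" assume "x \<notin> Om"
  then show "G x p = 0" "Phi x p = 0" by (auto simp: G_def Phi_def \<kappa>_out)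
next
  fix x show "G x 0 = 0" using DV_zero by (simp add: G_def S_def zero_prod_def)
next
  fix x and p :: "real \<times> real"
  have "((\<lambda>p. V (S x p)) has_derivative (\<lambda>h. DV (S x p) \<bullet> S x h)) (at p)"
    by (rule has_derivative_compose[OF bounded_linear_imp_has_derivative[OF S_linear] V_deriv])
  from has_derivative_mult_right[OF this, of "\<kappa> x"]
  have "(Phi x has_derivative (\<lambda>h. \<kappa> x * (DV (S x p) \<bullet> S x h))) (at p)" by (simp add: Phi_def[abs_def])
  moreover have "(\<lambda>h. \<kappa> x * (DV (S x p) \<bullet> S x h)) = (\<lambda>h. G x p \<bullet> h)"
    by (auto simp: G_def S_def inner_prod_def algebra_simps)
  ultimately show "(Phi x has_derivative (\<lambda>h. G x p \<bullet> h)) (at p)" by simp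
next
  fix e :: real assume e: "e > 0"
  \<comment> \<open>The outer \<open>S\<close> costs a factor \<open>L\<close>, the weight a factor
    \<open>\<Lambda>\<close>, and the inner \<open>S\<close> turns \<open>1 + L * norm q\<close>
    into at most \<open>(1 + L) * (1 + norm q)\<close>.\<close>
  define m where "m = \<Lambda> * L * (1 + L) + 1"
  have m: "m > 0" "\<Lambda> * L * (1 + L) \<le> m" using \<Lambda>0 L0 by (auto simp: m_def add_nonneg_pos)
  define d where "d = e / m"
  have d: "d > 0" "m * d = e" using e m by (auto simp: d_def)
  from DV_modulus[OF d(1)] obtain C where C: "C \<ge> 0" "\<And>p q. norm (DV p - DV q) \<le> d * (1 + norm q) + C * norm (p - q)" by blast
  have "norm (G x p - G x q) \<le> e * (1 + norm q) + \<Lambda> * L * C * L * norm (p - q)" for x p q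
  proof -
    have "G x p - G x q = \<kappa> x *\<^sub>R S x (DV (S x p) - DV (S x q))"
      by (simp add: G_def scaleR_diff_right[symmetric] S_diff)
    then have "norm (G x p - G x q) = \<kappa> x * norm (S x (DV (S x p) - DV (S x q)))" using \<kappa>_bound(1)[of x] by simp
    also have "\<dots> \<le> \<Lambda> * (L * (d * (1 + L * norm q) + C * (L * norm (p - q))))"
    proof -
      have "d * (1 + norm (S x q)) \<le> d * (1 + L * norm q)" using d(1) norm_S[of x q] by (intro mult_left_mono) auto
      moreover have "C * norm (S x p - S x q) \<le> C * (L * norm (p - q))" unfolding S_diff by (intro mult_left_mono norm_S C(1))
      ultimately have "norm (DV (S x p) - DV (S x q)) \<le> d * (1 + L * norm q) + C * (L * norm (p - q))"
        using C(2)[of "S x p" "S x q"] by linarith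
      from order_trans[OF norm_S mult_left_mono[OF this L0]]
      show ?thesis by (intro mult_mono \<kappa>_bound(2) \<Lambda>0 norm_ge_zero)
    qed
    also have "\<dots> = \<Lambda> * L * d * (1 + L * norm q) + \<Lambda> * L * C * L * norm (p - q)" by (simp add: algebra_simps)
    also have "\<Lambda> * L * d * (1 + L * norm q) \<le> \<Lambda> * L * d * ((1 + L) * (1 + norm q))"
      using \<Lambda>0 L0 d(1) by (intro mult_left_mono) (auto simp: algebra_simps)
    also have "\<dots> = (\<Lambda> * L * (1 + L)) * d * (1 + norm q)" by (simp add: algebra_simps)
    also have "\<dots> \<le> m * d * (1 + norm q)" using d(1) m by (intro mult_right_mono) auto
    also have "\<dots> = e * (1 + norm q)" by (simp only: d(2))
    finally show ?thesis by simp
  qed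
  moreover have "\<Lambda> * L * C * L \<ge> 0" using \<Lambda>0 L0 C by simp
  ultimately show "\<exists>C\<ge>0. \<forall>x p q. norm (G x p - G x q) \<le> e * (1 + norm q) + C * norm (p - q)" by blast
next
  fix x and p :: "real \<times> real" show "0 \<le> Phi x p" using \<kappa>_bound(1)[of x] V_nonneg by (simp add: Phi_def)
next
  fix e :: real assume e: "e > 0"
  define m where "m = \<Lambda> * L\<^sup>2 + 1"
  have m: "m > 0" "\<Lambda> * L\<^sup>2 \<le> m" using \<Lambda>0 by (auto simp: m_def add_nonneg_pos)
  define q where "q = e / m"
  have em: "q > 0" "m * q = e" using e m by (auto simp: q_def)
  \<comment> \<open>One scaling estimate for both growth conditions: with \<open>C = 0\<close> near
    the origin, with positive \<open>C\<close> at infinity.\<close>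
  have key: "Phi x p \<le> e * (norm p)\<^sup>2 + \<Lambda> * C" if "V (S x p) \<le> q * (norm (S x p))\<^sup>2 + C" "C \<ge> 0" for x p C
  proof -
    have "(norm (S x p))\<^sup>2 \<le> (L * norm p)\<^sup>2" using norm_S by (intro power_mono) auto
    then have "V (S x p) \<le> q * (L * norm p)\<^sup>2 + C" using that(1) mult_left_mono[of "(norm (S x p))\<^sup>2" "(L * norm p)\<^sup>2" "q"] em(1) by linarith
    then have "Phi x p \<le> \<Lambda> * (q * (L * norm p)\<^sup>2 + C)"
      unfolding Phi_def using \<kappa>_bound[of x] V_nonneg \<Lambda>0 by (intro mult_mono) auto
    also have "\<dots> = (\<Lambda> * L\<^sup>2) * q * (norm p)\<^sup>2 + \<Lambda> * C" by (simp add: power_mult_distrib algebra_simps)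
    also have "\<dots> \<le> m * q * (norm p)\<^sup>2 + \<Lambda> * C" using em(1) m by (intro add_right_mono mult_right_mono) auto
    finally show ?thesis by (simp only: em(2))
  qed
  obtain d where d: "d > 0" "\<And>p. norm p \<le> d \<Longrightarrow> V p \<le> q * (norm p)\<^sup>2" using V_small[OF em(1)] by blast
  have "Phi x p \<le> e * (norm p)\<^sup>2" if p: "norm p \<le> d / (L + 1)" for x p
  proof -
    have "norm (S x p) \<le> L * norm p" by (rule norm_S)
    also have "\<dots> \<le> (L + 1) * (d / (L + 1))" using p L0 by (intro mult_mono) auto
    also have "\<dots> = d" using L0 by simp
    finally show ?thesis using key[of x p 0] d(2)[of "S x p"] by simp
  qed
  moreover have "d / (L + 1) > 0" using d L0 by simp
  ultimately show "\<exists>d>0. \<forall>x p. norm p \<le> d \<longrightarrow> Phi x p \<le> e * (norm p)\<^sup>2" by blast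
  obtain C where C: "C \<ge> 0" "\<And>p. V p \<le> q * (norm p)\<^sup>2 + C" using V_large[OF em(1)] by blast
  have "Phi x p \<le> e * (norm p)\<^sup>2 + \<Lambda> * C" for x p by (rule key[OF C(2) C(1)])
  moreover have "\<Lambda> * C \<ge> 0" using \<Lambda>0 C by simp
  ultimately show "\<exists>C\<ge>0. \<forall>x p. Phi x p \<le> e * (norm p)\<^sup>2 + C" by blast
next
  obtain C where C: "C \<ge> 0" "\<And>p. V p \<le> C * (norm p)\<^sup>2" using V_quad by blast
  have "Phi x p \<le> \<Lambda> * (C * L\<^sup>2) * (norm p)\<^sup>2" for x p
  proof -
    have "V (S x p) \<le> C * (L * norm p)\<^sup>2"
      using C(2)[of "S x p"] mult_left_mono[OF power_mono[OF norm_S norm_ge_zero, of x p 2] C(1)] by linarith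
    then have "Phi x p \<le> \<Lambda> * (C * (L * norm p)\<^sup>2)"
      unfolding Phi_def using \<kappa>_bound[of x] V_nonneg \<Lambda>0 by (intro mult_mono) auto
    then show ?thesis by (simp add: power_mult_distrib mult.assoc)
  qed
  moreover have "\<Lambda> * (C * L\<^sup>2) \<ge> 0" using \<Lambda>0 C by simp
  ultimately show "\<exists>C\<ge>0. \<forall>x p. Phi x p \<le> C * (norm p)\<^sup>2" by blast
qed

end

section \<open>The first Sobolev space as a closed subspace\<close>

lemma AE_lebesgue_on_iff:
  "\<Omega> \<in> sets borel \<Longrightarrow> (AE x in lebesgue_on \<Omega>. P x) \<longleftrightarrow> (AE x in lborel. x \<in> \<Omega> \<longrightarrow> P x)"
  by (subst AE_restrict_space_iff) (auto simp: AE_completion_iff)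

lemma borel_measurable_lebesgue_on: "f \<in> borel_measurable borel \<Longrightarrow> f \<in> borel_measurable (lebesgue_on \<Omega>)"
  by (intro measurable_restrict_space1 measurable_completion) simp

lemma lebesgue_on_borel:
  fixes f :: "'a::euclidean_space \<Rightarrow> 'b::{banach, second_countable_topology}"
  assumes [measurable]: "\<Omega> \<in> sets borel" "f \<in> borel_measurable borel"
  shows integral_lebesgue_on_borel: "integral\<^sup>L (lebesgue_on \<Omega>) f = (\<integral>x. indicator \<Omega> x *\<^sub>R f x \<partial>lborel)"
    and integrable_lebesgue_on_borel: "integrable (lebesgue_on \<Omega>) f \<longleftrightarrow> integrable lborel (\<lambda>x. indicator \<Omega> x *\<^sub>R f x)"
proof -
  have m: "(\<lambda>x. indicator \<Omega> x *\<^sub>R f x) \<in> borel_measurable lborel" by measurable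
  have "\<Omega> \<inter> space lebesgue \<in> sets lebesgue" by simp
  from integral_restrict_space[OF this, of f] integrable_restrict_space[OF this, of f]
  show "integral\<^sup>L (lebesgue_on \<Omega>) f = (\<integral>x. indicator \<Omega> x *\<^sub>R f x \<partial>lborel)"
    "integrable (lebesgue_on \<Omega>) f \<longleftrightarrow> integrable lborel (\<lambda>x. indicator \<Omega> x *\<^sub>R f x)"
    using integral_completion[OF m] integrable_completion[OF m] by auto
qed

lemma borel_representative_real:
  fixes f :: "'a::euclidean_space \<Rightarrow> real"
  assumes [measurable]: "\<Omega> \<in> sets borel" and f: "f \<in> borel_measurable (lebesgue_on \<Omega>)"
  shows "\<exists>f'. f' \<in> borel_measurable borel \<and> (\<forall>x. x \<notin> \<Omega> \<longrightarrow> f' x = 0) \<and> (AE x in lborel. x \<in> \<Omega> \<longrightarrow> f x = f' x)"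
proof -
  have "(\<lambda>x. indicator \<Omega> x *\<^sub>R f x) \<in> borel_measurable (completion lborel)"
    using f by (subst (asm) borel_measurable_restrict_space_iff) auto
  from completion_ex_borel_measurable_real[OF this] obtain g where g: "g \<in> borel_measurable lborel"
    "AE x in lborel. indicator \<Omega> x *\<^sub>R f x = g x" by blast
  have [measurable]: "g \<in> borel_measurable borel" using g(1) by simp
  show ?thesis
  proof (intro exI conjI)
    show "(\<lambda>x. indicator \<Omega> x * g x) \<in> borel_measurable borel" by measurable
    show "AE x in lborel. x \<in> \<Omega> \<longrightarrow> f x = indicator \<Omega> x * g x" using g(2) by eventually_elim auto
  qed auto
qed

lemma borel_representative_vector:
  fixes f :: "'a::euclidean_space \<Rightarrow> 'b::euclidean_space"
  assumes \<Omega>: "\<Omega> \<in> sets borel" and f: "f \<in> borel_measurable (lebesgue_on \<Omega>)"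
  shows "\<exists>f'. f' \<in> borel_measurable borel \<and> (\<forall>x. x \<notin> \<Omega> \<longrightarrow> f' x = 0) \<and> (AE x in lborel. x \<in> \<Omega> \<longrightarrow> f x = f' x)"
proof -
  have "\<forall>i\<in>Basis. \<exists>f'. f' \<in> borel_measurable borel \<and> (\<forall>x. x \<notin> \<Omega> \<longrightarrow> f' x = 0) \<and> (AE x in lborel. x \<in> \<Omega> \<longrightarrow> f x \<bullet> i = f' x)"
    using f by (intro ballI borel_representative_real[OF \<Omega>]) auto
  from bchoice[OF this] obtain h where h: "\<And>i. i \<in> Basis \<Longrightarrow> h i \<in> borel_measurable borel"
    "\<And>i x. i \<in> Basis \<Longrightarrow> x \<notin> \<Omega> \<Longrightarrow> h i x = 0" "\<And>i. i \<in> Basis \<Longrightarrow> AE x in lborel. x \<in> \<Omega> \<longrightarrow> f x \<bullet> i = h i x" by blast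
  have "AE x in lborel. \<forall>i\<in>Basis. x \<in> \<Omega> \<longrightarrow> f x \<bullet> i = h i x"
    using h(3) by (subst AE_finite_all) auto
  then have "AE x in lborel. x \<in> \<Omega> \<longrightarrow> f x = (\<Sum>i\<in>Basis. h i x *\<^sub>R i)"
  proof eventually_elim
    case (elim x)
    show ?case
    proof
      assume "x \<in> \<Omega>"
      with elim have "(\<Sum>i\<in>Basis. h i x *\<^sub>R i) = (\<Sum>i\<in>Basis. (f x \<bullet> i) *\<^sub>R i)" by (intro sum.cong) auto
      then show "f x = (\<Sum>i\<in>Basis. h i x *\<^sub>R i)" by (simp add: euclidean_representation)
    qed
  qed
  moreover have "(\<lambda>x. \<Sum>i\<in>Basis. h i x *\<^sub>R i) \<in> borel_measurable borel"
    by (intro borel_measurable_sum borel_measurable_scaleR h(1) borel_measurable_const)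
  ultimately show ?thesis using h(2) by (intro exI[of _ "\<lambda>x. \<Sum>i\<in>Basis. h i x *\<^sub>R i"]) auto
qed

text \<open>Changing \<open>u\<close> and \<open>g\<close> on a null set and extending them by zero
  affects neither the square integrals over the domain nor the pairings with test functions.\<close>

lemma weak_grad_representative:
  fixes \<Omega> :: "'a::euclidean_space set"
  assumes \<Omega>[measurable]: "\<Omega> \<in> sets borel" and wg: "weak_grad \<Omega> u g"
  shows "\<exists>u' g'. weak_pair \<Omega> u' g' \<and> (AE x in lborel. x \<in> \<Omega> \<longrightarrow> u x = u' x \<and> g x = g' x)"
proof -
  have um: "u \<in> borel_measurable (lebesgue_on \<Omega>)" and gm: "g \<in> borel_measurable (lebesgue_on \<Omega>)"
    and ui: "integrable (lebesgue_on \<Omega>) (\<lambda>x. (u x)\<^sup>2)" and gi: "integrable (lebesgue_on \<Omega>) (\<lambda>x. (norm (g x))\<^sup>2)"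
    using wg by (auto simp: weak_grad_def L2_fun_def)
  obtain u' where u': "u' \<in> borel_measurable borel" "\<And>x. x \<notin> \<Omega> \<Longrightarrow> u' x = 0" "AE x in lborel. x \<in> \<Omega> \<longrightarrow> u x = u' x"
    using borel_representative_real[OF \<Omega> um] by blast
  obtain g' where g': "g' \<in> borel_measurable borel" "\<And>x. x \<notin> \<Omega> \<Longrightarrow> g' x = 0" "AE x in lborel. x \<in> \<Omega> \<longrightarrow> g x = g' x"
    using borel_representative_vector[OF \<Omega> gm] by blast
  note [measurable] = u'(1) g'(1)
  have u'm: "u' \<in> borel_measurable (lebesgue_on \<Omega>)" and g'm: "g' \<in> borel_measurable (lebesgue_on \<Omega>)"
    by (rule borel_measurable_lebesgue_on[OF u'(1)], rule borel_measurable_lebesgue_on[OF g'(1)])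
  have ue: "AE x in lebesgue_on \<Omega>. u x = u' x" and ge: "AE x in lebesgue_on \<Omega>. g x = g' x"
    using u'(3) g'(3) by (auto simp: AE_lebesgue_on_iff)
  have "integrable (lebesgue_on \<Omega>) (\<lambda>x. (norm (u' x))\<^sup>2)"
  proof (rule integrable_cong_AE_imp[OF ui])
    show "(\<lambda>x. (norm (u' x))\<^sup>2) \<in> borel_measurable (lebesgue_on \<Omega>)" using u'm by measurable
    show "AE x in lebesgue_on \<Omega>. (u x)\<^sup>2 = (norm (u' x))\<^sup>2" using ue by eventually_elim simp
  qed
  then have "integrable lborel (\<lambda>x. indicator \<Omega> x *\<^sub>R (norm (u' x))\<^sup>2)" by (subst (asm) integrable_lebesgue_on_borel) auto
  moreover have "(\<lambda>x. indicator \<Omega> x *\<^sub>R (norm (u' x))\<^sup>2) = (\<lambda>x. (norm (u' x))\<^sup>2)" using u'(2) by (auto simp: fun_eq_iff indicator_def)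
  ultimately have us: "sqint u'" using u'(1) by (simp add: sqint_def)
  have "integrable (lebesgue_on \<Omega>) (\<lambda>x. (norm (g' x))\<^sup>2)"
  proof (rule integrable_cong_AE_imp[OF gi])
    show "(\<lambda>x. (norm (g' x))\<^sup>2) \<in> borel_measurable (lebesgue_on \<Omega>)" using g'm by measurable
    show "AE x in lebesgue_on \<Omega>. (norm (g x))\<^sup>2 = (norm (g' x))\<^sup>2" using ge by eventually_elim simp
  qed
  then have "integrable lborel (\<lambda>x. indicator \<Omega> x *\<^sub>R (norm (g' x))\<^sup>2)" by (subst (asm) integrable_lebesgue_on_borel) auto
  moreover have "(\<lambda>x. indicator \<Omega> x *\<^sub>R (norm (g' x))\<^sup>2) = (\<lambda>x. (norm (g' x))\<^sup>2)" using g'(2) by (auto simp: fun_eq_iff indicator_def)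
  ultimately have gs: "sqint g'" using g'(1) by (simp add: sqint_def)
  have id: "(\<integral>x. u' x * frechet_derivative \<phi> (at x) i \<partial>lborel) = - (\<integral>x. (g' x \<bullet> i) * \<phi> x \<partial>lborel)"
    if \<phi>: "test_fun \<Omega> \<phi>" and i: "i \<in> Basis" for \<phi> i
  proof -
    note [measurable] = sqint_measurable[OF test_fun_sqint(1)[OF \<phi> i]] sqint_measurable[OF test_fun_sqint(2)[OF \<phi> i]]
    have m1: "\<phi> \<in> borel_measurable (lebesgue_on \<Omega>)" "(\<lambda>x. frechet_derivative \<phi> (at x) i) \<in> borel_measurable (lebesgue_on \<Omega>)"
      by (auto intro!: borel_measurable_lebesgue_on)
    have "(\<integral>x. u' x * frechet_derivative \<phi> (at x) i \<partial>lborel) = (\<integral>x. indicator \<Omega> x *\<^sub>R (u' x * frechet_derivative \<phi> (at x) i) \<partial>lborel)"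
      using u'(2) by (intro Bochner_Integration.integral_cong) (auto simp: indicator_def)
    also have "\<dots> = (\<integral>x. u' x * frechet_derivative \<phi> (at x) i \<partial>lebesgue_on \<Omega>)"
      by (rule integral_lebesgue_on_borel[symmetric]) measurable
    also have "\<dots> = (\<integral>x. u x * frechet_derivative \<phi> (at x) i \<partial>lebesgue_on \<Omega>)"
    proof (rule integral_cong_AE)
      show "AE x in lebesgue_on \<Omega>. u' x * frechet_derivative \<phi> (at x) i = u x * frechet_derivative \<phi> (at x) i"
        using ue by eventually_elim simp
    qed (use um u'm m1 in measurable)
    also have "\<dots> = - (\<integral>x. (g x \<bullet> i) * \<phi> x \<partial>lebesgue_on \<Omega>)"
      using wg \<phi> i by (simp add: weak_grad_def)
    also have "(\<integral>x. (g x \<bullet> i) * \<phi> x \<partial>lebesgue_on \<Omega>) = (\<integral>x. (g' x \<bullet> i) * \<phi> x \<partial>lebesgue_on \<Omega>)"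
    proof (rule integral_cong_AE)
      show "AE x in lebesgue_on \<Omega>. (g x \<bullet> i) * \<phi> x = (g' x \<bullet> i) * \<phi> x" using ge by eventually_elim simp
    qed (use gm g'm m1 in measurable)
    also have "\<dots> = (\<integral>x. indicator \<Omega> x *\<^sub>R ((g' x \<bullet> i) * \<phi> x) \<partial>lborel)"
      by (rule integral_lebesgue_on_borel) measurable
    also have "\<dots> = (\<integral>x. (g' x \<bullet> i) * \<phi> x \<partial>lborel)"
      using g'(2) by (intro Bochner_Integration.integral_cong) (auto simp: indicator_def)
    finally show ?thesis .
  qed
  have "weak_pair \<Omega> u' g'" unfolding weak_pair_def using us gs u'(2) g'(2) id by blast
  moreover have "AE x in lborel. x \<in> \<Omega> \<longrightarrow> u x = u' x \<and> g x = g' x" using u'(3) g'(3) by eventually_elim auto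
  ultimately show ?thesis by blast
qed

lemma weak_pair_imp_weak_grad:
  assumes \<Omega>[measurable]: "\<Omega> \<in> sets borel" and wp: "weak_pair \<Omega> u g"
  shows "weak_grad \<Omega> u g"
proof -
  have us: "sqint u" and gs: "sqint g" and z: "\<And>x. x \<notin> \<Omega> \<Longrightarrow> u x = 0" "\<And>x. x \<notin> \<Omega> \<Longrightarrow> g x = 0"
    using wp by (auto simp: weak_pair_def)
  note [measurable] = sqint_measurable[OF us] sqint_measurable[OF gs]
  have "(\<lambda>x. indicator \<Omega> x *\<^sub>R (u x)\<^sup>2) = (\<lambda>x. (norm (u x))\<^sup>2)" using z by (auto simp: fun_eq_iff indicator_def)
  then have 1: "integrable (lebesgue_on \<Omega>) (\<lambda>x. (u x)\<^sup>2)"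
    using sqint_integrable[OF us] by (subst integrable_lebesgue_on_borel) auto
  have "(\<lambda>x. indicator \<Omega> x *\<^sub>R (norm (g x))\<^sup>2) = (\<lambda>x. (norm (g x))\<^sup>2)" using z by (auto simp: fun_eq_iff indicator_def)
  then have 2: "integrable (lebesgue_on \<Omega>) (\<lambda>x. (norm (g x))\<^sup>2)"
    using sqint_integrable[OF gs] by (subst integrable_lebesgue_on_borel) auto
  have 3: "(\<integral>x. u x * frechet_derivative \<phi> (at x) i \<partial>lebesgue_on \<Omega>) = - (\<integral>x. (g x \<bullet> i) * \<phi> x \<partial>lebesgue_on \<Omega>)"
    if \<phi>: "test_fun \<Omega> \<phi>" and i: "i \<in> Basis" for \<phi> i
  proof -
    note [measurable] = sqint_measurable[OF test_fun_sqint(1)[OF \<phi> i]] sqint_measurable[OF test_fun_sqint(2)[OF \<phi> i]]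
    have "(\<integral>x. u x * frechet_derivative \<phi> (at x) i \<partial>lebesgue_on \<Omega>) = (\<integral>x. indicator \<Omega> x *\<^sub>R (u x * frechet_derivative \<phi> (at x) i) \<partial>lborel)"
      by (rule integral_lebesgue_on_borel) measurable
    also have "\<dots> = (\<integral>x. u x * frechet_derivative \<phi> (at x) i \<partial>lborel)"
      using z by (intro Bochner_Integration.integral_cong) (auto simp: indicator_def)
    also have "\<dots> = - (\<integral>x. (g x \<bullet> i) * \<phi> x \<partial>lborel)" using wp \<phi> i by (simp add: weak_pair_def)
    also have "(\<integral>x. (g x \<bullet> i) * \<phi> x \<partial>lborel) = (\<integral>x. indicator \<Omega> x *\<^sub>R ((g x \<bullet> i) * \<phi> x) \<partial>lborel)"
      using z by (intro Bochner_Integration.integral_cong) (auto simp: indicator_def)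
    also have "\<dots> = (\<integral>x. (g x \<bullet> i) * \<phi> x \<partial>lebesgue_on \<Omega>)"
      by (rule integral_lebesgue_on_borel[symmetric]) measurable
    finally show ?thesis .
  qed
  show ?thesis unfolding weak_grad_def L2_fun_def
    using 1 2 3 by (auto intro!: borel_measurable_lebesgue_on)
qed

text \<open>Needed to give constants the weak gradient 0. The difference quotients have integral 0
  by translation invariance, and the mean value theorem supplies a dominating function for passing
  to the derivative.\<close>

lemma test_fun_deriv_integral_0:
  fixes \<phi> :: "'a::euclidean_space \<Rightarrow> real"
  assumes \<phi>: "test_fun \<Omega> \<phi>" and i: "i \<in> Basis"
  shows "(\<integral>x. frechet_derivative \<phi> (at x) i \<partial>lborel) = 0"
proof -
  let ?C = "closure {x. \<phi> x \<noteq> 0}"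
  have sm: "smooth_on_real UNIV \<phi>" and C: "compact ?C" using \<phi> by (auto simp: test_fun_def)
  obtain \<phi>' where \<phi>': "\<And>i. smooth_on_real UNIV (\<phi>' i)"
    "\<And>x. (\<phi> has_derivative (\<lambda>h. \<Sum>i\<in>Basis. (h \<bullet> i) * \<phi>' i x)) (at x)"
    using smooth_on_real_derivative[OF sm] by blast
  have fr: "frechet_derivative \<phi> (at x) i = \<phi>' i x" for x
    using frechet_derivative_Basis[OF \<phi>'(2) i] .
  have \<phi>c: "continuous_on UNIV \<phi>" and \<phi>'c: "continuous_on UNIV (\<phi>' i)"
    using sm \<phi>'(1) smooth_on_real_continuous by auto
  note [measurable] = borel_measurable_continuous_onI[OF \<phi>c] borel_measurable_continuous_onI[OF \<phi>'c]
  have z: "\<phi> x = 0" if "x \<notin> ?C" for x using that closure_subset[of "{x. \<phi> x \<noteq> 0}"] by auto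
  obtain \<rho> where \<rho>: "\<rho> > 0" "\<And>x. \<phi> x \<noteq> 0 \<Longrightarrow> norm x \<le> \<rho>"
  proof -
    obtain \<rho> where "\<rho> > 0" "\<forall>x\<in>?C. norm x \<le> \<rho>" using compact_imp_bounded[OF C] unfolding bounded_pos by blast
    then show ?thesis using that[of \<rho>] closure_subset[of "{x. \<phi> x \<noteq> 0}"] by auto
  qed
  have "bounded (\<phi>' i ` cball 0 (\<rho> + 1))"
    by (intro compact_imp_bounded compact_continuous_image continuous_on_subset[OF \<phi>'c] compact_cball) auto
  then obtain M where M: "M > 0" "\<And>x. norm x \<le> \<rho> + 1 \<Longrightarrow> \<bar>\<phi>' i x\<bar> \<le> M" unfolding bounded_pos by auto
  have \<phi>i: "integrable lborel \<phi>" by (rule compact_support_sqint(2)[OF \<phi>c C z])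
  define q where "q = (\<lambda>n x. (\<phi> (x + inverse (real (Suc n)) *\<^sub>R i) - \<phi> x) / inverse (real (Suc n)))"
  have line: "((\<lambda>t. \<phi> (x + t *\<^sub>R i)) has_real_derivative \<phi>' i (x + t *\<^sub>R i)) (at t)" for x t
  proof -
    have "((\<lambda>t. x + t *\<^sub>R i) has_derivative (\<lambda>h. h *\<^sub>R i)) (at t)" by (auto intro!: derivative_eq_intros)
    from has_derivative_compose[OF this \<phi>'(2)]
    have "((\<lambda>t. \<phi> (x + t *\<^sub>R i)) has_derivative (\<lambda>h. \<Sum>j\<in>Basis. ((h *\<^sub>R i) \<bullet> j) * \<phi>' j (x + t *\<^sub>R i))) (at t)" .
    moreover have "(\<lambda>h. \<Sum>j\<in>Basis. ((h *\<^sub>R i) \<bullet> j) * \<phi>' j (x + t *\<^sub>R i)) = (*) (\<phi>' i (x + t *\<^sub>R i))"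
      using i by (auto simp: fun_eq_iff inner_Basis if_distrib if_distribR cong: if_cong)
    ultimately show ?thesis by (simp add: has_field_derivative_def)
  qed
  have "(\<lambda>n. \<integral>x. q n x \<partial>lborel) \<longlonglongrightarrow> (\<integral>x. \<phi>' i x \<partial>lborel)"
  \<comment> \<open>The increments are at most 1 and \<open>i\<close> is a unit vector, so all
    quotients vanish outside the ball of radius \<open>\<rho> + 1\<close>, on which \<open>M\<close>
    bounds the derivative.\<close>
  proof (rule integral_dominated_convergence[where w="\<lambda>x. M * indicator (cball 0 (\<rho> + 1)) x"])
    have "emeasure lborel (cball (0::'a) (\<rho> + 1)) < \<infinity>" by (rule emeasure_bounded_finite[OF bounded_cball])
    then show "integrable lborel (\<lambda>x. M * indicator (cball (0::'a) (\<rho> + 1)) x)" by (intro integrable_mult_right) simp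
    show "AE x in lborel. (\<lambda>n. q n x) \<longlonglongrightarrow> \<phi>' i x"
    proof (rule AE_I2)
      fix x
      have "((\<lambda>h. (\<phi> (x + h *\<^sub>R i) - \<phi> x) / h) \<longlongrightarrow> \<phi>' i x) (at 0)"
        using line[of x 0] by (simp add: DERIV_def)
      moreover have "filterlim (\<lambda>n. inverse (real (Suc n))) (at 0) sequentially"
        using LIMSEQ_inverse_real_of_nat by (auto simp: filterlim_at)
      ultimately show "(\<lambda>n. q n x) \<longlonglongrightarrow> \<phi>' i x" unfolding q_def by (rule filterlim_compose)
    qed
    show "AE x in lborel. norm (q n x) \<le> M * indicator (cball 0 (\<rho> + 1)) x" for n
    proof (rule AE_I2)
      fix x
      define h where "h = inverse (real (Suc n))"
      have h: "h > 0" "h \<le> 1" by (auto simp: h_def field_simps)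
      have qh: "q n x = (\<phi> (x + h *\<^sub>R i) - \<phi> x) / h" by (simp only: q_def h_def)
      show "norm (q n x) \<le> M * indicator (cball 0 (\<rho> + 1)) x"
      proof (cases "\<phi> (x + h *\<^sub>R i) = 0 \<and> \<phi> x = 0")
        case True
        then show ?thesis using M(1) by (simp add: qh indicator_def)
      next
        case False
        have "norm x \<le> \<rho> + h"
        proof (cases "\<phi> x = 0")
          case True
          then have "norm (x + h *\<^sub>R i) \<le> \<rho>" using False \<rho>(2) by blast
          moreover have "norm x \<le> norm (x + h *\<^sub>R i) + norm (h *\<^sub>R i)"
            using norm_triangle_ineq4[of "x + h *\<^sub>R i" "h *\<^sub>R i"] by simp
          ultimately show ?thesis using i h by simp
        qed (use \<rho>(2)[of x] h in auto)
        then have inb: "x \<in> cball 0 (\<rho> + 1)" using h by simp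
        obtain t where t: "0 < t" "t < h" "\<phi> (x + h *\<^sub>R i) - \<phi> (x + 0 *\<^sub>R i) = (h - 0) * \<phi>' i (x + t *\<^sub>R i)"
          using MVT2[OF h(1), of "\<lambda>t. \<phi> (x + t *\<^sub>R i)" "\<lambda>t. \<phi>' i (x + t *\<^sub>R i)"] line by auto
        then have qe: "q n x = \<phi>' i (x + t *\<^sub>R i)" using h by (simp add: qh)
        show ?thesis
        proof (cases "norm (x + t *\<^sub>R i) \<le> \<rho> + 1")
          case True
          then show ?thesis using qe M(2) inb by simp
        next
          \<comment> \<open>The intermediate point may leave the ball on which \<open>M\<close> is a
            bound; there \<open>\<phi>\<close> vanishes on an open set and so does its
            derivative.\<close>
          case out: False
          have "open {y. norm y > \<rho>}" by (intro open_Collect_less continuous_intros)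
          moreover have "x + t *\<^sub>R i \<in> {y. norm y > \<rho>}" using out by simp
          moreover have "0 = \<phi> y" if "y \<in> {y. norm y > \<rho>}" for y using \<rho>(2)[of y] that by auto
          ultimately have "(\<phi> has_derivative (\<lambda>h. 0)) (at (x + t *\<^sub>R i))"
            by (rule has_derivative_transform_within_open[where f="\<lambda>_. 0", OF has_derivative_const])
          from has_derivative_unique[OF \<phi>'(2) this] sum_inner_Basis_unique[of "\<lambda>j. \<phi>' j (x + t *\<^sub>R i)" "\<lambda>_. 0" i] i
          have "\<phi>' i (x + t *\<^sub>R i) = 0" by auto
          then show ?thesis using qe M(1) by (simp add: indicator_def)
        qed
      qed
    qed
  qed (auto simp: q_def)
  moreover have "(\<integral>x. q n x \<partial>lborel) = 0" for n
    using integrable_lborel_translate[OF \<phi>i, of "inverse (real (Suc n)) *\<^sub>R i"] \<phi>i by (simp add: q_def)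
  ultimately have "(\<lambda>n::nat. 0) \<longlonglongrightarrow> (\<integral>x. \<phi>' i x \<partial>lborel)" by simp
  then have "(\<integral>x. \<phi>' i x \<partial>lborel) = 0" using LIMSEQ_unique[OF tendsto_const] by metis
  then show ?thesis by (simp add: fr)
qed

lemma weak_pair_const:
  assumes \<Omega>[measurable]: "\<Omega> \<in> sets borel" and bd: "bounded \<Omega>"
  shows "weak_pair \<Omega> (\<lambda>x. indicator \<Omega> x * s) (\<lambda>_. 0)"
proof -
  have fin: "emeasure lborel \<Omega> < \<infinity>" by (rule emeasure_bounded_finite[OF bd])
  have "sqint (\<lambda>x. indicator \<Omega> x * s)" by (rule sqint_indicator_bounded[OF _ \<Omega> fin, where c="\<bar>s\<bar>"]) auto
  moreover have "(\<integral>x. (indicator \<Omega> x * s) * frechet_derivative \<phi> (at x) i \<partial>lborel) = 0" if "test_fun \<Omega> \<phi>" "i \<in> Basis" for \<phi> i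
  proof -
    have "(\<integral>x. (indicator \<Omega> x * s) * frechet_derivative \<phi> (at x) i \<partial>lborel) = (\<integral>x. s * frechet_derivative \<phi> (at x) i \<partial>lborel)"
      using test_fun_sqint(4)[OF that] by (intro Bochner_Integration.integral_cong) (auto simp: indicator_def)
    then show ?thesis by (simp add: test_fun_deriv_integral_0[OF that])
  qed
  ultimately show ?thesis by (simp add: weak_pair_def)
qed

section \<open>The Sobolev space as an orthogonal complement\<close>

text \<open>Orthogonality to the first family forces both components to vanish outside the domain.
  For the second family it reads: the integral of g_i \<phi> plus that of (u/\<alpha>) \<alpha> d_i
  \<phi> is 0, which is the definition of the weak gradient.\<close>

definition h1_annihilator :: "'a::euclidean_space set \<Rightarrow> ('a \<Rightarrow> real) \<Rightarrow> (('a, 'a) l2 \<times> ('a, real) l2) set" where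
  "h1_annihilator \<Omega> \<alpha> = {(mk h1, mk h2) | h1 h2. sqint h1 \<and> sqint h2 \<and> (\<forall>x\<in>\<Omega>. h1 x = 0 \<and> h2 x = 0)} \<union>
    {(mk (\<lambda>x. \<phi> x *\<^sub>R i), mk (\<lambda>x. \<alpha> x * frechet_derivative \<phi> (at x) i)) | \<phi> i. test_fun \<Omega> \<phi> \<and> i \<in> Basis}"

text \<open>The pairs \<open>(\<nabla>u, u / \<alpha>)\<close> with \<open>u \<in> H\<^sup>1(\<Omega>)\<close>, extended by zero; as an
  orthogonal complement this is visibly a closed subspace.\<close>
definition h1_space :: "'a::euclidean_space set \<Rightarrow> ('a \<Rightarrow> real) \<Rightarrow> (('a, 'a) l2 \<times> ('a, real) l2) set" where
  "h1_space \<Omega> \<alpha> = {w. \<forall>z\<in>h1_annihilator \<Omega> \<alpha>. inner w z = 0}"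

lemma subspace_h1_space: "subspace (h1_space \<Omega> \<alpha>)"
  by (auto simp: subspace_def h1_space_def inner_add_left)

lemma closed_h1_space: "closed (h1_space \<Omega> \<alpha>)"
proof -
  have "h1_space \<Omega> \<alpha> = (\<Inter>z\<in>h1_annihilator \<Omega> \<alpha>. {w. inner w z = 0})" by (auto simp: h1_space_def)
  moreover have "closed {w. inner w z = 0}" for z :: "('a, 'a) l2 \<times> ('a, real) l2"
    by (intro closed_Collect_eq continuous_intros)
  ultimately show ?thesis by auto
qed

locale h1_weight =
  fixes \<Omega> :: "'a::euclidean_space set" and \<alpha> :: "'a \<Rightarrow> real" and l L :: real
  assumes O_meas [measurable]: "\<Omega> \<in> sets borel" and \<alpha>_meas [measurable]: "\<alpha> \<in> borel_measurable borel"
    and l0: "l > 0" and \<alpha>_lower: "\<And>x. l \<le> \<alpha> x" and \<alpha>_upper: "\<And>x. \<alpha> x \<le> L"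
begin

lemma \<alpha>_pos: "\<alpha> x > 0" using \<alpha>_lower[of x] l0 by linarith

lemma sqint_div: assumes "sqint u" shows "sqint (\<lambda>x. u x / \<alpha> x)"
proof -
  have "\<bar>1 / \<alpha> x\<bar> \<le> 1 / l" for x using \<alpha>_lower[of x] l0 \<alpha>_pos[of x] by (simp add: frac_le)
  from sqint_bounded_mult[OF assms _ this] show ?thesis by simp
qed

lemma sqint_mult: assumes "sqint (u :: 'a \<Rightarrow> real)" shows "sqint (\<lambda>x. \<alpha> x * u x)"
proof -
  have "\<bar>\<alpha> x\<bar> \<le> L" for x using \<alpha>_upper[of x] \<alpha>_pos[of x] by simp
  from sqint_bounded_mult[OF assms \<alpha>_meas this] show ?thesis by simp
qed

lemma sqint_test:
  assumes "test_fun \<Omega> \<phi>" "i \<in> Basis"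
  shows "sqint (\<lambda>x. \<phi> x *\<^sub>R i)" "sqint (\<lambda>x. \<alpha> x * frechet_derivative \<phi> (at x) i)"
proof -
  note s = test_fun_sqint(1)[OF assms]
  note [measurable] = sqint_measurable[OF s]
  show "sqint (\<lambda>x. \<phi> x *\<^sub>R i)" by (rule sqint_norm_le[OF s]) (use assms(2) in simp_all)
  show "sqint (\<lambda>x. \<alpha> x * frechet_derivative \<phi> (at x) i)" by (rule sqint_mult[OF test_fun_sqint(2)[OF assms]])
qed

lemma h1_spaceI:
  assumes wp: "weak_pair \<Omega> u g"
  shows "(mk g, mk (\<lambda>x. u x / \<alpha> x)) \<in> h1_space \<Omega> \<alpha>"
  unfolding h1_space_def
proof (intro CollectI ballI)
  fix z assume "z \<in> h1_annihilator \<Omega> \<alpha>"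
  have us: "sqint u" and gs: "sqint g" and z0: "\<And>x. x \<notin> \<Omega> \<Longrightarrow> u x = 0" "\<And>x. x \<notin> \<Omega> \<Longrightarrow> g x = 0"
    using wp by (auto simp: weak_pair_def)
  have ud: "sqint (\<lambda>x. u x / \<alpha> x)" by (rule sqint_div[OF us])
  from \<open>z \<in> h1_annihilator \<Omega> \<alpha>\<close> consider
    (a) h1 h2 where "z = (mk h1, mk h2)" "sqint h1" "sqint h2" "\<And>x. x \<in> \<Omega> \<Longrightarrow> h1 x = 0" "\<And>x. x \<in> \<Omega> \<Longrightarrow> h2 x = 0"
    | (b) \<phi> i where "z = (mk (\<lambda>x. \<phi> x *\<^sub>R i), mk (\<lambda>x. \<alpha> x * frechet_derivative \<phi> (at x) i))" "test_fun \<Omega> \<phi>" "i \<in> Basis"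
    unfolding h1_annihilator_def by blast
  then show "inner (mk g, mk (\<lambda>x. u x / \<alpha> x)) z = 0"
  proof cases
    case a
    have "g x \<bullet> h1 x = 0" for x using z0(2)[of x] a(4)[of x] by (cases "x \<in> \<Omega>") auto
    moreover have "u x / \<alpha> x * h2 x = 0" for x using z0(1)[of x] a(5)[of x] by (cases "x \<in> \<Omega>") auto
    ultimately show ?thesis by (simp only: a(1) inner_prod_def fst_conv snd_conv inner_mk[OF gs a(2)] inner_mk[OF ud a(3)] inner_real_def) simp
  next
    case b
    have "inner (mk g, mk (\<lambda>x. u x / \<alpha> x)) z = (\<integral>x. g x \<bullet> (\<phi> x *\<^sub>R i) \<partial>lborel) + (\<integral>x. u x / \<alpha> x * (\<alpha> x * frechet_derivative \<phi> (at x) i) \<partial>lborel)"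
      by (simp only: b(1) inner_prod_def fst_conv snd_conv inner_mk[OF gs sqint_test(1)[OF b(2,3)]] inner_mk[OF ud sqint_test(2)[OF b(2,3)]] inner_real_def)
    also have "(\<integral>x. u x / \<alpha> x * (\<alpha> x * frechet_derivative \<phi> (at x) i) \<partial>lborel) = (\<integral>x. u x * frechet_derivative \<phi> (at x) i \<partial>lborel)"
      using less_imp_neq[OF \<alpha>_pos] by (intro Bochner_Integration.integral_cong) auto
    also have "\<dots> = - (\<integral>x. (g x \<bullet> i) * \<phi> x \<partial>lborel)" using wp b by (simp add: weak_pair_def)
    finally show ?thesis by (simp add: mult.commute)
  qed
qed

text \<open>Both components are split into the parts inside and outside the domain. The outside part
  belongs to the annihilator, and pairing with it gives the sum of the squared norms of the two
  outside parts, which must therefore be 0.\<close>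

lemma h1_spaceE:
  assumes w: "(G, f) \<in> h1_space \<Omega> \<alpha>"
  shows "\<exists>u g. weak_pair \<Omega> u g \<and> G = mk g \<and> f = mk (\<lambda>x. u x / \<alpha> x)"
proof -
  have orth: "inner G z1 + inner f z2 = 0" if "(z1, z2) \<in> h1_annihilator \<Omega> \<alpha>" for z1 z2
    using w that by (auto simp: h1_space_def)
  define g where "g = (\<lambda>x. indicator \<Omega> x *\<^sub>R fn G x)"
  define f0 where "f0 = (\<lambda>x. indicator \<Omega> x *\<^sub>R fn f x)"
  define g1 where "g1 = (\<lambda>x. indicator (- \<Omega>) x *\<^sub>R fn G x)"
  define f1 where "f1 = (\<lambda>x. indicator (- \<Omega>) x *\<^sub>R fn f x)"
  have ind: "\<bar>indicator B x :: real\<bar> \<le> 1" for B x by (simp add: indicator_def)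
  have gs: "sqint g" and fs: "sqint f0" and g1s: "sqint g1" and f1s: "sqint f1"
    unfolding g_def f0_def g1_def f1_def by (rule sqint_bounded_mult[OF sqint_fn _ ind], measurable)+
  have "\<forall>x\<in>\<Omega>. g1 x = 0 \<and> f1 x = 0" by (simp add: g1_def f1_def)
  then have "(mk g1, mk f1) \<in> h1_annihilator \<Omega> \<alpha>" unfolding h1_annihilator_def using g1s f1s by blast
  from orth[OF this] have "inner G (mk g1) + inner f (mk f1) = 0" .
  moreover have "inner G (mk g1) = (norm (mk g1))\<^sup>2"
  proof -
    have "inner G (mk g1) = (\<integral>x. fn G x \<bullet> g1 x \<partial>lborel)" using inner_mk[OF sqint_fn[of G] g1s] by simp
    also have "\<dots> = (norm (mk g1))\<^sup>2" unfolding norm_mk[OF g1s]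
      by (intro Bochner_Integration.integral_cong refl) (simp add: g1_def indicator_def dot_square_norm)
    finally show ?thesis .
  qed
  moreover have "inner f (mk f1) = (norm (mk f1))\<^sup>2"
  proof -
    have "inner f (mk f1) = (\<integral>x. fn f x * f1 x \<partial>lborel)" using inner_mk[OF sqint_fn[of f] f1s] by simp
    also have "\<dots> = (norm (mk f1))\<^sup>2" unfolding norm_mk[OF f1s]
      by (intro Bochner_Integration.integral_cong refl) (auto simp: f1_def indicator_def power2_eq_square)
    finally show ?thesis .
  qed
  ultimately have "(norm (mk g1))\<^sup>2 + (norm (mk f1))\<^sup>2 = 0" by linarith
  then have z: "mk g1 = 0" "mk f1 = 0" by (simp_all add: add_nonneg_eq_0_iff)
  have "mk g + mk g1 = mk (fn G)" unfolding mk_add[OF gs g1s]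
    by (rule arg_cong[where f=mk]) (auto simp: g_def g1_def fun_eq_iff indicator_def)
  then have Gg: "G = mk g" using z by simp
  have "mk f0 + mk f1 = mk (fn f)" unfolding mk_add[OF fs f1s]
    by (rule arg_cong[where f=mk]) (auto simp: f0_def f1_def fun_eq_iff indicator_def)
  then have ff: "f = mk f0" using z by simp
  define u where "u = (\<lambda>x. \<alpha> x * f0 x)"
  have us: "sqint u" unfolding u_def by (rule sqint_mult[OF fs])
  have uf: "(\<lambda>x. u x / \<alpha> x) = f0" using less_imp_neq[OF \<alpha>_pos] by (auto simp: u_def fun_eq_iff)
  have "(\<integral>x. u x * frechet_derivative \<phi> (at x) i \<partial>lborel) = - (\<integral>x. (g x \<bullet> i) * \<phi> x \<partial>lborel)"
    if t: "test_fun \<Omega> \<phi>" "i \<in> Basis" for \<phi> i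
  proof -
    have "(mk (\<lambda>x. \<phi> x *\<^sub>R i), mk (\<lambda>x. \<alpha> x * frechet_derivative \<phi> (at x) i)) \<in> h1_annihilator \<Omega> \<alpha>"
      unfolding h1_annihilator_def using t by blast
    from orth[OF this] have "(\<integral>x. g x \<bullet> (\<phi> x *\<^sub>R i) \<partial>lborel) + (\<integral>x. f0 x * (\<alpha> x * frechet_derivative \<phi> (at x) i) \<partial>lborel) = 0"
      unfolding Gg ff inner_mk[OF gs sqint_test(1)[OF t]] inner_mk[OF fs sqint_test(2)[OF t]] by simp
    moreover have "(\<integral>x. f0 x * (\<alpha> x * frechet_derivative \<phi> (at x) i) \<partial>lborel) = (\<integral>x. u x * frechet_derivative \<phi> (at x) i \<partial>lborel)"
      by (simp add: u_def mult_ac)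
    moreover have "(\<integral>x. g x \<bullet> (\<phi> x *\<^sub>R i) \<partial>lborel) = (\<integral>x. (g x \<bullet> i) * \<phi> x \<partial>lborel)" by (simp add: mult.commute)
    ultimately show ?thesis by linarith
  qed
  then have "weak_pair \<Omega> u g" unfolding weak_pair_def using us gs by (auto simp: u_def f0_def g_def)
  then show ?thesis using Gg ff uf by metis
qed

text \<open>Division by \<open>\<alpha>\<close> is a continuous multiplication operator on L^2, so
  the compactness for \<open>u\<close> carries over to \<open>u / \<alpha>\<close>. The constant
  \<open>K\<close> bounds both squared norms, using |u| at most L |u/\<alpha>|.\<close>

lemma h1_space_compact:
  assumes dom: "smooth_bounded_domain \<Omega>"
  shows "compact (closure (snd ` {w \<in> h1_space \<Omega> \<alpha>. norm w \<le> R}))"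
proof -
  define K where "K = max (L\<^sup>2 * R\<^sup>2) (R\<^sup>2)"
  have b: "\<bar>1 / \<alpha> x\<bar> \<le> 1 / l" for x using \<alpha>_lower[of x] l0 \<alpha>_pos[of x] by (simp add: frac_le)
  have m: "(\<lambda>x. 1 / \<alpha> x) \<in> borel_measurable borel" by measurable
  have "compact (l2_mult (\<lambda>x. 1 / \<alpha> x) ` closure (mk ` h1_ball \<Omega> K))"
    by (intro compact_continuous_image rellich[OF dom] l2_mult_continuous[OF m b])
  moreover have "snd ` {w \<in> h1_space \<Omega> \<alpha>. norm w \<le> R} \<subseteq> l2_mult (\<lambda>x. 1 / \<alpha> x) ` closure (mk ` h1_ball \<Omega> K)"
  proof (rule image_subsetI)
    fix w assume "w \<in> {w \<in> h1_space \<Omega> \<alpha>. norm w \<le> R}"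
    then have w: "w \<in> h1_space \<Omega> \<alpha>" "norm w \<le> R" by auto
    obtain u g where ug: "weak_pair \<Omega> u g" "fst w = mk g" "snd w = mk (\<lambda>x. u x / \<alpha> x)"
      using h1_spaceE[of "fst w" "snd w"] w by auto
    have us: "sqint u" and gs: "sqint g" using ug(1) by (auto simp: weak_pair_def)
    have "norm (fst w) \<le> R" "norm (snd w) \<le> R" using w(2) norm_fst_le[of "fst w" "snd w"] norm_snd_le[of "snd w" "fst w"] by auto
    then have n: "(norm (mk g))\<^sup>2 \<le> R\<^sup>2" "(norm (mk (\<lambda>x. u x / \<alpha> x)))\<^sup>2 \<le> R\<^sup>2" unfolding ug(2,3)[symmetric] by (auto intro: power_mono)
    have "(\<integral>x. (norm (u x))\<^sup>2 \<partial>lborel) \<le> (\<integral>x. L\<^sup>2 * (norm (u x / \<alpha> x))\<^sup>2 \<partial>lborel)"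
    proof (rule integral_mono)
      show "integrable lborel (\<lambda>x. L\<^sup>2 * (norm (u x / \<alpha> x))\<^sup>2)" by (intro integrable_mult_right sqint_integrable sqint_div us)
      show "(norm (u x))\<^sup>2 \<le> L\<^sup>2 * (norm (u x / \<alpha> x))\<^sup>2" for x
      proof -
        have "\<bar>u x\<bar> = \<alpha> x * \<bar>u x / \<alpha> x\<bar>" using \<alpha>_pos[of x] by (simp add: abs_divide)
        also have "\<dots> \<le> L * \<bar>u x / \<alpha> x\<bar>" by (intro mult_right_mono \<alpha>_upper) simp
        finally have "\<bar>u x\<bar>\<^sup>2 \<le> (L * \<bar>u x / \<alpha> x\<bar>)\<^sup>2" by (intro power_mono) auto
        then show ?thesis by (simp only: power_mult_distrib real_norm_def)
      qed
    qed (rule sqint_integrable[OF us])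
    also have "\<dots> = L\<^sup>2 * (norm (mk (\<lambda>x. u x / \<alpha> x)))\<^sup>2" by (simp add: norm_mk[OF sqint_div[OF us]])
    also have "\<dots> \<le> L\<^sup>2 * R\<^sup>2" by (intro mult_left_mono n) simp
    finally have "(\<integral>x. (norm (u x))\<^sup>2 \<partial>lborel) \<le> K" by (simp add: K_def)
    moreover have "(\<integral>x. (norm (g x))\<^sup>2 \<partial>lborel) \<le> K" using n(1) by (simp add: norm_mk[OF gs] K_def)
    ultimately have "u \<in> h1_ball \<Omega> K" using ug(1) by (auto simp: h1_ball_def)
    then have "mk u \<in> closure (mk ` h1_ball \<Omega> K)" by (intro subsetD[OF closure_subset] imageI)
    moreover have "snd w = l2_mult (\<lambda>x. 1 / \<alpha> x) (mk u)"
      unfolding ug(3) l2_mult_def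
    proof (subst mk_eq_iff)
      show "sqint (\<lambda>x. u x / \<alpha> x)" by (rule sqint_div[OF us])
      show "sqint (\<lambda>x. (1 / \<alpha> x) *\<^sub>R fn (mk u) x)" by (rule sqint_bounded_mult[OF sqint_fn m b])
      show "AE x in lborel. u x / \<alpha> x = (1 / \<alpha> x) *\<^sub>R fn (mk u) x" using fn_mk[OF us] by eventually_elim simp
    qed
    ultimately show "snd w \<in> l2_mult (\<lambda>x. 1 / \<alpha> x) ` closure (mk ` h1_ball \<Omega> K)" by blast
  qed
  ultimately show ?thesis by (rule compact_closure_subset)
qed

end

section \<open>The variational formulation\<close>

lemma borel_measurable_fst_comp:
  fixes f :: "'a \<Rightarrow> 'b::euclidean_space \<times> 'c::euclidean_space"
  assumes "f \<in> borel_measurable M"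
  shows "(\<lambda>x. fst (f x)) \<in> borel_measurable M" "(\<lambda>x. snd (f x)) \<in> borel_measurable M"
  by (rule measurable_compose[OF assms borel_measurable_continuous_onI], intro continuous_intros)+

lemma sqint_Pair:
  fixes f :: "'a::euclidean_space \<Rightarrow> 'b::euclidean_space" and g :: "'a \<Rightarrow> 'c::euclidean_space"
  assumes "sqint f" "sqint g" shows "sqint (\<lambda>x. (f x, g x))"
proof (rule sqintI_bound)
  show "integrable lborel (\<lambda>x. (norm (f x))\<^sup>2 + (norm (g x))\<^sup>2)"
    using assms by (intro Bochner_Integration.integrable_add sqint_integrable)
  show "(\<lambda>x. (f x, g x)) \<in> borel_measurable borel" using assms by (intro borel_measurable_Pair sqint_measurable)
qed (simp add: norm_Pair)

lemma sqint_fst_comp: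
  fixes f :: "'a::euclidean_space \<Rightarrow> 'b::euclidean_space \<times> 'c::euclidean_space"
  assumes "sqint f" shows "sqint (\<lambda>x. fst (f x))" "sqint (\<lambda>x. snd (f x))"
proof -
  have n: "norm (fst p) \<le> norm p" "norm (snd p) \<le> norm p" for p :: "'b \<times> 'c"
    using norm_fst_le[of "fst p" "snd p"] norm_snd_le[of "snd p" "fst p"] by auto
  note m = borel_measurable_fst_comp[OF sqint_measurable[OF assms]]
  show "sqint (\<lambda>x. fst (f x))" by (rule sqint_norm_le[OF assms m(1) n(1)])
  show "sqint (\<lambda>x. snd (f x))" by (rule sqint_norm_le[OF assms m(2) n(2)])
qed

text \<open>The potential couples \<open>u\<close> and \<open>v\<close> pointwise, so
  \<open>K\<close> lives on L^2 of pairs, while the state space is a product of L^2 spaces. These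
  maps identify the two, with \<open>l2_fst\<close> and \<open>l2_snd\<close> as adjoints in the
  sense of \<open>inner_l2_pair\<close>.\<close>

definition l2_pair :: "('a::euclidean_space, 'b::euclidean_space) l2 \<Rightarrow> ('a, 'c::euclidean_space) l2 \<Rightarrow> ('a, 'b \<times> 'c) l2" where
  "l2_pair f g = mk (\<lambda>x. (fn f x, fn g x))"
definition l2_fst :: "('a::euclidean_space, 'b::euclidean_space \<times> 'c::euclidean_space) l2 \<Rightarrow> ('a, 'b) l2" where
  "l2_fst h = mk (\<lambda>x. fst (fn h x))"
definition l2_snd :: "('a::euclidean_space, 'b::euclidean_space \<times> 'c::euclidean_space) l2 \<Rightarrow> ('a, 'c) l2" where
  "l2_snd h = mk (\<lambda>x. snd (fn h x))"

lemma inner_l2_pair: "inner h (l2_pair f g) = inner (l2_fst h) f + inner (l2_snd h) g"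
proof -
  have s: "sqint (\<lambda>x. (fn f x, fn g x))" "sqint (\<lambda>x. fst (fn h x))" "sqint (\<lambda>x. snd (fn h x))"
    by (auto intro: sqint_Pair sqint_fst_comp)
  have "inner h (l2_pair f g) = (\<integral>x. fn h x \<bullet> (fn f x, fn g x) \<partial>lborel)"
    unfolding l2_pair_def using inner_mk[OF sqint_fn s(1), of h] by simp
  also have "\<dots> = (\<integral>x. fst (fn h x) \<bullet> fn f x + snd (fn h x) \<bullet> fn g x \<partial>lborel)"
    by (simp add: inner_prod_def)
  also have "\<dots> = (\<integral>x. fst (fn h x) \<bullet> fn f x \<partial>lborel) + (\<integral>x. snd (fn h x) \<bullet> fn g x \<partial>lborel)"
    by (intro Bochner_Integration.integral_add sqint_inner s sqint_fn)
  also have "\<dots> = inner (l2_fst h) f + inner (l2_snd h) g"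
    unfolding l2_fst_def l2_snd_def
    using inner_mk[OF s(2) sqint_fn, of f] inner_mk[OF s(3) sqint_fn, of g] by simp
  finally show ?thesis .
qed

lemma norm_l2_pair: "(norm (l2_pair f g))\<^sup>2 = (norm f)\<^sup>2 + (norm g)\<^sup>2"
proof -
  have "(norm (l2_pair f g))\<^sup>2 = (\<integral>x. (norm (fn f x))\<^sup>2 + (norm (fn g x))\<^sup>2 \<partial>lborel)"
    unfolding l2_pair_def norm_mk[OF sqint_Pair[OF sqint_fn sqint_fn]] by (simp add: norm_Pair)
  also have "\<dots> = (norm f)\<^sup>2 + (norm g)\<^sup>2"
    unfolding norm_fn by (intro Bochner_Integration.integral_add sqint_integrable sqint_fn)
  finally show ?thesis .
qed

lemma l2_pair_mk:
  assumes f: "sqint f" and g: "sqint g"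
  shows "l2_pair (mk f) (mk g) = mk (\<lambda>x. (f x, g x))"
  unfolding l2_pair_def
proof (subst mk_eq_iff[OF sqint_Pair[OF sqint_fn sqint_fn] sqint_Pair[OF f g]])
  show "AE x in lborel. (fn (mk f) x, fn (mk g) x) = (f x, g x)" using fn_mk[OF f] fn_mk[OF g] by eventually_elim simp
qed

lemma l2_fst_mk:
  assumes f: "sqint f" shows "l2_fst (mk f) = mk (\<lambda>x. fst (f x))" "l2_snd (mk f) = mk (\<lambda>x. snd (f x))"
proof -
  show "l2_fst (mk f) = mk (\<lambda>x. fst (f x))"
    unfolding l2_fst_def
  proof (subst mk_eq_iff[OF sqint_fst_comp(1)[OF sqint_fn] sqint_fst_comp(1)[OF f]])
    show "AE x in lborel. fst (fn (mk f) x) = fst (f x)" using fn_mk[OF f] by eventually_elim simp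
  qed
  show "l2_snd (mk f) = mk (\<lambda>x. snd (f x))"
    unfolding l2_snd_def
  proof (subst mk_eq_iff[OF sqint_fst_comp(2)[OF sqint_fn] sqint_fst_comp(2)[OF f]])
    show "AE x in lborel. snd (fn (mk f) x) = snd (f x)" using fn_mk[OF f] by eventually_elim simp
  qed
qed

lemma l2_pair_diff: "l2_pair f g - l2_pair f' g' = l2_pair (f - f') (g - g')"
  unfolding minus_l2_def[of f f'] minus_l2_def[of g g'] l2_pair_mk[OF sqint_diff[OF sqint_fn sqint_fn] sqint_diff[OF sqint_fn sqint_fn]]
  unfolding l2_pair_def mk_diff[OF sqint_Pair[OF sqint_fn sqint_fn] sqint_Pair[OF sqint_fn sqint_fn]] by simp

lemma l2_pair_scaleR: "l2_pair (r *\<^sub>R f) (r *\<^sub>R g) = r *\<^sub>R l2_pair f g"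
  unfolding scaleR_l2_def[of r f] scaleR_l2_def[of r g] l2_pair_mk[OF sqint_scaleR[OF sqint_fn] sqint_scaleR[OF sqint_fn]]
  unfolding l2_pair_def mk_scaleR[OF sqint_Pair[OF sqint_fn sqint_fn]] by simp

lemma l2_fst_diff: "l2_fst h - l2_fst h' = l2_fst (h - h')" "l2_snd h - l2_snd h' = l2_snd (h - h')"
proof -
  note d = sqint_diff[OF sqint_fn[of h] sqint_fn[of h']]
  show "l2_fst h - l2_fst h' = l2_fst (h - h')"
    unfolding minus_l2_def[of h h'] l2_fst_mk(1)[OF d]
    unfolding l2_fst_def mk_diff[OF sqint_fst_comp(1)[OF sqint_fn] sqint_fst_comp(1)[OF sqint_fn]] by simp
  show "l2_snd h - l2_snd h' = l2_snd (h - h')"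
    unfolding minus_l2_def[of h h'] l2_fst_mk(2)[OF d]
    unfolding l2_snd_def mk_diff[OF sqint_fst_comp(2)[OF sqint_fn] sqint_fst_comp(2)[OF sqint_fn]] by simp
qed

lemma norm_l2_fst: "norm (l2_fst h) \<le> norm h" "norm (l2_snd h) \<le> norm h"
proof -
  have eq: "l2_pair (l2_fst h) (l2_snd h) = h"
    unfolding l2_fst_def l2_snd_def l2_pair_mk[OF sqint_fst_comp[OF sqint_fn]] by simp
  have "(norm (l2_fst h))\<^sup>2 \<le> (norm h)\<^sup>2" "(norm (l2_snd h))\<^sup>2 \<le> (norm h)\<^sup>2"
    using norm_l2_pair[of "l2_fst h" "l2_snd h"] unfolding eq by auto
  then show "norm (l2_fst h) \<le> norm h" "norm (l2_snd h) \<le> norm h" by (auto intro: power2_le_imp_le)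
qed

lemma l2_fst_zero: "l2_fst 0 = 0" "l2_snd 0 = 0"
  using norm_l2_fst[of 0] by auto

lemma continuous_l2_fst: "continuous_on S l2_fst" "continuous_on S l2_snd"
  by (rule lipschitz_on_continuous_on[of 1], rule lipschitz_onI, simp add: dist_norm l2_fst_diff norm_l2_fst, simp)+

lemma continuous_l2_pair: "continuous_on S (\<lambda>p. l2_pair (fst p) (snd p))"
proof (rule lipschitz_on_continuous_on[of 1], rule lipschitz_onI)
  fix p q :: "('a, 'b) l2 \<times> ('a, 'c) l2"
  have "(norm (l2_pair (fst (p - q)) (snd (p - q))))\<^sup>2 = (norm (p - q))\<^sup>2"
    unfolding norm_l2_pair by (simp add: norm_prod_def)
  then have "norm (l2_pair (fst (p - q)) (snd (p - q))) = norm (p - q)" by (simp add: power2_eq_iff_nonneg)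
  then show "dist (l2_pair (fst p) (snd p)) (l2_pair (fst q) (snd q)) \<le> 1 * dist p q"
    by (simp add: dist_norm l2_pair_diff)
qed simp

section \<open>The energy on pairs of Sobolev functions\<close>

text \<open>Read as ((grad u, u/\<alpha>), (grad v, v/\<beta>)).\<close>

type_synonym 'a h1_pair = "(('a, 'a) l2 \<times> ('a, real) l2) \<times> (('a, 'a) l2 \<times> ('a, real) l2)"

locale neumann_problem = weighted_potential F Fs Ft \<Omega> \<kappa> \<alpha> \<beta> \<Lambda> L
  for F Fs Ft and \<Omega> :: "'a::euclidean_space set" and \<kappa> \<alpha> \<beta> \<Lambda> L +
  fixes l :: real
  assumes dom: "smooth_bounded_domain \<Omega>"
    and l0: "l > 0" and \<alpha>_lower: "\<And>x. l \<le> \<alpha> x" and \<beta>_lower: "\<And>x. l \<le> \<beta> x"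
begin

sublocale A: h1_weight \<Omega> \<alpha> l L
proof
  show "\<alpha> x \<le> L" for x using \<alpha>_bound[of x] by linarith
qed (fact l0 \<alpha>_lower Om_meas \<alpha>_meas)+

sublocale B: h1_weight \<Omega> \<beta> l L
proof
  show "\<beta> x \<le> L" for x using \<beta>_bound[of x] by linarith
qed (fact l0 \<beta>_lower Om_meas \<beta>_meas)+

definition W :: "'a h1_pair set" where "W = h1_space \<Omega> \<alpha> \<times> h1_space \<Omega> \<beta>"
text \<open>\<open>J\<close> forgets the gradients and is compact on \<open>W\<close>.
  \<open>NJ\<close> is its adjoint applied after \<open>N\<close> and \<open>J\<close>, that is, the
  gradient of \<open>K\<close> composed with \<open>J\<close>.\<close>

definition J :: "'a h1_pair \<Rightarrow> ('a, real \<times> real) l2" where "J w = l2_pair (snd (fst w)) (snd (snd w))"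
definition NJ :: "'a h1_pair \<Rightarrow> 'a h1_pair" where "NJ w = ((0, l2_fst (N (J w))), (0, l2_snd (N (J w))))"

lemma W_subspace: "subspace W" "closed W"
  unfolding W_def
  by (intro subspace_Times subspace_h1_space, intro closed_Times closed_h1_space)

lemma J_diff: "J w - J w' = J (w - w')" by (simp add: J_def l2_pair_diff)

lemma J_scaleR: "J (r *\<^sub>R w) = r *\<^sub>R J w" by (simp add: J_def l2_pair_scaleR)

lemma J_zero: "J 0 = 0" using J_scaleR[of 0 0] by simp

lemma norm_J: "norm (J w) \<le> norm w"
proof -
  have "(norm (J w))\<^sup>2 = (norm (snd (fst w)))\<^sup>2 + (norm (snd (snd w)))\<^sup>2" by (simp add: J_def norm_l2_pair)
  also have "\<dots> \<le> (norm (fst w))\<^sup>2 + (norm (snd w))\<^sup>2"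
    using norm_snd_le[of "snd (fst w)" "fst (fst w)"] norm_snd_le[of "snd (snd w)" "fst (snd w)"]
    by (intro add_mono power_mono) auto
  also have "\<dots> = (norm w)\<^sup>2" by (simp add: norm_prod_def)
  finally show ?thesis by (rule power2_le_imp_le) simp
qed

lemma J_continuous: "continuous_on T J"
  by (rule lipschitz_on_continuous_on[of 1], rule lipschitz_onI)
     (use norm_J in \<open>auto simp: dist_norm J_diff simp del: split_paired_All\<close>)

lemma inner_NJ: "inner (NJ w) z = inner (N (J w)) (J z)"
  by (simp add: NJ_def J_def[of z] inner_l2_pair inner_prod_def)

lemma NJ_zero: "NJ 0 = 0"
  by (simp add: NJ_def J_zero N_zero l2_fst_zero) (simp add: zero_prod_def)

lemma J_compact: "compact (closure (J ` {w \<in> W. norm w \<le> R}))"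
proof -
  let ?A = "closure (snd ` {w \<in> h1_space \<Omega> \<alpha>. norm w \<le> R})" and ?B = "closure (snd ` {w \<in> h1_space \<Omega> \<beta>. norm w \<le> R})"
  have "compact ((\<lambda>p. l2_pair (fst p) (snd p)) ` (?A \<times> ?B))"
    by (intro compact_continuous_image continuous_l2_pair compact_Times A.h1_space_compact[OF dom] B.h1_space_compact[OF dom])
  moreover have "J ` {w \<in> W. norm w \<le> R} \<subseteq> (\<lambda>p. l2_pair (fst p) (snd p)) ` (?A \<times> ?B)"
  proof (rule image_subsetI)
    fix w assume "w \<in> {w \<in> W. norm w \<le> R}"
    then have w: "fst w \<in> h1_space \<Omega> \<alpha>" "snd w \<in> h1_space \<Omega> \<beta>" "norm w \<le> R" by (auto simp: W_def)
    have "norm (fst w) \<le> R" "norm (snd w) \<le> R"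
      using w(3) norm_fst_le[of "fst w" "snd w"] norm_snd_le[of "snd w" "fst w"] by auto
    then have "snd (fst w) \<in> ?A" "snd (snd w) \<in> ?B" using w by (auto intro!: subsetD[OF closure_subset] imageI)
    then show "J w \<in> (\<lambda>p. l2_pair (fst p) (snd p)) ` (?A \<times> ?B)"
      unfolding J_def by (intro image_eqI[of _ _ "(snd (fst w), snd (snd w))"]) auto
  qed
  ultimately show ?thesis by (rule compact_closure_subset)
qed

text \<open>The hypothesis says that the constant pair (s, t), whose gradients vanish, has negative
  energy. It plays the part of the vector \<open>e\<close> in the abstract theorem.\<close>

lemma two_critical_points:
  assumes e: "(\<integral>x. indicator \<Omega> x * (s\<^sup>2 / (\<alpha> x)\<^sup>2 + t\<^sup>2 / (\<beta> x)\<^sup>2) \<partial>lborel) / 2 < (\<integral>x. \<kappa> x * F s t \<partial>lborel)"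
  shows "\<exists>w1\<in>W. \<exists>w2\<in>W. w1 \<noteq> 0 \<and> w2 \<noteq> 0 \<and> w1 \<noteq> w2 \<and> orth_proj W (NJ w1) = w1 \<and> orth_proj W (NJ w2) = w2"
proof -
  define KJ where "KJ = (\<lambda>w. K (J w))"
  have bd: "bounded \<Omega>" using dom by (simp add: smooth_bounded_domain_def)
  have S: "\<exists>C\<ge>0. \<forall>f f'. norm f \<le> R \<longrightarrow>
        \<bar>KJ f' - KJ f - inner (NJ f) (f' - f)\<bar> \<le> e * norm (f' - f) + C * (norm (f' - f))\<^sup>2" if e: "e > 0" for R e
  proof -
    obtain C where C: "C \<ge> 0" "\<And>f f'. norm f \<le> R \<Longrightarrow> \<bar>K f' - K f - inner (N f) (f' - f)\<bar> \<le> e * norm (f' - f) + C * (norm (f' - f))\<^sup>2"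
      using K_expansion[OF e, of R] by blast
    have "\<bar>KJ f' - KJ f - inner (NJ f) (f' - f)\<bar> \<le> e * norm (f' - f) + C * (norm (f' - f))\<^sup>2" if f: "norm f \<le> R" for f f'
    proof -
      have "norm (J f) \<le> R" using norm_J[of f] f by linarith
      from C(2)[OF this, of "J f'"]
      have "\<bar>KJ f' - KJ f - inner (NJ f) (f' - f)\<bar> \<le> e * norm (J (f' - f)) + C * (norm (J (f' - f)))\<^sup>2"
        by (simp add: KJ_def inner_NJ J_diff)
      also have "\<dots> \<le> e * norm (f' - f) + C * (norm (f' - f))\<^sup>2"
        using e C(1) norm_J by (intro add_mono mult_left_mono power_mono) auto
      finally show ?thesis .
    qed
    with C(1) show ?thesis by blast
  qed
  have NJc: "continuous_on UNIV NJ"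
  proof -
    have "continuous_on UNIV (\<lambda>w. N (J w))" by (rule continuous_on_compose2[OF N_continuous J_continuous]) auto
    then show ?thesis unfolding NJ_def
      by (intro continuous_intros continuous_on_compose2[OF continuous_l2_fst(1)[of UNIV]] continuous_on_compose2[OF continuous_l2_fst(2)[of UNIV]]) auto
  qed
  have cpt: "\<exists>l r. strict_mono (r::nat \<Rightarrow> nat) \<and> (\<lambda>n. NJ (X (r n))) \<longlonglongrightarrow> l"
    if X: "\<forall>n. X n \<in> W \<and> norm (X n) \<le> R" for R X
  proof -
    have mem: "\<forall>n. J (X n) \<in> closure (J ` {w \<in> W. norm w \<le> R})" using X by (auto intro!: subsetD[OF closure_subset] imageI)
    obtain f r where r: "strict_mono (r::nat\<Rightarrow>nat)" "((\<lambda>n. J (X n)) \<circ> r) \<longlonglongrightarrow> f"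
      by (rule seq_compactE[OF compact_imp_seq_compact[OF J_compact[of R]] mem]) blast
    have "(\<lambda>n. N (J (X (r n)))) \<longlonglongrightarrow> N f"
      using continuous_on_tendsto_compose[OF N_continuous r(2)] by (simp add: o_def)
    then have "(\<lambda>n. NJ (X (r n))) \<longlonglongrightarrow> ((0, l2_fst (N f)), (0, l2_snd (N f)))"
      unfolding NJ_def
      by (intro tendsto_intros continuous_on_tendsto_compose[OF continuous_l2_fst(1)[of UNIV]] continuous_on_tendsto_compose[OF continuous_l2_fst(2)[of UNIV]]) auto
    with r(1) show ?thesis by blast
  qed
  have "KJ 0 = 0" by (simp add: KJ_def J_zero K_zero)
  \<comment> \<open>Each nonzero \<open>w\<close> in \<open>W\<close> is \<open>norm w\<close> times
    a unit vector, and \<open>J\<close> maps the unit ball of \<open>W\<close> into a compact set;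
    the uniform o(r^2) along rays thus gives the estimate on a whole ball of
    \<open>W\<close>.\<close>
  obtain r0 where r0: "r0 > 0" "\<And>f r. f \<in> closure (J ` {w \<in> W. norm w \<le> 1}) \<Longrightarrow> 0 \<le> r \<Longrightarrow> r \<le> r0 \<Longrightarrow> K (r *\<^sub>R f) \<le> 1/4 * r\<^sup>2"
    using K_small[OF J_compact[of 1], of "1/4"] by auto
  have small: "KJ w \<le> (norm w)\<^sup>2 / 4" if w: "w \<in> W" "norm w \<le> r0" for w
  proof (cases "w = 0")
    case True
    then show ?thesis by (simp add: \<open>KJ 0 = 0\<close>)
  next
    case False
    define z where "z = (1 / norm w) *\<^sub>R w"
    have "z \<in> W" "norm z \<le> 1" using w(1) W_subspace(1) False by (auto simp: z_def subspace_scale)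
    then have "J z \<in> closure (J ` {w \<in> W. norm w \<le> 1})" by (auto intro!: subsetD[OF closure_subset] imageI)
    from r0(2)[OF this _ w(2)] have "K (norm w *\<^sub>R J z) \<le> 1/4 * (norm w)\<^sup>2" by simp
    moreover have "norm w *\<^sub>R J z = J w" using False by (simp add: z_def J_scaleR)
    ultimately show ?thesis by (simp add: KJ_def)
  qed
  obtain C0 where C0: "\<And>f. K f \<le> 1/4 * (norm f)\<^sup>2 + C0" using K_coercive[of "1/4"] by auto
  have coerc: "KJ w \<le> (norm w)\<^sup>2 / 4 + C0" for w
    using C0[of "J w"] power_mono[OF norm_J norm_ge_zero, of w 2] unfolding KJ_def by linarith
  define us where "us = (\<lambda>x. indicator \<Omega> x * s)"
  define vt where "vt = (\<lambda>x. indicator \<Omega> x * t)"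
  have wpu: "weak_pair \<Omega> us (\<lambda>_. 0)" and wpv: "weak_pair \<Omega> vt (\<lambda>_. 0)"
    unfolding us_def vt_def by (rule weak_pair_const[OF Om_meas bd])+
  have sus: "sqint (\<lambda>x. us x / \<alpha> x)" and svt: "sqint (\<lambda>x. vt x / \<beta> x)"
    using wpu wpv by (auto simp: weak_pair_def intro: A.sqint_div B.sqint_div)
  define w0 :: "'a h1_pair" where "w0 = ((mk (\<lambda>_. 0), mk (\<lambda>x. us x / \<alpha> x)), (mk (\<lambda>_. 0), mk (\<lambda>x. vt x / \<beta> x)))"
  have w0W: "w0 \<in> W" unfolding W_def w0_def using A.h1_spaceI[OF wpu] B.h1_spaceI[OF wpv] by blast
  have Jw0: "J w0 = mk (\<lambda>x. (us x / \<alpha> x, vt x / \<beta> x))"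
    unfolding J_def w0_def by (simp add: l2_pair_mk[OF sus svt])
  have "KJ w0 = (\<integral>x. Phi x (us x / \<alpha> x, vt x / \<beta> x) \<partial>lborel)"
    unfolding KJ_def Jw0 by (rule K_mk[OF sqint_Pair[OF sus svt]])
  also have "\<dots> = (\<integral>x. \<kappa> x * F s t \<partial>lborel)"
  proof (intro Bochner_Integration.integral_cong refl)
    fix x
    show "Phi x (us x / \<alpha> x, vt x / \<beta> x) = \<kappa> x * F s t"
      using A.\<alpha>_pos[of x] B.\<alpha>_pos[of x] \<kappa>_out[of x] by (cases "x \<in> \<Omega>") (auto simp: Phi_def S_def V_def us_def vt_def)
  qed
  finally have Kw0: "KJ w0 = (\<integral>x. \<kappa> x * F s t \<partial>lborel)" .
  have "(norm w0)\<^sup>2 = (norm (mk (\<lambda>x. us x / \<alpha> x)))\<^sup>2 + (norm (mk (\<lambda>x. vt x / \<beta> x)))\<^sup>2"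
    unfolding w0_def zero_l2_def[symmetric] by (simp add: norm_prod_def)
  also have "\<dots> = (\<integral>x. (norm (us x / \<alpha> x))\<^sup>2 + (norm (vt x / \<beta> x))\<^sup>2 \<partial>lborel)"
    unfolding norm_mk[OF sus] norm_mk[OF svt] by (intro Bochner_Integration.integral_add[symmetric] sqint_integrable sus svt)
  also have "\<dots> = (\<integral>x. indicator \<Omega> x * (s\<^sup>2 / (\<alpha> x)\<^sup>2 + t\<^sup>2 / (\<beta> x)\<^sup>2) \<partial>lborel)"
    by (intro Bochner_Integration.integral_cong refl) (auto simp: us_def vt_def indicator_def power_divide)
  finally have w0: "(norm w0)\<^sup>2 / 2 < KJ w0" using e Kw0 by simp
  show ?thesis
  proof (rule two_nontrivial_critical_points[where K=KJ and N=NJ and ?r0.0=r0 and ?C0.0=C0 and e=w0, OF W_subspace])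
    show "KJ u \<ge> 0" for u by (simp add: KJ_def K_nonneg)
    show "KJ u \<le> (norm u)\<^sup>2 / 4 + C0" for u by (rule coerc)
  qed (fact S NJc cpt \<open>KJ 0 = 0\<close> NJ_zero r0(1) small w0W w0)+
qed

text \<open>A critical point is recovered from its image under \<open>J\<close> as the projection of
  \<open>NJ w\<close>. Distinctness and nontriviality can hence be read off \<open>u\<close> and
  \<open>v\<close> alone, without looking at gradients.\<close>

lemma critical_point_unique:
  assumes "orth_proj W (NJ w) = w" "orth_proj W (NJ w') = w'" "J w = J w'"
  shows "w = w'"
proof -
  have "NJ w = NJ w'" using assms(3) by (simp add: NJ_def)
  then show ?thesis using assms(1,2) by metis
qed

text \<open>A fixed point satisfies \<open>inner w z = inner (NJ w) z\<close> for all
  \<open>z\<close> in \<open>W\<close>. Taking \<open>z\<close> with one component 0 separates the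
  two equations, and the quotients by \<open>\<alpha>\<close> combine to the weight
  \<open>1 / \<alpha>^2\<close>, which is the coefficient \<open>a\<close>.\<close>

lemma critical_point_solution:
  assumes w: "w \<in> W" and crit: "orth_proj W (NJ w) = w"
  shows "\<exists>u v gu gv. weak_pair \<Omega> u gu \<and> weak_pair \<Omega> v gv \<and> J w = mk (\<lambda>x. (u x / \<alpha> x, v x / \<beta> x)) \<and>
    (\<forall>\<phi> g. weak_pair \<Omega> \<phi> g \<longrightarrow> (\<integral>x. gu x \<bullet> g x + u x * \<phi> x / (\<alpha> x)\<^sup>2 \<partial>lborel) = (\<integral>x. \<kappa> x * Fs (u x) (v x) * \<phi> x \<partial>lborel)) \<and>
    (\<forall>\<phi> g. weak_pair \<Omega> \<phi> g \<longrightarrow> (\<integral>x. gv x \<bullet> g x + v x * \<phi> x / (\<beta> x)\<^sup>2 \<partial>lborel) = (\<integral>x. \<kappa> x * Ft (u x) (v x) * \<phi> x \<partial>lborel))"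
proof -
  have w12: "(fst (fst w), snd (fst w)) \<in> h1_space \<Omega> \<alpha>" "(fst (snd w), snd (snd w)) \<in> h1_space \<Omega> \<beta>"
    using w by (auto simp: W_def)
  obtain u gu where u: "weak_pair \<Omega> u gu" "fst (fst w) = mk gu" "snd (fst w) = mk (\<lambda>x. u x / \<alpha> x)"
    using A.h1_spaceE[OF w12(1)] by blast
  obtain v gv where v: "weak_pair \<Omega> v gv" "fst (snd w) = mk gv" "snd (snd w) = mk (\<lambda>x. v x / \<beta> x)"
    using B.h1_spaceE[OF w12(2)] by blast
  have us: "sqint u" "sqint gu" and vs: "sqint v" "sqint gv" using u(1) v(1) by (auto simp: weak_pair_def)
  note ud = A.sqint_div[OF us(1)] and vd = B.sqint_div[OF vs(1)]
  have Jw: "J w = mk (\<lambda>x. (u x / \<alpha> x, v x / \<beta> x))" unfolding J_def u(3) v(3) by (rule l2_pair_mk[OF ud vd])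
  have sG: "sqint (\<lambda>x. G x (u x / \<alpha> x, v x / \<beta> x))" by (rule sqint_G[OF sqint_Pair[OF ud vd]])
  have NJw: "N (J w) = mk (\<lambda>x. G x (u x / \<alpha> x, v x / \<beta> x))" unfolding Jw by (rule N_mk[OF sqint_Pair[OF ud vd]])
  have SS: "S x (u x / \<alpha> x, v x / \<beta> x) = (u x, v x)" for x
    using A.\<alpha>_pos[of x] B.\<alpha>_pos[of x] by (simp add: S_def)
  have eq: "inner w z = inner (NJ w) z" if "z \<in> W" for z
    using orth_proj_inner[OF W_subspace that, of "NJ w"] crit by simp
  have e1: "(\<integral>x. gu x \<bullet> g x + u x * \<phi> x / (\<alpha> x)\<^sup>2 \<partial>lborel) = (\<integral>x. \<kappa> x * Fs (u x) (v x) * \<phi> x \<partial>lborel)"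
    if wp: "weak_pair \<Omega> \<phi> g" for \<phi> g
  proof -
    have ps: "sqint \<phi>" "sqint g" using wp by (auto simp: weak_pair_def)
    note pd = A.sqint_div[OF ps(1)]
    define z :: "'a h1_pair" where "z = ((mk g, mk (\<lambda>x. \<phi> x / \<alpha> x)), 0)"
    have zW: "z \<in> W" unfolding W_def z_def using A.h1_spaceI[OF wp] subspace_0[OF subspace_h1_space] by blast
    have "inner w z = inner (mk gu) (mk g) + inner (mk (\<lambda>x. u x / \<alpha> x)) (mk (\<lambda>x. \<phi> x / \<alpha> x))"
      by (simp add: z_def inner_prod_def u(2,3))
    also have "\<dots> = (\<integral>x. gu x \<bullet> g x + u x * \<phi> x / (\<alpha> x)\<^sup>2 \<partial>lborel)"
      unfolding inner_mk[OF us(2) ps(2)] inner_mk[OF ud pd]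
      by (subst Bochner_Integration.integral_add[symmetric]) (auto intro: sqint_inner us ps ud pd simp: power2_eq_square sqint_inner[OF ud pd, simplified])
    finally have 1: "inner w z = (\<integral>x. gu x \<bullet> g x + u x * \<phi> x / (\<alpha> x)\<^sup>2 \<partial>lborel)" .
    have "inner (NJ w) z = inner (l2_fst (N (J w))) (mk (\<lambda>x. \<phi> x / \<alpha> x))"
      by (simp add: NJ_def z_def inner_prod_def)
    also have "\<dots> = (\<integral>x. fst (G x (u x / \<alpha> x, v x / \<beta> x)) * (\<phi> x / \<alpha> x) \<partial>lborel)"
      unfolding NJw l2_fst_mk(1)[OF sG] inner_mk[OF sqint_fst_comp(1)[OF sG] pd] by simp
    also have "\<dots> = (\<integral>x. \<kappa> x * Fs (u x) (v x) * \<phi> x \<partial>lborel)"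
      using less_imp_neq[OF A.\<alpha>_pos] by (intro Bochner_Integration.integral_cong refl) (simp add: G_def SS DV_def, simp add: S_def)
    finally show ?thesis using 1 eq[OF zW] by simp
  qed
  have e2: "(\<integral>x. gv x \<bullet> g x + v x * \<phi> x / (\<beta> x)\<^sup>2 \<partial>lborel) = (\<integral>x. \<kappa> x * Ft (u x) (v x) * \<phi> x \<partial>lborel)"
    if wp: "weak_pair \<Omega> \<phi> g" for \<phi> g
  proof -
    have ps: "sqint \<phi>" "sqint g" using wp by (auto simp: weak_pair_def)
    note pd = B.sqint_div[OF ps(1)]
    define z :: "'a h1_pair" where "z = (0, (mk g, mk (\<lambda>x. \<phi> x / \<beta> x)))"
    have zW: "z \<in> W" unfolding W_def z_def using B.h1_spaceI[OF wp] subspace_0[OF subspace_h1_space] by blast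
    have "inner w z = inner (mk gv) (mk g) + inner (mk (\<lambda>x. v x / \<beta> x)) (mk (\<lambda>x. \<phi> x / \<beta> x))"
      by (simp add: z_def inner_prod_def v(2,3))
    also have "\<dots> = (\<integral>x. gv x \<bullet> g x + v x * \<phi> x / (\<beta> x)\<^sup>2 \<partial>lborel)"
      unfolding inner_mk[OF vs(2) ps(2)] inner_mk[OF vd pd]
      by (subst Bochner_Integration.integral_add[symmetric]) (auto intro: sqint_inner vs ps vd pd simp: power2_eq_square sqint_inner[OF vd pd, simplified])
    finally have 1: "inner w z = (\<integral>x. gv x \<bullet> g x + v x * \<phi> x / (\<beta> x)\<^sup>2 \<partial>lborel)" .
    have "inner (NJ w) z = inner (l2_snd (N (J w))) (mk (\<lambda>x. \<phi> x / \<beta> x))"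
      by (simp add: NJ_def z_def inner_prod_def)
    also have "\<dots> = (\<integral>x. snd (G x (u x / \<alpha> x, v x / \<beta> x)) * (\<phi> x / \<beta> x) \<partial>lborel)"
      unfolding NJw l2_fst_mk(2)[OF sG] inner_mk[OF sqint_fst_comp(2)[OF sG] pd] by simp
    also have "\<dots> = (\<integral>x. \<kappa> x * Ft (u x) (v x) * \<phi> x \<partial>lborel)"
      using less_imp_neq[OF B.\<alpha>_pos] by (intro Bochner_Integration.integral_cong refl) (simp add: G_def SS DV_def, simp add: S_def)
    finally show ?thesis using 1 eq[OF zW] by simp
  qed
  show ?thesis using u(1) v(1) Jw e1 e2 by blast
qed

end

section \<open>The two parameter ranges\<close>

text \<open>A Borel version clamped between the essential bounds, so that they hold at every point;
  taking the maximum with \<open>\<epsilon>\<close> in \<open>M\<close> keeps the two clamps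
  consistent.\<close>

lemma coefficient_representative:
  fixes a :: "'a::euclidean_space \<Rightarrow> real"
  assumes \<Omega>[measurable]: "\<Omega> \<in> sets borel" and a: "Linf_fun \<Omega> a" and pos: "\<exists>\<epsilon>>0. AE x in lebesgue_on \<Omega>. \<epsilon> \<le> a x"
  obtains a' \<epsilon> M where "a' \<in> borel_measurable borel" "\<epsilon> > 0" "\<And>x. \<epsilon> \<le> a' x" "\<And>x. a' x \<le> M"
    "AE x in lborel. x \<in> \<Omega> \<longrightarrow> a x = a' x"
proof -
  obtain \<epsilon> where \<epsilon>: "\<epsilon> > 0" "AE x in lborel. x \<in> \<Omega> \<longrightarrow> \<epsilon> \<le> a x" using pos by (auto simp: AE_lebesgue_on_iff)
  obtain M0 where M0: "AE x in lborel. x \<in> \<Omega> \<longrightarrow> \<bar>a x\<bar> \<le> M0" using a by (auto simp: Linf_fun_def AE_lebesgue_on_iff)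
  have am: "a \<in> borel_measurable (lebesgue_on \<Omega>)" using a by (simp add: Linf_fun_def)
  obtain f where f: "f \<in> borel_measurable borel" "AE x in lborel. x \<in> \<Omega> \<longrightarrow> a x = f x"
    using borel_representative_real[OF \<Omega> am] by blast
  note [measurable] = f(1)
  define M where "M = max M0 \<epsilon>"
  define a' where "a' = (\<lambda>x. max \<epsilon> (min M (f x)))"
  have "a' \<in> borel_measurable borel" unfolding a'_def by measurable
  moreover have "\<epsilon> \<le> a' x" "a' x \<le> M" for x by (auto simp: a'_def M_def)
  moreover have "AE x in lborel. x \<in> \<Omega> \<longrightarrow> a x = a' x"
    using \<epsilon>(2) M0 f(2) by eventually_elim (auto simp: a'_def M_def)
  ultimately show ?thesis using that \<epsilon>(1) by blast
qed

lemma integral_indicator_lower: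
  fixes a :: "'a::euclidean_space \<Rightarrow> real"
  assumes op: "open \<Omega>" "bounded \<Omega>" "\<Omega> \<noteq> {}" and am[measurable]: "a \<in> borel_measurable borel"
    and \<epsilon>: "\<epsilon> > 0" "\<And>x. \<epsilon> \<le> a x" "\<And>x. a x \<le> M"
  shows "integrable lborel (\<lambda>x. indicator \<Omega> x * a x)" "(\<integral>x. indicator \<Omega> x * a x \<partial>lborel) > 0"
proof -
  have [measurable]: "\<Omega> \<in> sets borel" using op by simp
  have fin: "emeasure lborel \<Omega> < \<infinity>" by (rule emeasure_bounded_finite[OF op(2)])
  have i1: "integrable lborel (\<lambda>x. indicator \<Omega> x * c :: real)" for c using fin by (intro integrable_mult_left) simp
  have a0: "0 < a x" for x using \<epsilon>(1) \<epsilon>(2)[of x] by linarith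
  show i: "integrable lborel (\<lambda>x. indicator \<Omega> x * a x)"
  proof (rule Bochner_Integration.integrable_bound[OF i1[of M]])
    show "AE x in lborel. norm (indicator \<Omega> x * a x) \<le> norm (indicator \<Omega> x * M)"
    proof (rule AE_I2)
      fix x
      have "\<bar>a x\<bar> \<le> \<bar>M\<bar>" using \<epsilon>(3)[of x] a0[of x] by linarith
      then show "norm (indicator \<Omega> x * a x) \<le> norm (indicator \<Omega> x * M)" by (simp add: indicator_def)
    qed
  qed measurable
  have "emeasure lborel \<Omega> \<noteq> 0"
    using op open_not_negligible[of \<Omega>] by (auto simp: negligible_iff_null_sets null_sets_def)
  then have "measure lborel \<Omega> > 0" using fin by (simp add: measure_def enn2real_positive_iff less_top zero_less_iff_neq_zero)
  then have "0 < \<epsilon> * measure lborel \<Omega>" using \<epsilon>(1) by simp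
  also have "\<dots> = (\<integral>x. indicator \<Omega> x * \<epsilon> \<partial>lborel)" by simp
  also have "\<dots> \<le> (\<integral>x. indicator \<Omega> x * a x \<partial>lborel)"
    using \<epsilon>(2) by (intro integral_mono i i1 mult_left_mono) auto
  finally show "(\<integral>x. indicator \<Omega> x * a x \<partial>lborel) > 0" .
qed

lemma L1_norm_representative:
  assumes \<Omega>[measurable]: "\<Omega> \<in> sets borel" and am: "a \<in> borel_measurable (lebesgue_on \<Omega>)"
    and a'[measurable]: "a' \<in> borel_measurable borel" and a'0: "\<And>x. 0 \<le> a' x"
    and ae: "AE x in lborel. x \<in> \<Omega> \<longrightarrow> a x = a' x"
  shows "L1_norm \<Omega> a = (\<integral>x. indicator \<Omega> x * a' x \<partial>lborel)"
proof -
  have "L1_norm \<Omega> a = (\<integral>x. a' x \<partial>lebesgue_on \<Omega>)"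
    unfolding L1_norm_def
  proof (rule integral_cong_AE)
    have "AE x in lebesgue_on \<Omega>. a x = a' x" using ae by (simp add: AE_lebesgue_on_iff)
    then show "AE x in lebesgue_on \<Omega>. \<bar>a x\<bar> = a' x" by eventually_elim (simp add: a'0)
    show "(\<lambda>x. \<bar>a x\<bar>) \<in> borel_measurable (lebesgue_on \<Omega>)" using am by measurable
    show "a' \<in> borel_measurable (lebesgue_on \<Omega>)" by (rule borel_measurable_lebesgue_on[OF a'])
  qed
  then show ?thesis by (simp add: integral_lebesgue_on_borel)
qed

text \<open>Carries one weak equation back to Lebesgue measure and the original coefficients, for
  every original test function. \<open>w\<close> stands for a partial derivative of \<open>F\<close>
  at the solution, so that both equations are covered.\<close>

lemma weak_form_transfer:
  fixes \<Omega> :: "'a::euclidean_space set"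
  assumes \<Omega>[measurable]: "\<Omega> \<in> sets borel"
    and am: "a \<in> borel_measurable (lebesgue_on \<Omega>)" and cm: "c \<in> borel_measurable (lebesgue_on \<Omega>)"
    and a'[measurable]: "a' \<in> borel_measurable borel" and c'[measurable]: "c' \<in> borel_measurable borel"
    and ae: "AE x in lborel. x \<in> \<Omega> \<longrightarrow> a x = a' x" "AE x in lborel. x \<in> \<Omega> \<longrightarrow> c x = c' x"
    and u[measurable]: "u \<in> borel_measurable borel" and gu[measurable]: "gu \<in> borel_measurable borel"
    and w[measurable]: "w \<in> borel_measurable borel"
    and weak: "\<And>\<phi> g. weak_pair \<Omega> \<phi> g \<Longrightarrow>
      (\<integral>x. gu x \<bullet> g x + a' x * u x * \<phi> x \<partial>lborel) = lam * (\<integral>x. c' x * w x * \<phi> x \<partial>lborel)"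
    and wg: "weak_grad \<Omega> \<phi> g"
  shows "(\<integral>x. gu x \<bullet> g x + a x * u x * \<phi> x \<partial>lebesgue_on \<Omega>) = lam * (\<integral>x. c x * w x * \<phi> x \<partial>lebesgue_on \<Omega>)"
proof -
  obtain \<phi>' g' where r: "weak_pair \<Omega> \<phi>' g'" "AE x in lborel. x \<in> \<Omega> \<longrightarrow> \<phi> x = \<phi>' x \<and> g x = g' x"
    using weak_grad_representative[OF \<Omega> wg] by blast
  have z: "\<And>x. x \<notin> \<Omega> \<Longrightarrow> \<phi>' x = 0" "\<And>x. x \<notin> \<Omega> \<Longrightarrow> g' x = 0" using r(1) by (auto simp: weak_pair_def)
  have [measurable]: "\<phi>' \<in> borel_measurable borel" "g' \<in> borel_measurable borel"
    using r(1) by (auto simp: weak_pair_def sqint_measurable)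
  have fm: "\<phi> \<in> borel_measurable (lebesgue_on \<Omega>)" "g \<in> borel_measurable (lebesgue_on \<Omega>)"
    using wg by (auto simp: weak_grad_def L2_fun_def)
  note bm = borel_measurable_lebesgue_on[of _ \<Omega>]
  have m: "u \<in> borel_measurable (lebesgue_on \<Omega>)" "gu \<in> borel_measurable (lebesgue_on \<Omega>)" "w \<in> borel_measurable (lebesgue_on \<Omega>)"
    by (rule bm, measurable)+
  have aeO: "AE x in lebesgue_on \<Omega>. a x = a' x \<and> c x = c' x \<and> \<phi> x = \<phi>' x \<and> g x = g' x"
    unfolding AE_lebesgue_on_iff[OF \<Omega>] using ae r(2) by eventually_elim auto
  have "(\<integral>x. gu x \<bullet> g x + a x * u x * \<phi> x \<partial>lebesgue_on \<Omega>) = (\<integral>x. gu x \<bullet> g' x + a' x * u x * \<phi>' x \<partial>lebesgue_on \<Omega>)"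
  proof (rule integral_cong_AE)
    show "AE x in lebesgue_on \<Omega>. gu x \<bullet> g x + a x * u x * \<phi> x = gu x \<bullet> g' x + a' x * u x * \<phi>' x"
      using aeO by eventually_elim simp
    show "(\<lambda>x. gu x \<bullet> g x + a x * u x * \<phi> x) \<in> borel_measurable (lebesgue_on \<Omega>)" using am m fm by measurable
    show "(\<lambda>x. gu x \<bullet> g' x + a' x * u x * \<phi>' x) \<in> borel_measurable (lebesgue_on \<Omega>)" by (rule bm) measurable
  qed
  also have "\<dots> = (\<integral>x. indicator \<Omega> x *\<^sub>R (gu x \<bullet> g' x + a' x * u x * \<phi>' x) \<partial>lborel)"
    by (rule integral_lebesgue_on_borel) measurable
  also have "\<dots> = (\<integral>x. gu x \<bullet> g' x + a' x * u x * \<phi>' x \<partial>lborel)"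
    using z by (intro Bochner_Integration.integral_cong) (auto simp: indicator_def)
  also have "\<dots> = lam * (\<integral>x. c' x * w x * \<phi>' x \<partial>lborel)" by (rule weak[OF r(1)])
  also have "(\<integral>x. c' x * w x * \<phi>' x \<partial>lborel) = (\<integral>x. indicator \<Omega> x *\<^sub>R (c' x * w x * \<phi>' x) \<partial>lborel)"
    using z by (intro Bochner_Integration.integral_cong) (auto simp: indicator_def)
  also have "\<dots> = (\<integral>x. c' x * w x * \<phi>' x \<partial>lebesgue_on \<Omega>)"
    by (rule integral_lebesgue_on_borel[symmetric]) measurable
  also have "\<dots> = (\<integral>x. c x * w x * \<phi> x \<partial>lebesgue_on \<Omega>)"
  proof (rule integral_cong_AE)
    show "AE x in lebesgue_on \<Omega>. c' x * w x * \<phi>' x = c x * w x * \<phi> x" using aeO by eventually_elim simp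
    show "(\<lambda>x. c x * w x * \<phi> x) \<in> borel_measurable (lebesgue_on \<Omega>)" using cm m fm by measurable
    show "(\<lambda>x. c' x * w x * \<phi>' x) \<in> borel_measurable (lebesgue_on \<Omega>)" by (rule bm) measurable
  qed
  finally show ?thesis .
qed

section \<open>Nonexistence for small parameters\<close>

text \<open>The infimum of the essential bounds is itself one: the bounds
  \<open>Linf_norm + 1/(n+1)\<close> hold off a countable union of null sets.\<close>

lemma Linf_norm_AE:
  assumes "AE x in lebesgue_on \<Omega>. \<bar>f x\<bar> \<le> C"
  shows "AE x in lebesgue_on \<Omega>. \<bar>f x\<bar> \<le> Linf_norm \<Omega> f"
proof -
  let ?S = "{C. 0 \<le> C \<and> (AE x in lebesgue_on \<Omega>. \<bar>f x\<bar> \<le> C)}"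
  have ne: "max C 0 \<in> ?S" using assms by (auto elim!: eventually_mono)
  have bdd: "bdd_below ?S" by (rule bdd_belowI[of _ 0]) auto
  have "AE x in lebesgue_on \<Omega>. \<bar>f x\<bar> \<le> Linf_norm \<Omega> f + inverse (real (Suc n))" for n
  proof -
    have "\<exists>C\<in>?S. C < Linf_norm \<Omega> f + inverse (real (Suc n))"
      using cInf_less_iff[OF _ bdd, of "Linf_norm \<Omega> f + inverse (real (Suc n))"] ne unfolding Linf_norm_def[symmetric] by fastforce
    then obtain C' where "C' < Linf_norm \<Omega> f + inverse (real (Suc n))" "AE x in lebesgue_on \<Omega>. \<bar>f x\<bar> \<le> C'" by blast
    then show ?thesis by (auto elim!: eventually_mono)
  qed
  then have "AE x in lebesgue_on \<Omega>. \<forall>n. \<bar>f x\<bar> \<le> Linf_norm \<Omega> f + inverse (real (Suc n))" by (simp add: AE_all_countable)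
  then show ?thesis
  proof eventually_elim
    case (elim x)
    have "(\<lambda>n. Linf_norm \<Omega> f + inverse (real (Suc n))) \<longlonglongrightarrow> Linf_norm \<Omega> f + 0"
      by (intro tendsto_intros LIMSEQ_inverse_real_of_nat)
    then have "\<bar>f x\<bar> \<le> Linf_norm \<Omega> f + 0" using elim by (intro LIMSEQ_le_const) auto
    then show ?case by simp
  qed
qed

lemma Linf_norm_pos:
  assumes op: "open \<Omega>" "\<Omega> \<noteq> {}" and "AE x in lebesgue_on \<Omega>. \<bar>f x\<bar> \<le> C"
    and \<delta>: "\<delta> > 0" "AE x in lebesgue_on \<Omega>. \<delta> \<le> f x"
  shows "Linf_norm \<Omega> f > 0"
proof (rule ccontr)
  assume neg: "\<not> Linf_norm \<Omega> f > 0"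
  have "AE x in lebesgue_on \<Omega>. False"
    using Linf_norm_AE[OF assms(3)] \<delta>(2) by eventually_elim (use neg \<delta>(1) in linarith)
  then have "AE x in lborel. x \<notin> \<Omega>" using op by (simp add: AE_lebesgue_on_iff)
  then have "\<Omega> \<in> null_sets lborel" using op by (subst (asm) AE_iff_null_sets[symmetric]) auto
  then show False using op open_not_negligible[of \<Omega>] by (auto simp: negligible_iff_null_sets null_sets_completionI)
qed

lemma (in potential) Fs_Ft_le:
  obtains C where "C \<ge> 0" "\<And>s t. \<bar>Fs s t\<bar> \<le> C * (\<bar>s\<bar> + \<bar>t\<bar>)" "\<And>s t. \<bar>Ft s t\<bar> \<le> C * (\<bar>s\<bar> + \<bar>t\<bar>)"
    "\<And>s t. F s t \<le> C * (s\<^sup>2 + t\<^sup>2)" "\<And>s t. \<bar>s * Fs s t + t * Ft s t\<bar> \<le> C * (s\<^sup>2 + t\<^sup>2)"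
proof -
  obtain C1 where C1: "C1 \<ge> 0" "\<And>p. norm (DV p) \<le> C1 * norm p" using DV_linear by blast
  obtain C2 where C2: "C2 \<ge> 0" "\<And>p. V p \<le> C2 * (norm p)\<^sup>2" using V_quad by blast
  define C where "C = max C1 C2"
  have C: "C \<ge> 0" "C1 \<le> C" "C2 \<le> C" using C1 by (auto simp: C_def)
  have D: "norm (DV (s, t)) \<le> C * norm (s, t)" for s t
    using C1(2)[of "(s, t)"] mult_right_mono[OF C(2), of "norm (s, t)"] by simp
  have n1: "norm (s, t) \<le> \<bar>s\<bar> + \<bar>t\<bar>" for s t :: real using norm_Pair_le[of s t] by simp
  have n2: "(norm (s, t))\<^sup>2 = s\<^sup>2 + t\<^sup>2" for s t :: real by (simp add: norm_Pair)
  have D2: "norm (DV (s, t)) \<le> C * (\<bar>s\<bar> + \<bar>t\<bar>)" for s t using D[of s t] mult_left_mono[OF n1 C(1), of s t] by linarith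
  have "\<bar>Fs s t\<bar> \<le> C * (\<bar>s\<bar> + \<bar>t\<bar>)" "\<bar>Ft s t\<bar> \<le> C * (\<bar>s\<bar> + \<bar>t\<bar>)" for s t
    using D2[of s t] norm_fst_le[of "Fs s t" "Ft s t"] norm_snd_le[of "Ft s t" "Fs s t"] by (auto simp: DV_def)
  moreover have "F s t \<le> C * (s\<^sup>2 + t\<^sup>2)" for s t
    using C2(2)[of "(s, t)"] mult_right_mono[OF C(3), of "s\<^sup>2 + t\<^sup>2"] by (simp add: V_def n2)
  moreover have "\<bar>s * Fs s t + t * Ft s t\<bar> \<le> C * (s\<^sup>2 + t\<^sup>2)" for s t
  proof -
    have "\<bar>s * Fs s t + t * Ft s t\<bar> = \<bar>(s, t) \<bullet> DV (s, t)\<bar>" by (simp add: DV_def inner_prod_def)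
    also have "\<dots> \<le> norm (s, t) * norm (DV (s, t))" by (rule Cauchy_Schwarz_ineq2)
    also have "\<dots> \<le> norm (s, t) * (C * norm (s, t))" by (intro mult_left_mono D) simp
    also have "\<dots> = C * (s\<^sup>2 + t\<^sup>2)" unfolding n2[symmetric] by (simp add: power2_eq_square)
    finally show ?thesis .
  qed
  ultimately show ?thesis using that C(1) by blast
qed

text \<open>The real \<open>Sup\<close> in \<open>s_F\<close> and \<open>S_F\<close> is an upper
  bound only for a set that is bounded above; quadratic growth of the numerator against a positive
  definite form provides this.\<close>

lemma quadratic_quotient_bdd:
  fixes f :: "real \<Rightarrow> real \<Rightarrow> real"
  assumes "C \<ge> 0" "\<And>s t. f s t \<le> C * (s\<^sup>2 + t\<^sup>2)" "A > 0" "B > 0"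
  shows "bdd_above {f s t / (A * s\<^sup>2 + B * t\<^sup>2) | s t. (s, t) \<noteq> (0, 0)}"
proof (rule bdd_aboveI[of _ "C / min A B"])
  fix y assume "y \<in> {f s t / (A * s\<^sup>2 + B * t\<^sup>2) | s t. (s, t) \<noteq> (0, 0)}"
  then obtain s t where y: "y = f s t / (A * s\<^sup>2 + B * t\<^sup>2)" "(s, t) \<noteq> (0, 0)" by blast
  define m where "m = min A B"
  have m: "m > 0" "m \<le> A" "m \<le> B" using assms by (auto simp: m_def)
  have st: "s\<^sup>2 + t\<^sup>2 > 0" using y(2) by (auto simp: sum_power2_gt_zero_iff)
  have le: "m * (s\<^sup>2 + t\<^sup>2) \<le> A * s\<^sup>2 + B * t\<^sup>2" unfolding distrib_left using m by (intro add_mono mult_right_mono) auto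
  have q: "A * s\<^sup>2 + B * t\<^sup>2 > 0" using le m st by (meson less_le_trans mult_pos_pos)
  have "f s t \<le> C * (s\<^sup>2 + t\<^sup>2)" by (rule assms)
  also have "\<dots> = C / m * (m * (s\<^sup>2 + t\<^sup>2))" using m by simp
  also have "\<dots> \<le> C / m * (A * s\<^sup>2 + B * t\<^sup>2)" using assms m le by (intro mult_left_mono) auto
  finally show "y \<le> C / min A B" unfolding y(1) m_def[symmetric] using q by (simp add: pos_divide_le_eq)
qed

lemma (in potential) small_parameter_trivial:
  fixes \<Omega> :: "'n::euclidean_space set"
  assumes dom: "smooth_bounded_domain \<Omega>"
    and a_inf: "Linf_fun \<Omega> a" and b_inf: "Linf_fun \<Omega> b" and c_inf: "Linf_fun \<Omega> c"
    and a_pos: "\<exists>\<epsilon>>0. AE x in lebesgue_on \<Omega>. \<epsilon> \<le> a x"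
    and b_pos: "\<exists>\<epsilon>>0. AE x in lebesgue_on \<Omega>. \<epsilon> \<le> b x"
    and c_pos: "\<exists>\<epsilon>>0. AE x in lebesgue_on \<Omega>. \<epsilon> \<le> c x"
    and lam: "0 \<le> lam" "lam < inverse (S_F \<Omega> a b c Fs Ft)"
    and sol: "neumann_solution \<Omega> a b c Fs Ft lam u v"
  shows "AE x in lebesgue_on \<Omega>. u x = 0 \<and> v x = 0"
proof -
  let ?M = "lebesgue_on \<Omega>"
  have op: "open \<Omega>" "\<Omega> \<noteq> {}" using dom by (auto simp: smooth_bounded_domain_def)
  obtain \<epsilon>a \<epsilon>b \<epsilon>c where \<epsilon>: "\<epsilon>a > 0" "AE x in ?M. \<epsilon>a \<le> a x" "\<epsilon>b > 0" "AE x in ?M. \<epsilon>b \<le> b x" "\<epsilon>c > 0" "AE x in ?M. \<epsilon>c \<le> c x"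
    using a_pos b_pos c_pos by blast
  obtain Ma Mb Mc where M: "AE x in ?M. \<bar>a x\<bar> \<le> Ma" "AE x in ?M. \<bar>b x\<bar> \<le> Mb" "AE x in ?M. \<bar>c x\<bar> \<le> Mc"
    using a_inf b_inf c_inf by (auto simp: Linf_fun_def)
  have [measurable]: "a \<in> borel_measurable ?M" "b \<in> borel_measurable ?M" "c \<in> borel_measurable ?M"
    using a_inf b_inf c_inf by (auto simp: Linf_fun_def)
  define p where "p = Linf_norm \<Omega> (\<lambda>x. c x / a x)"
  define q where "q = Linf_norm \<Omega> (\<lambda>x. c x / b x)"
  \<comment> \<open>The maximum with 1 makes the denominator visibly positive; the lower bound shows
    that the norm \<open>p\<close> is positive, so that its inverse behaves.\<close>
  have pbd: "AE x in ?M. \<bar>c x / a x\<bar> \<le> Mc / \<epsilon>a" and plow: "AE x in ?M. \<epsilon>c / max Ma 1 \<le> c x / a x"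
    using M(1) M(3) \<epsilon>(2) \<epsilon>(6) by (eventually_elim, use \<epsilon>(1,5) in \<open>auto simp: abs_divide intro!: frac_le\<close>)+
  have qbd: "AE x in ?M. \<bar>c x / b x\<bar> \<le> Mc / \<epsilon>b" and qlow: "AE x in ?M. \<epsilon>c / max Mb 1 \<le> c x / b x"
    using M(2) M(3) \<epsilon>(4) \<epsilon>(6) by (eventually_elim, use \<epsilon>(3,5) in \<open>auto simp: abs_divide intro!: frac_le\<close>)+
  have p0: "p > 0" unfolding p_def by (rule Linf_norm_pos[OF op pbd _ plow]) (use \<epsilon>(5) in simp)
  have q0: "q > 0" unfolding q_def by (rule Linf_norm_pos[OF op qbd _ qlow]) (use \<epsilon>(5) in simp)
  have pae: "AE x in ?M. \<bar>c x / a x\<bar> \<le> p" unfolding p_def by (rule Linf_norm_AE[OF pbd])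
  have qae: "AE x in ?M. \<bar>c x / b x\<bar> \<le> q" unfolding q_def by (rule Linf_norm_AE[OF qbd])
  obtain C where C: "C \<ge> 0" "\<And>s t. \<bar>Fs s t\<bar> \<le> C * (\<bar>s\<bar> + \<bar>t\<bar>)" "\<And>s t. \<bar>Ft s t\<bar> \<le> C * (\<bar>s\<bar> + \<bar>t\<bar>)"
    "\<And>s t. \<bar>s * Fs s t + t * Ft s t\<bar> \<le> C * (s\<^sup>2 + t\<^sup>2)"
    by (rule Fs_Ft_le) blast
  define SF where "SF = S_F \<Omega> a b c Fs Ft"
  let ?S = "{\<bar>s * Fs s t + t * Ft s t\<bar> / (inverse p * s\<^sup>2 + inverse q * t\<^sup>2) | s t. (s, t) \<noteq> (0, 0)}"
  have SF_eq: "SF = Sup ?S" by (simp add: SF_def S_F_def p_def q_def)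
  have "bdd_above ?S" using p0 q0 by (intro quadratic_quotient_bdd[OF C(1) C(4)]) auto
  have SF: "\<bar>s * Fs s t + t * Ft s t\<bar> \<le> SF * (inverse p * s\<^sup>2 + inverse q * t\<^sup>2)" for s t
  proof (cases "(s, t) = (0, 0)")
    case False
    have "s\<^sup>2 > 0 \<or> t\<^sup>2 > 0" using False by auto
    then have d: "inverse p * s\<^sup>2 + inverse q * t\<^sup>2 > 0"
      using p0 q0 by (auto intro: add_pos_nonneg add_nonneg_pos)
    have "\<bar>s * Fs s t + t * Ft s t\<bar> / (inverse p * s\<^sup>2 + inverse q * t\<^sup>2) \<le> SF"
      unfolding SF_eq using False by (intro cSup_upper \<open>bdd_above ?S\<close>) blast
    then show ?thesis using d by (simp add: pos_divide_le_eq)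
  qed auto
  \<comment> \<open>As \<open>inverse 0 = 0\<close>, the assumption
    \<open>0 \<le> lam < inverse SF\<close> can hold only for positive \<open>SF\<close>.\<close>
  have SF0: "SF > 0" using lam unfolding SF_def[symmetric] by (metis inverse_positive_iff_positive le_less_trans)
  have lS: "lam * SF < 1" using lam(2) SF0 unfolding SF_def[symmetric] by (simp add: field_simps)
  obtain gu gv where wgu: "weak_grad \<Omega> u gu" and wgv: "weak_grad \<Omega> v gv"
    and eu: "\<And>\<phi> g. weak_grad \<Omega> \<phi> g \<Longrightarrow> (\<integral>x. gu x \<bullet> g x + a x * u x * \<phi> x \<partial>?M) = lam * (\<integral>x. c x * Fs (u x) (v x) * \<phi> x \<partial>?M)"
    and ev: "\<And>\<phi> g. weak_grad \<Omega> \<phi> g \<Longrightarrow> (\<integral>x. gv x \<bullet> g x + b x * v x * \<phi> x \<partial>?M) = lam * (\<integral>x. c x * Ft (u x) (v x) * \<phi> x \<partial>?M)"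
    using sol unfolding neumann_solution_def by blast
  have [measurable]: "u \<in> borel_measurable ?M" "v \<in> borel_measurable ?M" "gu \<in> borel_measurable ?M" "gv \<in> borel_measurable ?M"
    and iu: "integrable ?M (\<lambda>x. (u x)\<^sup>2)" and iv: "integrable ?M (\<lambda>x. (v x)\<^sup>2)"
    and igu: "integrable ?M (\<lambda>x. (norm (gu x))\<^sup>2)" and igv: "integrable ?M (\<lambda>x. (norm (gv x))\<^sup>2)"
    using wgu wgv by (auto simp: weak_grad_def L2_fun_def)
  have uv: "(\<lambda>x. (u x, v x)) \<in> borel_measurable ?M" by (intro borel_measurable_Pair) measurable
  have [measurable]: "(\<lambda>x. Fs (u x) (v x)) \<in> borel_measurable ?M" "(\<lambda>x. Ft (u x) (v x)) \<in> borel_measurable ?M"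
    using measurable_compose[OF uv borel_measurable_continuous_onI[OF Fs_cont]] measurable_compose[OF uv borel_measurable_continuous_onI[OF Ft_cont]] by auto
  have iau: "integrable ?M (\<lambda>x. a x * (u x)\<^sup>2)"
  proof (rule Bochner_Integration.integrable_bound[OF integrable_mult_right[OF iu, of Ma]])
    show "AE x in ?M. norm (a x * (u x)\<^sup>2) \<le> norm (Ma * (u x)\<^sup>2)"
      using M(1) by eventually_elim (auto simp: abs_mult intro!: mult_right_mono)
  qed measurable
  have ibv: "integrable ?M (\<lambda>x. b x * (v x)\<^sup>2)"
  proof (rule Bochner_Integration.integrable_bound[OF integrable_mult_right[OF iv, of Mb]])
    show "AE x in ?M. norm (b x * (v x)\<^sup>2) \<le> norm (Mb * (v x)\<^sup>2)"
      using M(2) by eventually_elim (auto simp: abs_mult intro!: mult_right_mono)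
  qed measurable
  have iuv: "integrable ?M (\<lambda>x. Mc * (C * (2 * ((u x)\<^sup>2 + (v x)\<^sup>2))))" using iu iv by simp
  \<comment> \<open>Dominates the nonlinear terms by multiples of u^2 + v^2. Their integrability
    must be known before the two tested equations may be added under one integral.\<close>
  have cross: "\<bar>w\<bar> * (\<bar>s\<bar> + \<bar>t\<bar>) \<le> 2 * (s\<^sup>2 + t\<^sup>2)" if "w = s \<or> w = t" for w s t :: real
  proof -
    have "2 * (\<bar>s\<bar> * \<bar>t\<bar>) \<le> s\<^sup>2 + t\<^sup>2" using sum_squares_bound[of "\<bar>s\<bar>" "\<bar>t\<bar>"] by (simp add: mult.assoc)
    moreover have "0 \<le> s\<^sup>2" "0 \<le> t\<^sup>2" by auto
    moreover have "\<bar>s\<bar> * \<bar>s\<bar> = s\<^sup>2" "\<bar>t\<bar> * \<bar>t\<bar> = t\<^sup>2" "\<bar>t\<bar> * \<bar>s\<bar> = \<bar>s\<bar> * \<bar>t\<bar>"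
      by (simp_all add: power2_eq_square)
    ultimately have "\<bar>s\<bar> * (\<bar>s\<bar> + \<bar>t\<bar>) \<le> 2 * (s\<^sup>2 + t\<^sup>2)" "\<bar>t\<bar> * (\<bar>s\<bar> + \<bar>t\<bar>) \<le> 2 * (s\<^sup>2 + t\<^sup>2)"
      unfolding distrib_left by linarith+
    then show ?thesis using that by blast
  qed
  have nb: "\<bar>cx * f * w\<bar> \<le> \<bar>Mc * (C * (2 * (s\<^sup>2 + t\<^sup>2)))\<bar>"
    if "\<bar>cx\<bar> \<le> Mc" "\<bar>f\<bar> \<le> C * (\<bar>s\<bar> + \<bar>t\<bar>)" "w = s \<or> w = t" for cx f w s t :: real
  proof -
    have "\<bar>f\<bar> * \<bar>w\<bar> \<le> C * (\<bar>s\<bar> + \<bar>t\<bar>) * \<bar>w\<bar>" by (intro mult_right_mono that) simp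
    also have "\<dots> = C * (\<bar>w\<bar> * (\<bar>s\<bar> + \<bar>t\<bar>))" by simp
    also have "\<dots> \<le> C * (2 * (s\<^sup>2 + t\<^sup>2))" by (intro mult_left_mono cross that C(1))
    finally have h: "\<bar>f\<bar> * \<bar>w\<bar> \<le> C * (2 * (s\<^sup>2 + t\<^sup>2))" .
    have "0 \<le> Mc" using that(1) by linarith
    then have "\<bar>cx\<bar> * (\<bar>f\<bar> * \<bar>w\<bar>) \<le> Mc * (C * (2 * (s\<^sup>2 + t\<^sup>2)))"
      by (rule mult_mono[OF that(1) h]) simp
    moreover have "\<bar>cx * f * w\<bar> = \<bar>cx\<bar> * (\<bar>f\<bar> * \<bar>w\<bar>)" by (simp only: abs_mult mult.assoc)
    ultimately show ?thesis using abs_ge_self order_trans by metis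
  qed
  have icu: "integrable ?M (\<lambda>x. c x * Fs (u x) (v x) * u x)"
  proof (rule Bochner_Integration.integrable_bound[OF iuv])
    show "AE x in ?M. norm (c x * Fs (u x) (v x) * u x) \<le> norm (Mc * (C * (2 * ((u x)\<^sup>2 + (v x)\<^sup>2))))"
      using M(3) by eventually_elim (simp only: real_norm_def, intro nb C(2), auto)
  qed measurable
  have icv: "integrable ?M (\<lambda>x. c x * Ft (u x) (v x) * v x)"
  proof (rule Bochner_Integration.integrable_bound[OF iuv])
    show "AE x in ?M. norm (c x * Ft (u x) (v x) * v x) \<le> norm (Mc * (C * (2 * ((u x)\<^sup>2 + (v x)\<^sup>2))))"
      using M(3) by eventually_elim (simp only: real_norm_def, intro nb C(3), auto)
  qed measurable
  \<comment> \<open>Only the zero-order part of the energy is followed; the gradient terms are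
    nonnegative and are dropped. The chain below ends in \<open>X \<le> lam * SF * X\<close>, where
    the factor is less than 1.\<close>
  define X where "X = (\<integral>x. a x * (u x)\<^sup>2 + b x * (v x)\<^sup>2 \<partial>?M)"
  have "(\<integral>x. a x * (u x)\<^sup>2 \<partial>?M) \<le> (\<integral>x. gu x \<bullet> gu x + a x * u x * u x \<partial>?M)"
  proof -
    have "(\<integral>x. gu x \<bullet> gu x + a x * u x * u x \<partial>?M) = (\<integral>x. (norm (gu x))\<^sup>2 + a x * (u x)\<^sup>2 \<partial>?M)"
      by (simp add: dot_square_norm power2_eq_square[of "u _"] mult.assoc)
    also have "\<dots> = (\<integral>x. (norm (gu x))\<^sup>2 \<partial>?M) + (\<integral>x. a x * (u x)\<^sup>2 \<partial>?M)" using igu iau by simp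
    finally show ?thesis by simp
  qed
  then have Xu: "(\<integral>x. a x * (u x)\<^sup>2 \<partial>?M) \<le> lam * (\<integral>x. c x * Fs (u x) (v x) * u x \<partial>?M)" using eu[OF wgu] by simp
  have "(\<integral>x. b x * (v x)\<^sup>2 \<partial>?M) \<le> (\<integral>x. gv x \<bullet> gv x + b x * v x * v x \<partial>?M)"
  proof -
    have "(\<integral>x. gv x \<bullet> gv x + b x * v x * v x \<partial>?M) = (\<integral>x. (norm (gv x))\<^sup>2 + b x * (v x)\<^sup>2 \<partial>?M)"
      by (simp add: dot_square_norm power2_eq_square[of "v _"] mult.assoc)
    also have "\<dots> = (\<integral>x. (norm (gv x))\<^sup>2 \<partial>?M) + (\<integral>x. b x * (v x)\<^sup>2 \<partial>?M)" using igv ibv by simp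
    finally show ?thesis by simp
  qed
  then have Xv: "(\<integral>x. b x * (v x)\<^sup>2 \<partial>?M) \<le> lam * (\<integral>x. c x * Ft (u x) (v x) * v x \<partial>?M)" using ev[OF wgv] by simp
  have "X = (\<integral>x. a x * (u x)\<^sup>2 \<partial>?M) + (\<integral>x. b x * (v x)\<^sup>2 \<partial>?M)" unfolding X_def using iau ibv by simp
  also have "\<dots> \<le> lam * (\<integral>x. c x * Fs (u x) (v x) * u x + c x * Ft (u x) (v x) * v x \<partial>?M)"
    using Xu Xv icu icv by (simp add: distrib_left)
  also have "\<dots> \<le> lam * (\<integral>x. SF * (a x * (u x)\<^sup>2 + b x * (v x)\<^sup>2) \<partial>?M)"
  proof (intro mult_left_mono lam(1) integral_mono_AE)
    show "integrable ?M (\<lambda>x. c x * Fs (u x) (v x) * u x + c x * Ft (u x) (v x) * v x)" using icu icv by simp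
    show "integrable ?M (\<lambda>x. SF * (a x * (u x)\<^sup>2 + b x * (v x)\<^sup>2))" using iau ibv by simp
    show "AE x in ?M. c x * Fs (u x) (v x) * u x + c x * Ft (u x) (v x) * v x \<le> SF * (a x * (u x)\<^sup>2 + b x * (v x)\<^sup>2)"
      using pae qae \<epsilon>(2,4,6)
    proof eventually_elim
      case (elim x)
      have pos: "a x > 0" "b x > 0" "c x > 0" using elim \<epsilon>(1,3,5) by linarith+
      have "c x / a x \<le> p" "c x / b x \<le> q" using order_trans[OF abs_ge_self elim(1)] order_trans[OF abs_ge_self elim(2)] by auto
      \<comment> \<open>This is where the norms of c/a and c/b in the definition of
        \<open>S_F\<close> come from: they let \<open>c\<close> times the quadratic form be absorbed
        by a u^2 + b v^2.\<close>
      then have ca: "c x * inverse p \<le> a x" "c x * inverse q \<le> b x" using pos p0 q0 by (auto simp: field_simps)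
      have "c x * Fs (u x) (v x) * u x + c x * Ft (u x) (v x) * v x = c x * (u x * Fs (u x) (v x) + v x * Ft (u x) (v x))"
        by (simp add: algebra_simps)
      also have "\<dots> \<le> c x * (SF * (inverse p * (u x)\<^sup>2 + inverse q * (v x)\<^sup>2))"
        using SF[of "u x" "v x"] pos by (intro mult_left_mono) auto
      also have "\<dots> = SF * ((c x * inverse p) * (u x)\<^sup>2 + (c x * inverse q) * (v x)\<^sup>2)" by (simp add: algebra_simps)
      also have "\<dots> \<le> SF * (a x * (u x)\<^sup>2 + b x * (v x)\<^sup>2)"
        using SF0 ca by (intro mult_left_mono add_mono mult_right_mono) auto
      finally show ?case .
    qed
  qed
  also have "\<dots> = lam * SF * X" by (simp add: X_def)
  finally have "X * (1 - lam * SF) \<le> 0" by (simp add: algebra_simps)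
  then have "X \<le> 0" using lS by (simp add: mult_le_0_iff)
  have nn: "AE x in ?M. 0 \<le> a x * (u x)\<^sup>2 + b x * (v x)\<^sup>2"
    using \<epsilon>(2,4) by eventually_elim (use \<epsilon>(1,3) in auto)
  have "X \<ge> 0" unfolding X_def by (rule integral_nonneg_AE[OF nn])
  then have "X = 0" using \<open>X \<le> 0\<close> by simp
  then have "AE x in ?M. a x * (u x)\<^sup>2 + b x * (v x)\<^sup>2 = 0"
    unfolding X_def using integral_nonneg_eq_0_iff_AE[OF _ nn] iau ibv by simp
  then show ?thesis using \<epsilon>(2,4)
  proof eventually_elim
    case (elim x)
    have pos: "a x > 0" "b x > 0" using elim(2,3) \<epsilon>(1,3) by linarith+
    then have "a x * (u x)\<^sup>2 = 0 \<and> b x * (v x)\<^sup>2 = 0" using elim(1) by (subst (asm) add_nonneg_eq_0_iff) auto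
    then show ?case using pos by simp
  qed
qed

section \<open>Two solutions for large parameters\<close>

lemma (in potential) large_parameter_solutions:
  fixes \<Omega> :: "'n::euclidean_space set"
  assumes dom: "smooth_bounded_domain \<Omega>"
    and a_inf: "Linf_fun \<Omega> a" and b_inf: "Linf_fun \<Omega> b" and c_inf: "Linf_fun \<Omega> c"
    and a_pos: "\<exists>\<epsilon>>0. AE x in lebesgue_on \<Omega>. \<epsilon> \<le> a x"
    and b_pos: "\<exists>\<epsilon>>0. AE x in lebesgue_on \<Omega>. \<epsilon> \<le> b x"
    and c_pos: "\<exists>\<epsilon>>0. AE x in lebesgue_on \<Omega>. \<epsilon> \<le> c x"
    and F_nz: "\<exists>s t. F s t \<noteq> 0"
    and lam: "lam > inverse (s_F \<Omega> a b c F)"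
  shows "\<exists>u1 v1 u2 v2.
     neumann_solution \<Omega> a b c Fs Ft lam u1 v1 \<and>
     neumann_solution \<Omega> a b c Fs Ft lam u2 v2 \<and>
     \<not> (AE x in lebesgue_on \<Omega>. u1 x = 0 \<and> v1 x = 0) \<and>
     \<not> (AE x in lebesgue_on \<Omega>. u2 x = 0 \<and> v2 x = 0) \<and>
     \<not> (AE x in lebesgue_on \<Omega>. u1 x = u2 x \<and> v1 x = v2 x)"
proof -
  have op: "open \<Omega>" and bd: "bounded \<Omega>" and ne: "\<Omega> \<noteq> {}" using dom by (auto simp: smooth_bounded_domain_def)
  have O[measurable]: "\<Omega> \<in> sets borel" using op by simp
  have fin: "emeasure lborel \<Omega> < \<infinity>" by (rule emeasure_bounded_finite[OF bd])
  have am: "a \<in> borel_measurable (lebesgue_on \<Omega>)" "b \<in> borel_measurable (lebesgue_on \<Omega>)" "c \<in> borel_measurable (lebesgue_on \<Omega>)"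
    using a_inf b_inf c_inf by (auto simp: Linf_fun_def)
  obtain a' \<epsilon>a Ma where a': "a' \<in> borel_measurable borel" "\<epsilon>a > 0" "\<And>x. \<epsilon>a \<le> a' x" "\<And>x. a' x \<le> Ma" "AE x in lborel. x \<in> \<Omega> \<longrightarrow> a x = a' x"
    by (rule coefficient_representative[OF O a_inf a_pos]) blast
  obtain b' \<epsilon>b Mb where b': "b' \<in> borel_measurable borel" "\<epsilon>b > 0" "\<And>x. \<epsilon>b \<le> b' x" "\<And>x. b' x \<le> Mb" "AE x in lborel. x \<in> \<Omega> \<longrightarrow> b x = b' x"
    by (rule coefficient_representative[OF O b_inf b_pos]) blast
  obtain c' \<epsilon>c Mc where c': "c' \<in> borel_measurable borel" "\<epsilon>c > 0" "\<And>x. \<epsilon>c \<le> c' x" "\<And>x. c' x \<le> Mc" "AE x in lborel. x \<in> \<Omega> \<longrightarrow> c x = c' x"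
    by (rule coefficient_representative[OF O c_inf c_pos]) blast
  note [measurable] = a'(1) b'(1) c'(1)
  have pos: "a' x > 0" "b' x > 0" "c' x > 0" for x
    using a'(2) a'(3)[of x] b'(2) b'(3)[of x] c'(2) c'(3)[of x] by linarith+
  define A1 where "A1 = (\<integral>x. indicator \<Omega> x * a' x \<partial>lborel)"
  define B1 where "B1 = (\<integral>x. indicator \<Omega> x * b' x \<partial>lborel)"
  define C1 where "C1 = (\<integral>x. indicator \<Omega> x * c' x \<partial>lborel)"
  note ia = integral_indicator_lower[OF op bd ne a'(1,2,3,4)] and ib = integral_indicator_lower[OF op bd ne b'(1,2,3,4)]
    and ic = integral_indicator_lower[OF op bd ne c'(1,2,3,4)]
  have A1: "L1_norm \<Omega> a = A1" "A1 > 0" and B1: "L1_norm \<Omega> b = B1" "B1 > 0" and C1: "L1_norm \<Omega> c = C1" "C1 > 0"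
    unfolding A1_def B1_def C1_def
    using L1_norm_representative[OF O am(1) a'(1) less_imp_le[OF pos(1)] a'(5)] L1_norm_representative[OF O am(2) b'(1) less_imp_le[OF pos(2)] b'(5)]
      L1_norm_representative[OF O am(3) c'(1) less_imp_le[OF pos(3)] c'(5)] ia(2) ib(2) ic(2) by auto
  obtain C where C: "C \<ge> 0" "\<And>s t. F s t \<le> C * (s\<^sup>2 + t\<^sup>2)" by (rule Fs_Ft_le) blast
  let ?S = "{F s t / (A1 * s\<^sup>2 + B1 * t\<^sup>2) | s t. (s, t) \<noteq> (0, 0)}"
  have bdd: "bdd_above ?S" by (rule quadratic_quotient_bdd[OF C A1(2) B1(2)])
  have den: "A1 * s\<^sup>2 + B1 * t\<^sup>2 > 0" if "(s, t) \<noteq> (0, 0)" for s t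
  proof -
    have "s\<^sup>2 > 0 \<or> t\<^sup>2 > 0" using that by auto
    then show ?thesis using A1(2) B1(2) by (auto intro: add_pos_nonneg add_nonneg_pos)
  qed
  obtain s0 t0 where st0: "F s0 t0 \<noteq> 0" using F_nz by blast
  have nz0: "(s0, t0) \<noteq> (0, 0)" using st0 F_00 by auto
  have "0 < F s0 t0 / (A1 * s0\<^sup>2 + B1 * t0\<^sup>2)" using den[OF nz0] st0 F_nonneg[of s0 t0] by simp
  also have "\<dots> \<le> Sup ?S" using nz0 by (intro cSup_upper bdd) blast
  finally have Sup0: "Sup ?S > 0" .
  have sF: "s_F \<Omega> a b c F = 2 * C1 * Sup ?S" by (simp add: s_F_def A1(1) B1(1) C1(1))
  then have sF0: "s_F \<Omega> a b c F > 0" using Sup0 C1(2) by simp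
  then have l0: "lam > 0" using lam by (meson inverse_positive_iff_positive less_trans)
  have "1 < lam * (2 * C1 * Sup ?S)" using lam sF0 unfolding sF by (simp add: field_simps)
  \<comment> \<open>By definition of the supremum some (s, t) already exceeds this bound. The factor
    2 in \<open>s_F\<close> is the inverse of the 1/2 in front of the squared norm in the
    energy.\<close>
  then have "1 / (2 * lam * C1) < Sup ?S" using l0 C1(2) by (simp add: field_simps)
  then obtain y where y: "y \<in> ?S" "1 / (2 * lam * C1) < y" using less_cSup_iff[OF _ bdd] nz0 by blast
  then obtain s t where st: "(s, t) \<noteq> (0, 0)" "1 / (2 * lam * C1) < F s t / (A1 * s\<^sup>2 + B1 * t\<^sup>2)" by blast
  \<comment> \<open>The constant pair (s, t) has negative energy.\<close>
  have st2: "(A1 * s\<^sup>2 + B1 * t\<^sup>2) / 2 < lam * C1 * F s t"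
    using st(2) den[OF st(1)] l0 C1(2) by (simp add: field_simps)
  define \<alpha> where "\<alpha> = (\<lambda>x. 1 / sqrt (a' x))"
  define \<beta> where "\<beta> = (\<lambda>x. 1 / sqrt (b' x))"
  define \<kappa> where "\<kappa> = (\<lambda>x. lam * (indicator \<Omega> x * c' x))"
  \<comment> \<open>The weights decrease in the coefficients, so the larger upper bound gives
    \<open>l\<close> and the smaller lower bound gives \<open>L\<close>.\<close>
  define l where "l = 1 / sqrt (max Ma Mb)"
  define L where "L = 1 / sqrt (min \<epsilon>a \<epsilon>b)"
  have \<alpha>2: "1 / (\<alpha> x)\<^sup>2 = a' x" "1 / (\<beta> x)\<^sup>2 = b' x" for x
    using less_imp_le[OF pos(1)] less_imp_le[OF pos(2)] by (auto simp: \<alpha>_def \<beta>_def power_divide)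
  interpret P: neumann_problem F Fs Ft \<Omega> \<kappa> \<alpha> \<beta> "lam * Mc" L l
  proof
    show "\<Omega> \<in> sets borel" "emeasure lborel \<Omega> < \<infinity>" "smooth_bounded_domain \<Omega>" by (fact O fin dom)+
    show "\<kappa> \<in> borel_measurable borel" "\<alpha> \<in> borel_measurable borel" "\<beta> \<in> borel_measurable borel"
      unfolding \<kappa>_def \<alpha>_def \<beta>_def by measurable
    have Mc: "Mc > 0" using c'(4)[of undefined] pos(3)[of undefined] by linarith
    show "0 \<le> \<kappa> x" for x using l0 pos(3)[of x] by (simp add: \<kappa>_def indicator_def)
    show "\<kappa> x \<le> lam * Mc" for x
      unfolding \<kappa>_def using l0 c'(4)[of x] Mc by (intro mult_left_mono) (auto simp: indicator_def)
    show "\<kappa> x = 0" if "x \<notin> \<Omega>" for x using that by (simp add: \<kappa>_def)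
    show "\<bar>\<alpha> x\<bar> \<le> L" for x
      unfolding \<alpha>_def L_def using a'(2,3) b'(2) pos(1)[of x] by (auto simp: abs_divide intro!: frac_le min.coboundedI1)
    show "\<bar>\<beta> x\<bar> \<le> L" for x
      unfolding \<beta>_def L_def using b'(2,3) a'(2) pos(2)[of x] by (auto simp: abs_divide intro!: frac_le min.coboundedI2)
    show "l > 0" unfolding l_def using a'(4)[of undefined] pos(1)[of undefined] by (auto simp: less_max_iff_disj)
    show "l \<le> \<alpha> x" for x unfolding l_def \<alpha>_def using a'(4)[of x] pos(1)[of x] by (intro frac_le) (auto simp: max.coboundedI1)
    show "l \<le> \<beta> x" for x unfolding l_def \<beta>_def using b'(4)[of x] pos(2)[of x] by (intro frac_le) (auto simp: max.coboundedI2)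
  qed
  have "(\<integral>x. indicator \<Omega> x * (s\<^sup>2 / (\<alpha> x)\<^sup>2 + t\<^sup>2 / (\<beta> x)\<^sup>2) \<partial>lborel) = (\<integral>x. s\<^sup>2 * (indicator \<Omega> x * a' x) + t\<^sup>2 * (indicator \<Omega> x * b' x) \<partial>lborel)"
  proof (intro Bochner_Integration.integral_cong refl)
    fix x
    have "s\<^sup>2 / (\<alpha> x)\<^sup>2 = s\<^sup>2 * a' x" "t\<^sup>2 / (\<beta> x)\<^sup>2 = t\<^sup>2 * b' x" unfolding \<alpha>2[symmetric] by simp_all
    then show "indicator \<Omega> x * (s\<^sup>2 / (\<alpha> x)\<^sup>2 + t\<^sup>2 / (\<beta> x)\<^sup>2) = s\<^sup>2 * (indicator \<Omega> x * a' x) + t\<^sup>2 * (indicator \<Omega> x * b' x)"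
      by (simp add: algebra_simps)
  qed
  also have "\<dots> = s\<^sup>2 * A1 + t\<^sup>2 * B1" unfolding A1_def B1_def using ia(1) ib(1) by simp
  finally have "(\<integral>x. indicator \<Omega> x * (s\<^sup>2 / (\<alpha> x)\<^sup>2 + t\<^sup>2 / (\<beta> x)\<^sup>2) \<partial>lborel) / 2 < lam * C1 * F s t"
    using st2 by (simp add: mult.commute)
  also have "lam * C1 * F s t = (\<integral>x. \<kappa> x * F s t \<partial>lborel)" by (simp add: \<kappa>_def C1_def)
  finally obtain w1 w2 where w: "w1 \<in> P.W" "w2 \<in> P.W" "w1 \<noteq> 0" "w2 \<noteq> 0" "w1 \<noteq> w2"
    "orth_proj P.W (P.NJ w1) = w1" "orth_proj P.W (P.NJ w2) = w2"
    using P.two_critical_points by blast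
  \<comment> \<open>Zero is a critical point too, so uniqueness given the \<open>J\<close>-image
    shows that a nonzero critical point has a pair (u, v) that is not almost everywhere
    zero.\<close>
  have w0: "orth_proj P.W (P.NJ 0) = 0" by (simp add: P.NJ_zero orth_proj_zero[OF P.W_subspace])
  have sol: "\<exists>u v. neumann_solution \<Omega> a b c Fs Ft lam u v \<and> sqint u \<and> sqint v \<and> (\<forall>x. x \<notin> \<Omega> \<longrightarrow> u x = 0 \<and> v x = 0)
      \<and> P.J w = mk (\<lambda>x. (u x / \<alpha> x, v x / \<beta> x))" if wW: "w \<in> P.W" and crit: "orth_proj P.W (P.NJ w) = w" for w
  proof -
    obtain u v gu gv where u: "weak_pair \<Omega> u gu" "weak_pair \<Omega> v gv" "P.J w = mk (\<lambda>x. (u x / \<alpha> x, v x / \<beta> x))"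
      "\<And>\<phi> g. weak_pair \<Omega> \<phi> g \<Longrightarrow> (\<integral>x. gu x \<bullet> g x + u x * \<phi> x / (\<alpha> x)\<^sup>2 \<partial>lborel) = (\<integral>x. \<kappa> x * Fs (u x) (v x) * \<phi> x \<partial>lborel)"
      "\<And>\<phi> g. weak_pair \<Omega> \<phi> g \<Longrightarrow> (\<integral>x. gv x \<bullet> g x + v x * \<phi> x / (\<beta> x)\<^sup>2 \<partial>lborel) = (\<integral>x. \<kappa> x * Ft (u x) (v x) * \<phi> x \<partial>lborel)"
      using P.critical_point_solution[OF wW crit] by blast
    have s: "sqint u" "sqint v" "sqint gu" "sqint gv" and z: "\<forall>x. x \<notin> \<Omega> \<longrightarrow> u x = 0 \<and> v x = 0"
      using u(1,2) by (auto simp: weak_pair_def)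
    note m[measurable] = s[THEN sqint_measurable]
    have uv: "(\<lambda>x. (u x, v x)) \<in> borel_measurable borel" by (intro borel_measurable_Pair m)
    have Fm: "(\<lambda>x. Fs (u x) (v x)) \<in> borel_measurable borel" "(\<lambda>x. Ft (u x) (v x)) \<in> borel_measurable borel"
      using measurable_compose[OF uv borel_measurable_continuous_onI[OF Fs_cont]] measurable_compose[OF uv borel_measurable_continuous_onI[OF Ft_cont]] by auto
    have weight: "r / (\<alpha> x)\<^sup>2 = a' x * r" "r / (\<beta> x)\<^sup>2 = b' x * r" for r x unfolding \<alpha>2[symmetric] by simp_all
    have rhs: "(\<integral>x. \<kappa> x * f x * \<phi> x \<partial>lborel) = lam * (\<integral>x. c' x * f x * \<phi> x \<partial>lborel)" if "weak_pair \<Omega> \<phi> g" for f \<phi> g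
    proof -
      have "\<phi> x = 0" if "x \<notin> \<Omega>" for x using that \<open>weak_pair \<Omega> \<phi> g\<close> by (auto simp: weak_pair_def)
      then have "(\<integral>x. \<kappa> x * f x * \<phi> x \<partial>lborel) = (\<integral>x. lam * (c' x * f x * \<phi> x) \<partial>lborel)"
        by (intro Bochner_Integration.integral_cong) (auto simp: \<kappa>_def indicator_def)
      then show ?thesis by simp
    qed
    have e1: "(\<integral>x. gu x \<bullet> g x + a x * u x * \<phi> x \<partial>lebesgue_on \<Omega>) = lam * (\<integral>x. c x * Fs (u x) (v x) * \<phi> x \<partial>lebesgue_on \<Omega>)"
      if "weak_grad \<Omega> \<phi> g" for \<phi> g
    proof (rule weak_form_transfer[OF O am(1) am(3) a'(1) c'(1) a'(5) c'(5) m(1) m(3) Fm(1) _ that])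
      fix \<phi> g assume wp: "weak_pair \<Omega> \<phi> g"
      show "(\<integral>x. gu x \<bullet> g x + a' x * u x * \<phi> x \<partial>lborel) = lam * (\<integral>x. c' x * Fs (u x) (v x) * \<phi> x \<partial>lborel)"
        using u(4)[OF wp] rhs[OF wp] by (simp add: weight mult.assoc)
    qed
    have e2: "(\<integral>x. gv x \<bullet> g x + b x * v x * \<phi> x \<partial>lebesgue_on \<Omega>) = lam * (\<integral>x. c x * Ft (u x) (v x) * \<phi> x \<partial>lebesgue_on \<Omega>)"
      if "weak_grad \<Omega> \<phi> g" for \<phi> g
    proof (rule weak_form_transfer[OF O am(2) am(3) b'(1) c'(1) b'(5) c'(5) m(2) m(4) Fm(2) _ that])
      fix \<phi> g assume wp: "weak_pair \<Omega> \<phi> g"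
      show "(\<integral>x. gv x \<bullet> g x + b' x * v x * \<phi> x \<partial>lborel) = lam * (\<integral>x. c' x * Ft (u x) (v x) * \<phi> x \<partial>lborel)"
        using u(5)[OF wp] rhs[OF wp] by (simp add: weight mult.assoc)
    qed
    have "neumann_solution \<Omega> a b c Fs Ft lam u v"
      unfolding neumann_solution_def
      using weak_pair_imp_weak_grad[OF O u(1)] weak_pair_imp_weak_grad[OF O u(2)] e1 e2 by blast
    then show ?thesis using s(1,2) z u(3) by blast
  qed
  \<comment> \<open>Agreement almost everywhere on the domain suffices, since all functions involved
    vanish outside it.\<close>
  have Jeq: "mk (\<lambda>x. (u x / \<alpha> x, v x / \<beta> x)) = mk (\<lambda>x. (u' x / \<alpha> x, v' x / \<beta> x))"
    if "AE x in lebesgue_on \<Omega>. u x = u' x \<and> v x = v' x"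
      "sqint u" "sqint v" "\<forall>x. x \<notin> \<Omega> \<longrightarrow> u x = 0 \<and> v x = 0" "sqint u'" "sqint v'" "\<forall>x. x \<notin> \<Omega> \<longrightarrow> u' x = 0 \<and> v' x = 0"
    for u v u' v'
  proof (subst mk_eq_iff)
    show "sqint (\<lambda>x. (u x / \<alpha> x, v x / \<beta> x))" "sqint (\<lambda>x. (u' x / \<alpha> x, v' x / \<beta> x))"
      by (intro sqint_Pair P.A.sqint_div P.B.sqint_div that)+
    have "AE x in lborel. x \<in> \<Omega> \<longrightarrow> u x = u' x \<and> v x = v' x" by (rule iffD1[OF AE_lebesgue_on_iff[OF O] that(1)])
    then show "AE x in lborel. (u x / \<alpha> x, v x / \<beta> x) = (u' x / \<alpha> x, v' x / \<beta> x)"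
    proof eventually_elim
      case (elim x)
      then show ?case using that(4,7) by (cases "x \<in> \<Omega>") auto
    qed
  qed
  obtain u1 v1 where 1: "neumann_solution \<Omega> a b c Fs Ft lam u1 v1" "sqint u1" "sqint v1" "\<forall>x. x \<notin> \<Omega> \<longrightarrow> u1 x = 0 \<and> v1 x = 0"
    "P.J w1 = mk (\<lambda>x. (u1 x / \<alpha> x, v1 x / \<beta> x))" using sol[OF w(1) w(6)] by blast
  obtain u2 v2 where 2: "neumann_solution \<Omega> a b c Fs Ft lam u2 v2" "sqint u2" "sqint v2" "\<forall>x. x \<notin> \<Omega> \<longrightarrow> u2 x = 0 \<and> v2 x = 0"
    "P.J w2 = mk (\<lambda>x. (u2 x / \<alpha> x, v2 x / \<beta> x))" using sol[OF w(2) w(7)] by blast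
  have J0: "P.J 0 = mk (\<lambda>x. ((\<lambda>_. 0) x / \<alpha> x, (\<lambda>_. 0) x / \<beta> x))"
    unfolding P.J_zero unfolding zero_l2_def by (simp add: zero_prod_def)
  have "\<not> (AE x in lebesgue_on \<Omega>. u1 x = 0 \<and> v1 x = 0)"
  proof
    assume "AE x in lebesgue_on \<Omega>. u1 x = 0 \<and> v1 x = 0"
    from Jeq[of u1 "\<lambda>_. 0" v1 "\<lambda>_. 0", OF this 1(2,3,4)] have "P.J w1 = P.J 0" unfolding 1(5) J0 by simp
    then show False using P.critical_point_unique[OF w(6) w0] w(3) by simp
  qed
  moreover have "\<not> (AE x in lebesgue_on \<Omega>. u2 x = 0 \<and> v2 x = 0)"
  proof
    assume "AE x in lebesgue_on \<Omega>. u2 x = 0 \<and> v2 x = 0"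
    from Jeq[of u2 "\<lambda>_. 0" v2 "\<lambda>_. 0", OF this 2(2,3,4)] have "P.J w2 = P.J 0" unfolding 2(5) J0 by simp
    then show False using P.critical_point_unique[OF w(7) w0] w(4) by simp
  qed
  moreover have "\<not> (AE x in lebesgue_on \<Omega>. u1 x = u2 x \<and> v1 x = v2 x)"
  proof
    assume "AE x in lebesgue_on \<Omega>. u1 x = u2 x \<and> v1 x = v2 x"
    from Jeq[OF this 1(2,3,4) 2(2,3,4)] have "P.J w1 = P.J w2" unfolding 1(5) 2(5) .
    then show False using P.critical_point_unique[OF w(6,7)] w(5) by simp
  qed
  ultimately show ?thesis using 1(1) 2(1) by blast
qed

theorem theorem1p1:
  fixes \<Omega> :: "'n::euclidean_space set"
    and a b c :: "'n \<Rightarrow> real"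
    and F Fs Ft :: "real \<Rightarrow> real \<Rightarrow> real"
  assumes dom: "smooth_bounded_domain \<Omega>"
    and a_inf: "Linf_fun \<Omega> a" and b_inf: "Linf_fun \<Omega> b" and c_inf: "Linf_fun \<Omega> c"
    and a_pos: "\<exists>\<epsilon>>0. AE x in lebesgue_on \<Omega>. \<epsilon> \<le> a x"
    and b_pos: "\<exists>\<epsilon>>0. AE x in lebesgue_on \<Omega>. \<epsilon> \<le> b x"
    and c_pos: "\<exists>\<epsilon>>0. AE x in lebesgue_on \<Omega>. \<epsilon> \<le> c x"
    and F_deriv: "\<And>s t. ((\<lambda>(p, q). F p q) has_derivative
                      (\<lambda>(h, k). Fs s t * h + Ft s t * k)) (at (s, t))"
    and Fs_cont: "continuous_on UNIV (\<lambda>(s, t). Fs s t)"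
    and Ft_cont: "continuous_on UNIV (\<lambda>(s, t). Ft s t)"
    and F_nonneg: "\<And>s t. F s t \<ge> 0"
    and F_00: "F 0 0 = 0"
    and F_nz: "\<exists>s t. F s t \<noteq> 0"
    and F0_s: "((\<lambda>(s, t). Fs s t / (\<bar>s\<bar> + \<bar>t\<bar>)) \<longlongrightarrow> 0) (at (0, 0))"
    and F0_t: "((\<lambda>(s, t). Ft s t / (\<bar>s\<bar> + \<bar>t\<bar>)) \<longlongrightarrow> 0) (at (0, 0))"
    and Finf_s: "((\<lambda>(s, t). Fs s t / (\<bar>s\<bar> + \<bar>t\<bar>)) \<longlongrightarrow> 0)
                   (filtercomap (\<lambda>(s, t). \<bar>s\<bar> + \<bar>t\<bar>) at_top)"
    and Finf_t: "((\<lambda>(s, t). Ft s t / (\<bar>s\<bar> + \<bar>t\<bar>)) \<longlongrightarrow> 0)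
                   (filtercomap (\<lambda>(s, t). \<bar>s\<bar> + \<bar>t\<bar>) at_top)"
  shows "(\<forall>lam u v. 0 \<le> lam \<and> lam < inverse (S_F \<Omega> a b c Fs Ft)
              \<and> neumann_solution \<Omega> a b c Fs Ft lam u v
            \<longrightarrow> (AE x in lebesgue_on \<Omega>. u x = 0 \<and> v x = 0))
       \<and> (\<forall>lam. lam > inverse (s_F \<Omega> a b c F) \<longrightarrow>
            (\<exists>u1 v1 u2 v2.
               neumann_solution \<Omega> a b c Fs Ft lam u1 v1 \<and>
               neumann_solution \<Omega> a b c Fs Ft lam u2 v2 \<and>
               \<not> (AE x in lebesgue_on \<Omega>. u1 x = 0 \<and> v1 x = 0) \<and>
               \<not> (AE x in lebesgue_on \<Omega>. u2 x = 0 \<and> v2 x = 0) \<and>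
               \<not> (AE x in lebesgue_on \<Omega>. u1 x = u2 x \<and> v1 x = v2 x)))"
proof -
  interpret potential F Fs Ft
    by (rule potential.intro) (fact F_deriv Fs_cont Ft_cont F_nonneg F_00 F0_s F0_t Finf_s Finf_t)+
  show ?thesis
    using small_parameter_trivial[OF dom a_inf b_inf c_inf a_pos b_pos c_pos]
      large_parameter_solutions[OF dom a_inf b_inf c_inf a_pos b_pos c_pos F_nz] by blast
qed

end
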